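(* Let $A\in L^2(\triangle_2(0,T);\mathbb{R}^{d\times d})$, $B\in L^2(\triangle_2(0,T);\mathbb{R}^{d\times\ell})$, $C\in\mathscr{L}^2(\triangle_2(0,T);\mathbb{R}^{d\times d})$, $D\in\mathscr{L}^2(\triangle_2(0,T);\mathbb{R}^{d\times\ell})$, $b\in L^{2,1}_{\mathbb{F}}(\triangle_2(0,T);\mathbb{R}^d)$ and $\sigma\in L^2_{\mathbb{F}}(\triangle_2(0,T);\mathbb{R}^d)$. For each causal feedback strategy $(\Xi,\Gamma,v)\in\mathcal{S}(0,T)$ and each input condition $(t_0,x)\in\mathcal{I}$, the controlled SVIE has a unique causal feedback solution $(X^{t_0,x},\Theta^{t_0,x},u^{t_0,x})\in L^2_{\mathbb{F}}(t_0,T;\mathbb{R}^d)\times L^2_{\mathbb{F},\mathrm{c}}(\triangle_2(t_0,T);\mathbb{R}^d)\times\mathcal{U}(t_0,T)$ at $(t_0,x)$ corresponding to $(\Xi,\Gamma,v)$. Furthermore, there exists a constant $K>0$ depending only on $A,B,C,D,\Xi,\Gamma$ such that $$\|X^{t_0,x}\|_{L^2_{\mathbb{F}}(t_0,T)}+\|\Theta^{t_0,x}\|_{L^2_{\mathbb{F},\mathrm{c}}(\triangle_2(t_0,T))}+\|u^{t_0,x}\|_{L^2_{\mathbb{F}}(t_0,T)}\leq K\bigl(\|x\|_{L^2(t_0,T)}+\|b\|_{L^{2,1}_{\mathbb{F}}(\triangle_2(t_0,T))}+\|\sigma\|_{L^2_{\mathbb{F}}(\triangle_2(t_0,T))}+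\|v\|_{L^2_{\mathbb{F}}(t_0,T)}\bigr).$$
   Context: Setting. Fix $T\in(0,\infty)$ and $d,\ell\in\mathbb{N}$. $(\Omega,\mathcal{F},\mathbb{P})$ is a complete probability space, $W$ a one-dimensional Brownian motion, $\mathbb{F}=(\mathcal{F}_t)_{t\ge0}$ the $\mathbb{P}$-augmented filtration generated by $W$. $|M|$ is the Frobenius norm of a matrix; $\mathbb{E}[\cdot]^{1/2}$ is the square root of the expectation. For $0\le t_0<T$, $\triangle_2(t_0,T):=\{(t,s)\in(t_0,T)^2 \mid T>t>s>t_0\}$. Spaces (with values in $\mathbb{R}^{d_1\times d_2}$; $\mathbb{R}^{d_1}=\mathbb{R}^{d_1\times1}$): - $L^2_{\mathbb{F}}(t_0,T)$: square-integrable (on $\Omega\times(t_0,T)$) $\mathbb{F}$-progressively measurable processes on $(t_0,T)$. - $L^{2,1}_{\mathbb{F}}(\triangle_2(t_0,T))$: measurable processes $\xi$ on $\triangle_2(t_0,T)$ such that $\xi(t,\cdot)$ is $\mathbb{F}$-progressively measurable on $(t_0,t)$ for each $t$ and $\|\xi\|_{L^{2,1}_{\mathbb{F}}(\triangle_2(t_0,T))}:=\mathbb{E}[\int_{t_0}^T(\int_{t_0}^t|\xi(t,s)|ds)^2dt]^{1/2}<\infty$. - $L^2_{\mathbb{F}}(\triangle_2(t_0,T))$: those $\xi\in L^{2,1}_{\mathbb{F}}(\triangle_2(t_0,T))$ with $\|\xi\|_{L^2_{\mathbb{F}}(\triangle_2(t_0,T))}:=\mathbb{E}[\int_{t_0}^T\int_{t_0}^t|\xi(t,s)|^2ds\,dt]^{1/2}<\infty$.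 - $L^2_{\mathbb{F},\mathrm{c}}(\triangle_2(t_0,T))$: those $\xi\in L^2_{\mathbb{F}}(\triangle_2(t_0,T))$ such that $s\mapsto\xi(t,s)$ is uniformly continuous on $(t_0,t)$, with limits $\xi(t,t):=\lim_{s\uparrow t}\xi(t,s)$, $\xi(t,t_0):=\lim_{s\downarrow t_0}\xi(t,s)$, for a.e. $t\in(t_0,T)$, a.s., and $\|\xi\|_{L^2_{\mathbb{F},\mathrm{c}}(\triangle_2(t_0,T))}:=\mathbb{E}[\int_{t_0}^T\sup_{s\in[t_0,t]}|\xi(t,s)|^2dt]^{1/2}<\infty$. - $L^\infty(t_0,T)$, $L^2(t_0,T)$, $L^2(\triangle_2(t_0,T))$: usual spaces of deterministic functions. - $\mathscr{L}^2(\triangle_2(t_0,T))$: deterministic $f\in L^2(\triangle_2(t_0,T))$ with $\|f\|_{\mathscr{L}^2(\triangle_2(t_0,T))}:=\operatorname{ess\,sup}_{t\in(t_0,T)}(\int_t^T|f(s,t)|^2ds)^{1/2}<\infty$ and such that for every $\varepsilon>0$ there is a finite partition $t_0=U_0<U_1<\cdots<U_m=T$ with $\operatorname{ess\,sup}_{t\in(U_i,U_{i+1})}(\int_t^{U_{i+1}}|f(s,t)|^2ds)^{1/2}<\varepsilon$ for each $i\in\{0,\dots,m-1\}$. Definitions. $\mathcal{I}:=\{(t_0,x)\mid t_0\in[0,T),\ x\in L^2(t_0,T;\mathbb{R}^d)\}$ (input conditions); $\mathcal{U}(t_0,T):=L^2_{\mathbb{F}}(t_0,T;\mathbb{R}^\ell)$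 (controls); a causal feedback strategy is a triplet $(\Xi,\Gamma,v)\in\mathcal{S}(0,T):=L^\infty(0,T;\mathbb{R}^{\ell\times d})\times L^2(\triangle_2(0,T);\mathbb{R}^{\ell\times d})\times\mathcal{U}(0,T)$. The controlled (linear) SVIE is, for $t\in(t_0,T)$, $X(t)=x(t)+\int_{t_0}^t\{A(t,s)X(s)+B(t,s)u(s)+b(t,s)\}ds+\int_{t_0}^t\{C(t,s)X(s)+D(t,s)u(s)+\sigma(t,s)\}dW(s)$. A causal feedback solution of it at $(t_0,x)$ corresponding to $(\Xi,\Gamma,v)$ is a triplet $(X,\Theta,u)=(X^{t_0,x},\Theta^{t_0,x},u^{t_0,x})\in L^2_{\mathbb{F}}(t_0,T;\mathbb{R}^d)\times L^2_{\mathbb{F},\mathrm{c}}(\triangle_2(t_0,T);\mathbb{R}^d)\times\mathcal{U}(t_0,T)$ satisfying the closed-loop system $$X(t)=x(t)+\int_{t_0}^t\{A(t,s)X(s)+B(t,s)u(s)+b(t,s)\}ds+\int_{t_0}^t\{C(t,s)X(s)+D(t,s)u(s)+\sigma(t,s)\}dW(s),\ t\in(t_0,T),$$ $$\Theta(s,t)=x(s)+\int_{t_0}^t\{A(s,r)X(r)+B(s,r)u(r)+b(s,r)\}dr+\int_{t_0}^t\{C(s,r)X(r)+D(s,r)u(r)+\sigma(s,r)\}dW(r),\ (s,t)\in\triangle_2(t_0,T),$$ $$u(t)=\Xi(t)X(t)+\int_t^T\Gamma(s,t)\Theta(s,t)ds+v(t),\ t\in(t_0,T).$$ *)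

theory Defs
  imports "HOL-Probability.Probability"
begin

text \<open>
  Vectors in $R^{d}$ are \<open>real ^ 'd\<close>, and a $(d_1 \times d_2)$-matrix is an element of
  \<open>real ^ 'd2 ^ 'd1\<close>, whose library norm is the Frobenius norm.

  Elements of function spaces are represented by actual functions; values outside the relevant
  time domain are irrelevant. Deterministic functions are Lebesgue measurable, stochastic
  processes are measurable with respect to the Borel sets in the time variables. All (semi)norms
  are extended nonnegative reals, so that membership in a space can be written as finiteness
  of its norm.
\<close>

definition triangle2 :: "real \<Rightarrow> real \<Rightarrow> (real \<times> real) set" where
  "triangle2 t0 T = {(t, s). t0 < s \<and> s < t \<and> t < T}"

definition ennsqrt :: "ennreal \<Rightarrow> ennreal" where
  "ennsqrt x = (if x = \<infinity> then \<infinity> else ennreal (sqrt (enn2real x)))"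


subsection \<open>Brownian motion and its augmented filtration\<close>

definition natural_filtration :: "'a measure \<Rightarrow> (real \<Rightarrow> 'a \<Rightarrow> real) \<Rightarrow> real \<Rightarrow> 'a measure" where
  "natural_filtration M W t =
     sigma (space M) {W r -` S \<inter> space M | r S. 0 \<le> r \<and> r \<le> t \<and> S \<in> sets borel}"

definition augmented_filtration :: "'a measure \<Rightarrow> (real \<Rightarrow> 'a \<Rightarrow> real) \<Rightarrow> real \<Rightarrow> 'a measure" where
  "augmented_filtration M W t = sigma (space M) (sets (natural_filtration M W t) \<union> null_sets M)"

definition brownian_motion :: "'a measure \<Rightarrow> (real \<Rightarrow> 'a \<Rightarrow> real) \<Rightarrow> bool" where
  "brownian_motion M W \<longleftrightarrow>
     (\<forall>t\<ge>0. W t \<in> borel_measurable M) \<and>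
     (AE \<omega> in M. W 0 \<omega> = 0) \<and>
     (AE \<omega> in M. continuous_on {0..} (\<lambda>t. W t \<omega>)) \<and>
     (\<forall>s t. 0 \<le> s \<and> s < t \<longrightarrow>
        distributed M lborel (\<lambda>\<omega>. W t \<omega> - W s \<omega>)
          (\<lambda>y. ennreal (normal_density 0 (sqrt (t - s)) y)) \<and>
        prob_space.indep_set M (sets (natural_filtration M W s))
          {(\<lambda>\<omega>. W t \<omega> - W s \<omega>) -` S \<inter> space M | S. S \<in> sets borel})"

definition brownian_setting :: "'a measure \<Rightarrow> (real \<Rightarrow> 'a \<Rightarrow> real) \<Rightarrow> bool" where
  "brownian_setting M W \<longleftrightarrow> prob_space M \<and> complete_measure M \<and> brownian_motion M W"


subsection \<open>Spaces of deterministic functions\<close>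

definition norm_L2 :: "real \<Rightarrow> real \<Rightarrow> (real \<Rightarrow> 'b::euclidean_space) \<Rightarrow> ennreal" where
  "norm_L2 t0 T f = ennsqrt (\<integral>\<^sup>+t\<in>{t0<..<T}. ennreal ((norm (f t))\<^sup>2) \<partial>lebesgue)"

definition space_L2 :: "real \<Rightarrow> real \<Rightarrow> (real \<Rightarrow> 'b::euclidean_space) set" where
  "space_L2 t0 T = {f. f \<in> borel_measurable (lebesgue_on {t0<..<T}) \<and> norm_L2 t0 T f < \<infinity>}"

definition space_Linf :: "real \<Rightarrow> real \<Rightarrow> (real \<Rightarrow> 'b::euclidean_space) set" where
  "space_Linf t0 T = {f. f \<in> borel_measurable (lebesgue_on {t0<..<T}) \<and>
     esssup (lebesgue_on {t0<..<T}) (\<lambda>t. ennreal (norm (f t))) < \<infinity>}"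

definition norm_L2_tri :: "real \<Rightarrow> real \<Rightarrow> (real \<Rightarrow> real \<Rightarrow> 'b::euclidean_space) \<Rightarrow> ennreal" where
  "norm_L2_tri t0 T f =
     ennsqrt (\<integral>\<^sup>+p\<in>triangle2 t0 T. ennreal ((norm (f (fst p) (snd p)))\<^sup>2) \<partial>lebesgue)"

definition space_L2_tri :: "real \<Rightarrow> real \<Rightarrow> (real \<Rightarrow> real \<Rightarrow> 'b::euclidean_space) set" where
  "space_L2_tri t0 T = {f. (\<lambda>p. f (fst p) (snd p)) \<in> borel_measurable (lebesgue_on (triangle2 t0 T)) \<and>
     norm_L2_tri t0 T f < \<infinity>}"

definition norm_scrL2 :: "real \<Rightarrow> real \<Rightarrow> (real \<Rightarrow> real \<Rightarrow> 'b::euclidean_space) \<Rightarrow> ennreal" where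
  "norm_scrL2 t0 T f = esssup (lebesgue_on {t0<..<T})
     (\<lambda>t. ennsqrt (\<integral>\<^sup>+s\<in>{t<..<T}. ennreal ((norm (f s t))\<^sup>2) \<partial>lebesgue))"

definition space_scrL2 :: "real \<Rightarrow> real \<Rightarrow> (real \<Rightarrow> real \<Rightarrow> 'b::euclidean_space) set" where
  "space_scrL2 t0 T = {f. f \<in> space_L2_tri t0 T \<and> norm_scrL2 t0 T f < \<infinity> \<and>
     (\<forall>\<epsilon>>0. \<exists>(m::nat) U. U 0 = t0 \<and> U m = T \<and> (\<forall>i<m. U i < U (Suc i)) \<and>
        (\<forall>i<m. norm_scrL2 (U i) (U (Suc i)) f < ennreal \<epsilon>))}"


subsection \<open>Spaces of stochastic processes\<close>

definition prog_measurable ::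
  "(real \<Rightarrow> 'a measure) \<Rightarrow> real \<Rightarrow> real \<Rightarrow> (real \<Rightarrow> 'a \<Rightarrow> 'b::euclidean_space) \<Rightarrow> bool" where
  "prog_measurable F a b \<xi> \<longleftrightarrow> (\<forall>t\<in>{a<..<b}.
     (\<lambda>p. \<xi> (fst p) (snd p)) \<in> borel_measurable (restrict_space borel {a<..t} \<Otimes>\<^sub>M F t))"

definition norm_L2_F :: "'a measure \<Rightarrow> real \<Rightarrow> real \<Rightarrow> (real \<Rightarrow> 'a \<Rightarrow> 'b::euclidean_space) \<Rightarrow> ennreal" where
  "norm_L2_F M t0 T \<xi> =
     ennsqrt (\<integral>\<^sup>+\<omega>. (\<integral>\<^sup>+t\<in>{t0<..<T}. ennreal ((norm (\<xi> t \<omega>))\<^sup>2) \<partial>lborel) \<partial>M)"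

definition space_L2_F ::
  "'a measure \<Rightarrow> (real \<Rightarrow> 'a measure) \<Rightarrow> real \<Rightarrow> real \<Rightarrow> (real \<Rightarrow> 'a \<Rightarrow> 'b::euclidean_space) set" where
  "space_L2_F M F t0 T = {\<xi>. prog_measurable F t0 T \<xi> \<and> norm_L2_F M t0 T \<xi> < \<infinity>}"

definition norm_L21_F_tri ::
  "'a measure \<Rightarrow> real \<Rightarrow> real \<Rightarrow> (real \<Rightarrow> real \<Rightarrow> 'a \<Rightarrow> 'b::euclidean_space) \<Rightarrow> ennreal" where
  "norm_L21_F_tri M t0 T \<xi> =
     ennsqrt (\<integral>\<^sup>+\<omega>. (\<integral>\<^sup>+t\<in>{t0<..<T}.
       (\<integral>\<^sup>+s\<in>{t0<..<t}. ennreal (norm (\<xi> t s \<omega>)) \<partial>lborel)\<^sup>2 \<partial>lborel) \<partial>M)"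

definition space_L21_F_tri ::
  "'a measure \<Rightarrow> (real \<Rightarrow> 'a measure) \<Rightarrow> real \<Rightarrow> real \<Rightarrow> (real \<Rightarrow> real \<Rightarrow> 'a \<Rightarrow> 'b::euclidean_space) set" where
  "space_L21_F_tri M F t0 T = {\<xi>.
     (\<lambda>((t, s), \<omega>). \<xi> t s \<omega>) \<in> borel_measurable (restrict_space borel (triangle2 t0 T) \<Otimes>\<^sub>M M) \<and>
     (\<forall>t\<in>{t0<..<T}. prog_measurable F t0 t (\<xi> t)) \<and>
     norm_L21_F_tri M t0 T \<xi> < \<infinity>}"

definition norm_L2_F_tri ::
  "'a measure \<Rightarrow> real \<Rightarrow> real \<Rightarrow> (real \<Rightarrow> real \<Rightarrow> 'a \<Rightarrow> 'b::euclidean_space) \<Rightarrow> ennreal" where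
  "norm_L2_F_tri M t0 T \<xi> =
     ennsqrt (\<integral>\<^sup>+\<omega>. (\<integral>\<^sup>+t\<in>{t0<..<T}.
       (\<integral>\<^sup>+s\<in>{t0<..<t}. ennreal ((norm (\<xi> t s \<omega>))\<^sup>2) \<partial>lborel) \<partial>lborel) \<partial>M)"

definition space_L2_F_tri ::
  "'a measure \<Rightarrow> (real \<Rightarrow> 'a measure) \<Rightarrow> real \<Rightarrow> real \<Rightarrow> (real \<Rightarrow> real \<Rightarrow> 'a \<Rightarrow> 'b::euclidean_space) set" where
  "space_L2_F_tri M F t0 T = {\<xi>. \<xi> \<in> space_L21_F_tri M F t0 T \<and> norm_L2_F_tri M t0 T \<xi> < \<infinity>}"

text \<open>The function $s \mapsto \xi(t,s)$ extended to $[t_0,t]$ by its one-sided limits.\<close>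

definition endpoint_ext ::
  "real \<Rightarrow> (real \<Rightarrow> real \<Rightarrow> 'a \<Rightarrow> 'b::euclidean_space) \<Rightarrow> real \<Rightarrow> real \<Rightarrow> 'a \<Rightarrow> 'b" where
  "endpoint_ext t0 \<xi> t s \<omega> =
     (if t0 < s \<and> s < t then \<xi> t s \<omega> else Lim (at s within {t0<..<t}) (\<lambda>r. \<xi> t r \<omega>))"

definition norm_L2_Fc_tri ::
  "'a measure \<Rightarrow> real \<Rightarrow> real \<Rightarrow> (real \<Rightarrow> real \<Rightarrow> 'a \<Rightarrow> 'b::euclidean_space) \<Rightarrow> ennreal" where
  "norm_L2_Fc_tri M t0 T \<xi> =
     ennsqrt (\<integral>\<^sup>+\<omega>. (\<integral>\<^sup>+t\<in>{t0<..<T}.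
       (SUP s\<in>{t0..t}. ennreal ((norm (endpoint_ext t0 \<xi> t s \<omega>))\<^sup>2)) \<partial>lborel) \<partial>M)"

text \<open>
  Here "for a.e. $t$, a.s." is read with respect to the product measure $dt \otimes P$: the
  exceptional pairs are required to lie in a measurable set of product measure zero, so that
  both iterated readings follow.
\<close>

definition space_L2_Fc_tri ::
  "'a measure \<Rightarrow> (real \<Rightarrow> 'a measure) \<Rightarrow> real \<Rightarrow> real \<Rightarrow> (real \<Rightarrow> real \<Rightarrow> 'a \<Rightarrow> 'b::euclidean_space) set" where
  "space_L2_Fc_tri M F t0 T = {\<xi>. \<xi> \<in> space_L2_F_tri M F t0 T \<and>
     (AE (t, \<omega>) in lborel \<Otimes>\<^sub>M M. t \<in> {t0<..<T} \<longrightarrow>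
        uniformly_continuous_on {t0<..<t} (\<lambda>s. \<xi> t s \<omega>)) \<and>
     norm_L2_Fc_tri M t0 T \<xi> < \<infinity>}"


subsection \<open>The It\^o integral\<close>

text \<open>
  A simple process on $(a,b]$ is $\sum_{i<n} h_i 1_{(\tau_i, \tau_{i+1}]}$ with bounded
  $F_{\tau_i}$-measurable $h_i$.
\<close>

definition simple_process_data ::
  "'a measure \<Rightarrow> (real \<Rightarrow> 'a measure) \<Rightarrow> real \<Rightarrow> real \<Rightarrow> nat \<Rightarrow> (nat \<Rightarrow> real) \<Rightarrow>
   (nat \<Rightarrow> 'a \<Rightarrow> 'b::euclidean_space) \<Rightarrow> bool" where
  "simple_process_data M F a b n \<tau> h \<longleftrightarrow>
     a \<le> \<tau> 0 \<and> \<tau> n \<le> b \<and> (\<forall>i<n. \<tau> i \<le> \<tau> (Suc i)) \<and>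
     (\<forall>i<n. h i \<in> borel_measurable (F (\<tau> i)) \<and> (\<exists>c. \<forall>\<omega>\<in>space M. norm (h i \<omega>) \<le> c))"

definition simple_process ::
  "nat \<Rightarrow> (nat \<Rightarrow> real) \<Rightarrow> (nat \<Rightarrow> 'a \<Rightarrow> 'b::euclidean_space) \<Rightarrow> real \<Rightarrow> 'a \<Rightarrow> 'b" where
  "simple_process n \<tau> h s \<omega> = (\<Sum>i<n. indicat_real {\<tau> i<..\<tau> (Suc i)} s *\<^sub>R h i \<omega>)"

definition simple_integral ::
  "(real \<Rightarrow> 'a \<Rightarrow> real) \<Rightarrow> nat \<Rightarrow> (nat \<Rightarrow> real) \<Rightarrow> (nat \<Rightarrow> 'a \<Rightarrow> 'b::euclidean_space) \<Rightarrow> 'a \<Rightarrow> 'b" where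
  "simple_integral W n \<tau> h \<omega> = (\<Sum>i<n. (W (\<tau> (Suc i)) \<omega> - W (\<tau> i) \<omega>) *\<^sub>R h i \<omega>)"

text \<open>
  \<open>has_ito_integral M W F a b H Y\<close>: the random variable \<open>Y\<close> is a version of
  $\int_a^b H(s)\,dW(s)$, i.e. the $L^2$-limit of the elementary integrals of simple processes
  converging to \<open>H\<close> in $L^2(dt \otimes P)$. This determines \<open>Y\<close> up to almost sure equality.
  \<open>H\<close> need only be measurable for the completed product measure, because a kernel that is merely
  Lebesgue measurable in time may occur in it; the existence of the approximating
  sequence makes \<open>H\<close> square integrable and a.e. equal to a progressively measurable process.
\<close>

definition has_ito_integral ::
  "'a measure \<Rightarrow> (real \<Rightarrow> 'a \<Rightarrow> real) \<Rightarrow> (real \<Rightarrow> 'a measure) \<Rightarrow> real \<Rightarrow> real \<Rightarrow>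
   (real \<Rightarrow> 'a \<Rightarrow> 'b::euclidean_space) \<Rightarrow> ('a \<Rightarrow> 'b) \<Rightarrow> bool" where
  "has_ito_integral M W F a b H Y \<longleftrightarrow>
     (\<lambda>p. H (fst p) (snd p)) \<in> borel_measurable (completion (restrict_space lborel {a<..<b} \<Otimes>\<^sub>M M)) \<and>
     Y \<in> borel_measurable M \<and>
     (\<exists>n \<tau> h. (\<forall>k. simple_process_data M F a b (n k) (\<tau> k) (h k)) \<and>
        (\<lambda>k. \<integral>\<^sup>+p. ennreal ((norm (simple_process (n k) (\<tau> k) (h k) (fst p) (snd p) - H (fst p) (snd p)))\<^sup>2)
               \<partial>completion (restrict_space lborel {a<..<b} \<Otimes>\<^sub>M M)) \<longlonglongrightarrow> 0 \<and>
        (\<lambda>k. \<integral>\<^sup>+\<omega>. ennreal ((norm (simple_integral W (n k) (\<tau> k) (h k) \<omega> - Y \<omega>))\<^sup>2) \<partial>M) \<longlonglongrightarrow> 0)"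


subsection \<open>Causal feedback solutions\<close>

definition input_conditions :: "real \<Rightarrow> (real \<times> (real \<Rightarrow> real ^ 'd)) set" where
  "input_conditions T = {(t0, x). 0 \<le> t0 \<and> t0 < T \<and> x \<in> space_L2 t0 T}"

definition controls ::
  "'a measure \<Rightarrow> (real \<Rightarrow> 'a \<Rightarrow> real) \<Rightarrow> real \<Rightarrow> real \<Rightarrow> (real \<Rightarrow> 'a \<Rightarrow> real ^ 'l) set" where
  "controls M W t0 T = space_L2_F M (augmented_filtration M W) t0 T"

definition feedback_strategies ::
  "'a measure \<Rightarrow> (real \<Rightarrow> 'a \<Rightarrow> real) \<Rightarrow> real \<Rightarrow>
   ((real \<Rightarrow> real ^ 'd ^ 'l) \<times> (real \<Rightarrow> real \<Rightarrow> real ^ 'd ^ 'l) \<times> (real \<Rightarrow> 'a \<Rightarrow> real ^ 'l)) set" where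
  "feedback_strategies M W T = space_Linf 0 T \<times> space_L2_tri 0 T \<times> controls M W 0 T"

text \<open>
  The two equations with a stochastic integral hold almost surely for each fixed time (a.e. $t$
  in the first, a.e. $s$ and all $t \in (t_0,s)$ in the second). As $\Theta(s,\cdot)$ is
  continuous, the second one identifies its whole path up to a null event. For coefficients and
  strategies in the spaces above, membership of $(X,\Theta,u)$ in the solution spaces makes all Lebesgue
  integrals below absolutely convergent for a.e. time, almost surely.
\<close>

definition causal_feedback_solution ::
  "'a measure \<Rightarrow> (real \<Rightarrow> 'a \<Rightarrow> real) \<Rightarrow> real \<Rightarrow>
   (real \<Rightarrow> real \<Rightarrow> real ^ 'd ^ 'd) \<Rightarrow> (real \<Rightarrow> real \<Rightarrow> real ^ 'l ^ 'd) \<Rightarrow>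
   (real \<Rightarrow> real \<Rightarrow> real ^ 'd ^ 'd) \<Rightarrow> (real \<Rightarrow> real \<Rightarrow> real ^ 'l ^ 'd) \<Rightarrow>
   (real \<Rightarrow> real \<Rightarrow> 'a \<Rightarrow> real ^ 'd) \<Rightarrow> (real \<Rightarrow> real \<Rightarrow> 'a \<Rightarrow> real ^ 'd) \<Rightarrow>
   (real \<Rightarrow> real ^ 'd ^ 'l) \<Rightarrow> (real \<Rightarrow> real \<Rightarrow> real ^ 'd ^ 'l) \<Rightarrow> (real \<Rightarrow> 'a \<Rightarrow> real ^ 'l) \<Rightarrow>
   real \<Rightarrow> (real \<Rightarrow> real ^ 'd) \<Rightarrow>
   (real \<Rightarrow> 'a \<Rightarrow> real ^ 'd) \<Rightarrow> (real \<Rightarrow> real \<Rightarrow> 'a \<Rightarrow> real ^ 'd) \<Rightarrow> (real \<Rightarrow> 'a \<Rightarrow> real ^ 'l) \<Rightarrow> bool" where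
  "causal_feedback_solution M W T A B C D b \<sigma> \<Xi> \<Gamma> v t0 x X \<Theta> u \<longleftrightarrow>
     X \<in> space_L2_F M (augmented_filtration M W) t0 T \<and>
     \<Theta> \<in> space_L2_Fc_tri M (augmented_filtration M W) t0 T \<and>
     u \<in> controls M W t0 T \<and>
     (AE t in lborel. t \<in> {t0<..<T} \<longrightarrow>
        (\<exists>Y. has_ito_integral M W (augmented_filtration M W) t0 t
               (\<lambda>s \<omega>. C t s *v X s \<omega> + D t s *v u s \<omega> + \<sigma> t s \<omega>) Y \<and>
             (AE \<omega> in M. X t \<omega> =
                x t + (LINT s:{t0<..<t}|lebesgue. A t s *v X s \<omega> + B t s *v u s \<omega> + b t s \<omega>) + Y \<omega>))) \<and>
     (AE s in lborel. s \<in> {t0<..<T} \<longrightarrow> (\<forall>t\<in>{t0<..<s}.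
        (\<exists>Y. has_ito_integral M W (augmented_filtration M W) t0 t
               (\<lambda>r \<omega>. C s r *v X r \<omega> + D s r *v u r \<omega> + \<sigma> s r \<omega>) Y \<and>
             (AE \<omega> in M. \<Theta> s t \<omega> =
                x s + (LINT r:{t0<..<t}|lebesgue. A s r *v X r \<omega> + B s r *v u r \<omega> + b s r \<omega>) + Y \<omega>)))) \<and>
     (AE t in lborel. t \<in> {t0<..<T} \<longrightarrow> (AE \<omega> in M.
        u t \<omega> = \<Xi> t *v X t \<omega> + (LINT s:{t<..<T}|lebesgue. \<Gamma> s t *v \<Theta> s t \<omega>) + v t \<omega>))"

text \<open>
  Equality of two triplets as elements of the product of the three solution spaces, whose
  elements are functions modulo a.e. equality.
\<close>

definition same_triplet ::
  "'a measure \<Rightarrow> real \<Rightarrow> real \<Rightarrow>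
   (real \<Rightarrow> 'a \<Rightarrow> 'b) \<Rightarrow> (real \<Rightarrow> real \<Rightarrow> 'a \<Rightarrow> 'b) \<Rightarrow> (real \<Rightarrow> 'a \<Rightarrow> 'c) \<Rightarrow>
   (real \<Rightarrow> 'a \<Rightarrow> 'b) \<Rightarrow> (real \<Rightarrow> real \<Rightarrow> 'a \<Rightarrow> 'b) \<Rightarrow> (real \<Rightarrow> 'a \<Rightarrow> 'c) \<Rightarrow> bool" where
  "same_triplet M t0 T X \<Theta> u X' \<Theta>' u' \<longleftrightarrow>
     (AE (t, \<omega>) in lborel \<Otimes>\<^sub>M M. t \<in> {t0<..<T} \<longrightarrow>
        X t \<omega> = X' t \<omega> \<and> u t \<omega> = u' t \<omega> \<and> (\<forall>s\<in>{t0<..<t}. \<Theta> t s \<omega> = \<Theta>' t s \<omega>))"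

end

(* Replace the coefficients by Borel versions and the Brownian motion by a continuous version. The
   map sending (X, u) to the triplet obtained by inserting (X, u) into the integrals satisfies
   n'(t) <= d(t) + int_{t0}^t k(t,r) n(r) dr, where n and n' are the second moments of the differences
   of the inputs and of the outputs. The kernel k is the sum of an integrable function of t and of
   |C(t,r)|^2 + |D(t,r)|^2; the partitions in the definition of scrL2 give a bounded weight w with
   int w(t) k(t,r) dt <= eta w(r), so the map is a contraction in the norm weighted by w. *)
theory Submission
  imports Defs
begin

text \<open>The control equation reads Theta(s,t) at all future s, yet Theta(s,t) contains the input
  only up to time t. Integrating over s first therefore leaves an estimate in past times alone, with
  \<open>gn t\<close>, the mass of |Gamma(s,t)|^2 in s, as a further kernel. Cauchy-Schwarz detaches
  A and B from the input, so they act through an integrable function of t; C and D stay under the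
  time integral because of the isometry, which is why they need the finer space. The obstacle is
  measurability. Stochastic integrals are given only up to null events, for each s and t separately,
  but Theta must be jointly measurable, adapted and continuous in t, and X(t) is its diagonal
  Theta(t,t). Hence the integrals are built as explicit limits along one sequence of block averages
  that serves all s, with mean square errors (1/16)^k, so that Doob's inequality makes the
  increments summable uniformly in time. The contraction factor 1/16 gives the iteration the same
  rate. Weight and constants come from the kernels on (0,T) alone, before t0, the probability space
  and the data are chosen; this makes K uniform.\<close>

abbreviation "nsq x \<equiv> ennreal ((norm x)\<^sup>2)"
abbreviation "BM \<equiv> borel_measurable"
abbreviation "tprod N \<equiv> (lborel :: real measure) \<Otimes>\<^sub>M N"
abbreviation "joint N X \<equiv> (\<lambda>p. X (fst p) (snd p)) \<in> BM (tprod N)"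
abbreviation "joint3 N X \<equiv> (\<lambda>p. X (fst p) (fst (snd p)) (snd (snd p))) \<in> BM (tprod (tprod N))"
abbreviation "NN \<equiv> nn_integral"
abbreviation "NI S f \<equiv> \<integral>\<^sup>+t\<in>S. f t \<partial>(lborel :: real measure)"
abbreviation "nn2 N X \<equiv> \<integral>\<^sup>+z. nsq (X z) \<partial>N"
abbreviation "AEI a b P \<equiv> AE t in (lborel :: real measure). t \<in> {a<..<b} \<longrightarrow> P t"
abbreviation "AEP N a b P \<equiv> AE p in tprod N. fst p \<in> {a<..<b} \<longrightarrow> P p"
abbreviation "indr \<equiv> indicat_real"
abbreviation sequence_limit (infixr "~~>" 60) where "sequence_limit f l \<equiv> f \<longlonglongrightarrow> l"
lemmas ind_def = indicator_def
lemmas mcomp = measurable_compose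
lemmas nn_mono = nn_integral_mono
lemmas lb_nn_fst = lborel.borel_measurable_nn_integral_fst
lemmas nn_cmult = nn_integral_cmult
lemmas nn_cong = nn_integral_cong
lemmas nn_add = nn_integral_add
lemmas slint_def = set_lebesgue_integral_def
lemmas ml_mono = mult_left_mono
lemmas mr_mono = mult_right_mono
lemmas nn_mono_AE = nn_integral_mono_AE
lemmas nn_cong_AE = nn_integral_cong_AE
lemmas sp_pair = space_pair_measure


section \<open>Brownian motion under its augmented filtration\<close>

text \<open>Independence and normality of the increments are kept only as conditional moments: mean
  0 and variance \<open>t - s\<close>, tested against integrable \<open>F s\<close>-measurable
  weights \<open>G\<close>. Null sets in every \<open>F t\<close> together with completeness let
  adaptedness survive changes on null events.\<close>

locale brownian_basis = prob_space M for M :: "'a measure" +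
 fixes F :: "real => 'a measure" and W :: "real => 'a => real"
 assumes complete: "complete_measure M"
 and subalg: "0 <= t ==> subalgebra M (F t)"
 and filt_mono: "0 <= s ==> s <= t ==> subalgebra (F t) (F s)"
 and null_in_filt: "0 <= t ==> N : null_sets M ==> N : sets (F t)"
 and W_adapted: "0 <= t ==> W t : BM (F t)"
 and W_cont: "AE z in M. continuous_on {0..} (%t. W t z)"
 and increment_integrable: "0 <= s ==> s <= t ==> G : BM (F s) ==> integrable M G ==>
 integrable M (%z. G z * (W t z - W s z))"
 and increment_integral: "0 <= s ==> s <= t ==> G : BM (F s) ==> integrable M G ==>
 (LINT z|M. G z * (W t z - W s z)) = 0"
 and increment_sq_integrable: "0 <= s ==> s <= t ==> G : BM (F s) ==> integrable M G ==>
 integrable M (%z. G z * (W t z - W s z)^2)"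
 and increment_sq_integral: "0 <= s ==> s <= t ==> G : BM (F s) ==> integrable M G ==>
 (LINT z|M. G z * (W t z - W s z)^2) = integral\<^sup>L M G * (t - s)"

lemma space_natural_filtration [simp]: "space (natural_filtration M W t) = space M"
 unfolding natural_filtration_def by (rule space_measure_of) auto

lemma sets_natural_filtration:
 "sets (natural_filtration M W t) =
 sigma_sets (space M) {W r -` S \<inter> space M | r S. 0 <= r & r <= t & S : sets borel}"
 unfolding natural_filtration_def by (rule sets_measure_of) auto

lemma space_augmented_filtration [simp]: "space (augmented_filtration M W t) = space M"
 unfolding augmented_filtration_def
 by (rule space_measure_of) (use sets.sets_into_space[of _ "natural_filtration M W t"] sets.sets_into_space[of _ M] in auto)

lemma sets_augmented_filtration:
 "sets (augmented_filtration M W t) = sigma_sets (space M) (sets (natural_filtration M W t) \<union> null_sets M)"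
 unfolding augmented_filtration_def
 by (rule sets_measure_of) (use sets.sets_into_space[of _ "natural_filtration M W t"] sets.sets_into_space[of _ M] in auto)

lemma sets_natural_filtration_le:
 assumes "\<And>r. 0 <= r ==> W r : BM M"
 shows "sets (natural_filtration M W t) \<subseteq> sets M"
 unfolding sets_natural_filtration
 by (rule sets.sigma_sets_subset) (use assms in \<open>auto intro: measurable_sets\<close>)

text \<open>The events with this property form a sigma-algebra that contains both kinds of
  generators. Through it, independence of the increments passes from the natural filtration to the
  augmented one.\<close>

lemma augmented_filtration_set_AE_eq:
 assumes W: "\<And>r. 0 <= r ==> W r : BM M"
 and "A : sets (augmented_filtration M W t)"
 shows "EX B:sets (natural_filtration M W t). AE z in M. z : A \<longleftrightarrow> z : B"
 using assms(2) unfolding sets_augmented_filtration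
proof (induction rule: sigma_sets.induct)
 case (Basic a)
 then show ?case
 proof
 assume "a : null_sets M"
 then have "AE z in M. z : a \<longleftrightarrow> z : {}" by (auto dest: AE_not_in)
 then show ?thesis by blast
 qed auto
next
 case Empty
 show ?case using sets.empty_sets by blast
next
 case (Compl a)
 then obtain B where B: "B : sets (natural_filtration M W t)" "AE z in M. z : a \<longleftrightarrow> z : B" by blast
 have "space M - B : sets (natural_filtration M W t)"
 using sets.compl_sets[OF B(1)] by simp
 moreover have "AE z in M. z : space M - a \<longleftrightarrow> z : space M - B" using B(2) by eventually_elim auto
 ultimately show ?case by blast
next
 case (Union a)
 then obtain B where B: "\<And>i::nat. B i : sets (natural_filtration M W t)" "\<And>i. AE z in M. z : a i \<longleftrightarrow> z : B i"
 by metis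
 have "AE z in M. ALL i. z : a i \<longleftrightarrow> z : B i" using B(2) by (simp add: AE_all_countable)
 then have "AE z in M. z : (\<Union>i. a i) \<longleftrightarrow> z : (\<Union>i. B i)" by eventually_elim auto
 moreover have "(\<Union>i. B i) : sets (natural_filtration M W t)" using B(1) by auto
 ultimately show ?case by blast
qed

text \<open>The product rule only sees events up to null sets, so it extends to augmented events;
  stability of the preimages under intersection then carries it to the generated
  sigma-algebras.\<close>

lemma (in prob_space) indep_augmented_increment:
 assumes bm: "brownian_motion M W" and s: "0 <= s" "s < t"
 and G: "G : BM (augmented_filtration M W s)"
 shows "indep_var borel G borel (%z. W t z - W s z)"
proof -
 have W: "\<And>r. 0 <= r ==> W r : BM M" using bm by (auto simp: brownian_motion_def)
 have ind: "indep_set (sets (natural_filtration M W s)) {(%z. W t z - W s z) -` S \<inter> space M | S. S : sets borel}"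
 using bm s by (auto simp: brownian_motion_def)
 have le: "sets (augmented_filtration M W s) \<subseteq> sets M"
 unfolding sets_augmented_filtration
 by (rule sets.sigma_sets_subset) (use sets_natural_filtration_le[of W M, OF W] in \<open>auto simp: null_sets_def\<close>)
 have D: "(%z. W t z - W s z) : BM M" using W[of s] W[of t] s by auto
 have GM: "G : BM M"
 using G le by (auto simp: measurable_def)
 have prod: "prob (A \<inter> C) = prob A * prob C"
 if A: "A : sets (augmented_filtration M W s)" and C: "C : {(%z. W t z - W s z) -` S \<inter> space M | S. S : sets borel}" for A C
 proof -
 obtain B where B: "B : sets (natural_filtration M W s)" "AE z in M. z : A \<longleftrightarrow> z : B"
 using augmented_filtration_set_AE_eq[OF W A] by auto
 have BM: "B : sets M" using B(1) sets_natural_filtration_le[of W M s, OF W] by auto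
 have AM: "A : sets M" using A le by auto
 have CM: "C : sets M" using C D by (auto intro: measurable_sets)
 have "prob A = prob B" by (rule finite_measure_eq_AE[OF B(2) AM BM])
 moreover have "prob (A \<inter> C) = prob (B \<inter> C)"
 by (rule finite_measure_eq_AE) (use B(2) AM BM CM in auto)
 moreover have "prob (B \<inter> C) = prob B * prob C"
 using ind B(1) C unfolding indep_sets2_eq by blast
 ultimately show ?thesis by simp
 qed
 have "indep_set (sets (augmented_filtration M W s)) {(%z. W t z - W s z) -` S \<inter> space M | S. S : sets borel}"
 unfolding indep_sets2_eq using le prod measurable_sets[OF D] by blast
 then have "indep_set {G -` A \<inter> space M | A. A : sets borel} {(%z. W t z - W s z) -` S \<inter> space M | S. S : sets borel}"
 unfolding indep_set_def
 by (rule indep_sets_mono_sets) (use measurable_sets[OF G] in \<open>auto split: bool.split\<close>)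
 then have "indep_set (sigma_sets (space M) {G -` A \<inter> space M | A. A : sets borel})
 (sigma_sets (space M) {(%z. W t z - W s z) -` S \<inter> space M | S. S : sets borel})"
 proof (rule indep_set_sigma_sets)
 show "Int_stable {G -` A \<inter> space M | A. A : sets borel}"
 unfolding Int_stable_def
 by (safe, rule_tac x="A \<inter> Aa" in exI) auto
 show "Int_stable {(%z. W t z - W s z) -` S \<inter> space M | S. S : sets borel}"
 unfolding Int_stable_def
 by (safe, rule_tac x="S \<inter> Sa" in exI) auto
 qed
 then show ?thesis unfolding indep_var_eq using GM D by auto
qed

text \<open>Independence factorises the moments of \<open>G\<close> times an increment or its
  square, and the normal density supplies the moments of the increment.\<close>

lemma brownian_basis_augmented:
 assumes "brownian_setting M W"
 shows "brownian_basis M (augmented_filtration M W) W"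
proof -
 have ps: "prob_space M" and cm: "complete_measure M" and bm: "brownian_motion M W"
 using assms by (auto simp: brownian_setting_def)
 interpret prob_space M by fact
 have W: "\<And>r. 0 <= r ==> W r : BM M" using bm by (auto simp: brownian_motion_def)
 have sub: "subalgebra M (augmented_filtration M W t)" for t
 unfolding subalgebra_def sets_augmented_filtration
 using sets.sigma_sets_subset[of "sets (natural_filtration M W t) \<union> null_sets M" M]
 sets_natural_filtration_le[of W M, OF W] by (auto simp: null_sets_def)
 have dist: "distributed M lborel (%z. W t z - W s z) (%y. ennreal (normal_density 0 (sqrt (t - s)) y))"
 if "0 <= s" "s < t" for s t using bm that by (auto simp: brownian_motion_def)
 have D1: "integrable M (%z. W t z - W s z)" if "0 <= s" "s < t" for s t
 by (rule distributed_integrable_var[OF dist[OF that]]) (use that integrable_normal_moment_nz_1[of "sqrt (t-s)" 0] in auto)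
 have D2: "(LINT z|M. W t z - W s z) = 0" if "0 <= s" "s < t" for s t
 using distributed_integral[OF dist[OF that], of "%x. x"] integral_normal_moment_nz_1[of "sqrt (t-s)" 0] that by simp
 have D3: "integrable M (%z. (W t z - W s z)^2)" if "0 <= s" "s < t" for s t
 using distributed_integrable[OF dist[OF that], of "%x. x^2"] integrable_normal_moment[of "sqrt (t-s)" 0 2] that by simp
 have D4: "(LINT z|M. (W t z - W s z)^2) = t - s" if "0 <= s" "s < t" for s t
 using distributed_integral[OF dist[OF that], of "%x. x^2"] integral_normal_moment_even[of "sqrt (t-s)" 0 1] that
 by (simp add: fact_numeral)
 show ?thesis
 proof (intro brownian_basis.intro brownian_basis_axioms.intro)
 show "prob_space M" by fact
 show "complete_measure M" by fact
 show "subalgebra M (augmented_filtration M W t)" for t by (rule sub)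
 show "subalgebra (augmented_filtration M W t) (augmented_filtration M W s)" if "0 <= s" "s <= t" for s t
 proof -
 have "sets (natural_filtration M W s) \<subseteq> sets (natural_filtration M W t)"
 unfolding sets_natural_filtration by (rule sigma_sets_mono') (use that in auto, force)
 then show ?thesis unfolding subalgebra_def sets_augmented_filtration
 by (auto intro!: sigma_sets_mono' simp del: sets_natural_filtration)
 qed
 show "N : sets (augmented_filtration M W t)" if "N : null_sets M" for N t
 unfolding sets_augmented_filtration using that by (auto intro: sigma_sets.Basic)
 show "W t : BM (augmented_filtration M W t)" if "0 <= t" for t
 proof (rule measurableI)
 fix S :: "real set" assume "S : sets borel"
 then have "W t -` S \<inter> space M : sets (natural_filtration M W t)"
 unfolding sets_natural_filtration using that by (intro sigma_sets.Basic) auto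
 then show "W t -` S \<inter> space (augmented_filtration M W t) : sets (augmented_filtration M W t)"
 unfolding sets_augmented_filtration by (auto intro: sigma_sets.Basic)
 qed auto
 show "AE z in M. continuous_on {0..} (%t. W t z)" using bm by (auto simp: brownian_motion_def)
 fix s t :: real and G :: "'a => real"
 assume st: "0 <= s" "s <= t" and G: "G : BM (augmented_filtration M W s)" "integrable M G"
 have sq: "(%x::real. x^2) : BM borel" by simp
 have ind2: "indep_var borel G borel (%z. (W t z - W s z)^2)" if "s < t"
 using indep_var_compose[OF indep_augmented_increment[OF bm st(1) that G(1)] measurable_ident sq]
 by (simp add: comp_def)
 \<comment> \<open>The density of the increment is available only for \<open>s < t\<close>; for
   \<open>s = t\<close> the increment is 0 and all four claims are trivial.\<close>
 have "s < t \<or> s = t" using st by auto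
 then show "integrable M (%z. G z * (W t z - W s z))"
 using indep_var_integrable[OF indep_augmented_increment[OF bm st(1) _ G(1)] G(2) D1] st by auto
 show "(LINT z|M. G z * (W t z - W s z)) = 0"
 using \<open>s < t \<or> s = t\<close> indep_var_lebesgue_integral[OF indep_augmented_increment[OF bm st(1) _ G(1)] G(2) D1] st D2 by auto
 show "integrable M (%z. G z * (W t z - W s z)^2)"
 using \<open>s < t \<or> s = t\<close> indep_var_integrable[OF ind2 G(2) D3] st by auto
 show "(LINT z|M. G z * (W t z - W s z)^2) = integral\<^sup>L M G * (t - s)"
 using \<open>s < t \<or> s = t\<close> indep_var_lebesgue_integral[OF ind2 G(2) D3] st D4 by auto
 qed
qed

context brownian_basis
begin

lemma space_filt [simp]: "0 <= t ==> space (F t) = space M"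
 using subalg by (auto simp: subalgebra_def)

lemma sets_filt_le: "0 <= t ==> A : sets (F t) ==> A : sets M"
 using subalg by (auto simp: subalgebra_def)

lemma measurable_filt_mono: "0 <= s ==> s <= t ==> f : measurable (F s) N ==> f : measurable (F t) N"
 using measurable_from_subalg[OF filt_mono] by blast

lemma measurable_filt_M: "0 <= s ==> f : measurable (F s) N ==> f : measurable M N"
 using measurable_from_subalg[OF subalg] by blast

lemma W_adapted_le: "0 <= s ==> s <= t ==> W s : BM (F t)"
 using measurable_filt_mono W_adapted by blast

lemma W_measurable: "0 <= t ==> W t : BM M"
 using measurable_filt_M W_adapted by blast

lemma null_set_of_AE:
 assumes "AE z in M. P z"
 shows "{z : space M. \<not> P z} : null_sets M"
proof -
 interpret cm: complete_measure M by (rule complete)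
 show ?thesis
 using assms cm.complete2 by (auto simp: eventually_ae_filter)
qed

text \<open>By completeness every subset of the exceptional set is a null set and hence lies in
  \<open>F t\<close>. This is how limits and modifications that are only almost sure stay
  adapted.\<close>

lemma measurable_filt_AE_cong:
 fixes f g :: "'a => 'b::topological_space"
 assumes t: "0 <= t" and f: "f : BM (F t)" and eq: "AE z in M. f z = g z"
 shows "g : BM (F t)"
proof (rule measurableI)
 fix S :: "'b set" assume S: "S : sets borel"
 interpret cm: complete_measure M by (rule complete)
 let ?N = "{z : space M. f z ~= g z}"
 have N: "?N : null_sets M" using null_set_of_AE[OF eq] by simp
 have "g -` S \<inter> space M = ((f -` S \<inter> space M) - ?N) \<union> (?N \<inter> (g -` S))" by auto
 moreover have "?N \<inter> (g -` S) : null_sets M" using N using cm.complete2[OF _ N, of "?N \<inter> (g -` S)"] by blast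
 ultimately show "g -` S \<inter> space (F t) : sets (F t)"
 using measurable_sets[OF f S] null_in_filt[OF t] N t by auto
qed (use t in auto)

end

section \<open>Elementary stochastic integrals: isometry and Doob's maximal inequality\<close>

text \<open>Deterministic form of Doob's L2 inequality: \<open>s\<close> is the running maximum of
  the path \<open>m\<close>, and the sum is a discrete integral of \<open>s\<close> against
  \<open>m\<close>, which has mean zero when \<open>m\<close> is a martingale. Taking expectations
  gives the constant 4 without stopping times.\<close>

lemma doob_pathwise:
 fixes m :: "nat => real"
 assumes "m 0 = 0" "s 0 = 0" "\<And>i. s (Suc i) = max (s i) (m (Suc i))"
 shows "(s n)^2 + 4 * (\<Sum>i<n. s i * (m (Suc i) - m i)) <= 4 * (m n)^2"
proof -
 \<comment> \<open>The induction needs this sharper bound; the square of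
   \<open>2 * m n - s n\<close> turns it into the claim.\<close>
 have "4 * (\<Sum>i<n. s i * (m (Suc i) - m i)) <= 4 * s n * m n - 2 * (s n)^2"
 proof (induction n)
 case (Suc n)
 have "0 <= 2 * (m (Suc n) - s n)^2" by simp
 then have "4 * s n * m (Suc n) - 2 * (s n)^2 <= 2 * (m (Suc n))^2"
 by (simp add: power2_eq_square algebra_simps)
 then have "4 * s n * m (Suc n) - 2 * (s n)^2 <= 4 * s (Suc n) * m (Suc n) - 2 * (s (Suc n))^2"
 using assms(3)[of n] by (cases "m (Suc n) <= s n") (auto simp: power2_eq_square max_def)
 moreover have "4 * (\<Sum>i<Suc n. s i * (m (Suc i) - m i)) <= 4 * s n * m (Suc n) - 2 * (s n)^2"
 using Suc by (simp add: algebra_simps)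
 ultimately show ?case by linarith
 qed (use assms in simp)
 moreover have "0 <= (2 * m n - s n)^2" by simp
 ultimately show ?thesis by (simp add: power2_eq_square algebra_simps)
qed

lemma norm_sum_squared:
 fixes f :: "'i => 'b::real_inner"
 shows "(norm (\<Sum>k\<in>K. f k))^2 = (\<Sum>k\<in>K. \<Sum>l\<in>K. f k \<bullet> f l)"
 unfolding power2_norm_eq_inner inner_sum_left inner_sum_right by (rule sum.swap)

lemma abs_mult_le_sum_squares: "\<bar>x * y\<bar> <= x^2 + (y::real)^2"
proof -
 have "0 <= (\<bar>x\<bar> - \<bar>y\<bar>)^2" by simp
 then have "2 * \<bar>x * y\<bar> <= x^2 + y^2" by (simp add: power2_diff abs_mult)
 then show ?thesis using abs_ge_zero[of "x * y"] by linarith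
qed

lemma (in finite_measure) integrable_mult_L2:
 fixes f g :: "'a => real"
 assumes "f : BM M" "g : BM M"
 "integrable M (%x. (f x)^2)" "integrable M (%x. (g x)^2)"
 shows "integrable M (%x. f x * g x)"
 by (rule Bochner_Integration.integrable_bound[OF Bochner_Integration.integrable_add[OF assms(3,4)]])
 (use assms(1,2) abs_mult_le_sum_squares in auto)

text \<open>The intervals are indexed by an arbitrary finite set and may overlap. Hence the
  difference of two simple processes is again of this form, on the disjoint sum of the index sets,
  and no common refinement of partitions has to be built.\<close>

definition elementary_data ::
 "'a measure => (real => 'a measure) => 'i set => ('i => real) => ('i => real) => ('i => 'a => 'b::euclidean_space) => bool" where
 "elementary_data M F K a b h \<longleftrightarrow> finite K & (ALL k:K. 0 <= a k & a k <= b k & h k : BM (F (a k)) &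
 (EX c. ALL z:space M. norm (h k z) <= c))"

definition elementary_integral ::
 "(real => 'a => real) => 'i set => ('i => real) => ('i => real) => ('i => 'a => 'b::euclidean_space) => real => 'a => 'b" where
 "elementary_integral W K a b h t z = (\<Sum>k\<in>K. (W (min (b k) t) z - W (min (a k) t) z) *\<^sub>R h k z)"

context brownian_basis
begin

lemma W_increment_sq_integrable:
 assumes "0 <= s" "s <= t" shows "integrable M (%z. (W t z - W s z)^2)"
proof -
 have "integrable M (%z. 1 * (W t z - W s z)^2)"
 by (rule increment_sq_integrable[OF assms]) auto
 then show ?thesis by (simp only: mult_1)
qed

lemma increment_mult_integrable:
 assumes "0 <= a" "a <= b" "0 <= c" "c <= d" and G: "G : BM M" "\<And>z. z : space M ==> \<bar>G z\<bar> <= B"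
 shows "integrable M (%z. G z * ((W b z - W a z) * (W d z - W c z)))"
proof (rule Bochner_Integration.integrable_bound)
 show "integrable M (%z. B * ((W b z - W a z) * (W d z - W c z)))"
 using assms W_measurable by (intro integrable_mult_right integrable_mult_L2 W_increment_sq_integrable) auto
 show "(%z. G z * ((W b z - W a z) * (W d z - W c z))) : BM M"
 using assms W_measurable by auto
 show "AE z in M. norm (G z * ((W b z - W a z) * (W d z - W c z))) <= norm (B * ((W b z - W a z) * (W d z - W c z)))"
 proof (rule AE_I2)
 fix z assume "z : space M"
 then have "\<bar>G z\<bar> <= \<bar>B\<bar>" using G(2)[of z] by linarith
 then show "norm (G z * ((W b z - W a z) * (W d z - W c z))) <= norm (B * ((W b z - W a z) * (W d z - W c z)))"
 by (simp only: real_norm_def abs_mult) (rule mr_mono, auto)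
 qed
qed

text \<open>The weight times the earlier increment is known at time \<open>c\<close>, so the later
  increment averages it to zero.\<close>

lemma increment_mult_integral_disjoint:
 assumes "0 <= a" "a <= b" "b <= c" "c <= d"
 and G: "G : BM (F c)" "\<And>z. z : space M ==> \<bar>G z\<bar> <= B"
 shows "(LINT z|M. G z * ((W b z - W a z) * (W d z - W c z))) = 0"
proof -
 have GM: "G : BM M" using measurable_filt_M[OF _ G(1)] assms by auto
 have "integrable M (%z. B * (W b z - W a z))"
 by (rule increment_integrable[OF assms(1,2)]) auto
 then have "integrable M (%z. G z * (W b z - W a z))"
 proof (rule Bochner_Integration.integrable_bound)
 show "(%z. G z * (W b z - W a z)) : BM M" using GM W_measurable assms by auto
 show "AE z in M. norm (G z * (W b z - W a z)) <= norm (B * (W b z - W a z))"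
 proof (rule AE_I2)
 fix z assume "z : space M"
 then have "\<bar>G z\<bar> <= \<bar>B\<bar>" using G(2)[of z] by linarith
 then show "norm (G z * (W b z - W a z)) <= norm (B * (W b z - W a z))"
 by (simp only: real_norm_def abs_mult) (rule mr_mono, auto)
 qed
 qed
 moreover have "(%z. G z * (W b z - W a z)) : BM (F c)"
 using G W_adapted_le assms by (intro borel_measurable_times borel_measurable_diff) auto
 ultimately have "(LINT z|M. (G z * (W b z - W a z)) * (W d z - W c z)) = 0"
 using assms by (intro increment_integral) auto
 then show ?thesis by (simp add: mult.assoc)
qed

lemma bounded_filt_integrable:
 assumes "0 <= t" "G : BM (F t)" "\<And>z. z : space M ==> \<bar>G z\<bar> <= (B::real)"
 shows "integrable M G"
 using measurable_filt_M[OF assms(1,2)] assms(3) by (intro integrable_const_bound[of _ B]) auto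

text \<open>If the intervals overlap, cutting at \<open>c\<close> and at \<open>min b d\<close>
  leaves the square of the increment over the common part and two products over disjoint intervals,
  which vanish in the mean.\<close>

lemma increment_mult_integral_ordered:
 assumes ab: "0 <= a" "a <= b" and ac: "a <= c" and cd: "c <= d"
 and G: "G : BM (F c)" "\<And>z. z : space M ==> \<bar>G z\<bar> <= B"
 shows "(LINT z|M. G z * ((W b z - W a z) * (W d z - W c z))) = integral\<^sup>L M G * max 0 (min b d - c)"
proof (cases "b <= c")
 case True
 then show ?thesis using increment_mult_integral_disjoint[OF ab True cd G] by simp
next
 case False
 define m where "m = min b d"
 define n where "n = max b d"
 have m: "c <= m" "m <= n" using False cd by (auto simp: m_def n_def)
 have c0: "0 <= c" using ab ac by linarith
 have GM: "G : BM M" using measurable_filt_M[OF c0 G(1)] .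
 have Gm: "G : BM (F m)" using measurable_filt_mono[OF c0 m(1) G(1)] .
 have eq: "G z * ((W b z - W a z) * (W d z - W c z)) =
 (G z * ((W c z - W a z) * (W d z - W c z)) + G z * (W m z - W c z)^2)
 + G z * ((W m z - W c z) * (W n z - W m z))" for z
 by (cases "b <= d") (simp_all add: m_def n_def min_def max_def power2_eq_square algebra_simps)
 have i1: "integrable M (%z. G z * ((W c z - W a z) * (W d z - W c z)))"
 using ab ac cd c0 G(2) GM by (intro increment_mult_integrable) auto
 have i2: "integrable M (%z. G z * (W m z - W c z)^2)"
 using increment_sq_integrable[OF c0 m(1) G(1) bounded_filt_integrable[OF c0 G]] .
 have i3: "integrable M (%z. G z * ((W m z - W c z) * (W n z - W m z)))"
 using m c0 G(2) GM by (intro increment_mult_integrable) auto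
 have "(LINT z|M. G z * ((W b z - W a z) * (W d z - W c z))) = 0 + integral\<^sup>L M G * (m - c) + 0"
 unfolding eq
 using increment_mult_integral_disjoint[OF ab(1) ac order_refl cd G] increment_mult_integral_disjoint[OF c0 m(1) order_refl m(2) Gm G(2)]
 increment_sq_integral[OF c0 m(1) G(1) bounded_filt_integrable[OF c0 G]]
 by (simp only: Bochner_Integration.integral_add[OF Bochner_Integration.integrable_add[OF i1 i2] i3] Bochner_Integration.integral_add[OF i1 i2])
 then show ?thesis using m by (simp add: m_def)
qed

lemma increment_mult_integral:
 assumes ab: "0 <= a" "a <= b" and cd: "0 <= c" "c <= d"
 and G: "G : BM (F (max a c))" "\<And>z. z : space M ==> \<bar>G z\<bar> <= B"
 shows "(LINT z|M. G z * ((W b z - W a z) * (W d z - W c z))) = integral\<^sup>L M G * max 0 (min b d - max a c)"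
proof -
 show ?thesis
 proof (cases "a <= c")
 case True
 then show ?thesis using increment_mult_integral_ordered[OF ab True cd(2) _ G(2)] G(1) by (simp add: max_def)
 next
 case False
 then have "c <= a" by simp
 from increment_mult_integral_ordered[OF cd this ab(2) _ G(2)] G(1) False show ?thesis
 by (simp add: max_def min.commute mult.commute[of "W b _ - W a _"])
 qed
qed

lemma has_bochner_integral_indicator_Ioc_mult:
 "has_bochner_integral lborel (%r. indr {a<..b} r * indr {c<..d} r) (max 0 (min b d - max a c))"
proof -
 have "(%r. indr {a<..b} r * indr {c<..d} r) = indicator {max a c<..min b d}"
 by (auto simp: ind_def)
 then show ?thesis
 using has_bochner_integral_real_indicator[of "{max a c<..min b d}" lborel]
 by (cases "max a c <= min b d") (auto simp: max_def min_def split: if_splits)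
qed

text \<open>Expand both squares over pairs of indices. The weight \<open>h k . h l\<close> is known
  at the later left endpoint, so the mean of the product of the two increments contributes the
  length of the overlap of the intervals, which is also the time integral of the product of the
  indicators.\<close>

lemma elementary_isometry:
 fixes h :: "'i => 'a => 'b::euclidean_space"
 assumes ed: "elementary_data M F K a b h"
 shows "(NN M (%z. nsq (\<Sum>k\<in>K. (W (b k) z - W (a k) z) *\<^sub>R h k z))) =
 (NN M (%z. NN lborel (%r. nsq (\<Sum>k\<in>K. indr {a k<..b k} r *\<^sub>R h k z))))"
proof -
 have fin: "finite K" and ab: "\<And>k. k : K ==> 0 <= a k" "\<And>k. k : K ==> a k <= b k"
 and hF: "\<And>k. k : K ==> h k : BM (F (a k))"
 and "ALL k:K. EX c. ALL z:space M. norm (h k z) <= c"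
 using ed by (auto simp: elementary_data_def)
 then obtain c where c: "\<And>k z. k : K ==> z : space M ==> norm (h k z) <= c k" by metis
 have hM: "h k : BM M" if "k : K" for k using measurable_filt_M[OF ab(1) hF] that by blast
 let ?m = "%k l. max 0 (min (b k) (b l) - max (a k) (a l))"
 let ?G = "%k l z. h k z \<bullet> h l z"
 have G1: "?G k l : BM (F (max (a k) (a l)))" if "k : K" "l : K" for k l
 using measurable_filt_mono[OF ab(1) _ hF, of k "max (a k) (a l)"] measurable_filt_mono[OF ab(1) _ hF, of l "max (a k) (a l)"] that
 by (intro borel_measurable_inner) auto
 have G2: "\<bar>?G k l z\<bar> <= c k * c l" if "k : K" "l : K" "z : space M" for k l z
 using Cauchy_Schwarz_ineq2[of "h k z" "h l z"] mult_mono[OF c[of k z] c[of l z]] norm_ge_zero[of "h k z"] c[of k z] that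
 by (metis norm_ge_zero order_trans)
 have Gi: "integrable M (?G k l)" if "k : K" "l : K" for k l
 using hM G2 that by (intro integrable_const_bound[of _ "c k * c l"]) auto
 have L: "(norm (\<Sum>k\<in>K. (W (b k) z - W (a k) z) *\<^sub>R h k z))^2 =
 (\<Sum>k\<in>K. \<Sum>l\<in>K. ?G k l z * ((W (b k) z - W (a k) z) * (W (b l) z - W (a l) z)))" for z
 unfolding norm_sum_squared by (intro sum.cong refl) (simp add: algebra_simps)
 have R: "has_bochner_integral lborel (%r. (norm (\<Sum>k\<in>K. indr {a k<..b k} r *\<^sub>R h k z))^2)
 (\<Sum>k\<in>K. \<Sum>l\<in>K. ?G k l z * ?m k l)" for z
 proof -
 have eq: "(norm (\<Sum>k\<in>K. indr {a k<..b k} r *\<^sub>R h k z))^2 =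
 (\<Sum>k\<in>K. \<Sum>l\<in>K. ?G k l z * (indr {a k<..b k} r * indr {a l<..b l} r))" for r
 unfolding norm_sum_squared by (intro sum.cong refl) (simp add: algebra_simps)
 show ?thesis unfolding eq
 by (intro has_bochner_integral_sum has_bochner_integral_mult_right has_bochner_integral_indicator_Ioc_mult)
 qed
 have int: "integrable M (%z. ?G k l z * ((W (b k) z - W (a k) z) * (W (b l) z - W (a l) z)))" if "k : K" "l : K" for k l
 using that ab hM G2 by (intro increment_mult_integrable[where B="c k * c l"]) auto
 have "(NN M (%z. nsq (\<Sum>k\<in>K. (W (b k) z - W (a k) z) *\<^sub>R h k z))) =
 ennreal (LINT z|M. (norm (\<Sum>k\<in>K. (W (b k) z - W (a k) z) *\<^sub>R h k z))^2)"
 proof (rule nn_integral_eq_integral)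
 show "integrable M (%z. (norm (\<Sum>k\<in>K. (W (b k) z - W (a k) z) *\<^sub>R h k z))^2)"
 unfolding L by (intro Bochner_Integration.integrable_sum int)
 qed auto
 also have "(LINT z|M. (norm (\<Sum>k\<in>K. (W (b k) z - W (a k) z) *\<^sub>R h k z))^2) =
 (\<Sum>k\<in>K. \<Sum>l\<in>K. integral\<^sup>L M (?G k l) * ?m k l)"
 unfolding L
 proof (rule has_bochner_integral_integral_eq, intro has_bochner_integral_sum)
 fix k l assume kl: "k : K" "l : K"
 show "has_bochner_integral M (%z. ?G k l z * ((W (b k) z - W (a k) z) * (W (b l) z - W (a l) z))) (integral\<^sup>L M (?G k l) * ?m k l)"
 using increment_mult_integral[OF ab[OF kl(1)] ab[OF kl(2)] G1[OF kl] G2[OF kl]] int[OF kl]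
 by (simp add: has_bochner_integral_iff)
 qed
 also have "... = (LINT z|M. (\<Sum>k\<in>K. \<Sum>l\<in>K. ?G k l z * ?m k l))"
 by (rule has_bochner_integral_integral_eq[symmetric], intro has_bochner_integral_sum has_bochner_integral_mult_left)
 (use Gi in \<open>auto simp: has_bochner_integral_iff\<close>)
 also have "ennreal ... = (NN M (%z. ennreal (\<Sum>k\<in>K. \<Sum>l\<in>K. ?G k l z * ?m k l)))"
 proof (rule nn_integral_eq_integral[symmetric])
 show "integrable M (%z. \<Sum>k\<in>K. \<Sum>l\<in>K. ?G k l z * ?m k l)"
 by (intro Bochner_Integration.integrable_sum integrable_mult_left Gi)
 show "AE z in M. 0 <= (\<Sum>k\<in>K. \<Sum>l\<in>K. ?G k l z * ?m k l)"
 unfolding has_bochner_integral_integral_eq[OF R, symmetric] by simp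
 qed
 also have "... = (NN M (%z. NN lborel (%r. nsq (\<Sum>k\<in>K. indr {a k<..b k} r *\<^sub>R h k z))))"
 using nn_integral_eq_integral[OF integrable.intros[OF R]] has_bochner_integral_integral_eq[OF R] by simp
 finally show ?thesis .
qed

end

lemma SUP_countable_eq_SUP_finite:
 fixes f :: "'b => ennreal"
 assumes "countable Q" "Q ~= {}"
 shows "(SUP q\<in>Q. f q) = (SUP m::nat. SUP i\<in>{..m}. f (from_nat_into Q i))"
proof (rule antisym)
 show "(SUP q\<in>Q. f q) <= (SUP m::nat. SUP i\<in>{..m}. f (from_nat_into Q i))"
 proof (rule SUP_least)
 fix q assume "q : Q"
 then obtain i where "q = from_nat_into Q i" using assms by (metis from_nat_into_surj)
 then show "f q <= (SUP m::nat. SUP i\<in>{..m}. f (from_nat_into Q i))"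
 by (intro SUP_upper2[of i UNIV] SUP_upper2[of i "{..i}"]) auto
 qed
 show "(SUP m::nat. SUP i\<in>{..m}. f (from_nat_into Q i)) <= (SUP q\<in>Q. f q)"
 using assms by (intro SUP_least SUP_upper from_nat_into)
qed

lemma norm_sq_eq_sum_Basis: "(norm x)^2 = (\<Sum>e\<in>Basis. (x \<bullet> e)^2)"
 for x :: "'b::euclidean_space"
 unfolding power2_norm_eq_inner by (subst euclidean_inner) (simp add: power2_eq_square)

lemma elementary_data_inner:
 assumes "elementary_data M F K a b h"
 shows "elementary_data M F K a b (%k z. h k z \<bullet> e)"
 unfolding elementary_data_def
proof (intro conjI ballI)
 fix k assume k: "k : K"
 from assms k obtain c where c: "ALL z:space M. norm (h k z) <= c" by (auto simp: elementary_data_def)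
 have "norm (h k z \<bullet> e) <= c * norm e" if "z : space M" for z
 using Cauchy_Schwarz_ineq2[of "h k z" e] mr_mono[OF c[rule_format, OF that] norm_ge_zero[of e]] by simp
 then show "EX c. ALL z:space M. norm (h k z \<bullet> e) <= c" by blast
qed (use assms in \<open>auto simp: elementary_data_def\<close>)

lemma elementary_integral_inner:
 "elementary_integral W K a b h t z \<bullet> e = elementary_integral W K a b (%k z. h k z \<bullet> e) t z"
 by (simp add: elementary_integral_def inner_sum_left)

context brownian_basis
begin

lemma elementary_sum_measurable:
 fixes h :: "'i => 'a => 'b::euclidean_space"
 assumes "elementary_data M F K a0 b0 h" "\<And>k. k : K ==> 0 <= a k & a k <= b k"
 shows "(%z. \<Sum>k\<in>K. (W (b k) z - W (a k) z) *\<^sub>R h k z) : BM M"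
proof (intro borel_measurable_sum borel_measurable_scaleR borel_measurable_diff W_measurable)
 fix k assume "k : K"
 then show "0 <= b k" "0 <= a k" "h k : BM M"
 using assms measurable_filt_M[of "a0 k" "h k"] by (auto simp: elementary_data_def dest!: bspec intro: order_trans)
qed

lemma elementary_integral_measurable:
 fixes h :: "'i => 'a => 'b::euclidean_space"
 assumes "elementary_data M F K a b h" "0 <= t"
 shows "elementary_integral W K a b h t : BM M"
 unfolding elementary_integral_def
 by (rule elementary_sum_measurable[OF assms(1)]) (use assms in \<open>auto simp: elementary_data_def\<close>)

lemma elementary_integral_adapted:
 fixes h :: "'i => 'a => 'b::euclidean_space"
 assumes "elementary_data M F K a b h" "0 <= t"
 shows "elementary_integral W K a b h t : BM (F t)"
 unfolding elementary_integral_def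
proof (rule borel_measurable_sum)
 fix k assume k: "k : K"
 then have ab: "0 <= a k" "a k <= b k" "h k : BM (F (a k))" using assms by (auto simp: elementary_data_def)
 show "(%z. (W (min (b k) t) z - W (min (a k) t) z) *\<^sub>R h k z) : BM (F t)"
 proof (cases "a k <= t")
 case True
 then show ?thesis using ab assms(2)
 by (intro borel_measurable_scaleR borel_measurable_diff W_adapted_le measurable_filt_mono[OF ab(1) True ab(3)]) auto
 next
 case False
 then have "min (b k) t = t" "min (a k) t = t" using ab by auto
 then show ?thesis by simp
 qed
qed

lemma elementary_sum_sq_integrable:
 fixes h :: "'i => 'a => 'b::euclidean_space"
 assumes ed: "elementary_data M F K a0 b0 h" and ab: "\<And>k. k : K ==> 0 <= a k & a k <= b k"
 shows "integrable M (%z. (norm (\<Sum>k\<in>K. (W (b k) z - W (a k) z) *\<^sub>R h k z))^2)"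
proof -
 from ed have a0: "\<And>k. k : K ==> 0 <= a0 k" and hF: "\<And>k. k : K ==> h k : BM (F (a0 k))"
 and "ALL k:K. EX c. ALL z:space M. norm (h k z) <= c" by (auto simp: elementary_data_def)
 then obtain c where c: "\<And>k z. k : K ==> z : space M ==> norm (h k z) <= c k" by metis
 have hM: "h k : BM M" if "k : K" for k using measurable_filt_M[OF a0 hF] that by blast
 have G2: "\<bar>h k z \<bullet> h l z\<bar> <= c k * c l" if "k : K" "l : K" "z : space M" for k l z
 using Cauchy_Schwarz_ineq2[of "h k z" "h l z"] mult_mono[OF c[of k z] c[of l z]] norm_ge_zero[of "h k z"] c[of k z] that
 by (metis norm_ge_zero order_trans)
 have L: "(norm (\<Sum>k\<in>K. (W (b k) z - W (a k) z) *\<^sub>R h k z))^2 =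
 (\<Sum>k\<in>K. \<Sum>l\<in>K. (h k z \<bullet> h l z) * ((W (b k) z - W (a k) z) * (W (b l) z - W (a l) z)))" for z
 unfolding norm_sum_squared by (intro sum.cong refl) (simp add: algebra_simps)
 show ?thesis unfolding L
 proof (intro Bochner_Integration.integrable_sum)
 fix k l assume "k : K" "l : K"
 then show "integrable M (%z. (h k z \<bullet> h l z) * ((W (b k) z - W (a k) z) * (W (b l) z - W (a l) z)))"
 using ab hM G2 by (intro increment_mult_integrable[where B="c k * c l"]) auto
 qed
qed

lemma elementary_integral_sq_integrable:
 fixes h :: "'i => 'a => 'b::euclidean_space"
 assumes "elementary_data M F K a b h" "0 <= t"
 shows "integrable M (%z. (norm (elementary_integral W K a b h t z))^2)"
 unfolding elementary_integral_def
 by (rule elementary_sum_sq_integrable[OF assms(1)]) (use assms in \<open>auto simp: elementary_data_def\<close>)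

lemma clamped_increment:
 assumes "a <= b" "t <= t'"
 shows "(W (min b t') z - W (min a t') z) - (W (min b t) z - W (min a t) z) =
 (if max a t <= min b t' then W (min b t') z - W (max a t) z else 0)"
proof (cases "a <= t")
 case True
 then show ?thesis using assms by (auto simp: min_def max_def)
next
 case False
 then show ?thesis using assms by (auto simp: min_def max_def)
qed

text \<open>The running maximum of the sampled integral is adapted, so its discrete integral against
  the increments has mean zero and \<open>doob_pathwise\<close> integrates to the factor 4. Only
  signed values are dominated; the absolute value is reached later by using a direction and its
  negative.\<close>

lemma elementary_doob_real:
 fixes h :: "'i => 'a => real"
 assumes ed: "elementary_data M F K a b h" and tu: "tu 0 = 0" "mono tu"
 shows "EX S. S : BM M &
 (\<forall>i\<le>n::nat. ALL y. 0 <= S y & elementary_integral W K a b h (tu i) y <= S y) &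
 (NN M (%y. ennreal ((S y)^2))) <= 4 * (NN M (%y. ennreal ((elementary_integral W K a b h (tu n) y)^2)))"
proof -
 define m where "m = (%i. elementary_integral W K a b h (tu i))"
 define s where "s = rec_nat (%_. 0) (%i r y. max (r y) (m (Suc i) y))"
 have s0: "s 0 y = 0" and sS: "s (Suc i) y = max (s i y) (m (Suc i) y)" for i y by (simp_all add: s_def)
 have tu0: "0 <= tu i" for i using tu by (metis le0 monoD)
 have tuS: "tu i <= tu (Suc i)" for i using tu by (simp add: monoD)
 have ab: "\<And>k. k : K ==> 0 <= a k" "\<And>k. k : K ==> a k <= b k" and hF: "\<And>k. k : K ==> h k : BM (F (a k))"
 and hb: "\<And>k. k : K ==> EX c. ALL y:space M. norm (h k y) <= c"
 using ed by (auto simp: elementary_data_def)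
 have m0: "m 0 y = 0" for y
 unfolding m_def elementary_integral_def
 proof (intro sum.neutral ballI)
 fix k assume "k : K"
 then have "min (b k) (tu 0) = 0" "min (a k) (tu 0) = 0" using ab[of k] tu(1) by auto
 then show "(W (min (b k) (tu 0)) y - W (min (a k) (tu 0)) y) *\<^sub>R h k y = 0" by simp
 qed
 have mm: "m i : BM (F (tu i))" for i unfolding m_def by (rule elementary_integral_adapted[OF ed tu0])
 have mM: "m i : BM M" for i using measurable_filt_M[OF tu0 mm] .
 have mi: "integrable M (%y. (m i y)^2)" for i
 using elementary_integral_sq_integrable[OF ed tu0[of i]] by (simp add: m_def)
 have sm: "s i : BM (F (tu i))" for i
 proof (induction i)
 case 0
 then show ?case by (simp add: s_def)
 next
 case (Suc i)
 have "(%y. max (s i y) (m (Suc i) y)) : BM (F (tu (Suc i)))"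
 by (intro borel_measurable_max mm measurable_filt_mono[OF tu0 tuS Suc])
 then show ?case by (simp add: sS[symmetric])
 qed
 have sM: "s i : BM M" for i using measurable_filt_M[OF tu0 sm] .
 have si: "integrable M (%y. (s i y)^2)" for i
 proof (induction i)
 case (Suc i)
 show ?case
 by (rule Bochner_Integration.integrable_bound[OF Bochner_Integration.integrable_add[OF Suc mi[of "Suc i"]]])
 (use borel_measurable_power[OF sM[of "Suc i"], of 2] in \<open>auto simp: sS max_def\<close>)
 qed (simp add: s0)
 have s_int: "integrable M (s i)" for i
 using integrable_mult_L2[of "s i" "%_. 1"] sM si by simp
 have sh: "integrable M (%y. s i y * h k y)" if k: "k : K" for i k
 proof -
 obtain c where c: "ALL y:space M. norm (h k y) <= c" using hb[OF k] by auto
 show ?thesis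
 proof (rule Bochner_Integration.integrable_bound[OF integrable_mult_right[OF s_int[of i], of c]])
 show "(%y. s i y * h k y) : BM M" using sM measurable_filt_M[OF ab(1) hF] k by auto
 have "\<bar>h k y\<bar> <= \<bar>c\<bar>" if "y : space M" for y using c that by fastforce
 then show "AE y in M. norm (s i y * h k y) <= norm (c * s i y)"
 by (intro AE_I2) (auto simp: abs_mult mult.commute intro: mr_mono)
 qed
 qed
 \<comment> \<open>The step from \<open>tu i\<close> to \<open>tu (Suc i)\<close> meets the interval
   of index \<open>k\<close> between \<open>?p k\<close> and \<open>?q k\<close>. Since
   \<open>s i * h k\<close> is known at \<open>?p k\<close>, each summand has mean zero.\<close>
 have increment_term: "has_bochner_integral M (%y. s i y * (m (Suc i) y - m i y)) 0" for i
 proof -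
 let ?p = "%k. max (a k) (tu i)" and ?q = "%k. min (b k) (tu (Suc i))"
 have eq: "s i y * (m (Suc i) y - m i y) = (\<Sum>k\<in>K. if ?p k <= ?q k then (s i y * h k y) * (W (?q k) y - W (?p k) y) else 0)" for y
 unfolding m_def elementary_integral_def sum_subtractf[symmetric] sum_distrib_left
 proof (rule sum.cong[OF refl])
 fix k assume "k : K"
 have "s i y * ((W (min (b k) (tu (Suc i))) y - W (min (a k) (tu (Suc i))) y) *\<^sub>R h k y - (W (min (b k) (tu i)) y - W (min (a k) (tu i)) y) *\<^sub>R h k y)
 = (s i y * h k y) * ((W (min (b k) (tu (Suc i))) y - W (min (a k) (tu (Suc i))) y) - (W (min (b k) (tu i)) y - W (min (a k) (tu i)) y))"
 by (simp add: algebra_simps)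
 also have "... = (if ?p k <= ?q k then (s i y * h k y) * (W (?q k) y - W (?p k) y) else 0)"
 unfolding clamped_increment[OF ab(2)[OF \<open>k \<in> K\<close>] tuS] by simp
 finally show "s i y * ((W (min (b k) (tu (Suc i))) y - W (min (a k) (tu (Suc i))) y) *\<^sub>R h k y - (W (min (b k) (tu i)) y - W (min (a k) (tu i)) y) *\<^sub>R h k y)
 = (if ?p k <= ?q k then (s i y * h k y) * (W (?q k) y - W (?p k) y) else 0)" .
 qed
 have "has_bochner_integral M (%y. if ?p k <= ?q k then (s i y * h k y) * (W (?q k) y - W (?p k) y) else 0) 0" if k: "k : K" for k
 proof (cases "?p k <= ?q k")
 case True
 have p0: "0 <= ?p k" using ab(1)[OF k] by auto
 have me: "(%y. s i y * h k y) : BM (F (?p k))"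
 using measurable_filt_mono[OF tu0 _ sm, of i "?p k"] measurable_filt_mono[OF ab(1) _ hF, of k "?p k"] k by auto
 show ?thesis using True increment_integrable[OF p0 True me sh[OF k]] increment_integral[OF p0 True me sh[OF k]]
 by (simp add: has_bochner_integral_iff)
 next
 case False
 then show ?thesis by (simp only: if_False has_bochner_integral_zero)
 qed
 then have "has_bochner_integral M (%y. \<Sum>k\<in>K. if ?p k <= ?q k then (s i y * h k y) * (W (?q k) y - W (?p k) y) else 0) (\<Sum>k\<in>K. 0)"
 by (rule has_bochner_integral_sum)
 then show ?thesis unfolding eq by simp
 qed
 have "has_bochner_integral M (%y. 4 * (\<Sum>i<n. s i y * (m (Suc i) y - m i y))) (4 * (\<Sum>i<n. 0))"
 by (intro has_bochner_integral_mult_right has_bochner_integral_sum increment_term)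
 then have z: "integrable M (%y. 4 * (\<Sum>i<n. s i y * (m (Suc i) y - m i y)))" "(LINT y|M. 4 * (\<Sum>i<n. s i y * (m (Suc i) y - m i y))) = 0"
 by (auto simp: has_bochner_integral_iff)
 have "(LINT y|M. (s n y)^2 + 4 * (\<Sum>i<n. s i y * (m (Suc i) y - m i y))) <= (LINT y|M. 4 * (m n y)^2)"
 by (rule integral_mono[OF Bochner_Integration.integrable_add[OF si z(1)] integrable_mult_right[OF mi]])
 (rule doob_pathwise[of "%i. m i _" "%i. s i _", OF m0 s0 sS])
 then have le: "(LINT y|M. (s n y)^2) <= 4 * (LINT y|M. (m n y)^2)"
 unfolding Bochner_Integration.integral_add[OF si z(1)] z(2) by simp
 have "(NN M (%y. ennreal ((s n y)^2))) <= 4 * (NN M (%y. ennreal ((m n y)^2)))"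
 using ennreal_leI[OF le] by (simp add: nn_integral_eq_integral[OF si] nn_integral_eq_integral[OF mi] ennreal_mult)
 moreover have "0 <= s i y" for i y by (induction i) (auto simp: s0 sS)
 moreover have "i <= j ==> s i y <= s j y" for i j y by (induction j rule: dec_induct) (auto simp: sS)
 moreover have "m i y <= s i y" for i y by (cases i) (auto simp: m0 s0 sS)
 ultimately show ?thesis using sM unfolding m_def by (intro exI[of _ "s n"]) (meson order_trans)
qed

text \<open>Each coordinate is bounded from both sides by Doob's inequality for \<open>e\<close> and
  for \<open>- e\<close>, which doubles 4 to 8; squares of coordinates add up to the squared
  norm.\<close>

lemma elementary_maximal_finite:
 fixes h :: "'i => 'a => 'b::euclidean_space"
 assumes ed: "elementary_data M F K a b h" and T: "0 <= T" and D: "finite D" "D \<subseteq> {0..T}"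
 shows "(NN M (%z. (SUP r\<in>D. nsq (elementary_integral W K a b h r z))))
 <= 8 * (nn2 M (elementary_integral W K a b h T))"
proof -
 let ?E = "elementary_integral W K a b h"
 \<comment> \<open>The points 0 and T are added because Doob's inequality starts where the integral
   vanishes and is stated at the terminal time. \<open>min i n\<close> below keeps \<open>tu\<close>
   monotone on all of nat.\<close>
 define xs where "xs = sorted_list_of_set (insert 0 (insert T D))"
 define n where "n = length xs - 1"
 define tu where "tu i = xs ! min i n" for i
 have set: "set xs = insert 0 (insert T D)" and so: "sorted xs" using D unfolding xs_def
 by (auto simp del: sorted_list_of_set_insert_remove)
 have ne: "xs ~= []" using set by auto
 then have len: "n < length xs" by (simp add: n_def)
 have mono: "mono tu" unfolding tu_def by (rule monoI, rule sorted_nth_mono[OF so]) (use len in auto)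
 have rng: "0 <= x & x <= T" if "x : set xs" for x using that set D T by auto
 have surj: "\<exists>i\<le>n. tu i = x" if "x : set xs" for x
 proof -
 obtain i where "i < length xs" "xs ! i = x" using \<open>x \<in> set xs\<close> by (auto simp: in_set_conv_nth)
 then show ?thesis unfolding tu_def n_def by (intro exI[of _ i]) auto
 qed
 have in_set: "tu i : set xs" for i using len by (simp add: tu_def)
 obtain i0 where "tu i0 = 0" using surj[of 0] set by auto
 then have tu0: "tu 0 = 0" using monoD[OF mono, of 0 i0] rng[OF in_set[of 0]] by simp
 obtain iT where "iT <= n" "tu iT = T" using surj[of T] set by auto
 then have tun: "tu n = T" using monoD[OF mono, of iT n] rng[OF in_set[of n]] by simp
 let ?P = "%e S. S : BM M &
 (\<forall>i\<le>n::nat. ALL z. 0 <= S z & ?E (tu i) z \<bullet> e <= S z) &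
 (NN M (%z. ennreal ((S z)^2))) <= 4 * (NN M (%z. ennreal ((?E (tu n) z \<bullet> e)^2)))"
 have "ALL e. EX S. ?P e S"
 using elementary_doob_real[OF elementary_data_inner[OF ed] tu0 mono, of n] unfolding elementary_integral_inner by blast
 then obtain S where S: "\<And>e. ?P e (S e)" by metis
 have bound: "(SUP r\<in>D. nsq (?E r z)) <= (\<Sum>e\<in>Basis. ennreal ((S e z)^2) + ennreal ((S (- e) z)^2))" for z
 proof (rule SUP_least)
 fix r assume "r : D"
 then obtain i where i: "i <= n" "tu i = r" using surj[of r] set by auto
 have sq: "(?E r z \<bullet> e)^2 <= (S e z)^2 + (S (- e) z)^2" for e
 proof -
 have *: "?E r z \<bullet> e <= S e z" "- (?E r z \<bullet> e) <= S (- e) z" "0 <= S e z" "0 <= S (- e) z"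
 using S[of e, THEN conjunct2, THEN conjunct1, rule_format, OF i(1), of z]
 S[of "- e", THEN conjunct2, THEN conjunct1, rule_format, OF i(1), of z] unfolding i(2) by (auto simp: inner_minus_right)
 show ?thesis
 proof (cases "0 <= ?E r z \<bullet> e")
 case True
 then have "(?E r z \<bullet> e)^2 <= (S e z)^2" using * by (intro power_mono) auto
 then show ?thesis by (simp add: add_increasing2)
 next
 case False
 then have "(- (?E r z \<bullet> e))^2 <= (S (- e) z)^2" using * by (intro power_mono) auto
 then show ?thesis by (simp add: add_increasing)
 qed
 qed
 have "(norm (?E r z))^2 = (\<Sum>e\<in>Basis. (?E r z \<bullet> e)^2)"
 by (rule norm_sq_eq_sum_Basis)
 also have "... <= (\<Sum>e\<in>Basis. (S e z)^2 + (S (- e) z)^2)" by (rule sum_mono) (rule sq)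
 finally have "nsq (?E r z) <= ennreal (\<Sum>e\<in>Basis. (S e z)^2 + (S (- e) z)^2)" by (rule ennreal_leI)
 also have "... = (\<Sum>e\<in>Basis. ennreal ((S e z)^2) + ennreal ((S (- e) z)^2))"
 by (simp add: sum_ennreal[symmetric] ennreal_plus del: sum_ennreal)
 finally show "nsq (?E r z) <= (\<Sum>e\<in>Basis. ennreal ((S e z)^2) + ennreal ((S (- e) z)^2))" .
 qed
 have Sm[measurable]: "S e : BM M" for e using S by blast
 have ET: "?E T : BM M" by (rule elementary_integral_measurable[OF ed T])
 have S4: "(NN M (%z. ennreal ((S e z)^2))) <= 4 * (NN M (%z. ennreal ((?E T z \<bullet> e)^2)))" for e using S[of e] tun by simp
 have "(NN M (%z. (SUP r\<in>D. nsq (?E r z)))) <= (NN M (%z. (\<Sum>e\<in>Basis. ennreal ((S e z)^2) + ennreal ((S (- e) z)^2))))"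
 by (rule nn_mono) (rule bound)
 also have "... = (\<Sum>e\<in>Basis. (NN M (%z. ennreal ((S e z)^2))) + (NN M (%z. ennreal ((S (- e) z)^2))))"
 by (simp add: nn_integral_sum nn_add)
 also have "... <= (\<Sum>e\<in>Basis. 8 * (NN M (%z. ennreal ((?E T z \<bullet> e)^2))))"
 proof (rule sum_mono)
 fix e :: 'b
 have "(NN M (%z. ennreal ((S e z)^2))) + (NN M (%z. ennreal ((S (- e) z)^2))) <=
 4 * (NN M (%z. ennreal ((?E T z \<bullet> e)^2))) + 4 * (NN M (%z. ennreal ((?E T z \<bullet> e)^2)))"
 using add_mono[OF S4[of e] S4[of "- e"]] by (simp add: inner_minus_right)
 also have "... = 8 * (NN M (%z. ennreal ((?E T z \<bullet> e)^2)))" by (simp add: distrib_right[symmetric])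
 finally show "(NN M (%z. ennreal ((S e z)^2))) + (NN M (%z. ennreal ((S (- e) z)^2))) <= 8 * (NN M (%z. ennreal ((?E T z \<bullet> e)^2)))" .
 qed
 also have "... = 8 * (NN M (%z. (\<Sum>e\<in>Basis. ennreal ((?E T z \<bullet> e)^2))))"
 using ET by (subst nn_integral_sum) (auto simp: sum_distrib_left)
 also have "... = 8 * (nn2 M (?E T))"
 by (simp add: norm_sq_eq_sum_Basis)
 finally show ?thesis .
qed

text \<open>Monotone convergence along an enumeration of \<open>Q\<close>, as the bound for finite
  sets does not depend on the set.\<close>

lemma elementary_maximal:
 fixes h :: "'i => 'a => 'b::euclidean_space"
 assumes ed: "elementary_data M F K a b h" and T: "0 <= T" and Q: "countable Q" "Q \<subseteq> {0..T}" "Q ~= {}"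
 shows "(NN M (%z. (SUP r\<in>Q. nsq (elementary_integral W K a b h r z))))
 <= 8 * (nn2 M (elementary_integral W K a b h T))"
proof -
 let ?E = "elementary_integral W K a b h"
 let ?f = "%m z. SUP r\<in>from_nat_into Q ` {..m::nat}. nsq (?E r z)"
 have in_Q: "from_nat_into Q i : Q" for i using Q(3) by (rule from_nat_into)
 have "?E (from_nat_into Q i) : BM M" for i
 by (rule elementary_integral_measurable[OF ed]) (use in_Q[of i] Q(2) in auto)
 then have meas: "?f m : BM M" for m
 by (intro borel_measurable_SUP) auto
 have "(NN M (%z. (SUP r\<in>Q. nsq (?E r z)))) = (NN M (%z. (SUP m. ?f m z)))"
 unfolding SUP_countable_eq_SUP_finite[OF Q(1,3)] by (simp add: image_image)
 also have "... = (SUP m. NN M (%z. ?f m z))"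
 by (rule nn_integral_monotone_convergence_SUP[OF _ meas]) (auto simp: incseq_def le_fun_def intro!: SUP_subset_mono)
 also have "... <= 8 * (nn2 M (?E T))"
 by (rule SUP_least, rule elementary_maximal_finite[OF ed T]) (use in_Q Q(2) in auto)
 finally show ?thesis .
qed

end

section \<open>Joint measurability of continuous processes, and continuous paths for Brownian
  motion\<close>

text \<open>Time is rounded down to the grid of mesh 1/(n+1). The rounded process is pieced together
  from countably many measurable functions, and it converges by continuity.\<close>

lemma caratheodory_measurable:
 fixes f :: "real => 'x => 'b::metric_space"
 assumes f: "\<And>t. f t : BM N" and c: "\<And>x. x : space N ==> continuous_on UNIV (%t. f t x)"
 shows "(%p. f (fst p) (snd p)) : BM (borel \<Otimes>\<^sub>M N)"
proof (rule borel_measurable_LIMSEQ_metric)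
 fix n :: nat
 let ?g = "%p::real \<times> 'x. \<lfloor>fst p * real (Suc n)\<rfloor>"
 have 1: "?g : measurable (borel \<Otimes>\<^sub>M N) (count_space UNIV)" by measurable
 have 2: "(%p. f (real_of_int i / real (Suc n)) (snd p)) : BM (borel \<Otimes>\<^sub>M N)" for i :: int
 using f by measurable
 show "(%p. f (real_of_int (?g p) / real (Suc n)) (snd p)) : BM (borel \<Otimes>\<^sub>M N)"
 by (rule measurable_compose_countable[where g="?g" and f="%i p. f (real_of_int i / real (Suc n)) (snd p)", OF 2 1])
next
 fix p :: "real \<times> 'x" assume "p : space (borel \<Otimes>\<^sub>M N)"
 then have x: "snd p : space N" by (auto simp: sp_pair)
 have fl: "fst p - inverse (real (Suc n)) <= real_of_int \<lfloor>fst p * real (Suc n)\<rfloor> / real (Suc n)"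
 "real_of_int \<lfloor>fst p * real (Suc n)\<rfloor> / real (Suc n) <= fst p" for n
 proof -
 have "(fst p - inverse (real (Suc n))) * real (Suc n) = fst p * real (Suc n) - 1" by (simp add: left_diff_distrib)
 then show "fst p - inverse (real (Suc n)) <= real_of_int \<lfloor>fst p * real (Suc n)\<rfloor> / real (Suc n)"
 using real_of_int_floor_ge_diff_one[of "fst p * real (Suc n)"] by (subst pos_le_divide_eq) auto
 show "real_of_int \<lfloor>fst p * real (Suc n)\<rfloor> / real (Suc n) <= fst p"
 by (subst pos_divide_le_eq) (auto simp del: of_nat_Suc)
 qed
 have l: "(%n. real_of_int \<lfloor>fst p * real (Suc n)\<rfloor> / real (Suc n)) ~~> fst p"
 proof (rule tendsto_sandwich)
 show "\<forall>\<^sub>F n in sequentially. fst p - inverse (real (Suc n)) <= real_of_int \<lfloor>fst p * real (Suc n)\<rfloor> / real (Suc n)"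
 by (intro always_eventually allI fl)
 show "\<forall>\<^sub>F n in sequentially. real_of_int \<lfloor>fst p * real (Suc n)\<rfloor> / real (Suc n) <= fst p"
 by (intro always_eventually allI fl)
 show "(%n. fst p - inverse (real (Suc n))) ~~> fst p"
 using tendsto_diff[OF tendsto_const LIMSEQ_inverse_real_of_nat, of "fst p"] by simp
 qed simp
 show "(%n. f (real_of_int \<lfloor>fst p * real (Suc n)\<rfloor> / real (Suc n)) (snd p)) ~~> f (fst p) (snd p)"
 by (rule continuous_on_tendsto_compose[OF c[OF x] l]) auto
qed

text \<open>Continuity of every path at all real times lets \<open>W\<close> be inserted into joint
  measurability arguments without exceptional events.\<close>

locale continuous_brownian_basis = brownian_basis +
 assumes W_continuous: "z : space M ==> continuous_on UNIV (%t. W t z)"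

text \<open>Discontinuous paths are replaced by 0 and negative times by time 0. The change at times
  \<open>t \<ge> 0\<close> happens on a null event, so adaptedness and all moments survive for the
  same filtration.\<close>

lemma (in brownian_basis) continuous_version:
 "EX W'. continuous_brownian_basis M F W' & (AE z in M. \<forall>t\<ge>0. W' t z = W t z)"
proof -
 define W' where "W' t z = (if continuous_on {0..} (%t. W t z) then W (max 0 t) z else 0)" for t z
 have eq: "AE z in M. \<forall>t\<ge>0. W' t z = W t z"
 using W_cont by eventually_elim (auto simp: W'_def max_def)
 have eqt: "AE z in M. W t z = W' t z" if "0 <= t" for t using eq by eventually_elim (use that in auto)
 have ad: "W' t : BM (F t)" if "0 <= t" for t
 by (rule measurable_filt_AE_cong[OF that W_adapted[OF that] eqt[OF that]])
 have cont: "continuous_on UNIV (%t. W' t z)" for z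
 proof (cases "continuous_on {0..} (%t. W t z)")
 case True
 have "continuous_on UNIV (%t. W (max 0 t) z)"
 by (rule continuous_on_compose2[OF True]) (auto intro!: continuous_intros)
 then show ?thesis using True by (simp add: W'_def)
 qed (simp add: W'_def)
 have meas: "W' t : BM M" if "0 <= t" for t using measurable_filt_M[OF that ad[OF that]] .
 have "continuous_brownian_basis M F W'"
 proof (intro continuous_brownian_basis.intro brownian_basis.intro brownian_basis_axioms.intro continuous_brownian_basis_axioms.intro)
 show "prob_space M" by (rule prob_space_axioms)
 show "AE z in M. continuous_on {0..} (%t. W' t z)" using cont by (auto intro: continuous_on_subset)
 fix s t :: real and G :: "'a => real"
 assume st: "0 <= s" "s <= t" and G: "G : BM (F s)" "integrable M G"
 have t0: "0 <= t" using st by simp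
 have e1: "AE z in M. G z * (W t z - W s z) = G z * (W' t z - W' s z)"
 using eqt[OF st(1)] eqt[OF t0] by eventually_elim simp
 have e2: "AE z in M. G z * (W t z - W s z)^2 = G z * (W' t z - W' s z)^2"
 using eqt[OF st(1)] eqt[OF t0] by eventually_elim simp
 note m[measurable] = measurable_filt_M[OF st(1) G(1)] W_measurable[OF st(1)] W_measurable[OF t0] meas[OF st(1)] meas[OF t0]
 have m1: "(%z. G z * (W t z - W s z)) : BM M" "(%z. G z * (W' t z - W' s z)) : BM M"
 "(%z. G z * (W t z - W s z)^2) : BM M" "(%z. G z * (W' t z - W' s z)^2) : BM M"
 by measurable
 show "integrable M (%z. G z * (W' t z - W' s z))"
 using increment_integrable[OF st G] integrable_cong_AE[OF m1(1,2) e1] by simp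
 show "(LINT z|M. G z * (W' t z - W' s z)) = 0"
 using increment_integral[OF st G] integral_cong_AE[OF m1(1,2) e1] by simp
 show "integrable M (%z. G z * (W' t z - W' s z)^2)"
 using increment_sq_integrable[OF st G] integrable_cong_AE[OF m1(3,4) e2] by simp
 show "(LINT z|M. G z * (W' t z - W' s z)^2) = integral\<^sup>L M G * (t - s)"
 using increment_sq_integral[OF st G] integral_cong_AE[OF m1(3,4) e2] by simp
 qed (use complete subalg filt_mono null_in_filt ad cont in auto)
 then show ?thesis using eq by blast
qed

section \<open>Stability and uniqueness of the stochastic integral\<close>

lemma norm_add3_sq: "(norm (x + y + z))^2 <= 3 * ((norm x)^2 + (norm y)^2 + (norm z)^2)"
 for x y z :: "'b::real_normed_vector"
proof -
 have "norm (x + y + z) <= norm x + norm y + norm z"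
 by (meson add_right_mono norm_triangle_ineq order_trans)
 then have "(norm (x + y + z))^2 <= (norm x + norm y + norm z)^2" by (rule power_mono) simp
 also have "... <= 3 * ((norm x)^2 + (norm y)^2 + (norm z)^2)"
 using sum_squares_bound[of "norm x" "norm y"] sum_squares_bound[of "norm x" "norm z"] sum_squares_bound[of "norm y" "norm z"]
 by (simp add: power2_eq_square algebra_simps)
 finally show ?thesis .
qed

lemma ennreal_norm_add3_sq: "nsq (x + y + z) <= 3 * (nsq x + nsq y + nsq z)"
 for x y z :: "'b::real_normed_vector"
proof -
 have "nsq (x + y + z) <= ennreal (3 * ((norm x)^2 + (norm y)^2 + (norm z)^2))"
 by (rule ennreal_leI[OF norm_add3_sq])
 also have "... = 3 * (nsq x + nsq y + nsq z)"
 by (simp add: ennreal_mult ennreal_plus del: distrib_left_numeral)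
 finally show ?thesis .
qed

lemma nn_integral_norm_add3_sq:
 fixes f g h :: "'x => 'b::euclidean_space"
 assumes [measurable]: "f : BM N" "g : BM N" "h : BM N"
 shows "(NN N (%x. nsq (f x + g x + h x))) <=
 3 * ((nn2 N f) + (nn2 N g) + (nn2 N h))"
proof -
 have "(NN N (%x. nsq (f x + g x + h x))) <=
 (NN N (%x. 3 * (nsq (f x) + nsq (g x) + nsq (h x))))"
 by (rule nn_mono) (rule ennreal_norm_add3_sq)
 also have "... = 3 * ((nn2 N f) + (nn2 N g) + (nn2 N h))"
 by (simp add: nn_cmult nn_add)
 finally show ?thesis .
qed

lemma simple_process_data_times:
 assumes "simple_process_data M F a b n tu h" "i <= n"
 shows "a <= tu i" "tu i <= b"
proof -
 have "tu 0 <= tu i" using assms(2)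
 proof (induction i)
 case (Suc i)
 then show ?case using assms(1) by (auto simp: simple_process_data_def dest!: spec[of _ i])
 qed simp
 then show "a <= tu i" using assms(1) by (auto simp: simple_process_data_def)
 have "tu i <= tu n" using assms(2)
 proof (induction rule: inc_induct)
 case (step m)
 then show ?case using assms(1) by (auto simp: simple_process_data_def dest!: spec[of _ m])
 qed simp
 then show "tu i <= b" using assms(1) by (auto simp: simple_process_data_def)
qed

context brownian_basis
begin

lemma simple_process_measurable:
 fixes h :: "nat => 'a => 'b::euclidean_space"
 assumes "simple_process_data M F a b n tu h" "0 <= a"
 shows "(%p. simple_process n tu h (fst p) (snd p)) : BM (borel \<Otimes>\<^sub>M M)"
 unfolding simple_process_def
proof (rule borel_measurable_sum)
 fix i assume i: "i : {..<n}"
 then have "0 <= tu i" using simple_process_data_times(1)[OF assms(1), of i] assms(2) by auto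
 then have [measurable]: "h i : BM M"
 using measurable_filt_M[of "tu i" "h i" borel] assms(1) i by (auto simp: simple_process_data_def)
 show "(%p. indr {tu i<..tu (Suc i)} (fst p) *\<^sub>R h i (snd p)) : BM (borel \<Otimes>\<^sub>M M)"
 by measurable
qed

lemma simple_integral_measurable:
 fixes h :: "nat => 'a => 'b::euclidean_space"
 assumes "simple_process_data M F a b n tu h" "0 <= a"
 shows "simple_integral W n tu h : BM M"
 unfolding simple_integral_def
proof (rule borel_measurable_sum)
 fix i assume i: "i : {..<n}"
 then have t: "0 <= tu i" "0 <= tu (Suc i)"
 using simple_process_data_times(1)[OF assms(1), of i] simple_process_data_times(1)[OF assms(1), of "Suc i"] assms(2) by auto
 then have [measurable]: "h i : BM M"
 using measurable_filt_M[of "tu i" "h i" borel] assms(1) i by (auto simp: simple_process_data_def)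
 show "(%z. (W (tu (Suc i)) z - W (tu i) z) *\<^sub>R h i z) : BM M"
 using W_measurable[OF t(1)] W_measurable[OF t(2)] by measurable
qed

text \<open>The difference of the two simple processes is an elementary process on the disjoint sum
  of the index sets, with the second family of coefficients negated, and the isometry applies to
  it.\<close>

lemma simple_integral_diff_isometry:
 fixes h h' :: "nat => 'a => 'b::euclidean_space"
 assumes d: "simple_process_data M F a b n tu h" "simple_process_data M F a b n' tu' h'" and a: "0 <= a"
 shows "(NN M (%z. nsq (simple_integral W n tu h z - simple_integral W n' tu' h' z))) <=
 (NN (restrict_space lborel {a<..<b} \<Otimes>\<^sub>M M) (%p. nsq (simple_process n tu h (fst p) (snd p) - simple_process n' tu' h' (fst p) (snd p))))"
proof -
 let ?K = "{..<n} <+> {..<n'}"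
 let ?a = "case_sum tu tu'" and ?b = "case_sum (%i. tu (Suc i)) (%i. tu' (Suc i))"
 let ?h = "case_sum h (%i z. - h' i z)"
 have ed: "elementary_data M F ?K ?a ?b ?h"
 unfolding elementary_data_def
 proof (intro conjI ballI)
 fix k assume k: "k : ?K"
 show "0 <= ?a k"
 using k simple_process_data_times(1)[OF d(1)] simple_process_data_times(1)[OF d(2)] a
 by (cases k) (auto intro: order_trans less_imp_le)
 show "?a k <= ?b k" "?h k : BM (F (?a k))" "EX c. ALL z:space M. norm (?h k z) <= c"
 using k d by (auto simp: simple_process_data_def)
 qed auto
 let ?D = "%p. simple_process n tu h (fst p) (snd p) - simple_process n' tu' h' (fst p) (snd p)"
 have Dm[measurable]: "?D : BM (tprod M)"
 using simple_process_measurable[OF d(1) a] simple_process_measurable[OF d(2) a]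
 by (intro borel_measurable_diff) (simp_all cong: measurable_cong_sets)
 have D0: "?D (r, z) = 0" if "r ~: {a<..b}" for r z
 proof -
 have "simple_process n tu h r z = 0"
 unfolding simple_process_def
 proof (intro sum.neutral ballI)
 fix i assume "i : {..<n}"
 then have "a <= tu i" "tu (Suc i) <= b" using simple_process_data_times[OF d(1)] by auto
 then show "indr {tu i<..tu (Suc i)} r *\<^sub>R h i z = 0" using that by (auto simp: ind_def)
 qed
 moreover have "simple_process n' tu' h' r z = 0"
 unfolding simple_process_def
 proof (intro sum.neutral ballI)
 fix i assume "i : {..<n'}"
 then have "a <= tu' i" "tu' (Suc i) <= b" using simple_process_data_times[OF d(2)] by auto
 then show "indr {tu' i<..tu' (Suc i)} r *\<^sub>R h' i z = 0" using that by (auto simp: ind_def)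
 qed
 ultimately show ?thesis by simp
 qed
 have "(NN M (%z. nsq (simple_integral W n tu h z - simple_integral W n' tu' h' z)))
 = (NN M (%z. nsq (\<Sum>k\<in>?K. (W (?b k) z - W (?a k) z) *\<^sub>R ?h k z)))"
 by (subst sum.Plus) (auto simp: simple_integral_def sum_negf)
 also have "... = (NN M (%z. NN lborel (%r. nsq (?D (r, z)))))"
 proof -
 have "?D (r, z) = (\<Sum>k\<in>?K. indr {?a k<..?b k} r *\<^sub>R ?h k z)" for r z
 by (subst sum.Plus) (auto simp only: o_def simple_process_def sum_negf sum.case prod.sel scaleR_minus_right finite_lessThan diff_conv_add_uminus)
 then show ?thesis unfolding elementary_isometry[OF ed] by simp
 qed
 \<comment> \<open>Simple processes live on \<open>{a<..b}\<close> while the integral is defined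
   over \<open>{a<..<b}\<close>; the endpoint \<open>b\<close> has measure zero.\<close>
 also have "... = (NN M (%z. NN lborel (%r. nsq (?D (r, z)) * indicator {a<..<b} r)))"
 proof (rule nn_cong, rule nn_cong_AE)
 fix z
 show "AE r in lborel. nsq (?D (r, z)) = nsq (?D (r, z)) * indicator {a<..<b} r"
 using AE_lborel_singleton[of b]
 proof eventually_elim
 case (elim r)
 show ?case
 proof (cases "r : {a<..b}")
 case False
 then show ?thesis using D0[OF False, of z] by simp
 qed (use elim in \<open>auto simp: ind_def\<close>)
 qed
 qed
 also have "... = (NN lborel (%r. NN M (%z. nsq (?D (r, z)) * indicator {a<..<b} r)))"
 proof -
 interpret pair_sigma_finite lborel M ..
 show ?thesis by (rule Fubini') measurable
 qed
 also have "... = (\<integral>\<^sup>+r. (NN M (%z. nsq (?D (r, z)))) \<partial>restrict_space lborel {a<..<b})"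
 by (subst nn_integral_restrict_space) (auto intro!: nn_cong simp: ind_def)
 also have "... = (nn2 (restrict_space lborel {a<..<b} \<Otimes>\<^sub>M M) ?D)"
 proof (rule nn_integral_fst[where f="%p. nsq (?D p)"])
 have "?D : BM (restrict_space lborel {a<..<b} \<Otimes>\<^sub>M M)"
 by (rule mcomp[OF _ Dm, of "%p. p", simplified])
 (auto intro!: measurable_Pair[of fst _ _ snd, simplified] measurable_restrict_space1 mcomp[OF measurable_fst])
 then show "(%p. nsq (?D p)) : BM (restrict_space lborel {a<..<b} \<Otimes>\<^sub>M M)"
 by measurable
 qed
 finally show ?thesis by simp
qed

text \<open>Both integrals are approximated and the approximations compared by the isometry. Two
  splittings into three terms cost 3 * 3 = 9. For equal integrands this says that the integral is
  unique almost surely.\<close>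

lemma has_ito_integral_diff:
 fixes H H' :: "real => 'a => 'b::euclidean_space"
 assumes "has_ito_integral M W F a b H Y" "has_ito_integral M W F a b H' Y'" and a: "0 <= a"
 shows "(NN M (%z. nsq (Y z - Y' z))) <=
 9 * (\<integral>\<^sup>+p. nsq (H (fst p) (snd p) - H' (fst p) (snd p)) \<partial>completion (restrict_space lborel {a<..<b} \<Otimes>\<^sub>M M))"
proof -
 let ?Q = "restrict_space lborel {a<..<b} \<Otimes>\<^sub>M M"
 let ?P = "completion ?Q"
 from assms(1) obtain n tu h where
 Hm[measurable]: "(%p. H (fst p) (snd p)) : BM ?P" and Ym[measurable]: "Y : BM M" and
 d: "\<And>k. simple_process_data M F a b (n k) (tu k) (h k)" and
 l1: "(%k. NN ?P (%p. nsq (simple_process (n k) (tu k) (h k) (fst p) (snd p) - H (fst p) (snd p)))) ~~> 0" and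
 l2: "(%k. NN M (%z. nsq (simple_integral W (n k) (tu k) (h k) z - Y z))) ~~> 0"
 unfolding has_ito_integral_def by blast
 from assms(2) obtain n' tu' h' where
 Hm'[measurable]: "(%p. H' (fst p) (snd p)) : BM ?P" and Ym'[measurable]: "Y' : BM M" and
 d': "\<And>k. simple_process_data M F a b (n' k) (tu' k) (h' k)" and
 l1': "(%k. NN ?P (%p. nsq (simple_process (n' k) (tu' k) (h' k) (fst p) (snd p) - H' (fst p) (snd p)))) ~~> 0" and
 l2': "(%k. NN M (%z. nsq (simple_integral W (n' k) (tu' k) (h' k) z - Y' z))) ~~> 0"
 unfolding has_ito_integral_def by blast
 let ?I = "%k. simple_integral W (n k) (tu k) (h k)" and ?I' = "%k. simple_integral W (n' k) (tu' k) (h' k)"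
 let ?S = "%k p. simple_process (n k) (tu k) (h k) (fst p) (snd p)" and ?S' = "%k p. simple_process (n' k) (tu' k) (h' k) (fst p) (snd p)"
 have Im[measurable]: "?I k : BM M" "?I' k : BM M" for k
 using simple_integral_measurable[OF d a] simple_integral_measurable[OF d' a] by auto
 have id: "(%p. p) : measurable ?Q (borel \<Otimes>\<^sub>M M)"
 by (auto intro!: measurable_Pair[of fst _ _ snd, simplified] measurable_restrict_space1 mcomp[OF measurable_fst])
 have Sm0[measurable]: "?S k : BM ?Q" "?S' k : BM ?Q" for k
 using mcomp[OF id simple_process_measurable[OF d a]] mcomp[OF id simple_process_measurable[OF d' a]] by auto
 have Sm[measurable]: "?S k : BM ?P" "?S' k : BM ?P" for k
 using measurable_completion[OF Sm0(1)[of k]] measurable_completion[OF Sm0(2)[of k]] by (auto simp only:)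
 let ?e = "%k. NN ?P (%p. nsq (?S k p - H (fst p) (snd p)))"
 let ?e' = "%k. NN ?P (%p. nsq (?S' k p - H' (fst p) (snd p)))"
 let ?g = "%k. NN M (%z. nsq (?I k z - Y z))"
 let ?g' = "%k. NN M (%z. nsq (?I' k z - Y' z))"
 let ?R = "NN ?P (%p. nsq (H (fst p) (snd p) - H' (fst p) (snd p)))"
 have ineq: "(NN M (%z. nsq (Y z - Y' z))) <= 3 * (?g k + 3 * (?e k + ?R + ?e' k) + ?g' k)" for k
 proof -
 have "(NN M (%z. nsq (?I k z - ?I' k z))) <= (NN ?Q (%p. nsq (?S k p - ?S' k p)))"
 by (rule simple_integral_diff_isometry[OF d[of k] d'[of k] a])
 also have "... = (NN ?P (%p. nsq (?S k p - ?S' k p)))"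
 by (simp add: nn_integral_completion)
 also have "... = (NN ?P (%p. nsq ((?S k p - H (fst p) (snd p)) + (H (fst p) (snd p) - H' (fst p) (snd p)) + (H' (fst p) (snd p) - ?S' k p))))"
 by simp
 also have "... <= 3 * (?e k + ?R + (NN ?P (%p. nsq (H' (fst p) (snd p) - ?S' k p))))"
 by (rule nn_integral_norm_add3_sq) measurable
 also have "(NN ?P (%p. nsq (H' (fst p) (snd p) - ?S' k p))) = ?e' k"
 by (simp only: norm_minus_commute)
 finally have i1: "(NN M (%z. nsq (?I k z - ?I' k z))) <= 3 * (?e k + ?R + ?e' k)" .
 have "(NN M (%z. nsq (Y z - Y' z))) = (NN M (%z. nsq ((Y z - ?I k z) + (?I k z - ?I' k z) + (?I' k z - Y' z))))"
 by simp
 also have "... <= 3 * ((NN M (%z. nsq (Y z - ?I k z))) + (NN M (%z. nsq (?I k z - ?I' k z))) + ?g' k)"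
 by (rule nn_integral_norm_add3_sq) measurable
 also have "... <= 3 * (?g k + 3 * (?e k + ?R + ?e' k) + ?g' k)"
 using i1 by (intro ml_mono add_mono) (auto simp: norm_minus_commute)
 finally show ?thesis .
 qed
 have "(%k. 3 * (?g k + 3 * (?e k + ?R + ?e' k) + ?g' k)) ~~> 3 * (0 + 3 * (0 + ?R + 0) + 0)"
 by (intro ennreal_tendsto_cmult tendsto_add l1 l2 l1' l2' tendsto_const) auto
 then have "(NN M (%z. nsq (Y z - Y' z))) <= 3 * (0 + 3 * (0 + ?R + 0) + 0)"
 by (rule LIMSEQ_le_const) (use ineq in blast)
 then show ?thesis by (simp add: mult.assoc[symmetric])
qed

end

text \<open>Simple integrals evaluate the Brownian path only at partition points in
  \<open>{a..b}\<close>, which are nonnegative.\<close>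

lemma has_ito_integral_cong_W:
 assumes H: "has_ito_integral M W F a b H Y" and eq: "AE z in M. \<forall>t\<ge>0. W' t z = W t z" and a: "0 <= a"
 shows "has_ito_integral M W' F a b H Y"
proof -
 have "(NN M (%z. nsq (simple_integral W' n tu h z - Y z))) =
 (NN M (%z. nsq (simple_integral W n tu h z - Y z)))"
 if d: "simple_process_data M F a b n tu h" for n tu h
 proof (rule nn_cong_AE)
 show "AE z in M. nsq (simple_integral W' n tu h z - Y z) = nsq (simple_integral W n tu h z - Y z)"
 using eq
 proof eventually_elim
 case (elim z)
 have "0 <= tu i" if "i <= n" for i using simple_process_data_times(1)[OF d that] a by simp
 then have "simple_integral W' n tu h z = simple_integral W n tu h z"
 unfolding simple_integral_def using elim by (intro sum.cong) auto
 then show ?case by simp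
 qed
 qed
 then show ?thesis using H unfolding has_ito_integral_def by (elim conjE exE) (intro conjI exI, auto)
qed

section \<open>Adaptedness of time integrals\<close>

context brownian_basis
begin

text \<open>Joint measurability is known only with respect to \<open>M\<close>, so Fubini cannot be
  applied inside \<open>F t\<close>. Instead the integral \<open>Y\<close> is shown to equal its
  conditional expectation \<open>Z\<close>: conditioning is self-adjoint and leaves almost every
  \<open>f r\<close> unchanged, so \<open>Y\<close> and \<open>Z\<close> have the same integral
  against every bounded test function.\<close>

lemma adapted_integral_bounded_real:
 fixes f :: "'r => 'a => real"
 assumes L: "finite_measure L" and f[measurable]: "(%p. f (fst p) (snd p)) : BM (L \<Otimes>\<^sub>M M)"
 and B: "\<And>r z. r : space L ==> z : space M ==> \<bar>f r z\<bar> <= B"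
 and ad: "AE r in L. f r : BM (F t)" and t: "0 <= t"
 shows "(%z. LINT r|L. f r z) : BM (F t)"
proof -
 interpret L: finite_measure L by fact
 interpret S: finite_measure_subalgebra M "F t" by unfold_locales (rule subalg[OF t])
 interpret P: pair_sigma_finite L M ..
 define Y where "Y z = (LINT r|L. f r z)" for z
 have f2: "(%(r, z). f r z) : BM (L \<Otimes>\<^sub>M M)" using f by (simp add: case_prod_beta')
 have f3: "(%p. f (snd p) (fst p)) : BM (M \<Otimes>\<^sub>M L)"
 using mcomp[OF measurable_pair_swap' f2] by (simp add: case_prod_beta')
 have Ym[measurable]: "Y : BM M"
 unfolding Y_def by (rule L.borel_measurable_lebesgue_integral) (use f3 in \<open>simp add: case_prod_beta'\<close>)
 have fr: "f r : BM M" if "r : space L" for r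
 using mcomp[OF measurable_Pair1'[OF that, of M] f] by simp
 have fI: "integrable M (%z. f r z * G z)" if "r : space L" "integrable M G" for r G
 by (rule Bochner_Integration.integrable_bound[OF integrable_mult_right[OF that(2), of B]])
 (use fr that B in \<open>auto simp: abs_mult intro!: mr_mono order_trans[OF B abs_ge_self] AE_I2\<close>)
 have prod: "(LINT z|M. Y z * G z) = (LINT r|L. LINT z|M. f r z * G z)" if G: "integrable M G" for G
 proof -
 have Gm[measurable]: "G : BM M" using G by auto
 have "integrable (L \<Otimes>\<^sub>M M) (%(r, z). f r z * G z)"
 proof (rule P.Fubini_integrable)
 show "(%(r, z). f r z * G z) : BM (L \<Otimes>\<^sub>M M)" using f2 by measurable
 have bd: "(LINT z|M. norm (f r z * G z)) <= (LINT z|M. B * norm (G z))" if "r : space L" for r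
 by (rule integral_mono[OF integrable_norm[OF fI[OF that G]] integrable_mult_right[OF integrable_norm[OF G]]])
 (use B that in \<open>auto simp: abs_mult intro!: mr_mono\<close>)
 show "integrable L (%x. LINT y|M. norm (case (x, y) of (r, z) => f r z * G z))"
 proof (rule L.integrable_const_bound)
 show "AE x in L. norm (LINT y|M. norm (case (x, y) of (r, z) => f r z * G z)) <= (LINT z|M. B * norm (G z))"
 using bd by (intro AE_I2) auto
 have "(%p. norm (f (fst p) (snd p) * G (snd p))) : BM (L \<Otimes>\<^sub>M M)" by measurable
 then show "(%x. LINT y|M. norm (case (x, y) of (r, z) => f r z * G z)) : BM L"
 by (intro borel_measurable_lebesgue_integral) (simp add: case_prod_beta')
 qed
 show "AE x in L. integrable M (%y. case (x, y) of (r, z) => f r z * G z)"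
 using fI[OF _ G] by (intro AE_I2) auto
 qed
 from P.Fubini_integral[OF this]
 have "(LINT z|M. LINT r|L. f r z * G z) = (LINT r|L. LINT z|M. f r z * G z)" by simp
 then show ?thesis unfolding Y_def by simp
 qed
 have Yb: "\<bar>Y z\<bar> <= B * measure L (space L)" if "z : space M" for z
 proof -
 have "\<bar>Y z\<bar> <= (LINT r|L. \<bar>f r z\<bar>)" unfolding Y_def using integral_abs_bound by blast
 also have "... <= (LINT r|L. B)"
 by (rule integral_mono') (use B that order_trans[OF abs_ge_zero B[OF _ that]] in auto)
 finally show ?thesis by (simp add: mult.commute)
 qed
 have Yi: "integrable M Y" by (rule integrable_const_bound[of _ "B * measure L (space L)"]) (use Yb in auto)
 define Z where "Z = real_cond_exp M (F t) Y"
 have Zm: "Z : BM (F t)" unfolding Z_def by simp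
 have Zm'[measurable]: "Z : BM M" by (rule measurable_filt_M[OF t Zm])
 have Zi: "integrable M Z" unfolding Z_def by (rule S.real_cond_exp_int[OF Yi])
 \<comment> \<open>With the sign of the difference as test function, equal integrals say that
   \<open>\<bar>Y - Z\<bar>\<close> has mean zero.\<close>
 define g where "g z = sgn (Y z - Z z)" for z
 have gm[measurable]: "g : BM M" unfolding g_def by measurable
 have gb: "\<bar>g z\<bar> <= 1" for z by (auto simp: g_def sgn_if)
 have gi: "integrable M g" by (rule integrable_const_bound[of _ 1]) (use gb in auto)
 have mult_gi: "integrable M (%z. X z * g z)" if "integrable M X" for X :: "'a => real"
 by (rule Bochner_Integration.integrable_bound[OF that])
 (use that gb in \<open>auto simp: abs_mult intro!: mult_left_le AE_I2\<close>)
 define g' where "g' = real_cond_exp M (F t) g"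
 have g'm: "g' : BM (F t)" unfolding g'_def by simp
 have g'i: "integrable M g'" unfolding g'_def by (rule S.real_cond_exp_int[OF gi])
 have "(LINT z|M. Y z * g z) = (LINT r|L. LINT z|M. f r z * g z)" by (rule prod[OF gi])
 also have "... = (LINT r|L. LINT z|M. f r z * g' z)"
 proof (rule integral_cong_AE)
 show "AE r in L. (LINT z|M. f r z * g z) = (LINT z|M. f r z * g' z)"
 using ad AE_space
 proof eventually_elim
 case (elim r)
 show ?case unfolding g'_def by (rule S.real_cond_exp_intg(2)[symmetric]) (use elim fI[OF _ gi] in auto)
 qed
 have [measurable]: "g' : BM M" using g'i by auto
 have "(%p. f (fst p) (snd p) * g (snd p)) : BM (L \<Otimes>\<^sub>M M)" "(%p. f (fst p) (snd p) * g' (snd p)) : BM (L \<Otimes>\<^sub>M M)"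
 by measurable
 then show "(%r. LINT z|M. f r z * g z) : BM L" "(%r. LINT z|M. f r z * g' z) : BM L"
 by (auto intro!: borel_measurable_lebesgue_integral simp: case_prod_beta')
 qed
 also have "... = (LINT z|M. Y z * g' z)" by (rule prod[OF g'i, symmetric])
 also have "... = (LINT z|M. g' z * Z z)" unfolding Z_def
 proof (subst S.real_cond_exp_intg(2))
 show "integrable M (%z. g' z * Y z)"
 proof (rule Bochner_Integration.integrable_bound[OF integrable_mult_right[OF g'i, of "B * measure L (space L)"]])
 have [measurable]: "g' : BM M" using g'i by auto
 show "(%z. g' z * Y z) : BM M" by measurable
 show "AE z in M. norm (g' z * Y z) <= norm (B * measure L (space L) * g' z)"
 proof (rule AE_I2)
 fix z assume "z : space M"
 then have "\<bar>Y z\<bar> <= \<bar>B * measure L (space L)\<bar>" using order_trans[OF Yb abs_ge_self] by blast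
 then show "norm (g' z * Y z) <= norm (B * measure L (space L) * g' z)"
 unfolding real_norm_def abs_mult[of "g' z"] abs_mult[of _ "g' z"] mult.commute[of "\<bar>g' z\<bar>"]
 by (rule mr_mono) auto
 qed
 qed
 qed (use g'm in \<open>auto simp: mult.commute\<close>)
 also have "... = (LINT z|M. Z z * g' z)" by (simp add: mult.commute)
 also have "... = (LINT z|M. Z z * g z)" unfolding g'_def by (rule S.real_cond_exp_intg(2)[OF mult_gi[OF Zi] Zm gm])
 finally have "(LINT z|M. (Y z - Z z) * g z) = 0"
 using mult_gi[OF Yi] mult_gi[OF Zi] by (simp add: left_diff_distrib)
 then have "(LINT z|M. \<bar>Y z - Z z\<bar>) = 0" by (simp add: g_def abs_sgn mult.commute)
 then have "AE z in M. Z z = Y z"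
 using integral_nonneg_eq_0_iff_AE[of M "%z. \<bar>Y z - Z z\<bar>"] Yi Zi by auto
 then have "Y : BM (F t)" by (rule measurable_filt_AE_cong[OF t Zm])
 then show ?thesis by (simp add: Y_def[abs_def])
qed

text \<open>Coordinates are clipped to the range from -m to m, and m tends to infinity by dominated
  convergence. The limit is only almost sure, which \<open>measurable_filt_AE_cong\<close>
  allows.\<close>

lemma adapted_integral:
 fixes f :: "'r => 'a => 'b::euclidean_space"
 assumes L: "finite_measure L" and f[measurable]: "(%p. f (fst p) (snd p)) : BM (L \<Otimes>\<^sub>M M)"
 and ad: "AE r in L. f r : BM (F t)" and t: "0 <= t"
 and int: "AE z in M. integrable L (%r. f r z)"
 shows "(%z. LINT r|L. f r z) : BM (F t)"
proof (subst borel_measurable_euclidean_space, rule ballI)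
 fix e :: 'b assume "e : Basis"
 define g where "g m r z = max (- real m) (min (real m) (f r z \<bullet> e))" for m :: nat and r z
 have gF: "(%z. LINT r|L. g m r z) : BM (F t)" for m
 proof (rule adapted_integral_bounded_real[OF L _ _ _ t])
 show "(%p. g m (fst p) (snd p)) : BM (L \<Otimes>\<^sub>M M)" unfolding g_def by measurable
 show "\<bar>g m r z\<bar> <= real m" for r z by (auto simp: g_def)
 show "AE r in L. g m r : BM (F t)"
 using ad by eventually_elim (simp add: g_def[abs_def])
 qed
 have lim: "AE z in M. (%m. LINT r|L. g m r z) ~~> (LINT r|L. f r z) \<bullet> e"
 using int
 proof eventually_elim
 case (elim z)
 have "(%m. LINT r|L. g m r z) ~~> (LINT r|L. f r z \<bullet> e)"
 proof (rule integral_dominated_convergence[where w="%r. \<bar>f r z \<bullet> e\<bar>"])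
 show "integrable L (%r. \<bar>f r z \<bullet> e\<bar>)" "(%r. f r z \<bullet> e) : BM L" using elim by auto
 then show "(%r. g m r z) : BM L" for m unfolding g_def by measurable
 show "AE r in L. norm (g m r z) <= \<bar>f r z \<bullet> e\<bar>" for m by (auto simp: g_def)
 show "AE r in L. (%m. g m r z) ~~> f r z \<bullet> e"
 proof (rule AE_I2)
 fix r
 obtain m0 :: nat where m0: "\<bar>f r z \<bullet> e\<bar> <= real m0" using real_arch_simple by blast
 show "(%m. g m r z) ~~> f r z \<bullet> e"
 proof (rule tendsto_eventually, rule eventually_sequentiallyI[of m0])
 fix m assume "m0 <= m"
 then have "\<bar>f r z \<bullet> e\<bar> <= real m" using m0 by linarith
 then show "g m r z = f r z \<bullet> e" by (auto simp: g_def)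
 qed
 qed
 qed
 then show ?case using elim by simp
 qed
 have "(%z. lim (%m. LINT r|L. g m r z)) : BM (F t)"
 by (rule borel_measurable_lim_metric[OF gF])
 moreover have "AE z in M. lim (%m. LINT r|L. g m r z) = (LINT r|L. f r z) \<bullet> e"
 using lim by eventually_elim (simp add: limI)
 ultimately show "(%z. (LINT r|L. f r z) \<bullet> e) : BM (F t)"
 by (rule measurable_filt_AE_cong[OF t])
qed

end

section \<open>Approximation of processes by averages over the preceding block\<close>

text \<open>Lebesgue differentiation for intervals to the right of a point, applied to the reflected
  function. The error is written as \<open>e * h\<close>, without division, so that two left
  intervals can be subtracted from each other.\<close>

lemma AE_left_average:
 fixes f :: "real => 'b::euclidean_space"
 assumes f: "integrable lborel f"
 shows "AE r in lborel. \<forall>e>0. \<exists>d>0. ALL h. 0 < h & h < d -->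
 norm ((LINT q:{r - h<..r}|lborel. f q) - h *\<^sub>R f r) <= e * h"
proof -
 define g where "g x = f (- x)" for x
 have g: "integrable lborel g"
 using lborel_integrable_real_affine[OF f, of "-1" 0] by (simp add: g_def[abs_def])
 have "g integrable_on cbox a b" for a b
 using integrable_on_lborel[OF g] integrable_on_subcbox by blast
 then obtain N where N: "negligible N"
 "\<And>x e. \<lbrakk>x ~: N; 0 < e\<rbrakk> \<Longrightarrow> \<exists>d>0. ALL h. 0 < h & h < d -->
 norm (integral (cbox x (x + h *\<^sub>R One)) g /\<^sub>R h ^ DIM(real) - g x) < e"
 using integrable_ccontinuous_explicit[of g] by metis
 have "AE r in lborel. r ~: N"
 using AE_not_in[of N lebesgue] N(1) by (simp add: negligible_iff_null_sets AE_completion_iff)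
 then obtain N' where N': "N \<subseteq> N'" "N' : null_sets lborel"
 by (auto simp: eventually_ae_filter)
 have null: "uminus -` N' : null_sets lborel"
 proof (rule null_setsI)
 have "emeasure lborel (uminus -` N') = emeasure (distr lborel borel uminus) N'"
 using N'(2) by (subst emeasure_distr) auto
 then show "emeasure lborel (uminus -` N') = 0" using N'(2) by (simp add: lborel_distr_uminus null_setsD1)
 show "uminus -` N' : sets lborel"
 using N'(2) measurable_sets[of uminus borel borel N'] by auto
 qed
 have "AE r in lborel. r ~: uminus ` N"
 by (rule AE_I'[OF null]) (use N'(1) in auto)
 then show ?thesis
 proof eventually_elim
 case (elim r)
 then have r: "- r ~: N" by force
 have eq: "(LINT q:{r - h<..r}|lborel. f q) = integral (cbox (- r) (- r + h *\<^sub>R One)) g" if "0 < h" for h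
 proof -
 have "(LINT q:{r - h<..r}|lborel. f q) = (LINT q|lborel. indr {r - h..r} q *\<^sub>R f q)"
 unfolding slint_def
 proof (rule integral_cong_AE)
 show "AE x in lborel. indr {r - h<..r} x *\<^sub>R f x = indr {r - h..r} x *\<^sub>R f x"
 using AE_lborel_singleton[of "r - h"] by eventually_elim (auto simp: ind_def)
 qed (use f in auto)
 also have "... = (LINT q|lborel. indr {r - h..r} (- q) *\<^sub>R f (- q))"
 using lborel_integral_real_affine[of "-1" "%q. indr {r - h..r} q *\<^sub>R f q" 0] by simp
 also have "... = (LINT q:{- r..- r + h}|lborel. g q)"
 unfolding slint_def g_def by (rule Bochner_Integration.integral_cong) (auto simp: ind_def)
 also have "... = integral {- r..- r + h} g"
 by (rule set_borel_integral_eq_integral(2)) (use integrable_mult_indicator[OF _ g, of "{- r..- r + h}"] in \<open>auto simp: set_integrable_def\<close>)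
 finally show ?thesis by simp
 qed
 show ?case
 proof (intro allI impI)
 fix e :: real assume "0 < e"
 from N(2)[OF r this] obtain d where d: "d > 0" "\<And>h. 0 < h ==> h < d ==> norm (integral (cbox (- r) (- r + h *\<^sub>R One)) g /\<^sub>R h - g (- r)) < e"
 by auto
 have "norm ((LINT q:{r - h<..r}|lborel. f q) - h *\<^sub>R f r) <= e * h" if h: "0 < h" "h < d" for h
 proof -
 have "(LINT q:{r - h<..r}|lborel. f q) - h *\<^sub>R f r = h *\<^sub>R (integral (cbox (- r) (- r + h *\<^sub>R One)) g /\<^sub>R h - g (- r))"
 using h by (simp add: eq g_def scaleR_diff_right)
 then have "norm ((LINT q:{r - h<..r}|lborel. f q) - h *\<^sub>R f r) = h * norm (integral (cbox (- r) (- r + h *\<^sub>R One)) g /\<^sub>R h - g (- r))"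
 using h by simp
 then show ?thesis using d(2)[OF h] h by (simp add: mult.commute)
 qed
 then show "\<exists>d>0. ALL h. 0 < h & h < d --> norm ((LINT q:{r - h<..r}|lborel. f q) - h *\<^sub>R f r) <= e * h"
 using d(1) by blast
 qed
 qed
qed

definition grid :: "real => real => nat => nat => real" where
 "grid t0 T n i = t0 + real i * ((T - t0) / real n)"

text \<open>The average over the block before the current one, which makes the result adapted.\<close>

definition past_average :: "real => real => nat => (real => 'b::euclidean_space) => nat => 'b" where
 "past_average t0 T n f i = (real n / (T - t0)) *\<^sub>R
 (LINT q:{grid t0 T n i - (T - t0) / real n<..grid t0 T n i}|lborel. f q)"

definition block_average :: "real => real => nat => (real => 'b::euclidean_space) => real => 'b" where
 "block_average t0 T n f r = (\<Sum>i<n. indr {grid t0 T n i<..grid t0 T n (Suc i)} r *\<^sub>R past_average t0 T n f i)"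

lemma grid_Suc: "grid t0 T n (Suc i) = grid t0 T n i + (T - t0) / real n"
 by (simp add: grid_def distrib_right add_divide_distrib)

lemma grid_mono: "t0 <= T ==> i <= j ==> grid t0 T n i <= grid t0 T n j"
 unfolding grid_def by (intro add_left_mono mr_mono divide_nonneg_nonneg) auto

lemma grid_0 [simp]: "grid t0 T n 0 = t0" by (simp add: grid_def)
lemma grid_n [simp]: "0 < n ==> grid t0 T n n = T" by (simp add: grid_def)

lemma block_average_eq:
 assumes "t0 < T" "0 < n" "i < n" "grid t0 T n i < r" "r <= grid t0 T n (Suc i)"
 shows "block_average t0 T n f r = past_average t0 T n f i"
proof -
 have "indr {grid t0 T n j<..grid t0 T n (Suc j)} r *\<^sub>R past_average t0 T n f j = (if j = i then past_average t0 T n f i else 0)" for j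
 proof (cases j i rule: linorder_cases)
 case less
 then have "grid t0 T n (Suc j) <= grid t0 T n i" using assms by (intro grid_mono) auto
 then show ?thesis using less assms by (auto simp: ind_def)
 next
 case greater
 then have "grid t0 T n (Suc i) <= grid t0 T n j" using assms by (intro grid_mono) auto
 then show ?thesis using greater assms by (auto simp: ind_def)
 qed (use assms in auto)
 then show ?thesis unfolding block_average_def using assms(3) by (simp add: sum.delta)
qed

lemma grid_index_exists:
 assumes "t0 < T" "0 < n" "t0 < r" "r <= T"
 obtains i where "i < n" "grid t0 T n i < r" "r <= grid t0 T n (Suc i)"
proof -
 define i where "i = (LEAST j. r <= grid t0 T n (Suc j))"
 have ex: "r <= grid t0 T n (Suc (n - 1))" using assms by simp
 have 1: "r <= grid t0 T n (Suc i)" unfolding i_def by (rule LeastI[of _ "n - 1"]) (rule ex)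
 have "i <= n - 1" unfolding i_def by (rule Least_le) (rule ex)
 then have 2: "i < n" using assms by simp
 have "grid t0 T n i < r"
 proof (cases i)
 case (Suc j)
 then have "\<not> r <= grid t0 T n (Suc j)" using not_less_Least[of j "%j. r <= grid t0 T n (Suc j)"] i_def by simp
 then show ?thesis using Suc by simp
 qed (use assms in simp)
 then show ?thesis using that 1 2 by blast
qed

text \<open>For \<open>r\<close> in a block starting at \<open>tu\<close>, the preceding block is
  the difference of two intervals ending at \<open>r\<close>, of lengths \<open>h + dl\<close> and
  \<open>h\<close>, both at most \<open>2 * dl\<close>. Relative errors \<open>e / 6\<close> on each
  add up to at most \<open>(e / 2) * dl\<close>.\<close>

lemma block_average_tendsto:
 fixes f :: "real => 'b::euclidean_space"
 assumes f: "integrable lborel f" and t: "t0 < T"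
 shows "AE r in lborel. r : {t0<..T} --> (%n. block_average t0 T (Suc n) f r) ~~> f r"
 using AE_left_average[OF f]
proof eventually_elim
 case (elim r)
 show ?case
 proof (intro impI LIMSEQ_I)
 fix e :: real assume r: "r : {t0<..T}" and e: "0 < e"
 then obtain d where d: "d > 0" "\<And>h. 0 < h ==> h < d ==> norm ((LINT q:{r - h<..r}|lborel. f q) - h *\<^sub>R f r) <= (e / 6) * h"
 using elim by (metis divide_pos_pos zero_less_numeral)
 obtain n0 :: nat where n0: "2 * (T - t0) / d < real n0" using reals_Archimedean2 by blast
 show "EX n0. \<forall>n\<ge>n0. norm (block_average t0 T (Suc n) f r - f r) < e"
 proof (intro exI allI impI)
 fix n assume n: "n0 <= n"
 define dl where "dl = (T - t0) / real (Suc n)"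
 have dl: "0 < dl" using t by (simp add: dl_def)
 have "2 * (T - t0) < d * real n0" using n0 d(1) by (simp add: pos_divide_less_eq mult.commute)
 also have "... <= d * real (Suc n)" using n d(1) by (intro ml_mono) auto
 finally have dld: "2 * dl < d" unfolding dl_def by (simp add: pos_divide_less_eq)
 obtain i where i: "i < Suc n" "grid t0 T (Suc n) i < r" "r <= grid t0 T (Suc n) (Suc i)"
 using grid_index_exists[of t0 T "Suc n" r] t r by auto
 define tu where "tu = grid t0 T (Suc n) i"
 define h where "h = r - tu"
 have h: "0 < h" "h <= dl" using i by (auto simp: h_def tu_def grid_Suc dl_def)
 have tu: "r - h = tu" "r - (h + dl) = tu - dl" by (auto simp: h_def)
 have fs: "set_integrable lborel A f" if "A : sets borel" for A
 unfolding set_integrable_def using integrable_mult_indicator[OF _ f, of A] that by simp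
 have "{tu - dl<..r} = {tu - dl<..tu} \<union> {tu<..r}" using h dl by (auto simp: h_def)
 then have "(LINT q:{tu - dl<..r}|lborel. f q) = (LINT q:{tu - dl<..tu}|lborel. f q) + (LINT q:{tu<..r}|lborel. f q)"
 using set_integral_Un[of "{tu - dl<..tu}" "{tu<..r}" lborel f] fs by auto
 then have "(LINT q:{tu - dl<..tu}|lborel. f q) - dl *\<^sub>R f r =
 ((LINT q:{r - (h + dl)<..r}|lborel. f q) - (h + dl) *\<^sub>R f r) - ((LINT q:{r - h<..r}|lborel. f q) - h *\<^sub>R f r)"
 unfolding tu by (simp add: algebra_simps)
 also have "norm ... <= (e / 6) * (h + dl) + (e / 6) * h"
 by (rule order_trans[OF norm_triangle_ineq4 add_mono[OF d(2)[of "h + dl"] d(2)[of h]]]) (use h dl dld in auto)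
 also have "... <= (e / 6) * (3 * dl)"
 unfolding distrib_left[symmetric] using h e by (intro ml_mono) auto
 finally have b: "norm ((LINT q:{tu - dl<..tu}|lborel. f q) - dl *\<^sub>R f r) <= e / 2 * dl" by (simp add: mult.commute)
 have "block_average t0 T (Suc n) f r = (1 / dl) *\<^sub>R (LINT q:{tu - dl<..tu}|lborel. f q)"
 unfolding block_average_eq[OF t zero_less_Suc i] past_average_def dl_def[symmetric] tu_def[symmetric]
 by (simp add: dl_def)
 then have "block_average t0 T (Suc n) f r - f r = (1 / dl) *\<^sub>R ((LINT q:{tu - dl<..tu}|lborel. f q) - dl *\<^sub>R f r)"
 using dl by (simp add: scaleR_diff_right)
 then have "norm (block_average t0 T (Suc n) f r - f r) = (1 / dl) * norm ((LINT q:{tu - dl<..tu}|lborel. f q) - dl *\<^sub>R f r)"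
 using dl by simp
 also have "... <= (1 / dl) * (e / 2 * dl)" using b dl by (intro ml_mono) auto
 also have "... < e" using dl e by simp
 finally show "norm (block_average t0 T (Suc n) f r - f r) < e" .
 qed
 qed
qed

lemma past_average_bound:
 fixes f :: "real => 'b::euclidean_space"
 assumes t: "t0 < T" "0 < n" and B: "\<And>r. norm (f r) <= B"
 shows "norm (past_average t0 T n f i) <= B"
proof -
 let ?dl = "(T - t0) / real n" let ?tu = "grid t0 T n i"
 have B0: "0 <= B" using norm_ge_zero B order_trans by blast
 have "norm (LINT q:{?tu - ?dl<..?tu}|lborel. f q) <= (LINT q|lborel. norm (indr {?tu - ?dl<..?tu} q *\<^sub>R f q))"
 unfolding slint_def by (rule integral_norm_bound)
 also have "... <= (LINT q|lborel. B * indr {?tu - ?dl<..?tu} q)"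
 proof (rule integral_mono')
 show "integrable lborel (%q. B * indr {?tu - ?dl<..?tu} q)"
 by (intro integrable_mult_right integrable_real_indicator, simp, subst emeasure_lborel_Ioc) (use t in auto)
 qed (use B B0 in \<open>auto simp: ind_def\<close>)
 also have "... = B * ?dl" using t by simp
 finally have "norm (past_average t0 T n f i) <= (real n / (T - t0)) * (B * ?dl)"
 unfolding past_average_def using t by (simp add: ml_mono del: times_divide_eq_left times_divide_eq_right)
 also have "... = B" using t by simp
 finally show ?thesis .
qed

definition truncation :: "nat => (real => 'b::euclidean_space) => real => 'b" where
 "truncation m f r = (if norm (f r) <= real m then f r else 0)"

lemma norm_truncation: "norm (truncation m f r) <= real m" "norm (truncation m f r) <= norm (f r)"
 by (auto simp: truncation_def)

lemma norm_add_sq: "(norm (x + y))^2 <= 2 * ((norm x)^2 + (norm y)^2)"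
 for x y :: "'b::real_normed_vector"
proof -
 have "(norm (x + y))^2 <= (norm x + norm y)^2" by (rule power_mono) (auto intro: norm_triangle_ineq)
 also have "... <= 2 * ((norm x)^2 + (norm y)^2)"
 using sum_squares_bound[of "norm x" "norm y"] by (simp add: power2_eq_square algebra_simps)
 finally show ?thesis .
qed

lemma ennreal_norm_add_sq: "nsq (x + y) <= 2 * (nsq x + nsq y)"
 for x y :: "'b::real_normed_vector"
proof -
 have "nsq (x + y) <= ennreal (2 * ((norm x)^2 + (norm y)^2))"
 by (rule ennreal_leI[OF norm_add_sq])
 also have "... = 2 * (nsq x + nsq y)"
 by (simp add: ennreal_mult ennreal_plus del: distrib_left_numeral)
 finally show ?thesis .
qed

lemma nn_integral2_norm_add_sq:
 fixes f g :: "'z => 'r => 'b::euclidean_space"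
 assumes "sigma_finite_measure L"
 and f[measurable]: "(%p. f (fst p) (snd p)) : BM (R \<Otimes>\<^sub>M L)"
 and g[measurable]: "(%p. g (fst p) (snd p)) : BM (R \<Otimes>\<^sub>M L)"
 shows "(NN R (%z. NN L (%r. nsq (f z r + g z r)))) <=
 2 * ((NN R (%z. nn2 L (f z))) + (NN R (%z. nn2 L (g z))))"
proof -
 interpret L: sigma_finite_measure L by fact
 have "(NN R (%z. NN L (%r. nsq (f z r + g z r)))) = (NN (R \<Otimes>\<^sub>M L) (%p. nsq (f (fst p) (snd p) + g (fst p) (snd p))))"
 using L.nn_integral_fst[of "%p. nsq (f (fst p) (snd p) + g (fst p) (snd p))" R] by simp
 also have "... <= (NN (R \<Otimes>\<^sub>M L) (%p. 2 * (nsq (f (fst p) (snd p)) + nsq (g (fst p) (snd p)))))"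
 by (rule nn_mono) (rule ennreal_norm_add_sq)
 also have "... = 2 * ((NN (R \<Otimes>\<^sub>M L) (%p. nsq (f (fst p) (snd p)))) + (NN (R \<Otimes>\<^sub>M L) (%p. nsq (g (fst p) (snd p)))))"
 by (simp add: nn_cmult nn_add)
 also have "(NN (R \<Otimes>\<^sub>M L) (%p. nsq (f (fst p) (snd p)))) = (NN R (%z. nn2 L (f z)))"
 using L.nn_integral_fst[of "%p. nsq (f (fst p) (snd p))" R] by simp
 also have "(NN (R \<Otimes>\<^sub>M L) (%p. nsq (g (fst p) (snd p)))) = (NN R (%z. nn2 L (g z)))"
 using L.nn_integral_fst[of "%p. nsq (g (fst p) (snd p))" R] by simp
 finally show ?thesis .
qed

lemma past_average_measurable:
 fixes f :: "'z => real => 'b::euclidean_space"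
 assumes [measurable]: "(%p. f (fst p) (snd p)) : BM (R \<Otimes>\<^sub>M lborel)"
 shows "(%z. past_average t0 T n (f z) i) : BM R"
proof -
 have "(%p. indr {grid t0 T n i - (T - t0) / real n<..grid t0 T n i} (snd p) *\<^sub>R f (fst p) (snd p)) : BM (R \<Otimes>\<^sub>M lborel)"
 by measurable
 then show ?thesis unfolding past_average_def slint_def
 by (intro borel_measurable_scaleR lborel.borel_measurable_lebesgue_integral) (auto simp: case_prod_beta')
qed

lemma block_average_measurable:
 fixes f :: "'z => real => 'b::euclidean_space"
 assumes "(%p. f (fst p) (snd p)) : BM (R \<Otimes>\<^sub>M lborel)"
 shows "(%p. block_average t0 T n (f (fst p)) (snd p)) : BM (R \<Otimes>\<^sub>M lborel)"
proof -
 have [measurable]: "(%z. past_average t0 T n (f z) i) : BM R" for i by (rule past_average_measurable[OF assms])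
 show ?thesis unfolding block_average_def by measurable
qed

lemma block_average_outside:
 assumes "t0 < T" "0 < n" "r ~: {t0<..T}" shows "block_average t0 T n f r = 0"
 unfolding block_average_def
proof (intro sum.neutral ballI)
 fix i assume "i : {..<n}"
 then have "t0 <= grid t0 T n i" "grid t0 T n (Suc i) <= T"
 using grid_mono[of t0 T 0 i n] grid_mono[of t0 T "Suc i" n n] assms by auto
 then show "indr {grid t0 T n i<..grid t0 T n (Suc i)} r *\<^sub>R past_average t0 T n f i = 0"
 using assms by (auto simp: ind_def)
qed

lemma norm_block_average_le:
 assumes t: "t0 < T" "0 < n" and B: "\<And>r. norm (f r) <= B"
 shows "norm (block_average t0 T n f r) <= B * indr {t0<..T} r"
proof (cases "r : {t0<..T}")
 case True
 then obtain i where i: "i < n" "grid t0 T n i < r" "r <= grid t0 T n (Suc i)"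
 using grid_index_exists[of t0 T n r] t by auto
 then show ?thesis unfolding block_average_eq[OF t i] using past_average_bound[of t0 T n f B i, OF t B] True by simp
qed (use block_average_outside[OF t] in simp)

lemma block_average_L2_tendsto:
 fixes g :: "'z => real => 'b::euclidean_space"
 assumes R: "finite_measure R" and g[measurable]: "(%p. g (fst p) (snd p)) : BM (R \<Otimes>\<^sub>M lborel)"
 and t: "t0 < T" and z0: "\<And>z r. r ~: {t0<..<T} ==> g z r = 0" and B: "\<And>z r. norm (g z r) <= B"
 shows "(%n. NN R (%z. NN lborel (%r. nsq (block_average t0 T (Suc n) (g z) r - g z r)))) ~~> 0"
proof -
 interpret R: finite_measure R by fact
 note [measurable] = block_average_measurable[OF g, of t0 T]
 have B0: "0 <= B" using B norm_ge_zero order_trans by blast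
 have bd: "nsq (block_average t0 T (Suc n) (g z) r - g z r) <= ennreal ((2 * B)^2) * indicator {t0<..T} r" for n z r
 proof (cases "r : {t0<..T}")
 case True
 have "norm (block_average t0 T (Suc n) (g z) r) <= B"
 using norm_block_average_le[of t0 T "Suc n" "g z" B r, OF t zero_less_Suc B] True by simp
 then have "norm (block_average t0 T (Suc n) (g z) r - g z r) <= B + B"
 using B[of z r] norm_triangle_ineq4[of "block_average t0 T (Suc n) (g z) r" "g z r"] by linarith
 then have "(norm (block_average t0 T (Suc n) (g z) r - g z r))^2 <= (2 * B)^2" by (intro power_mono) auto
 then show ?thesis using True by (simp add: ennreal_leI)
 next
 case False
 then show ?thesis using z0[of r z] block_average_outside[OF t zero_less_Suc False, of n "g z"] by auto
 qed
 have bdI: "(NN lborel (%r. ennreal ((2 * B)^2) * indicator {t0<..T} r)) = ennreal ((2 * B)^2) * ennreal (T - t0)"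
 using t by (simp add: nn_integral_cmult_indicator)
 have gz: "g z : BM borel" if "z : space R" for z
 using mcomp[OF measurable_Pair1'[OF that, of lborel] g] by simp
 have gi: "integrable lborel (g z)" if "z : space R" for z
 proof (rule Bochner_Integration.integrable_bound)
 show "integrable lborel (%r. B * indr {t0<..T} r)"
 by (intro integrable_mult_right integrable_real_indicator, simp, subst emeasure_lborel_Ioc) (use t in auto)
 show "AE r in lborel. norm (g z r) <= norm (B * indr {t0<..T} r)"
 proof (rule AE_I2)
 fix r show "norm (g z r) <= norm (B * indr {t0<..T} r)"
 using B[of z r] z0[of r z] B0 by (cases "r : {t0<..T}") (auto simp: ind_def)
 qed
 qed (use gz[OF that] in simp)
 have inner: "(%n. NN lborel (%r. nsq (block_average t0 T (Suc n) (g z) r - g z r))) ~~> (NN lborel (%r::real. 0))"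
 if z: "z : space R" for z
 proof (rule nn_integral_dominated_convergence[where w="%r. ennreal ((2 * B)^2) * indicator {t0<..T} r"])
 show "(%r. nsq (block_average t0 T (Suc n) (g z) r - g z r)) : BM lborel" for n
 using gz[OF z] unfolding block_average_def by measurable
 show "AE r in lborel. (%n. nsq (block_average t0 T (Suc n) (g z) r - g z r)) ~~> 0"
 using block_average_tendsto[OF gi[OF z] t]
 proof eventually_elim
 case (elim r)
 show ?case
 proof (cases "r : {t0<..T}")
 case True
 then have "(%n. block_average t0 T (Suc n) (g z) r - g z r) ~~> 0" using elim by (simp add: LIM_zero)
 then have "(%n. (norm (block_average t0 T (Suc n) (g z) r - g z r))^2) ~~> 0^2"
 by (intro tendsto_power) (rule tendsto_norm_zero)
 then show ?thesis using tendsto_ennrealI by fastforce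
 next
 case False
 then show ?thesis using z0[of r z] block_average_outside[OF t zero_less_Suc False, of _ "g z"] by auto
 qed
 qed
 show "AE r in lborel. nsq (block_average t0 T (Suc n) (g z) r - g z r) <= ennreal ((2 * B)^2) * indicator {t0<..T} r" for n
 by (rule AE_I2, rule bd)
 show "(NN lborel (%r. ennreal ((2 * B)^2) * indicator {t0<..T} r)) < \<infinity>" unfolding bdI by (simp add: ennreal_mult_less_top)
 qed auto
 have "(%n. NN R (%z. NN lborel (%r. nsq (block_average t0 T (Suc n) (g z) r - g z r)))) ~~> (NN R (%z. 0))"
 proof (rule nn_integral_dominated_convergence[where w="%_. ennreal ((2 * B)^2) * ennreal (T - t0)"])
 have "(%p. nsq (block_average t0 T (Suc n) (g (fst p)) (snd p) - g (fst p) (snd p))) : BM (R \<Otimes>\<^sub>M lborel)" for n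
 by measurable
 from lb_nn_fst[OF this]
 show "(%z. NN lborel (%r. nsq (block_average t0 T (Suc n) (g z) r - g z r))) : BM R" for n by simp
 show "AE z in R. (NN lborel (%r. nsq (block_average t0 T (Suc n) (g z) r - g z r))) <= ennreal ((2 * B)^2) * ennreal (T - t0)" for n
 unfolding bdI[symmetric] by (intro AE_I2 nn_mono bd)
 show "(NN R (%z. ennreal ((2 * B)^2) * ennreal (T - t0))) < \<infinity>"
 using R.emeasure_finite[of "space R"] by (simp add: ennreal_mult_eq_top_iff less_top[symmetric])
 show "AE z in R. (%n. NN lborel (%r. nsq (block_average t0 T (Suc n) (g z) r - g z r))) ~~> 0"
 using inner by (intro AE_I2) simp
 qed auto
 then show ?thesis by simp
qed

text \<open>Truncate first, then average: each error is at most \<open>e / 4\<close>, and the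
  squared triangle inequality doubles their sum. The variable \<open>z\<close> stands for everything
  except time, so one pair of indices works in the mean over all parameters and no measurable
  selection arises.\<close>

lemma simple_approximation:
 fixes f :: "'z => real => 'b::euclidean_space"
 assumes R: "finite_measure R" and f[measurable]: "(%p. f (fst p) (snd p)) : BM (R \<Otimes>\<^sub>M lborel)"
 and t: "t0 < T" and z0: "\<And>z r. r ~: {t0<..<T} ==> f z r = 0"
 and fin: "(NN R (%z. nn2 lborel (f z))) < \<infinity>" and e: "0 < (e::real)"
 shows "EX n m. 0 < n &
 (NN R (%z. NN lborel (%r. nsq (block_average t0 T n (truncation m (f z)) r - f z r)))) <= ennreal e"
proof -
 interpret R: finite_measure R by fact
 have tm[measurable]: "(%p. truncation m (f (fst p)) (snd p)) : BM (R \<Otimes>\<^sub>M lborel)" for m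
 unfolding truncation_def by measurable
 let ?tr = "%m. NN R (%z. NN lborel (%r. nsq (truncation m (f z) r - f z r)))"
 have tr_eq: "?tr m = (NN (R \<Otimes>\<^sub>M lborel) (%p. nsq (truncation m (f (fst p)) (snd p) - f (fst p) (snd p))))" for m
 using lborel.nn_integral_fst[of "%p. nsq (truncation m (f (fst p)) (snd p) - f (fst p) (snd p))" R] by simp
 have "(%m. NN (R \<Otimes>\<^sub>M lborel) (%p. nsq (truncation m (f (fst p)) (snd p) - f (fst p) (snd p)))) ~~> (NN (R \<Otimes>\<^sub>M (lborel :: real measure)) (%p. 0))"
 proof (rule nn_integral_dominated_convergence[where w="%p. nsq (f (fst p) (snd p))"])
 show "(NN (R \<Otimes>\<^sub>M lborel) (%p. nsq (f (fst p) (snd p)))) < \<infinity>"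
 using fin lborel.nn_integral_fst[of "%p. nsq (f (fst p) (snd p))" R] by simp
 show "AE p in R \<Otimes>\<^sub>M lborel. nsq (truncation m (f (fst p)) (snd p) - f (fst p) (snd p)) <= nsq (f (fst p) (snd p))" for m
 by (intro AE_I2 ennreal_leI power_mono) (auto simp: truncation_def)
 show "AE p in R \<Otimes>\<^sub>M lborel. (%m. nsq (truncation m (f (fst p)) (snd p) - f (fst p) (snd p))) ~~> 0"
 proof (rule AE_I2)
 fix p :: "'z \<times> real"
 obtain m0 :: nat where m0: "norm (f (fst p) (snd p)) <= real m0" using real_arch_simple by blast
 show "(%m. nsq (truncation m (f (fst p)) (snd p) - f (fst p) (snd p))) ~~> 0"
 by (rule tendsto_eventually, rule eventually_sequentiallyI[of m0]) (use m0 in \<open>auto simp: truncation_def\<close>)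
 qed
 qed auto
 then have "?tr ~~> 0" unfolding tr_eq by simp
 then have "\<forall>\<^sub>F m in sequentially. ?tr m < ennreal (e / 4)"
 using e by (intro order_tendstoD(2)) auto
 then obtain m where m: "?tr m <= ennreal (e / 4)" unfolding eventually_sequentially by (blast intro: less_imp_le)
 let ?g = "%z. truncation m (f z)"
 let ?b = "%n. NN R (%z. NN lborel (%r. nsq (block_average t0 T (Suc n) (?g z) r - ?g z r)))"
 have "?b ~~> 0"
 by (rule block_average_L2_tendsto[OF R tm t _ norm_truncation(1)]) (use z0 in \<open>simp add: truncation_def\<close>)
 then have "\<forall>\<^sub>F n in sequentially. ?b n < ennreal (e / 4)"
 using e by (intro order_tendstoD(2)) auto
 then obtain n where n: "?b n <= ennreal (e / 4)" unfolding eventually_sequentially by (blast intro: less_imp_le)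
 note [measurable] = block_average_measurable[OF tm, of t0 T "Suc n" m]
 have "(NN R (%z. NN lborel (%r. nsq (block_average t0 T (Suc n) (?g z) r - f z r)))) =
 (NN R (%z. NN lborel (%r. nsq ((block_average t0 T (Suc n) (?g z) r - ?g z r) + (?g z r - f z r)))))" by simp
 also have "... <= 2 * (?b n + ?tr m)"
 by (rule nn_integral2_norm_add_sq[OF lborel.sigma_finite_measure_axioms]; measurable)
 also have "... <= 2 * (ennreal (e / 4) + ennreal (e / 4))" by (intro ml_mono add_mono m n) auto
 also have "... = ennreal e" using e by (simp add: ennreal_plus[symmetric] ennreal_mult'[symmetric] del: ennreal_plus flip: ennreal_numeral)
 finally show ?thesis by (intro exI[of _ "Suc n"] exI[of _ m]) simp
qed

lemma elementary_data_diff: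
 assumes "elementary_data M F K a b h" "elementary_data M F K' a' b' h'"
 shows "elementary_data M F (K <+> K') (case_sum a a') (case_sum b b') (case_sum h (%i z. - h' i z))"
 unfolding elementary_data_def
proof (intro conjI ballI)
 fix k assume k: "k : K <+> K'"
 show "0 <= case_sum a a' k" "case_sum a a' k <= case_sum b b' k"
 "case_sum h (%i z. - h' i z) k : BM (F (case_sum a a' k))"
 "EX c. ALL z:space M. norm (case_sum h (%i z. - h' i z) k z) <= c"
 using k assms by (auto simp: elementary_data_def)
qed (use assms in \<open>auto simp: elementary_data_def\<close>)

lemma sum_case_sum_diff:
 fixes f :: "'i => 'b::real_vector"
 assumes "finite K" "finite K'"
 shows "(\<Sum>k\<in>K <+> K'. c (case_sum a a' k) (case_sum b b' k) *\<^sub>R case_sum h (%i z. - h' i z) k z) =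
 (\<Sum>k\<in>K. c (a k) (b k) *\<^sub>R h k z) - (\<Sum>k\<in>K'. c (a' k) (b' k) *\<^sub>R h' k z :: 'b)"
 using assms by (subst sum.Plus) (auto simp: o_def sum_negf)

lemma (in brownian_basis) elementary_maximal_diff:
 fixes h :: "'i => 'a => 'b::euclidean_space" and h' :: "'j => 'a => 'b"
 assumes ed: "elementary_data M F K a b h" "elementary_data M F K' a' b' h'"
 and T: "0 <= T" "\<And>k. k : K ==> b k <= T" "\<And>k. k : K' ==> b' k <= T"
 and Q: "countable Q" "Q \<subseteq> {0..T}" "Q ~= {}"
 shows "(NN M (%z. (SUP r\<in>Q. nsq (elementary_integral W K a b h r z - elementary_integral W K' a' b' h' r z))))
 <= 8 * (NN M (%z. NN lborel (%r. nsq ((\<Sum>k\<in>K. indr {a k<..b k} r *\<^sub>R h k z) -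
 (\<Sum>k\<in>K'. indr {a' k<..b' k} r *\<^sub>R h' k z)))))"
proof -
 note ed2 = elementary_data_diff[OF ed]
 let ?K = "K <+> K'" let ?a = "case_sum a a'" let ?b = "case_sum b b'" let ?h = "case_sum h (%i z. - h' i z)"
 have fin: "finite K" "finite K'" using ed by (auto simp: elementary_data_def)
 have e1: "elementary_integral W ?K ?a ?b ?h r z = elementary_integral W K a b h r z - elementary_integral W K' a' b' h' r z" for r z
 unfolding elementary_integral_def
 using sum_case_sum_diff[OF fin, of "%x y. W (min y r) z - W (min x r) z" a a' b b' h h' z] by simp
 have e2: "(\<Sum>k\<in>?K. indr {?a k<..?b k} r *\<^sub>R ?h k z) = (\<Sum>k\<in>K. indr {a k<..b k} r *\<^sub>R h k z) -
 (\<Sum>k\<in>K'. indr {a' k<..b' k} r *\<^sub>R h' k z)" for r z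
 using sum_case_sum_diff[OF fin, of "%x y. indr {x<..y} r" a a' b b' h h' z] by simp
 have bT: "?b k <= T" "?a k <= T" if "k : ?K" for k
 proof -
 have "?a k <= ?b k" using that ed by (auto simp: elementary_data_def)
 moreover show "?b k <= T" using that T by auto
 ultimately show "?a k <= T" by simp
 qed
 have e3: "elementary_integral W ?K ?a ?b ?h T z = (\<Sum>k\<in>?K. (W (?b k) z - W (?a k) z) *\<^sub>R ?h k z)" for z
 unfolding elementary_integral_def by (intro sum.cong refl) (simp only: bT min_absorb1)
 show ?thesis
 using elementary_maximal[OF ed2 T(1) Q] unfolding e1 e3[folded e1] e3[symmetric] elementary_isometry[OF ed2, folded e3] e2
 using elementary_isometry[OF ed2] unfolding e3[symmetric] e1 e2 by simp
qed

text \<open>Rationals are dense in the interval and the path is continuous. Suprema over time are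
  thus always taken over countably many times, where they are measurable.\<close>

lemma norm_sq_le_SUP_rational:
 fixes ph :: "real => 'b::real_normed_vector"
 assumes c: "continuous_on UNIV ph" and t: "t0 < T" "t : {t0..T}"
 shows "nsq (ph t) <= (SUP q\<in>{t0..T} \<inter> \<rat>. nsq (ph q))" (is "_ <= ?S")
proof (cases "?S = \<infinity>")
 case False
 then obtain c' where c': "?S = ennreal c'" "0 <= c'" by (cases ?S) auto
 have "t : closure ({t0..T} \<inter> \<rat>)"
 unfolding closure_approachable
 proof (intro allI impI)
 fix e :: real assume "0 < e"
 then have "max t0 (t - e) < min T (t + e)" using t by auto
 then obtain q where "q : \<rat>" "max t0 (t - e) < q" "q < min T (t + e)" using Rats_dense_in_real by blast
 then show "EX y:{t0..T} \<inter> \<rat>. dist y t < e" by (intro bexI[of _ q]) (auto simp: dist_real_def)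
 qed
 then have "(norm (ph t))^2 <= c'"
 proof (rule continuous_le_on_closure[rotated])
 show "continuous_on (closure ({t0..T} \<inter> \<rat>)) (%t. (norm (ph t))^2)"
 by (intro continuous_intros continuous_on_subset[OF c]) auto
 fix q assume "q : {t0..T} \<inter> \<rat>"
 then have "nsq (ph q) <= ennreal c'" unfolding c'(1)[symmetric] by (rule SUP_upper)
 then show "(norm (ph q))^2 <= c'" using c'(2) by simp
 qed
 then show ?thesis unfolding c'(1) by (rule ennreal_leI)
next
 case True
 then show ?thesis by (metis infinity_ennreal_def top_greatest)
qed

text \<open>The averaged block ends where the current one begins, so its average is already known at
  the left end of the current block. For the first block the average reaches before
  \<open>t0\<close>, where \<open>f\<close> vanishes.\<close>

lemma (in brownian_basis) past_average_elementary_data: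
 fixes f :: "real => 'a => 'b::euclidean_space"
 assumes t: "0 <= t0" "t0 < T" and n: "0 < n"
 and f: "joint M f"
 and z: "\<And>r y. r ~: {t0<..<T} ==> f r y = 0"
 and ad: "AEI t0 T (%r. f r : BM (F r))"
 shows "elementary_data M F {..<n} (grid t0 T n) (%i. grid t0 T n (Suc i))
 (%i y. past_average t0 T n (truncation m (%r. f r y)) i)"
 unfolding elementary_data_def
proof (intro conjI ballI)
 fix i assume i: "i : {..<n}"
 let ?tu = "grid t0 T n i"
 have tu: "t0 <= ?tu" using grid_mono[of t0 T 0 i n] t by simp
 then show tu0: "0 <= ?tu" using t by simp
 show "?tu <= grid t0 T n (Suc i)" using t by (intro grid_mono) auto
 show "EX c. ALL y:space M. norm (past_average t0 T n (truncation m (%r. f r y)) i) <= c"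
 by (intro exI[of _ "real m"] ballI past_average_bound t(2) n norm_truncation(1))
 let ?I = "{?tu - (T - t0) / real n<..?tu}"
 let ?L = "restrict_space lborel ?I"
 have fin: "finite_measure ?L"
 by (rule finite_measureI) (use t n in \<open>simp add: emeasure_restrict_space space_restrict_space emeasure_lborel_Ioc\<close>)
 have "(%p. truncation m (%r. f r (snd p)) (fst p)) : BM (tprod M)"
 using f unfolding truncation_def by measurable
 moreover have "(%p. (fst p, snd p)) : measurable (?L \<Otimes>\<^sub>M M) (tprod M)"
 by (intro measurable_Pair measurable_snd mcomp[OF measurable_fst measurable_restrict_space1]) simp
 ultimately have meas: "(%p. truncation m (%r. f r (snd p)) (fst p)) : BM (?L \<Otimes>\<^sub>M M)"
 using mcomp by fastforce
 have adL: "AE r in ?L. (%y. truncation m (%r. f r y) r) : BM (F ?tu)"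
 proof (subst AE_restrict_space_iff)
 show "AE r in lborel. r : ?I --> (%y. truncation m (%r. f r y) r) : BM (F ?tu)"
 using ad
 proof (eventually_elim, intro impI)
 fix r assume r: "r : {t0<..<T} --> f r : BM (F r)" "r : ?I"
 have "f r : BM (F ?tu)"
 proof (cases "r : {t0<..<T}")
 case True
 then show ?thesis using r t by (intro measurable_filt_mono[of r ?tu "f r"]) auto
 next
 case False
 then have "f r = (%_. 0)" using z by auto
 then show ?thesis by simp
 qed
 then show "(%y. truncation m (%r. f r y) r) : BM (F ?tu)"
 unfolding truncation_def by measurable
 qed
 qed auto
 have "(%y. LINT r|?L. truncation m (%r. f r y) r) : BM (F ?tu)"
 proof (rule adapted_integral[OF fin meas adL tu0])
 interpret L: finite_measure ?L by fact
 show "AE y in M. integrable ?L (truncation m (%r. f r y))"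
 proof (rule AE_I2, rule L.integrable_const_bound[of _ "real m"])
 fix y assume y: "y : space M"
 show "truncation m (%r. f r y) : BM ?L"
 using mcomp[OF measurable_Pair2'[OF y, of ?L] meas] by simp
 qed (auto simp: norm_truncation)
 qed
 moreover have "(LINT r|?L. g r) = (LINT r:?I|lborel. g r)" for g :: "real => 'b"
 unfolding slint_def by (rule integral_restrict_space) auto
 ultimately show "(%y. past_average t0 T n (truncation m (%r. f r y)) i) : BM (F ?tu)"
 unfolding past_average_def by simp
qed simp

section \<open>The stochastic integral as a continuous adapted process\<close>

context continuous_brownian_basis
begin

lemma elementary_integral_continuous:
 "z : space M ==> continuous_on UNIV (%t. elementary_integral W K a b h t z)"
 unfolding elementary_integral_def
 by (intro continuous_on_sum continuous_on_scaleR continuous_on_diff continuous_on_const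
 continuous_on_compose2[OF W_continuous] continuous_intros) auto

definition block_ito :: "real => real => nat => nat => (real => 'a => 'b::euclidean_space) => real => 'a => 'b" where
 "block_ito t0 T n m f = elementary_integral W {..<n} (grid t0 T n) (%i. grid t0 T n (Suc i))
 (%i z. past_average t0 T n (truncation m (%r. f r z)) i)"

text \<open>An explicit total limit, with time clamped from below at \<open>t0\<close>: joint
  measurability in all parameters is inherited from the approximations, whether or not they
  converge.\<close>

definition ito_limit :: "real => real => (nat => nat) => (nat => nat) => (real => 'a => 'b::euclidean_space) => real => 'a => 'b" where
 "ito_limit t0 T n m f t z = lim (%k. block_ito t0 T (n k) (m k) f (max t0 t) z)"

text \<open>The weights \<open>4 ^ k\<close> in \<open>fin\<close> together with the maximal
  inequality make the squared increments of the approximating integrals summable uniformly in time,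
  which gives almost surely uniform convergence. \<open>S\<close> is a measurable majorant of the
  squared path, and Fatou's lemma bounds its mean.\<close>

lemma ito_limit_properties:
 fixes f :: "real => 'a => 'b::euclidean_space"
 assumes t: "0 <= t0" "t0 < T" and n: "\<And>k. 0 < n k"
 and f[measurable]: "joint M f"
 and z: "\<And>r y. r ~: {t0<..<T} ==> f r y = 0"
 and ad: "AEI t0 T (%r. f r : BM (F r))"
 and fin: "(\<Sum>k. 4 ^ k * (NN M (%y. NN lborel (%r. nsq (block_average t0 T (n k) (truncation (m k) (%r. f r y)) r - f r y))))) < \<infinity>"
 defines "J \<equiv> ito_limit t0 T n m f"
 and "S \<equiv> (%y. liminf (%k. SUP q\<in>{t0..T} \<inter> \<rat>. nsq (block_ito t0 T (n k) (m k) f q y)))"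
 shows "AE y in M. continuous_on {t0..T} (%t. J t y)"
 and "AE y in M. ALL t:{t0..T}. nsq (J t y) <= S y"
 and "(NN M S) <= 16 * (NN M (%y. NN lborel (%r. nsq (f r y))))"
 and "\<And>t. t : {t0<..T} ==> has_ito_integral M W F t0 t f (J t)"
 and "\<And>t. t : {t0..T} ==> J t : BM (F t)"
proof -
 let ?H = "%k y. block_average t0 T (n k) (truncation (m k) (%r. f r y))"
 let ?e = "%k. NN M (%y. NN lborel (%r. nsq (?H k y r - f r y)))"
 let ?J = "%k. block_ito t0 T (n k) (m k) f"
 let ?Q = "{t0..T} \<inter> \<rat>"
 interpret P: pair_sigma_finite lborel M ..
 have T0: "0 <= T" using t by simp
 have Q: "countable ?Q" "?Q \<subseteq> {0..T}" "?Q ~= {}"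
 proof -
 obtain r where "r : \<rat>" "t0 < r" "r < T" using Rats_dense_in_real[OF t(2)] by blast
 then have "r : ?Q" by auto
 then show "?Q ~= {}" by blast
 qed (use countable_rat t in auto)
 note ed = past_average_elementary_data[OF t n f z ad]
 have f': "(%p. f (snd p) (fst p)) : BM (M \<Otimes>\<^sub>M lborel)"
 using mcomp[OF measurable_pair_swap' f] by (simp add: case_prod_beta')
 have "(%p. truncation (m k) (%r. f r (fst p)) (snd p)) : BM (M \<Otimes>\<^sub>M lborel)" for k
 using f' unfolding truncation_def by measurable
 then have Hm[measurable]: "(%p. ?H k (fst p) (snd p)) : BM (M \<Otimes>\<^sub>M lborel)" for k
 by (rule block_average_measurable)
 have fm'[measurable]: "(%p. f (snd p) (fst p)) : BM (M \<Otimes>\<^sub>M lborel)" by fact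
 have gT: "grid t0 T (n k) (Suc i) <= T" if "i < n k" for k i
 using grid_mono[of t0 T "Suc i" "n k" "n k"] t n[of k] that by simp
 \<comment> \<open>The factor 16 is 8 from the maximal inequality times 2 from passing through
   \<open>f\<close>.\<close>
 have maxi: "(NN M (%y. (SUP q\<in>D. nsq (?J k q y - ?J l q y)))) <= 16 * (?e k + ?e l)"
 if D: "countable D" "D \<subseteq> {0..T}" "D ~= {}" for k l D
 proof -
 have "(NN M (%y. (SUP q\<in>D. nsq (?J k q y - ?J l q y)))) <=
 8 * (NN M (%y. NN lborel (%r. nsq (?H k y r - ?H l y r))))"
 unfolding block_ito_def block_average_def
 by (rule elementary_maximal_diff[OF ed ed T0 _ _ D]) (use gT in auto)
 also have "(NN M (%y. NN lborel (%r. nsq (?H k y r - ?H l y r)))) =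
 (NN M (%y. NN lborel (%r. nsq ((?H k y r - f r y) + (f r y - ?H l y r)))))" by simp
 also have "... <= 2 * (?e k + (NN M (%y. NN lborel (%r. nsq (f r y - ?H l y r)))))"
 by (rule nn_integral2_norm_add_sq[OF lborel.sigma_finite_measure_axioms]; measurable)
 also have "(NN M (%y. NN lborel (%r. nsq (f r y - ?H l y r)))) = ?e l"
 by (simp only: norm_minus_commute)
 finally show ?thesis by (simp add: mult.assoc[symmetric] ml_mono)
 qed
 \<comment> \<open>The same comparison against the empty simple process, whose integral is
   0.\<close>
 have maxi1: "(NN M (%y. (SUP q\<in>?Q. nsq (?J k q y)))) <= 16 * (?e k + (NN M (%y. NN lborel (%r. nsq (f r y)))))" for k
 proof -
 have ed0: "elementary_data M F ({}::nat set) (%_. 0) (%_. 0) (%_ _. 0 :: 'b)" by (simp add: elementary_data_def)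
 have "(NN M (%y. (SUP q\<in>?Q. nsq (?J k q y)))) <=
 8 * (NN M (%y. nn2 lborel (?H k y)))"
 using elementary_maximal_diff[OF ed[of k "m k"] ed0 T0 _ _ Q] gT[of _ k]
 by (simp add: block_ito_def block_average_def elementary_integral_def)
 also have "(NN M (%y. nn2 lborel (?H k y))) =
 (NN M (%y. NN lborel (%r. nsq ((?H k y r - f r y) + f r y))))" by simp
 also have "... <= 2 * (?e k + (NN M (%y. NN lborel (%r. nsq (f r y)))))"
 by (rule nn_integral2_norm_add_sq[OF lborel.sigma_finite_measure_axioms]; measurable)
 finally show ?thesis by (simp add: mult.assoc[symmetric] ml_mono)
 qed
 obtain c where c: "(\<Sum>k. 4 ^ k * ?e k) = ennreal c" "0 <= c"
 using fin by (cases "\<Sum>k. 4 ^ k * ?e k") auto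
 have e_le: "4 ^ k * ?e k <= ennreal c" for k
 unfolding c(1)[symmetric] using sum_le_suminf[of "%k. 4 ^ k * ?e k" "{k}"] by simp
 have "?e k <= ennreal (c * (1/4) ^ k)" for k
 proof -
 have "?e k = ennreal ((1/4)^k) * (4 ^ k * ?e k)"
 by (simp add: mult.assoc[symmetric] ennreal_power[symmetric] ennreal_mult'[symmetric] power_mult_distrib[symmetric] flip: ennreal_numeral)
 also have "... <= ennreal ((1/4)^k) * ennreal c" by (intro ml_mono e_le) auto
 finally show ?thesis using c(2) by (simp add: ennreal_mult' mult.commute)
 qed
 moreover have "(%k. ennreal (c * (1/4) ^ k)) ~~> ennreal (c * 0)"
 by (intro tendsto_ennrealI tendsto_mult_left LIMSEQ_power_zero) simp
 ultimately have e0: "?e ~~> 0"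
 by (intro tendsto_sandwich[of "%_. 0" ?e sequentially "%k. ennreal (c * (1/4) ^ k)"]) (auto simp del: ennreal_mult'')
 have JF: "?J k q : BM (F q)" if "0 <= q" for k q
 unfolding block_ito_def by (rule elementary_integral_adapted[OF ed that])
 have JM: "?J k q : BM M" if "0 <= q" for k q
 using measurable_filt_M[OF that JF[OF that]] .
 have Jc: "continuous_on UNIV (%q. ?J k q y)" if "y : space M" for k y
 unfolding block_ito_def by (rule elementary_integral_continuous[OF that])
 let ?D = "%k y. SUP q\<in>?Q. nsq (?J (Suc k) q y - ?J k q y)"
 have Dm[measurable]: "?D k : BM M" for k
 proof (intro borel_measurable_SUP Q(1))
 fix q assume "q : ?Q"
 then have "0 <= q" using t by auto
 note [measurable] = JM[OF this]
 show "(%y. nsq (?J (Suc k) q y - ?J k q y)) : BM M" by measurable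
 qed
 have "(NN M (%y. (\<Sum>k. 4 ^ k * ?D k y))) = (\<Sum>k. 4 ^ k * (NN M (%y. ?D k y)))"
 by (simp add: nn_integral_suminf nn_cmult)
 also have "... <= (\<Sum>k. 16 * (4 ^ Suc k * ?e (Suc k)) + 16 * (4 ^ k * ?e k))"
 proof (intro suminf_le allI summableI)
 fix k
 have "4 ^ k * (NN M (%y. ?D k y)) <= 4 ^ k * (16 * (?e (Suc k) + ?e k))"
 by (intro ml_mono maxi Q) auto
 also have "... = 16 * (4 ^ k * ?e (Suc k)) + 16 * (4 ^ k * ?e k)"
 by (simp only: distrib_left mult.left_commute[of "4 ^ k" 16])
 also have "... <= 16 * (4 ^ Suc k * ?e (Suc k)) + 16 * (4 ^ k * ?e k)"
 proof -
 have "(4::ennreal) ^ k * 1 <= 4 ^ k * 4" by (rule ml_mono) auto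
 then have "(4::ennreal) ^ k <= 4 ^ Suc k" by (simp only: mult_1_right power_Suc2)
 then show ?thesis by (intro add_mono ml_mono mr_mono order_refl) (auto simp del: power_Suc)
 qed
 finally show "4 ^ k * (NN M (%y. ?D k y)) <= 16 * (4 ^ Suc k * ?e (Suc k)) + 16 * (4 ^ k * ?e k)" .
 qed
 also have "... = 16 * (\<Sum>k. 4 ^ Suc k * ?e (Suc k)) + 16 * (\<Sum>k. 4 ^ k * ?e k)"
 by (simp add: suminf_add[symmetric] del: power_Suc)
 also have "... <= 16 * (\<Sum>k. 4 ^ k * ?e k) + 16 * (\<Sum>k. 4 ^ k * ?e k)"
 proof (intro add_mono ml_mono order_refl)
 have "(\<Sum>k. 4 ^ k * ?e k) = (\<Sum>k. 4 ^ Suc k * ?e (Suc k)) + 4 ^ 0 * ?e 0"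
 using suminf_offset[of "%k. 4 ^ k * ?e k" 1] by (simp add: add.commute)
 then show "(\<Sum>k. 4 ^ Suc k * ?e (Suc k)) <= (\<Sum>k. 4 ^ k * ?e k)" by simp
 qed auto
 also have "... < \<infinity>" unfolding c(1) by (simp add: ennreal_mult_less_top)
 finally have "AE y in M. (\<Sum>k. 4 ^ k * ?D k y) ~= \<infinity>"
 by (intro nn_integral_PInf_AE) auto
 \<comment> \<open>On each such path the increments are at most \<open>sqrt d * (1/2) ^ k\<close> on
   the whole interval, so the Weierstrass test applies to the telescoping series.\<close>
 then have ul: "AE y in M. y : space M & uniform_limit {t0..T} (%k q. ?J k q y) (%q. J q y) sequentially"
 using AE_space
 proof eventually_elim
 case (elim y)
 then obtain d where d: "(\<Sum>k. 4 ^ k * ?D k y) = ennreal d" "0 <= d" by (cases "\<Sum>k. 4 ^ k * ?D k y") auto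
 have bd: "norm (?J (Suc k) q y - ?J k q y) <= sqrt d * (1/2) ^ k" if q: "q : {t0..T}" for k q
 proof -
 have "ennreal (4 ^ k * (norm (?J (Suc k) q y - ?J k q y))^2) = 4 ^ k * nsq (?J (Suc k) q y - ?J k q y)"
 by (simp add: ennreal_mult ennreal_power[symmetric])
 also have "... <= 4 ^ k * ?D k y"
 by (intro ml_mono norm_sq_le_SUP_rational[OF _ t(2) q] continuous_on_diff Jc elim) auto
 also have "... <= ennreal d" unfolding d(1)[symmetric] using sum_le_suminf[of "%k. 4 ^ k * ?D k y" "{k}"] by simp
 finally have "4 ^ k * (norm (?J (Suc k) q y - ?J k q y))^2 <= d" using d(2) by simp
 then have "(2 ^ k * norm (?J (Suc k) q y - ?J k q y))^2 <= d"
 unfolding power_mult_distrib[of "2 ^ k"] by (simp add: power2_eq_square[of "2 ^ k"] power_mult_distrib[symmetric])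
 then have "2 ^ k * norm (?J (Suc k) q y - ?J k q y) <= sqrt d" by (rule real_le_rsqrt)
 then show ?thesis by (simp add: power_one_over field_simps)
 qed
 have "summable (%k. sqrt d * (1/2) ^ k)" by (intro summable_mult summable_geometric) auto
 with bd have "uniform_limit {t0..T} (%k q. \<Sum>i<k. ?J (Suc i) q y - ?J i q y) (%q. \<Sum>i. ?J (Suc i) q y - ?J i q y) sequentially"
 by (rule Weierstrass_m_test)
 then have "uniform_limit {t0..T} (%k q. ?J k q y - ?J 0 q y) (%q. \<Sum>i. ?J (Suc i) q y - ?J i q y) sequentially"
 by (simp add: sum_lessThan_telescope[of "%i. ?J i _ y"])
 then have "uniform_limit {t0..T} (%k q. (?J k q y - ?J 0 q y) + ?J 0 q y) (%q. (\<Sum>i. ?J (Suc i) q y - ?J i q y) + ?J 0 q y) sequentially"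
 by (intro uniform_limit_add uniform_limit_const)
 then have ul: "uniform_limit {t0..T} (%k q. ?J k q y) (%q. (\<Sum>i. ?J (Suc i) q y - ?J i q y) + ?J 0 q y) sequentially" by simp
 have "J q y = (\<Sum>i. ?J (Suc i) q y - ?J i q y) + ?J 0 q y" if "q : {t0..T}" for q
 using limI[OF tendsto_uniform_limitI[OF ul that]] that unfolding J_def ito_limit_def by (simp add: max_def)
 then show ?case using uniform_limit_cong'[THEN iffD1, OF _ _ ul] elim by auto
 qed
 have ptw: "AE y in M. ALL q:{t0..T}. (%k. ?J k q y) ~~> J q y"
 using ul by eventually_elim (auto intro: tendsto_uniform_limitI)
 show "AE y in M. continuous_on {t0..T} (%t. J t y)"
 using ul
 proof eventually_elim
 case (elim y)
 show ?case
 by (rule uniform_limit_theorem[OF _ conjunct2[OF elim]]) (use Jc elim in \<open>auto intro!: always_eventually continuous_on_subset[OF Jc]\<close>)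
 qed
 show "AE y in M. ALL t:{t0..T}. nsq (J t y) <= S y"
 using ul
 proof (eventually_elim, intro ballI)
 fix y q assume y: "y : space M & uniform_limit {t0..T} (%k q. ?J k q y) (%q. J q y) sequentially" and q: "q : {t0..T}"
 have "(%k. nsq (?J k q y)) ~~> nsq (J q y)"
 by (intro tendsto_ennrealI tendsto_power tendsto_norm tendsto_uniform_limitI[OF conjunct2[OF y] q])
 then have "nsq (J q y) = liminf (%k. nsq (?J k q y))"
 by (intro lim_imp_Liminf[symmetric]) auto
 also have "... <= S y" unfolding S_def
 by (intro Liminf_mono always_eventually allI norm_sq_le_SUP_rational[OF Jc t(2) q]) (use y in auto)
 finally show "nsq (J q y) <= S y" .
 qed
 have "(NN M S) <= liminf (%k. NN M (%y. (SUP q\<in>?Q. nsq (?J k q y))))"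
 unfolding S_def
 proof (intro nn_integral_liminf borel_measurable_SUP Q(1))
 fix k q assume "q : ?Q"
 then have "0 <= q" using t by auto
 note [measurable] = JM[OF this]
 show "(%y. nsq (?J k q y)) : BM M" by measurable
 qed
 also have "... <= liminf (%k. 16 * (?e k + (NN M (%y. NN lborel (%r. nsq (f r y))))))"
 by (intro Liminf_mono always_eventually allI maxi1)
 also have "... = 16 * (0 + (NN M (%y. NN lborel (%r. nsq (f r y)))))"
 by (intro lim_imp_Liminf ennreal_tendsto_cmult tendsto_add e0 tendsto_const) auto
 finally show "(NN M S) <= 16 * (NN M (%y. NN lborel (%r. nsq (f r y))))" by simp
 show JFt: "J q : BM (F q)" if "q : {t0..T}" for q
 using borel_measurable_lim_metric[OF JF[of q]] that t unfolding J_def ito_limit_def by (simp add: max_def)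
 show "has_ito_integral M W F t0 q f (J q)" if q: "q : {t0<..T}" for q
 unfolding has_ito_integral_def
 proof (intro conjI exI allI)
 let ?P = "restrict_space lborel {t0<..<q} \<Otimes>\<^sub>M M"
 have id: "(%p. p) : measurable ?P (tprod M)"
 by (auto intro!: measurable_Pair[of fst _ _ snd, simplified] measurable_restrict_space1 mcomp[OF measurable_fst])
 have fP[measurable]: "(%p. f (fst p) (snd p)) : BM ?P" using mcomp[OF id f] .
 show "(%p. f (fst p) (snd p)) : BM (completion ?P)" by (rule measurable_completion[OF fP])
 have q0: "0 <= q" using t q by auto
 show JMq[measurable]: "J q : BM M" using measurable_filt_M[OF q0 JFt] q by auto
 \<comment> \<open>For the integral up to \<open>q\<close>, later grid points are moved to
   \<open>q\<close>. The coefficient of a block that starts after \<open>q\<close> is set to 0,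
   since it need not be known at time \<open>q\<close>; the corresponding increment is 0
   anyway.\<close>
 let ?tu = "%k i. min (grid t0 T (n k) i) q"
 let ?h = "%k i y. if grid t0 T (n k) i <= q then past_average t0 T (n k) (truncation (m k) (%r. f r y)) i else 0"
 show sp: "simple_process_data M F t0 q (n k) (?tu k) (?h k)" for k
 unfolding simple_process_data_def
 proof (intro conjI allI impI)
 show "t0 <= ?tu k 0" "?tu k (n k) <= q" using q by auto
 fix i assume i: "i < n k"
 show "?tu k i <= ?tu k (Suc i)" using grid_mono[of t0 T i "Suc i" "n k"] t by auto
 show "?h k i : BM (F (?tu k i))"
 using ed[of k "m k"] i by (cases "grid t0 T (n k) i <= q") (auto simp: elementary_data_def min_absorb1)
 show "EX c. ALL y:space M. norm (?h k i y) <= c"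
 using ed[of k "m k"] i by (cases "grid t0 T (n k) i <= q") (auto simp: elementary_data_def)
 qed
 have Spr: "simple_process (n k) (?tu k) (?h k) r y = ?H k y r" if "r < q" for k r y
 unfolding simple_process_def block_average_def
 by (intro sum.cong refl) (use that in \<open>auto simp: ind_def min_def\<close>)
 have Sint: "simple_integral W (n k) (?tu k) (?h k) y = ?J k q y" for k y
 unfolding simple_integral_def block_ito_def elementary_integral_def
 proof (intro sum.cong refl)
 fix i assume "i : {..<n k}"
 have "grid t0 T (n k) i <= grid t0 T (n k) (Suc i)" using t by (intro grid_mono) auto
 then show "(W (?tu k (Suc i)) y - W (?tu k i) y) *\<^sub>R ?h k i y =
 (W (min (grid t0 T (n k) (Suc i)) q) y - W (min (grid t0 T (n k) i) q) y) *\<^sub>R past_average t0 T (n k) (truncation (m k) (%r. f r y)) i"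
 by (cases "grid t0 T (n k) i <= q") (auto simp: min_def)
 qed
 have "(\<integral>\<^sup>+p. nsq (simple_process (n k) (?tu k) (?h k) (fst p) (snd p) - f (fst p) (snd p)) \<partial>completion ?P) <= ?e k" for k
 proof -
 have [measurable]: "(%p. simple_process (n k) (?tu k) (?h k) (fst p) (snd p)) : BM ?P"
 using mcomp[OF id, of "%p. simple_process (n k) (?tu k) (?h k) (fst p) (snd p)"] simple_process_measurable[OF sp t(1)]
 by (simp cong: measurable_cong_sets)
 have "(\<integral>\<^sup>+p. nsq (simple_process (n k) (?tu k) (?h k) (fst p) (snd p) - f (fst p) (snd p)) \<partial>completion ?P)
 = (\<integral>\<^sup>+r. NN M (%y. nsq (simple_process (n k) (?tu k) (?h k) r y - f r y)) \<partial>restrict_space lborel {t0<..<q})"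
 unfolding nn_integral_completion
 using nn_integral_fst[of "%p. nsq (simple_process (n k) (?tu k) (?h k) (fst p) (snd p) - f (fst p) (snd p))" "restrict_space lborel {t0<..<q}"] by simp
 also have "... <= (NN lborel (%r. NN M (%y. nsq (?H k y r - f r y))))"
 by (subst nn_integral_restrict_space) (auto intro!: nn_mono simp: ind_def Spr)
 also have "... = ?e k"
 proof (rule P.Fubini'[symmetric])
 have "(%p. nsq (?H k (fst p) (snd p) - f (snd p) (fst p))) : BM (M \<Otimes>\<^sub>M lborel)" by measurable
 from mcomp[OF measurable_pair_swap' this]
 show "(%(r, y). nsq (?H k y r - f r y)) : BM (tprod M)" by (simp add: case_prod_beta')
 qed
 finally show ?thesis .
 qed
 then show "(%k. \<integral>\<^sup>+p. nsq (simple_process (n k) (?tu k) (?h k) (fst p) (snd p) - f (fst p) (snd p)) \<partial>completion ?P) ~~> 0"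
 by (intro tendsto_sandwich[OF _ _ tendsto_const e0]) (auto intro!: always_eventually)
 \<comment> \<open>Fatou's lemma in the second index: \<open>J q\<close> is the almost sure limit of
   \<open>?J l q\<close>, and \<open>?e l\<close> tends to 0.\<close>
 have "(NN M (%y. nsq (?J k q y - J q y))) <= 16 * (?e k + 0)" for k
 proof -
 have "(NN M (%y. nsq (?J k q y - J q y))) = (NN M (%y. liminf (%l. nsq (?J k q y - ?J l q y))))"
 proof (rule nn_cong_AE)
 show "AE y in M. nsq (?J k q y - J q y) = liminf (%l. nsq (?J k q y - ?J l q y))"
 using ptw
 proof eventually_elim
 case (elim y)
 have "(%l. nsq (?J k q y - ?J l q y)) ~~> nsq (?J k q y - J q y)"
 by (intro tendsto_ennrealI tendsto_power tendsto_norm tendsto_diff tendsto_const) (use elim q in auto)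
 then show ?case by (intro lim_imp_Liminf[symmetric]) auto
 qed
 qed
 also have "... <= liminf (%l. NN M (%y. nsq (?J k q y - ?J l q y)))"
 using JM[OF q0] by (intro nn_integral_liminf) measurable
 also have "... <= liminf (%l. 16 * (?e k + ?e l))"
 using maxi[of "{q}" k] q0 q by (intro Liminf_mono always_eventually allI) auto
 also have "... = 16 * (?e k + 0)"
 by (intro lim_imp_Liminf ennreal_tendsto_cmult tendsto_add e0 tendsto_const) auto
 finally show ?thesis .
 qed
 note le = this
 have "(%k. 16 * (?e k + 0)) ~~> 16 * (0 + 0)"
 by (intro ennreal_tendsto_cmult tendsto_add e0 tendsto_const) auto
 then have z: "(%k. 16 * (?e k + 0)) ~~> 0" by (simp only: add_0_right mult_zero_right)
 show "(%k. NN M (%y. nsq (simple_integral W (n k) (?tu k) (?h k) y - J q y))) ~~> 0"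
 unfolding Sint
 proof (rule tendsto_sandwich[OF always_eventually always_eventually tendsto_const z])
 show "ALL k. (NN M (%y. nsq (?J k q y - J q y))) <= 16 * (?e k + 0)" by (rule allI, rule le)
 qed simp
 qed
qed

end

section \<open>Progressive versions and jointly measurable fields of stochastic integrals\<close>

text \<open>Against the weights \<open>4 ^ k\<close>, the rate \<open>(1/16) ^ k\<close> leaves the
  geometric series of 1/4. A finite weighted sum of squares in turn gives the rate
  \<open>(1/2) ^ k\<close> for norms.\<close>

lemma nn_integral_suminf_finite_AE:
 fixes e :: "nat => 's => ennreal"
 assumes [measurable]: "\<And>k. e k : BM N" and le: "\<And>k. (NN N (e k)) <= ennreal ((1/16) ^ k)"
 shows "AE s in N. (\<Sum>k. 4 ^ k * e k s) < \<infinity>"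
proof -
 have "(NN N (%s. (\<Sum>k. 4 ^ k * e k s))) = (\<Sum>k. 4 ^ k * (NN N (e k)))"
 by (simp add: nn_integral_suminf nn_cmult)
 also have "... <= (\<Sum>k. ennreal ((1/4) ^ k))"
 proof (intro suminf_le allI summableI)
 fix k
 have "(4::ennreal) ^ k = ennreal (4 ^ k)" by (metis ennreal_numeral ennreal_power zero_le_numeral)
 then have "4 ^ k * (NN N (e k)) <= ennreal (4 ^ k) * ennreal ((1/16) ^ k)"
 using ml_mono[OF le[of k], of "ennreal (4 ^ k)"] by simp
 also have "... = ennreal ((1/4) ^ k)"
 by (simp add: ennreal_mult'[symmetric] power_mult_distrib[symmetric])
 finally show "4 ^ k * (NN N (e k)) <= ennreal ((1/4) ^ k)" .
 qed
 also have "... = ennreal (\<Sum>k. (1/4) ^ k)"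
 by (intro suminf_ennreal_eq) (auto intro!: summable_sums summable_geometric)
 also have "... < \<infinity>" by simp
 finally have "AE s in N. (\<Sum>k. 4 ^ k * e k s) ~= \<infinity>" by (intro nn_integral_PInf_AE) auto
 then show ?thesis by eventually_elim (simp add: less_top)
qed

lemma tendsto_of_suminf_finite:
 fixes f :: "nat => 'b::real_normed_vector"
 assumes "(\<Sum>k. 4 ^ k * nsq (f k - l)) < \<infinity>"
 shows "f ~~> l"
proof -
 obtain c where c: "(\<Sum>k. 4 ^ k * nsq (f k - l)) = ennreal c" "0 <= c"
 using assms by (cases "\<Sum>k. 4 ^ k * nsq (f k - l)") auto
 have "norm (f k - l) <= sqrt c * (1/2) ^ k" for k
 proof -
 have "(4::ennreal) ^ k = ennreal (4 ^ k)" by (metis ennreal_numeral ennreal_power zero_le_numeral)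
 then have "ennreal (4 ^ k * (norm (f k - l))^2) = 4 ^ k * nsq (f k - l)" by (simp add: ennreal_mult)
 also have "... <= ennreal c" unfolding c(1)[symmetric] using sum_le_suminf[of "%k. 4 ^ k * nsq (f k - l)" "{k}"] by simp
 finally have "4 ^ k * (norm (f k - l))^2 <= c" using c(2) by simp
 then have "(2 ^ k * norm (f k - l))^2 <= c"
 unfolding power_mult_distrib[of "2 ^ k"] by (simp add: power2_eq_square[of "2 ^ k"] power_mult_distrib[symmetric])
 then have "2 ^ k * norm (f k - l) <= sqrt c" by (rule real_le_rsqrt)
 then show ?thesis by (simp add: power_one_over field_simps)
 qed
 moreover have "(%k. sqrt c * (1/2) ^ k) ~~> sqrt c * 0" by (intro tendsto_mult_left LIMSEQ_power_zero) simp
 ultimately have "(%k. f k - l) ~~> 0"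
 using Lim_null_comparison[OF always_eventually, of "%k. f k - l" "%k. sqrt c * (1/2) ^ k"] by simp
 then show ?thesis by (rule LIM_zero_cancel)
qed

context brownian_basis
begin

text \<open>A block average is a step function in time whose values are known from the left end of
  their block, hence progressive. The total function \<open>lim\<close> preserves this, and the fast
  rate makes the limit equal to \<open>f\<close> almost everywhere.\<close>

lemma progressive_version:
 fixes f :: "real => 'a => 'b::euclidean_space"
 assumes t: "0 <= t0" "t0 < T"
 and f[measurable]: "joint M f"
 and ad: "AEI t0 T (%r. f r : BM (F r))"
 and fin: "(NN M (%y. (NI {t0<..<T} (%r. nsq (f r y))))) < \<infinity>"
 shows "EX g. prog_measurable F t0 T g & (AEP M t0 T (%p. g (fst p) (snd p) = f (fst p) (snd p)))"
proof -
 define f0 where "f0 r y = indr {t0<..<T} r *\<^sub>R f r y" for r y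
 have f0[measurable]: "joint M f0" unfolding f0_def by measurable
 have z: "r ~: {t0<..<T} ==> f0 r y = 0" for r y by (simp add: f0_def)
 have ad0: "AEI t0 T (%r. f0 r : BM (F r))"
 using ad by eventually_elim (auto simp: f0_def[abs_def])
 interpret P: pair_sigma_finite lborel M ..
 interpret P': pair_sigma_finite M lborel ..
 have f0': "(%p. f0 (snd p) (fst p)) : BM (M \<Otimes>\<^sub>M lborel)"
 using mcomp[OF measurable_pair_swap' f0] by (simp add: case_prod_beta')
 have "(NN M (%y. NN lborel (%r. nsq (f0 r y)))) = (NN M (%y. (NI {t0<..<T} (%r. nsq (f r y)))))"
 by (intro nn_cong) (auto simp: f0_def ind_def)
 then have fin0: "(NN M (%y. NN lborel (%r. nsq (f0 r y)))) < \<infinity>" using fin by simp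
 define P where "P k n m \<longleftrightarrow> 0 < n & (NN M (%y. NN lborel (%r. nsq (block_average t0 T n (truncation m (%r. f0 r y)) r - f0 r y)))) <= ennreal ((1/16) ^ k)" for k n m
 have "EX n m. P k n m" for k
 unfolding P_def using simple_approximation[where f="%y r. f0 r y" and R=M, OF finite_measure_axioms f0' t(2) z fin0] by simp
 then obtain n m where "\<And>k. P k (n k) (m k)" by metis
 then have nm: "\<And>k. 0 < n k"
 "\<And>k. (NN M (%y. NN lborel (%r. nsq (block_average t0 T (n k) (truncation (m k) (%r. f0 r y)) r - f0 r y)))) <= ennreal ((1/16) ^ k)"
 by (simp_all add: P_def)
 let ?H = "%k r y. block_average t0 T (n k) (truncation (m k) (%r. f0 r y)) r"
 have "(%p. truncation (m k) (%r. f0 r (fst p)) (snd p)) : BM (M \<Otimes>\<^sub>M lborel)" for k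
 proof -
 have "(%x::'b. if norm x <= real (m k) then x else 0) : BM borel" by measurable
 from mcomp[OF f0' this] show ?thesis by (simp add: truncation_def)
 qed
 then have Hm'[measurable]: "(%p. ?H k (snd p) (fst p)) : BM (M \<Otimes>\<^sub>M lborel)" for k
 by (rule block_average_measurable)
 have Hm[measurable]: "(%p. ?H k (fst p) (snd p)) : BM (tprod M)" for k
 using mcomp[OF measurable_pair_swap' Hm'] by (simp add: case_prod_beta')
 have "AE p in lborel \<Otimes>\<^sub>M M. (\<Sum>k. 4 ^ k * nsq (?H k (fst p) (snd p) - f0 (fst p) (snd p))) < \<infinity>"
 proof (rule nn_integral_suminf_finite_AE)
 fix k
 show "(%p. nsq (?H k (fst p) (snd p) - f0 (fst p) (snd p))) : BM (tprod M)" by measurable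
 then show "(NN (tprod M) (%p. nsq (?H k (fst p) (snd p) - f0 (fst p) (snd p)))) <= ennreal ((1/16) ^ k)"
 using P.nn_integral_snd[of "%p. nsq (?H k (fst p) (snd p) - f0 (fst p) (snd p))"] nm(2)[of k] by (simp add: case_prod_beta')
 qed
 then have lim: "AE p in lborel \<Otimes>\<^sub>M M. (%k. ?H k (fst p) (snd p)) ~~> f0 (fst p) (snd p)"
 proof eventually_elim
 case (elim p)
 then show ?case by (rule tendsto_of_suminf_finite[where f="%k. ?H k (fst p) (snd p)"])
 qed
 define g where "g r y = lim (%k. ?H k r y)" for r y
 have "AEP M t0 T (%p. g (fst p) (snd p) = f (fst p) (snd p))"
 using lim by eventually_elim (auto simp: g_def f0_def dest: limI)
 moreover have "prog_measurable F t0 T g"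
 unfolding prog_measurable_def g_def
 proof (rule ballI, rule borel_measurable_lim_metric)
 fix q k assume q: "q : {t0<..<T}"
 have q0: "0 <= q" using q t by auto
 let ?R = "restrict_space borel {t0<..q} \<Otimes>\<^sub>M F q"
 show "(%p. ?H k (fst p) (snd p)) : BM ?R"
 unfolding block_average_def
 proof (rule borel_measurable_sum)
 fix i assume i: "i : {..<n k}"
 show "(%p. indr {grid t0 T (n k) i<..grid t0 T (n k) (Suc i)} (fst p) *\<^sub>R past_average t0 T (n k) (truncation (m k) (%r. f0 r (snd p))) i) : BM ?R"
 proof (cases "grid t0 T (n k) i <= q")
 case True
 have "(%y. past_average t0 T (n k) (truncation (m k) (%r. f0 r y)) i) : BM (F (grid t0 T (n k) i))" "0 <= grid t0 T (n k) i"
 using past_average_elementary_data[OF t nm(1) f0 z ad0, of k "m k"] i by (auto simp: elementary_data_def)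
 then have "(%y. past_average t0 T (n k) (truncation (m k) (%r. f0 r y)) i) : BM (F q)"
 using measurable_filt_mono[OF _ True] by blast
 moreover have "fst : measurable ?R borel"
 by (rule mcomp[OF measurable_fst]) (simp add: measurable_restrict_space1)
 ultimately show ?thesis
 by (intro borel_measurable_scaleR mcomp[OF measurable_snd]
 mcomp[of fst _ borel "indr _"]) auto
 next
 case False
 show ?thesis
 proof (subst measurable_cong)
 fix p assume "p : space ?R"
 then have "fst p : {t0<..q}" by (auto simp: sp_pair space_restrict_space)
 then show "indr {grid t0 T (n k) i<..grid t0 T (n k) (Suc i)} (fst p) *\<^sub>R past_average t0 T (n k) (truncation (m k) (%r. f0 r (snd p))) i = 0"
 using False by (auto simp: ind_def)
 qed simp
 qed
 qed
 qed
 ultimately show ?thesis by blast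
qed

text \<open>Freezing the path at time \<open>q\<close> makes it \<open>F q\<close>-measurable at
  every time, so that \<open>caratheodory_measurable\<close> can be used with \<open>F q\<close> in
  place of \<open>M\<close>.\<close>

lemma progressive_of_continuous:
 fixes xx :: "real => 'a => 'b::euclidean_space"
 assumes t: "0 <= t0" "b <= T" and ad: "\<And>t. t : {t0..T} ==> xx t : BM (F t)"
 and c: "\<And>z. z : space M ==> continuous_on {t0..T} (%t. xx t z)"
 shows "prog_measurable F t0 b xx"
 unfolding prog_measurable_def
proof
 fix q assume q: "q : {t0<..<b}"
 let ?g = "%r. xx (max t0 (min q r))"
 let ?R = "restrict_space borel {t0<..q} \<Otimes>\<^sub>M F q"
 have q0: "0 <= q" using q t by auto
 have g: "(%p. ?g (fst p) (snd p)) : BM (borel \<Otimes>\<^sub>M F q)"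
 proof (rule caratheodory_measurable)
 fix r
 have r: "max t0 (min q r) : {t0..T}" "0 <= max t0 (min q r)" "max t0 (min q r) <= q" using q t by auto
 show "?g r : BM (F q)" by (rule measurable_filt_mono[OF r(2,3) ad[OF r(1)]])
 next
 fix z assume "z : space (F q)"
 then show "continuous_on UNIV (%r. ?g r z)"
 using q t q0 by (intro continuous_on_compose2[OF c]) (auto intro!: continuous_intros)
 qed
 have "(%p. (fst p, snd p)) : measurable ?R (borel \<Otimes>\<^sub>M F q)"
 by (intro measurable_Pair measurable_snd mcomp[OF measurable_fst]) (simp add: measurable_restrict_space1)
 from mcomp[OF this g] have "(%p. ?g (fst p) (snd p)) : BM ?R" by simp
 then show "(%p. xx (fst p) (snd p)) : BM ?R"
 proof (rule measurable_cong[THEN iffD1, rotated])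
 fix p assume "p : space ?R"
 then have "fst p : {t0<..q}" by (auto simp: sp_pair space_restrict_space)
 then show "?g (fst p) (snd p) = xx (fst p) (snd p)" by (cases "fst p = q") (auto simp: max_def min_def)
 qed
qed

end

context continuous_brownian_basis
begin

text \<open>The parameter \<open>s\<close> joins omega in one product space, and the indices
  \<open>n k\<close>, \<open>m k\<close> are chosen once, with mean error \<open>(1/16) ^ k\<close>
  over that space. For almost every \<open>s\<close> the errors are then summable with weights
  \<open>4 ^ k\<close>, so \<open>ito_limit_properties\<close> applies, while the explicit form of
  the limit gives measurability in all variables.\<close>

theorem stochastic_integral_field:
 fixes h :: "'s => real => 'a => 'b::euclidean_space"
 assumes N: "finite_measure N" and t: "0 <= t0" "t0 < T"
 and h[measurable]: "(%p. h (fst p) (fst (snd p)) (snd (snd p))) : BM (N \<Otimes>\<^sub>M (tprod M))"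
 and z: "\<And>s r y. r ~: {t0<..<T} ==> h s r y = 0"
 and ad: "AE s in N. AEI t0 T (%r. h s r : BM (F r))"
 and fin: "(NN N (%s. NN M (%y. NN lborel (%r. nsq (h s r y))))) < \<infinity>"
 shows "EX J S. (%p. J (fst p) (fst (snd p)) (snd (snd p))) : BM (N \<Otimes>\<^sub>M (tprod M)) &
 (%p. S (fst p) (snd p)) : BM (N \<Otimes>\<^sub>M M) &
 (NN N (%s. NN M (S s))) <= 16 * (NN N (%s. NN M (%y. NN lborel (%r. nsq (h s r y))))) &
 (AE s in N. (AE y in M. continuous_on {t0..T} (%t. J s t y)) &
 (AE y in M. ALL t:{t0..T}. nsq (J s t y) <= S s y) &
 (ALL t:{t0<..T}. has_ito_integral M W F t0 t (h s) (J s t)) &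
 (ALL t:{t0..T}. J s t : BM (F t)))"
proof -
 interpret N: finite_measure N by fact
 interpret NM: pair_sigma_finite N M ..
 have Z: "finite_measure (N \<Otimes>\<^sub>M M)"
 proof (rule finite_measureI)
 have "emeasure (N \<Otimes>\<^sub>M M) (space N \<times> space M) = emeasure N (space N) * emeasure M (space M)"
 by (rule emeasure_pair_measure_Times) auto
 then show "emeasure (N \<Otimes>\<^sub>M M) (space (N \<Otimes>\<^sub>M M)) ~= \<infinity>"
 using N.emeasure_finite emeasure_finite by (auto simp: sp_pair ennreal_mult_eq_top_iff)
 qed
 let ?f = "%z r. h (fst z) r (snd z)"
 have "(%p. (fst (fst p), (snd p, snd (fst p)))) : measurable ((N \<Otimes>\<^sub>M M) \<Otimes>\<^sub>M lborel) (N \<Otimes>\<^sub>M (tprod M))"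
 by measurable
 from mcomp[OF this h]
 have f[measurable]: "(%p. ?f (fst p) (snd p)) : BM ((N \<Otimes>\<^sub>M M) \<Otimes>\<^sub>M lborel)" by simp
 have iter: "(NN (N \<Otimes>\<^sub>M M) (%z. nn2 lborel (g z))) = (NN N (%s. NN M (%y. NN lborel (%r. nsq (g (s, y) r)))))"
 if [measurable]: "(%p. g (fst p) (snd p)) : BM ((N \<Otimes>\<^sub>M M) \<Otimes>\<^sub>M lborel)" for g :: "'s \<times> 'a => real => 'b"
 proof -
 have "(%p. nsq (g (fst p) (snd p))) : BM ((N \<Otimes>\<^sub>M M) \<Otimes>\<^sub>M lborel)" by measurable
 from lb_nn_fst[OF this] nn_integral_fst[of "%z. nn2 lborel (g z)" N]
 show ?thesis by simp
 qed
 have finZ: "(NN (N \<Otimes>\<^sub>M M) (%z. nn2 lborel (?f z))) < \<infinity>"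
 unfolding iter[OF f] using fin by simp
 have z': "\<And>z r. r ~: {t0<..<T} ==> ?f z r = 0" using z by simp
 define P where "P k n m \<longleftrightarrow> 0 < n & (NN (N \<Otimes>\<^sub>M M) (%z. NN lborel (%r. nsq (block_average t0 T n (truncation m (?f z)) r - ?f z r)))) <= ennreal ((1/16) ^ k)" for k n m
 have "EX n m. P k n m" for k
 unfolding P_def using simple_approximation[where f="?f", OF Z f t(2) z' finZ] by simp
 then obtain n m where "\<And>k. P k (n k) (m k)" by metis
 then have nm: "\<And>k. 0 < n k"
 "\<And>k. (NN (N \<Otimes>\<^sub>M M) (%z. NN lborel (%r. nsq (block_average t0 T (n k) (truncation (m k) (?f z)) r - ?f z r)))) <= ennreal ((1/16) ^ k)"
 by (simp_all add: P_def)
 have tm: "(%p. truncation (m k) (?f (fst p)) (snd p)) : BM ((N \<Otimes>\<^sub>M M) \<Otimes>\<^sub>M lborel)" for k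
 unfolding truncation_def by measurable
 have Hm[measurable]: "(%p. block_average t0 T (n k) (truncation (m k) (?f (fst p))) (snd p)) : BM ((N \<Otimes>\<^sub>M M) \<Otimes>\<^sub>M lborel)" for k
 by (rule block_average_measurable[OF tm])
 have pam: "(%z. past_average t0 T (n k) (truncation (m k) (?f z)) i) : BM (N \<Otimes>\<^sub>M M)" for k i
 by (rule past_average_measurable[OF tm])
 let ?e = "%k s. NN M (%y. NN lborel (%r. nsq (block_average t0 T (n k) (truncation (m k) (%r. h s r y)) r - h s r y)))"
 have dm: "(%p. block_average t0 T (n k) (truncation (m k) (?f (fst p))) (snd p) - ?f (fst p) (snd p)) : BM ((N \<Otimes>\<^sub>M M) \<Otimes>\<^sub>M lborel)" for k
 by measurable
 have sm: "AE s in N. (\<Sum>k. 4 ^ k * ?e k s) < \<infinity>"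
 proof (rule nn_integral_suminf_finite_AE)
 fix k
 show "(NN N (%s. ?e k s)) <= ennreal ((1/16) ^ k)"
 using nm(2)[of k] iter[OF dm[of k]] by simp
 have "(%p. nsq (block_average t0 T (n k) (truncation (m k) (?f (fst p))) (snd p) - ?f (fst p) (snd p))) : BM ((N \<Otimes>\<^sub>M M) \<Otimes>\<^sub>M lborel)"
 by measurable
 from borel_measurable_nn_integral_fst[OF lb_nn_fst[OF this]]
 show "?e k : BM N" by simp
 qed
 define J where "J s = ito_limit t0 T n m (h s)" for s
 define S where "S s y = liminf (%k. SUP q\<in>{t0..T} \<inter> \<rat>. nsq (block_ito t0 T (n k) (m k) (h s) q y))" for s y
 have hs: "(%p. h s (fst p) (snd p)) : BM (tprod M)" if "s : space N" for s
 using mcomp[OF measurable_Pair1'[OF that, of "lborel \<Otimes>\<^sub>M M"] h] by simp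
 have main: "AE s in N. (AE y in M. continuous_on {t0..T} (%t. J s t y)) &
 (AE y in M. ALL t:{t0..T}. nsq (J s t y) <= S s y) &
 (ALL t:{t0<..T}. has_ito_integral M W F t0 t (h s) (J s t)) &
 (ALL t:{t0..T}. J s t : BM (F t)) &
 (NN M (S s)) <= 16 * (NN M (%y. NN lborel (%r. nsq (h s r y))))"
 using sm ad AE_space
 proof eventually_elim
 case (elim s)
 show ?case
 using ito_limit_properties[OF t nm(1) hs[OF elim(3)] z elim(2) elim(1)] unfolding J_def S_def by blast
 qed
 have Wm: "(%p. W (max 0 (fst p)) (snd p)) : BM (borel \<Otimes>\<^sub>M M)"
 proof (rule caratheodory_measurable)
 show "W (max 0 t) : BM M" for t by (rule W_measurable) simp
 show "continuous_on UNIV (%t. W (max 0 t) y)" if "y : space M" for y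
 by (intro continuous_on_compose2[OF W_continuous[OF that]] continuous_intros) auto
 qed
 have bim: "(%p. block_ito t0 T (n k) (m k) (h (fst p)) (max t0 (fst (snd p))) (snd (snd p))) : BM (N \<Otimes>\<^sub>M (tprod M))" for k
 unfolding block_ito_def elementary_integral_def
 proof (intro borel_measurable_sum borel_measurable_scaleR borel_measurable_diff)
 fix i :: nat
 have W1: "(%p. W (min c (max t0 (fst (snd p)))) (snd (snd p))) : BM (N \<Otimes>\<^sub>M (tprod M))" if "t0 <= c" for c
 proof -
 have "(%p::'s \<times> real \<times> 'a. (min c (max t0 (fst (snd p))), snd (snd p))) : measurable (N \<Otimes>\<^sub>M (tprod M)) (borel \<Otimes>\<^sub>M M)" by measurable
 from mcomp[OF this Wm] show ?thesis using that t by (simp add: max_absorb2)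
 qed
 show "(%p. W (min (grid t0 T (n k) (Suc i)) (max t0 (fst (snd p)))) (snd (snd p))) : BM (N \<Otimes>\<^sub>M (tprod M))"
 "(%p. W (min (grid t0 T (n k) i) (max t0 (fst (snd p)))) (snd (snd p))) : BM (N \<Otimes>\<^sub>M (tprod M))"
 using grid_mono[of t0 T 0 i "n k"] grid_mono[of t0 T 0 "Suc i" "n k"] t by (auto intro!: W1)
 have "(%p::'s \<times> real \<times> 'a. (fst p, snd (snd p))) : measurable (N \<Otimes>\<^sub>M (tprod M)) (N \<Otimes>\<^sub>M M)" by measurable
 from mcomp[OF this pam[of k i]]
 show "(%p::'s \<times> real \<times> 'a. past_average t0 T (n k) (truncation (m k) (%r. h (fst p) r (snd (snd p)))) i) : BM (N \<Otimes>\<^sub>M (tprod M))" by simp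
 qed
 have Jm: "(%p. J (fst p) (fst (snd p)) (snd (snd p))) : BM (N \<Otimes>\<^sub>M (tprod M))"
 unfolding J_def ito_limit_def by (rule borel_measurable_lim_metric[OF bim])
 have Sm: "(%p. S (fst p) (snd p)) : BM (N \<Otimes>\<^sub>M M)"
 unfolding S_def
 proof (intro borel_measurable_liminf borel_measurable_SUP)
 fix k q assume q: "q : {t0..T} \<inter> \<rat>"
 have "(%p::'s \<times> 'a. (fst p, (q, snd p))) : measurable (N \<Otimes>\<^sub>M M) (N \<Otimes>\<^sub>M (tprod M))" by measurable
 from mcomp[OF this bim[of k]] q
 have [measurable]: "(%p. block_ito t0 T (n k) (m k) (h (fst p)) q (snd p)) : BM (N \<Otimes>\<^sub>M M)" by (simp add: max_absorb2)
 show "(%p. nsq (block_ito t0 T (n k) (m k) (h (fst p)) q (snd p))) : BM (N \<Otimes>\<^sub>M M)" by measurable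
 qed (use countable_rat in auto)
 have "(NN N (%s. NN M (S s))) <= (NN N (%s. 16 * (NN M (%y. NN lborel (%r. nsq (h s r y))))))"
 by (rule nn_mono_AE) (use main in eventually_elim, blast)
 also have "... = 16 * (NN N (%s. NN M (%y. NN lborel (%r. nsq (h s r y)))))"
 proof (rule nn_cmult)
 have "(%p. nsq (?f (fst p) (snd p))) : BM ((N \<Otimes>\<^sub>M M) \<Otimes>\<^sub>M lborel)" by measurable
 from borel_measurable_nn_integral_fst[OF lb_nn_fst[OF this]]
 show "(%s. NN M (%y. NN lborel (%r. nsq (h s r y)))) : BM N" by simp
 qed
 finally show ?thesis using Jm Sm main by (intro exI[of _ J] exI[of _ S]) (auto elim!: eventually_mono)
qed

end

section \<open>Weights for Volterra kernels\<close>

lemma ennreal_mult_add_mult: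
 "0 <= a ==> 0 <= b ==> 0 <= c ==> 0 <= d ==> ennreal a * ennreal b + ennreal c * ennreal d = ennreal (a * b + c * d)"
 by (simp add: ennreal_mult ennreal_plus)

text \<open>The bounds \<open>dl\<close> and 1 make the weighted norm equivalent to the plain one.
  Monotonicity allows the weights of two kernels to be multiplied, see
  \<open>volterra_small_add\<close>.\<close>

definition volterra_weight :: "real => (real => real => ennreal) => real => (real => real) => bool" where
 "volterra_weight T k eta w \<longleftrightarrow> w : BM borel & antimono w & (\<exists>dl>0. ALL t. dl <= w t) & (ALL t. w t <= 1) &
 (AEI 0 T (%r. (NI {r<..<T} (%t. ennreal (w t) * k t r)) <= ennreal (eta * w r)))"

definition volterra_small :: "real => (real => real => ennreal) => bool" where
 "volterra_small T k \<longleftrightarrow> joint lborel k &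
 (\<forall>eta>0. EX w. volterra_weight T k eta w)"

lemma kernel_section_measurable:
 assumes "(%p. k (fst p) (snd p)) : BM (lborel \<Otimes>\<^sub>M (lborel :: real measure))"
 shows "(%t. k t r) : BM (lborel :: real measure)"
 using mcomp[OF measurable_Pair2'[of r lborel lborel] assms] by simp

text \<open>The weight drops by the factor \<open>kp\<close> at each node. From \<open>r\<close>,
  the kernel mass within the current block is at most \<open>eta / 2\<close> by the fineness of the
  partition; the remaining mass is at most \<open>B\<close>, but is seen with a weight smaller by
  \<open>kp\<close>.\<close>

lemma volterra_small_partition:
 fixes k :: "real => real => ennreal"
 assumes k: "joint lborel k"
 and B: "AEI 0 T (%r. (NI {r<..<T} (%t. k t r)) <= ennreal B)"
 and part: "\<And>ep. 0 < ep ==> EX m U. U 0 = 0 & U m = T & (\<forall>i<m. U i < U (Suc i)) &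
 (\<forall>i<m. AE r in lborel. r : {U i<..<U (Suc i)} --> (NI {r<..<U (Suc i)} (%t. k t r)) <= ennreal ep)"
 shows "volterra_small T k"
 unfolding volterra_small_def
proof (intro conjI allI impI k)
 fix eta :: real assume eta: "0 < eta"
 from part[of "eta / 2"] eta obtain m :: nat and U where U: "U 0 = 0" "U m = T" "\<forall>i<m. U i < U (Suc i)"
 "\<forall>i<m. AE r in lborel. r : {U i<..<U (Suc i)} --> (NI {r<..<U (Suc i)} (%t. k t r)) <= ennreal (eta / 2)"
 by auto
 \<comment> \<open>\<open>kp * B'\<close> is at most \<open>eta / 2\<close>; the maximum with 1
   keeps the denominator of \<open>kp\<close> positive.\<close>
 define B' where "B' = max 1 B"
 define kp where "kp = min 1 (eta / (2 * B'))"
 have B': "0 < B'" "B <= B'" by (auto simp: B'_def)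
 have kp: "0 < kp" "kp <= 1" "kp * B' <= eta / 2" using eta B' by (auto simp: kp_def min_def field_simps)
 define w where "w t = (\<Prod>j<m. if U (Suc j) <= t then kp else 1)" for t
 have wm[measurable]: "w : BM borel" unfolding w_def by measurable
 have w0: "0 < w t" for t unfolding w_def by (rule prod_pos) (use kp in auto)
 have w1: "w t <= 1" for t unfolding w_def by (rule prod_le_1) (use kp in auto)
 have wd: "kp ^ m <= w t" for t
 proof -
 have "(\<Prod>j<m. kp) <= w t" unfolding w_def by (rule prod_mono) (use kp in auto)
 then show ?thesis by simp
 qed
 have anti: "antimono w"
 proof (rule antimonoI)
 fix s t :: real assume "s <= t"
 then show "w t <= w s" unfolding w_def by (intro prod_mono) (use kp in auto)
 qed
 \<comment> \<open>Between \<open>r\<close> and \<open>t\<close> lies the node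
   \<open>U (Suc i)\<close>, whose factor is \<open>kp\<close> at \<open>t\<close> and 1 at
   \<open>r\<close>; all other factors can only decrease.\<close>
 have jump: "w t <= kp * w r" if i: "i < m" and rt: "r < U (Suc i)" "U (Suc i) <= t" for i r t
 proof -
 have fi: "finite {..<m}" "i : {..<m}" using i by auto
 have "w t = (if U (Suc i) <= t then kp else 1) * (\<Prod>j\<in>{..<m} - {i}. if U (Suc j) <= t then kp else 1)"
 unfolding w_def by (rule prod.remove[OF fi])
 also have "... <= kp * (\<Prod>j\<in>{..<m} - {i}. if U (Suc j) <= r then kp else 1)"
 using kp rt by (auto intro!: ml_mono prod_mono)
 also have "(\<Prod>j\<in>{..<m} - {i}. if U (Suc j) <= r then kp else 1) = w r"
 unfolding w_def by (subst prod.remove[OF fi]) (use rt in auto)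
 finally show ?thesis .
 qed
 have main: "AE r in lborel. \<forall>i<m. r : {U i<..<U (Suc i)} --> r : {0<..<T} -->
 (NI {r<..<T} (%t. ennreal (w t) * k t r)) <= ennreal (eta * w r)"
 proof (subst AE_all_countable, intro allI, rule AE_impI)
 fix i assume i: "i < m"
 show "AE r in lborel. r : {U i<..<U (Suc i)} --> r : {0<..<T} -->
 (NI {r<..<T} (%t. ennreal (w t) * k t r)) <= ennreal (eta * w r)"
 using U(4)[rule_format, OF i] B
 proof (eventually_elim, intro impI)
 fix r assume h: "r : {U i<..<U (Suc i)} --> (NI {r<..<U (Suc i)} (%t. k t r)) <= ennreal (eta / 2)"
 "r : {0<..<T} --> (NI {r<..<T} (%t. k t r)) <= ennreal B" "r : {U i<..<U (Suc i)}" "r : {0<..<T}"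
 have km[measurable]: "(%t. k t r) : BM borel" using kernel_section_measurable[OF k, of r] by simp
 have "(NI {r<..<T} (%t. ennreal (w t) * k t r)) <=
 (NN lborel (%t. ennreal (w r) * (k t r * indicator {r<..<U (Suc i)} t) + ennreal (kp * w r) * (k t r * indicator {r<..<T} t)))"
 proof (rule nn_mono)
 fix t
 show "ennreal (w t) * k t r * indicator {r<..<T} t <=
 ennreal (w r) * (k t r * indicator {r<..<U (Suc i)} t) + ennreal (kp * w r) * (k t r * indicator {r<..<T} t)"
 proof (cases "r < t & t < T")
 case rtT: True
 show ?thesis
 proof (cases "t < U (Suc i)")
 case True
 have "ennreal (w t) * k t r <= ennreal (w r) * k t r"
 using antimonoD[OF anti, of r t] rtT by (intro mr_mono ennreal_leI) auto
 then show ?thesis using True rtT by (auto intro: order_trans add_increasing2)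
 next
 case False
 have "ennreal (w t) * k t r <= ennreal (kp * w r) * k t r"
 using jump[OF i, of r t] False h(3) by (intro mr_mono ennreal_leI) auto
 then show ?thesis using False rtT by (auto intro: order_trans)
 qed
 qed auto
 qed
 also have "... = ennreal (w r) * (NI {r<..<U (Suc i)} (%t. k t r)) + ennreal (kp * w r) * (NI {r<..<T} (%t. k t r))"
 by (simp add: nn_add nn_cmult)
 also have "... <= ennreal (w r) * ennreal (eta / 2) + ennreal (kp * w r) * ennreal B'"
 using h B'(2) by (intro add_mono ml_mono) (auto intro: order_trans ennreal_leI)
 also have "... = ennreal (w r * (eta / 2) + kp * w r * B')"
 using w0[of r] eta kp B' by (intro ennreal_mult_add_mult) (auto intro: less_imp_le mult_nonneg_nonneg)
 also have "... <= ennreal (eta * w r)"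
 proof (rule ennreal_leI)
 have "w r * (kp * B') <= w r * (eta / 2)" using w0[of r] kp(3) by (intro ml_mono) auto
 then show "w r * (eta / 2) + kp * w r * B' <= eta * w r" by (simp add: algebra_simps)
 qed
 finally show "(NI {r<..<T} (%t. ennreal (w t) * k t r)) <= ennreal (eta * w r)" .
 qed
 qed
 have nodes: "AE r in lborel. ALL i:{..m}. r ~= U i"
 by (rule AE_finite_allI) (auto intro: AE_lborel_singleton)
 have cover: "\<exists>i<m. U i < r & r < U (Suc i)" if r: "r : {0<..<T}" "ALL i:{..m}. r ~= U i" for r
 proof -
 define i where "i = (LEAST j. r < U j)"
 have ex: "r < U m" using r U by simp
 have 1: "r < U i" unfolding i_def by (rule LeastI[of _ m]) (rule ex)
 have 2: "i <= m" unfolding i_def by (rule Least_le) (rule ex)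
 have "i ~= 0" using 1 r U(1) by (intro notI) auto
 then obtain j where j: "i = Suc j" by (cases i) auto
 have "\<not> r < U j" using not_less_Least[of j "%j. r < U j"] j unfolding i_def by simp
 moreover have "r ~= U j" using r(2) 2 j by auto
 ultimately show ?thesis using 1 2 j by (intro exI[of _ j]) auto
 qed
 have "AEI 0 T (%r. (NI {r<..<T} (%t. ennreal (w t) * k t r)) <= ennreal (eta * w r))"
 using main nodes
 proof (eventually_elim, intro impI)
 fix r assume h: "\<forall>i<m. r : {U i<..<U (Suc i)} --> r : {0<..<T} --> (NI {r<..<T} (%t. ennreal (w t) * k t r)) <= ennreal (eta * w r)"
 "ALL i:{..m}. r ~= U i" "r : {0<..<T}"
 from cover[OF h(3,2)] h(1,3) show "(NI {r<..<T} (%t. ennreal (w t) * k t r)) <= ennreal (eta * w r)" by auto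
 qed
 then show "EX w. volterra_weight T k eta w"
 unfolding volterra_weight_def using wm anti w1 wd kp(1) by (intro exI[of _ w] conjI) (auto intro!: exI[of _ "kp ^ m"])
qed

text \<open>The product of the two weights serves the sum: for \<open>t > r\<close> one factor at
  \<open>t\<close> is at most its value at \<open>r\<close> and leaves the integral, and the other
  handles its own kernel with \<open>eta / 2\<close>.\<close>

lemma volterra_small_add:
 assumes k: "volterra_small T k" and l: "volterra_small T l"
 shows "volterra_small T (%t r. k t r + l t r)"
 unfolding volterra_small_def
proof (intro conjI allI impI)
 have km: "joint lborel k" and lm: "joint lborel l"
 using k l by (auto simp: volterra_small_def)
 then show "(%p. k (fst p) (snd p) + l (fst p) (snd p)) : BM (tprod lborel)" by measurable
 fix eta :: real assume eta: "0 < eta"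
 then have "EX w. volterra_weight T k (eta / 2) w" "EX w. volterra_weight T l (eta / 2) w"
 using k l unfolding volterra_small_def by auto
 then obtain v w where v: "volterra_weight T k (eta / 2) v" and w: "volterra_weight T l (eta / 2) w" by blast
 obtain dl dl' where d: "0 < dl" "\<And>t. dl <= v t" "0 < dl'" "\<And>t. dl' <= w t"
 using v w unfolding volterra_weight_def by blast
 have v0: "0 < v t" and w0: "0 < w t" for t using d by (auto intro: less_le_trans)
 have v1: "v t <= 1" and w1: "w t <= 1" for t using v w by (auto simp: volterra_weight_def)
 have va: "antimono v" and wa: "antimono w" using v w by (auto simp: volterra_weight_def)
 have [measurable]: "v : BM borel" "w : BM borel" using v w by (auto simp: volterra_weight_def)
 show "EX w. volterra_weight T (%t r. k t r + l t r) eta w"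
 proof (intro exI[of _ "%t. v t * w t"], unfold volterra_weight_def, intro conjI allI)
 show "(%t. v t * w t) : BM borel" by measurable
 show "antimono (%t. v t * w t)"
 by (rule antimonoI, rule mult_mono) (use va wa v0 w0 in \<open>auto simp: antimono_def intro: less_imp_le\<close>)
 show "\<exists>dl>0. ALL t. dl <= v t * w t"
 using d by (intro exI[of _ "dl * dl'"]) (auto intro!: mult_mono less_imp_le[OF v0])
 show "v t * w t <= 1" for t using v1[of t] w1[of t] v0[of t] w0[of t] by (intro mult_le_one) auto
 have "AEI 0 T (%r. (NI {r<..<T} (%t. ennreal (v t) * k t r)) <= ennreal (eta / 2 * v r))"
 "AEI 0 T (%r. (NI {r<..<T} (%t. ennreal (w t) * l t r)) <= ennreal (eta / 2 * w r))"
 using v w by (auto simp: volterra_weight_def)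
 then show "AE r in lborel. r : {0<..<T} -->
 (NI {r<..<T} (%t. ennreal (v t * w t) * (k t r + l t r))) <= ennreal (eta * (v r * w r))"
 proof (eventually_elim, intro impI)
 fix r assume h: "r : {0<..<T} --> (NI {r<..<T} (%t. ennreal (v t) * k t r)) <= ennreal (eta / 2 * v r)"
 "r : {0<..<T} --> (NI {r<..<T} (%t. ennreal (w t) * l t r)) <= ennreal (eta / 2 * w r)" "r : {0<..<T}"
 have [measurable]: "(%t. k t r) : BM borel" "(%t. l t r) : BM borel"
 using kernel_section_measurable[OF km, of r] kernel_section_measurable[OF lm, of r] by simp_all
 have "(NI {r<..<T} (%t. ennreal (v t * w t) * (k t r + l t r))) <=
 (NN lborel (%t. ennreal (w r) * (ennreal (v t) * k t r * indicator {r<..<T} t) + ennreal (v r) * (ennreal (w t) * l t r * indicator {r<..<T} t)))"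
 proof (rule nn_mono)
 fix t
 show "ennreal (v t * w t) * (k t r + l t r) * indicator {r<..<T} t <=
 ennreal (w r) * (ennreal (v t) * k t r * indicator {r<..<T} t) + ennreal (v r) * (ennreal (w t) * l t r * indicator {r<..<T} t)"
 proof (cases "r < t & t < T")
 case True
 have "v t <= v r" "w t <= w r" using True va wa by (auto simp: antimono_def)
 then have "ennreal (v t * w t) <= ennreal (w r) * ennreal (v t)" "ennreal (v t * w t) <= ennreal (v r) * ennreal (w t)"
 using v0[of t] w0[of t] v0[of r] w0[of r] by (auto simp: ennreal_mult[symmetric] mult.commute intro!: ennreal_leI mult_mono)
 then have "ennreal (v t * w t) * (k t r + l t r) <= ennreal (w r) * ennreal (v t) * k t r + ennreal (v r) * ennreal (w t) * l t r"
 unfolding distrib_left by (intro add_mono mr_mono) auto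
 then show ?thesis using True by (simp add: mult.assoc)
 qed auto
 qed
 also have "... = ennreal (w r) * (NI {r<..<T} (%t. ennreal (v t) * k t r)) + ennreal (v r) * (NI {r<..<T} (%t. ennreal (w t) * l t r))"
 by (simp add: nn_add nn_cmult)
 also have "... <= ennreal (w r) * ennreal (eta / 2 * v r) + ennreal (v r) * ennreal (eta / 2 * w r)"
 using h by (intro add_mono ml_mono) auto
 also have "... = ennreal (w r * (eta / 2 * v r) + v r * (eta / 2 * w r))"
 using eta v0[of r] w0[of r] by (intro ennreal_mult_add_mult) auto
 also have "w r * (eta / 2 * v r) + v r * (eta / 2 * w r) = eta * (v r * w r)" by (simp add: algebra_simps)
 finally show "(NI {r<..<T} (%t. ennreal (v t * w t) * (k t r + l t r))) <= ennreal (eta * (v r * w r))" .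
 qed
 qed
qed

lemma volterra_small_cmult:
 assumes k: "volterra_small T k" and c: "0 <= (c::real)"
 shows "volterra_small T (%t r. ennreal c * k t r)"
 unfolding volterra_small_def
proof (intro conjI allI impI)
 have km: "joint lborel k"
 using k by (auto simp: volterra_small_def)
 then show "(%p. ennreal c * k (fst p) (snd p)) : BM (tprod lborel)" by measurable
 fix eta :: real assume eta: "0 < eta"
 \<comment> \<open>Dividing by \<open>c + 1\<close> rather than \<open>c\<close> covers
   \<open>c = 0\<close>.\<close>
 then obtain w where w: "volterra_weight T k (eta / (c + 1)) w" using k c unfolding volterra_small_def by fastforce
 then have wm[measurable]: "w : BM borel" by (auto simp: volterra_weight_def)
 have w0: "0 <= w t" for t using w unfolding volterra_weight_def by (meson less_le_trans less_imp_le)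
 have "AEI 0 T (%r. (NI {r<..<T} (%t. ennreal (w t) * k t r)) <= ennreal (eta / (c + 1) * w r))"
 using w by (auto simp: volterra_weight_def)
 then have "AEI 0 T (%r. (NI {r<..<T} (%t. ennreal (w t) * (ennreal c * k t r))) <= ennreal (eta * w r))"
 proof (eventually_elim, intro impI)
 fix r assume h: "r : {0<..<T} --> (NI {r<..<T} (%t. ennreal (w t) * k t r)) <= ennreal (eta / (c + 1) * w r)" "r : {0<..<T}"
 have [measurable]: "(%t. k t r) : BM borel" using kernel_section_measurable[OF km, of r] by simp
 have "(NI {r<..<T} (%t. ennreal (w t) * (ennreal c * k t r))) = (NN lborel (%t. ennreal c * (ennreal (w t) * k t r * indicator {r<..<T} t)))"
 by (intro nn_cong) (simp add: ac_simps)
 also have "... = ennreal c * (NI {r<..<T} (%t. ennreal (w t) * k t r))" by (rule nn_cmult) measurable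
 also have "... <= ennreal c * ennreal (eta / (c + 1) * w r)" using h by (intro ml_mono) auto
 also have "... = ennreal ((c / (c + 1)) * (eta * w r))" using c eta w0[of r] by (simp add: ennreal_mult'[symmetric])
 also have "... <= ennreal (eta * w r)"
 using c eta w0[of r] by (intro ennreal_leI mult_left_le_one_le) auto
 finally show "(NI {r<..<T} (%t. ennreal (w t) * (ennreal c * k t r))) <= ennreal (eta * w r)" .
 qed
 then show "EX w. volterra_weight T (%t r. ennreal c * k t r) eta w" using w unfolding volterra_weight_def by blast
qed

lemma volterra_small_const:
 assumes T: "0 < T" shows "volterra_small T (%t r. 1)"
proof (rule volterra_small_partition[where B=T])
 show "AEI 0 T (%r. (NI {r<..<T} (%t. 1)) <= ennreal T)"
 by (intro AE_I2 impI) (auto intro!: ennreal_leI)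
 fix ep :: real assume e: "0 < ep"
 obtain n :: nat where n: "T / ep < real n" using reals_Archimedean2 by blast
 then have n0: "0 < n" using T e by (metis divide_pos_pos gr0I less_asym of_nat_0)
 have d: "T / real n <= ep" using n n0 e by (simp add: field_simps)
 have gs: "grid 0 T n (Suc i) = grid 0 T n i + T / real n" for i using grid_Suc[of 0 T n i] by simp
 show "EX m U. U 0 = 0 & U m = T & (\<forall>i<m. U i < U (Suc i)) &
 (\<forall>i<m. AE r in lborel. r : {U i<..<U (Suc i)} --> (NI {r<..<U (Suc i)} (%t. 1)) <= ennreal ep)"
 by (intro exI[of _ n] exI[of _ "grid 0 T n"] conjI allI impI AE_I2)
 (use n0 T d in \<open>auto simp: gs intro!: ennreal_leI\<close>)
qed auto

text \<open>Where \<open>g\<close> exceeds a large \<open>m\<close> its integral is at most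
  \<open>eta / 2\<close>; the rest is dominated by the constant kernel \<open>m\<close>. The weight
  of that constant kernel also serves the large part, because it is decreasing.\<close>

lemma volterra_small_integrable:
 fixes g :: "real => ennreal"
 assumes T: "0 < T" and g[measurable]: "g : BM borel" and fin: "(NI {0<..<T} g) < \<infinity>"
 shows "volterra_small T (%t r. g t)"
 unfolding volterra_small_def
proof (intro conjI allI impI)
 show "(%p. g (fst p)) : BM (tprod lborel)" by measurable
 fix eta :: real assume eta: "0 < eta"
 let ?g2 = "%m::nat. %t. g t * indicator {t. ennreal m < g t} t"
 have "(%m. NN lborel (%t. ?g2 m t * indicator {0<..<T} t)) ~~> (NN lborel (%t::real. 0))"
 proof (rule nn_integral_dominated_convergence[where w="%t. g t * indicator {0<..<T} t"])
 show "(NN lborel (%t. g t * indicator {0<..<T} t)) < \<infinity>" by (rule fin)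
 then have "AE t in lborel. g t * indicator {0<..<T} t ~= \<infinity>" by (intro nn_integral_PInf_AE) auto
 then show "AE t in lborel. (%m. ?g2 m t * indicator {0<..<T} t) ~~> 0"
 proof eventually_elim
 case (elim t)
 show ?case
 proof (cases "t : {0<..<T}")
 case True
 then have "g t < \<infinity>" using elim by (simp add: less_top)
 then obtain c where c: "g t = ennreal c" "0 <= c" by (cases "g t") auto
 obtain m0 :: nat where m0: "c <= real m0" using real_arch_simple by blast
 show ?thesis
 proof (rule tendsto_eventually, rule eventually_sequentiallyI[of m0])
 fix m assume "m0 <= m"
 then have "\<not> ennreal (real m) < g t" using m0 c by (simp add: not_less ennreal_leI)
 then show "?g2 m t * indicator {0<..<T} t = 0" by (simp add: ennreal_of_nat_eq_real_of_nat)
 qed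
 qed simp
 qed
 show "AE t in lborel. ?g2 m t * indicator {0<..<T} t <= g t * indicator {0<..<T} t" for m by (auto simp: ind_def)
 qed auto
 then have "\<forall>\<^sub>F m in sequentially. (NN lborel (%t. ?g2 m t * indicator {0<..<T} t)) < ennreal (eta / 2)"
 using eta by (intro order_tendstoD(2)) auto
 then obtain m where m: "(NN lborel (%t. ?g2 m t * indicator {0<..<T} t)) <= ennreal (eta / 2)"
 unfolding eventually_sequentially by (blast intro: less_imp_le)
 have "EX w. volterra_weight T (%t r. ennreal (real m) * 1) (eta / 2) w"
 using volterra_small_cmult[OF volterra_small_const[OF T], of "real m"] eta unfolding volterra_small_def by auto
 then obtain w where w: "volterra_weight T (%t r. ennreal (real m) * 1) (eta / 2) w" by blast
 then have wm[measurable]: "w : BM borel" by (auto simp: volterra_weight_def)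
 have w0: "0 <= w t" for t using w unfolding volterra_weight_def by (meson less_le_trans less_imp_le)
 have "AEI 0 T (%r. (NI {r<..<T} (%t. ennreal (w t) * (ennreal (real m) * 1))) <= ennreal (eta / 2 * w r))"
 using w unfolding volterra_weight_def by blast
 then have "AEI 0 T (%r. (NI {r<..<T} (%t. ennreal (w t) * g t)) <= ennreal (eta * w r))"
 proof (eventually_elim, intro impI)
 fix r assume h: "r : {0<..<T} --> (NI {r<..<T} (%t. ennreal (w t) * (ennreal (real m) * 1))) <= ennreal (eta / 2 * w r)" "r : {0<..<T}"
 have "(NI {r<..<T} (%t. ennreal (w t) * g t)) <=
 (NN lborel (%t. ennreal (w t) * (ennreal (real m) * 1) * indicator {r<..<T} t + ennreal (w r) * (?g2 m t * indicator {0<..<T} t)))"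
 proof (rule nn_mono)
 fix t
 show "ennreal (w t) * g t * indicator {r<..<T} t <= ennreal (w t) * (ennreal (real m) * 1) * indicator {r<..<T} t + ennreal (w r) * (?g2 m t * indicator {0<..<T} t)"
 proof (cases "r < t & t < T")
 case True
 show ?thesis
 proof (cases "ennreal (real m) < g t")
 case gt: True
 have "w t <= w r" using w True by (auto simp: volterra_weight_def antimono_def)
 then have "ennreal (w t) * g t <= ennreal (w r) * g t" by (intro mr_mono ennreal_leI) auto
 then show ?thesis using True gt h(2) by (auto simp: ennreal_of_nat_eq_real_of_nat intro: add_increasing)
 next
 case False
 then have "ennreal (w t) * g t <= ennreal (w t) * ennreal (real m)" by (intro ml_mono) (auto simp: not_less)
 then show ?thesis using True by (auto intro: add_increasing2)
 qed
 qed auto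
 qed
 also have "... = (NI {r<..<T} (%t. ennreal (w t) * (ennreal (real m) * 1))) + ennreal (w r) * (NN lborel (%t. ?g2 m t * indicator {0<..<T} t))"
 by (simp add: nn_add nn_cmult)
 also have "... <= ennreal (eta / 2 * w r) + ennreal (w r) * ennreal (eta / 2)"
 using h m by (intro add_mono ml_mono) auto
 also have "... = ennreal (eta / 2 * w r + w r * (eta / 2))"
 using ennreal_mult_add_mult[of "eta / 2 * w r" 1 "w r" "eta / 2"] w0[of r] eta by simp
 also have "eta / 2 * w r + w r * (eta / 2) = eta * w r" by (simp add: algebra_simps)
 finally show "(NI {r<..<T} (%t. ennreal (w t) * g t)) <= ennreal (eta * w r)" .
 qed
 then show "EX w. volterra_weight T (%t r. g t) eta w" using w unfolding volterra_weight_def by blast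
qed

text \<open>Multiply by the weight and exchange the integrals; the inner integral over
  \<open>t > r\<close> is exactly what \<open>volterra_weight\<close> bounds by
  \<open>eta * w r\<close>.\<close>

lemma volterra_weighted_estimate:
 fixes n n' d :: "real => ennreal"
 assumes w: "volterra_weight T k eta w" and t0: "0 <= t0" and eta: "0 < eta"
 and k[measurable]: "joint lborel k"
 and n[measurable]: "n : BM borel" and d[measurable]: "d : BM borel"
 and le: "AEI t0 T (%t. n' t <= d t + (NI {t0<..<t} (%r. k t r * n r)))"
 shows "(NI {t0<..<T} (%t. ennreal (w t) * n' t)) <=
 (NI {t0<..<T} (%t. ennreal (w t) * d t)) + ennreal eta * (NI {t0<..<T} (%t. ennreal (w t) * n t))"
proof -
 have wm[measurable]: "w : BM borel" using w by (auto simp: volterra_weight_def)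
 have w0: "0 <= w t" for t using w unfolding volterra_weight_def by (meson less_le_trans less_imp_le)
 let ?f = "%p::real \<times> real. ennreal (w (fst p)) * (k (fst p) (snd p) * n (snd p)) * indicator {p. t0 < snd p & snd p < fst p & fst p < T} p"
 have fm[measurable]: "?f : BM (tprod lborel)" by measurable
 have sec[measurable]: "(%r. k t r) : BM borel" for t
 using mcomp[OF measurable_Pair1'[of t lborel lborel] k] by simp
 have "(NI {t0<..<T} (%t. ennreal (w t) * n' t)) <=
 (NN lborel (%t. ennreal (w t) * d t * indicator {t0<..<T} t + (NN lborel (%r. ?f (t, r)))))"
 proof (rule nn_mono_AE, use le in eventually_elim)
 fix t assume h: "t : {t0<..<T} --> n' t <= d t + (NI {t0<..<t} (%r. k t r * n r))"
 show "ennreal (w t) * n' t * indicator {t0<..<T} t <= ennreal (w t) * d t * indicator {t0<..<T} t + (NN lborel (%r. ?f (t, r)))"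
 proof (cases "t : {t0<..<T}")
 case True
 have "ennreal (w t) * n' t <= ennreal (w t) * (d t + (NI {t0<..<t} (%r. k t r * n r)))"
 using h True by (intro ml_mono) auto
 also have "... = ennreal (w t) * d t + (NN lborel (%r. ennreal (w t) * (k t r * n r * indicator {t0<..<t} r)))"
 unfolding distrib_left by (subst nn_cmult) auto
 also have "(NN lborel (%r. ennreal (w t) * (k t r * n r * indicator {t0<..<t} r))) = (NN lborel (%r. ?f (t, r)))"
 using True by (intro nn_cong) (auto simp: ind_def)
 finally show ?thesis using True by simp
 qed simp
 qed
 also have "... = (NI {t0<..<T} (%t. ennreal (w t) * d t)) + (NN lborel (%t. NN lborel (%r. ?f (t, r))))"
 by (rule nn_add) (use lb_nn_fst[OF fm] in \<open>simp_all\<close>)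
 also have "(NN lborel (%t. NN lborel (%r. ?f (t, r)))) = (NN lborel (%r. NN lborel (%t. ?f (t, r))))"
 by (rule lborel_pair.Fubini'[symmetric]) (use fm in \<open>simp add: case_prod_beta'\<close>)
 also have "... <= (NN lborel (%r. ennreal eta * (ennreal (w r) * n r * indicator {t0<..<T} r)))"
 proof (rule nn_mono_AE)
 have "AEI 0 T (%r. (NI {r<..<T} (%t. ennreal (w t) * k t r)) <= ennreal (eta * w r))"
 using w by (auto simp: volterra_weight_def)
 then show "AE r in lborel. (NN lborel (%t. ?f (t, r))) <= ennreal eta * (ennreal (w r) * n r * indicator {t0<..<T} r)"
 proof eventually_elim
 case (elim r)
 have [measurable]: "(%t. k t r) : BM borel" using kernel_section_measurable[OF k, of r] by simp
 have "(NN lborel (%t. ?f (t, r))) = (NN lborel (%t. (n r * indicator {t0<..<T} r) * (ennreal (w t) * k t r * indicator {r<..<T} t)))"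
 by (intro nn_cong) (auto simp: ind_def ac_simps)
 also have "... = (n r * indicator {t0<..<T} r) * (NI {r<..<T} (%t. ennreal (w t) * k t r))"
 by (rule nn_cmult) measurable
 also have "... <= (n r * indicator {t0<..<T} r) * ennreal (eta * w r)"
 using elim t0 by (cases "r : {t0<..<T}") (auto intro!: ml_mono)
 also have "... = ennreal eta * (ennreal (w r) * n r * indicator {t0<..<T} r)"
 using eta w0[of r] by (simp add: ennreal_mult ac_simps)
 finally show ?case .
 qed
 qed
 also have "... = ennreal eta * (NI {t0<..<T} (%t. ennreal (w t) * n t))" by (rule nn_cmult) measurable
 finally show ?thesis by (simp add: add_left_mono)
qed

section \<open>Second moment bounds for drift and diffusion terms\<close>

lemma add_le_mult_add:
 fixes c d x u p q :: real
 assumes "0 <= c" "0 <= d" "0 <= x" "0 <= u" "p <= c * x" "q <= d * u"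
 shows "p + q <= (c + d) * (x + u)"
proof -
 have "(c + d) * (x + u) = c * x + c * u + d * x + d * u" by (simp add: algebra_simps)
 moreover have "0 <= c * u" "0 <= d * x" using assms by auto
 ultimately show ?thesis using assms(5,6) by linarith
qed

text \<open>Cauchy-Schwarz in every row; the sum of the squared row norms is the squared Frobenius
  norm.\<close>

lemma norm_matrix_vector_le: "norm (A *v x) <= norm A * norm x"
 for A :: "real ^ 'n::finite ^ 'm::finite"
proof -
 have "(norm (A *v x))^2 = (\<Sum>i\<in>UNIV. ((A *v x) $ i)^2)"
 by (simp add: norm_vec_def L2_set_def sum_nonneg)
 also have "... <= (\<Sum>i\<in>UNIV. (norm (A $ i))^2 * (norm x)^2)"
 proof (rule sum_mono)
 fix i
 have "\<bar>(A *v x) $ i\<bar> <= norm (A $ i) * norm x"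
 unfolding matrix_vector_mul_component by (rule Cauchy_Schwarz_ineq2)
 then have "\<bar>(A *v x) $ i\<bar>^2 <= (norm (A $ i) * norm x)^2" by (rule power_mono) simp
 then show "((A *v x) $ i)^2 <= (norm (A $ i))^2 * (norm x)^2" by (simp add: power_mult_distrib)
 qed
 also have "... = (norm A * norm x)^2"
 by (simp add: norm_vec_def[of A] L2_set_def sum_nonneg power_mult_distrib sum_distrib_right)
 finally show ?thesis by (rule power2_le_imp_le) simp
qed

lemma borel_measurable_matrix_vector [measurable (raw)]:
 fixes A :: "'x => real ^ 'n::finite ^ 'm::finite"
 assumes "A : BM N" "x : BM N"
 shows "(%p. A p *v x p) : BM N"
 by (rule borel_measurable_continuous_Pair[OF assms])
 (unfold matrix_vector_mult_def, intro continuous_on_vec_lambda continuous_intros)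

lemma (in complete_measure) borel_measurable_AE_cong:
 fixes f g :: "'a => 'b::topological_space"
 assumes f: "f : BM M" and eq: "AE x in M. f x = g x"
 shows "g : BM M"
proof (rule measurableI)
 fix S :: "'b set" assume S: "S : sets borel"
 let ?N = "{x : space M. f x ~= g x}"
 have N: "?N : null_sets M" using eq by (simp add: AE_iff_null_sets)
 have "g -` S \<inter> space M = ((f -` S \<inter> space M) - ?N) \<union> (?N \<inter> (g -` S))" by auto
 moreover have "?N \<inter> (g -` S) : null_sets M" using complete2[OF _ N, of "?N \<inter> (g -` S)"] by blast
 ultimately show "g -` S \<inter> space M : sets M"
 using measurable_sets[OF f S] N by (auto simp: null_sets_def)
qed auto

lemma has_ito_integral_cong_AE:
 assumes H: "has_ito_integral M W F a b H Y"
 and eq: "AE p in completion (restrict_space lborel {a<..<b} \<Otimes>\<^sub>M M). H (fst p) (snd p) = H' (fst p) (snd p)"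
 shows "has_ito_integral M W F a b H' Y"
proof -
 let ?P = "completion (restrict_space lborel {a<..<b} \<Otimes>\<^sub>M M)"
 have "(%p. H' (fst p) (snd p)) : BM ?P"
 by (rule completion.borel_measurable_AE_cong[OF _ eq]) (use H in \<open>simp add: has_ito_integral_def\<close>)
 moreover have "(NN ?P (%p. nsq (simple_process n tu h (fst p) (snd p) - H' (fst p) (snd p)))) =
 (NN ?P (%p. nsq (simple_process n tu h (fst p) (snd p) - H (fst p) (snd p))))" for n tu h
 by (rule nn_cong_AE) (use eq in eventually_elim, simp)
 ultimately show ?thesis using H unfolding has_ito_integral_def by simp
qed

lemma set_integral_lebesgue_eq_lborel:
 fixes f :: "real => 'b::euclidean_space"
 assumes "f : BM borel" "S : sets borel"
 shows "(LINT r:S|lebesgue. f r) = (LINT r:S|lborel. f r)"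
proof -
 note [measurable] = assms
 show ?thesis unfolding slint_def by (rule integral_completion) measurable
qed

lemma ennreal_norm_add3_le:
 fixes x y z :: real
 assumes "0 <= x" "0 <= y" "0 <= z"
 shows "(ennreal x + ennreal y + ennreal z)^2 <= 3 * (ennreal (x^2) + ennreal (y^2) + ennreal (z^2))"
 using ennreal_norm_add3_sq[of x y z] assms by (simp add: ennreal_power ennreal_plus[symmetric] del: ennreal_plus)

lemma ennreal_add3_sq: "(x + y + z)^2 <= 3 * (x^2 + y^2 + (z::ennreal)^2)"
proof (cases "x = \<infinity> \<or> y = \<infinity> \<or> z = \<infinity>")
 case True
 then show ?thesis by (auto simp: power2_eq_square ennreal_top_mult)
next
 case False
 then obtain a b c where "x = ennreal a" "y = ennreal b" "z = ennreal c" "0 <= a" "0 <= b" "0 <= c"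
 by (cases x; cases y; cases z) auto
 then show ?thesis using ennreal_norm_add3_le[of a b c] by (simp add: ennreal_power)
qed

lemma nn_integral_mult_sq_le:
 fixes g :: "real => 'b::euclidean_space" and a :: "real => real"
 assumes [measurable]: "a : BM borel" "g : BM borel" "S : sets borel"
 shows "(NI S (%r. ennreal (\<bar>a r\<bar> * norm (g r))))^2 <=
 (NI S (%r. ennreal ((a r)^2))) * (NI S (%r. nsq (g r)))"
proof -
 have "(NI S (%r. ennreal (\<bar>a r\<bar> * norm (g r))))^2 =
 (NN lborel (%r. (ennreal \<bar>a r\<bar> * indicator S r) * (ennreal (norm (g r)) * indicator S r)))^2"
 by (intro arg_cong[where f="%x. x^2"] nn_cong) (auto simp: ennreal_mult ind_def)
 also have "... <= (NN lborel (%r. (ennreal \<bar>a r\<bar> * indicator S r)^2)) * (NN lborel (%r. (ennreal (norm (g r)) * indicator S r)^2))"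
 by (rule Cauchy_Schwarz_nn_integral) measurable
 also have "... = (NI S (%r. ennreal ((a r)^2))) * (NI S (%r. nsq (g r)))"
 by (intro arg_cong2[where f="(*)"] nn_cong) (auto simp: ennreal_power ind_def)
 finally show ?thesis .
qed

context brownian_basis
begin

lemma section_measurable:
 assumes "joint M f" "z : space M"
 shows "(%r. f r z) : BM (borel :: real measure)"
 using mcomp[OF measurable_Pair2'[OF assms(2), of lborel] assms(1)] by simp

lemma time_section_measurable:
 assumes "joint M f"
 shows "f (r :: real) : BM M"
 using mcomp[OF measurable_Pair1'[of r lborel M] assms] by simp

lemma swap_measurable:
 assumes "(%p. f (fst p) (snd p)) : measurable (tprod M) K"
 shows "(%p. f (snd p :: real) (fst p)) : measurable (M \<Otimes>\<^sub>M lborel) K"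
 using mcomp[OF measurable_pair_swap' assms] by (simp add: case_prod_beta')

lemma nn_integral_swap:
 assumes "joint M g"
 shows "(NN M (%z. NN lborel (%r. g r z))) = (NN lborel (%r::real. NN M (g r)))"
proof -
 interpret P: pair_sigma_finite lborel M ..
 show ?thesis by (rule P.Fubini') (use assms in \<open>simp add: case_prod_beta'\<close>)
qed

lemma integral_measurable_omega:
 fixes f :: "real => 'a => 'b::euclidean_space"
 assumes f: "joint M f" and S: "S : sets borel"
 shows "(%z. LINT r:S|lborel. f r z) : BM M"
proof -
 note [measurable] = swap_measurable[OF f] S
 have "(%p. indr S (snd p) *\<^sub>R f (snd p) (fst p)) : BM (M \<Otimes>\<^sub>M lborel)" by measurable
 then show ?thesis unfolding slint_def
 by (intro lborel.borel_measurable_lebesgue_integral) (simp add: case_prod_beta')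
qed

lemma nn_integral_measurable_omega:
 fixes g :: "real => 'a => ennreal"
 assumes g: "joint M g" and S: "S : sets borel"
 shows "(%z. NI S (%r. g r z)) : BM M"
proof -
 note [measurable] = swap_measurable[OF g] S
 have "(%p. g (snd p) (fst p) * indicator S (snd p)) : BM (M \<Otimes>\<^sub>M lborel)" by measurable
 from lb_nn_fst[OF this] show ?thesis by simp
qed

text \<open>The factor 27 is 3 from the splitting into initial value, drift and stochastic integral,
  times 9 from \<open>has_ito_integral_diff\<close>. The other two terms are enlarged by 9 to share
  one constant.\<close>

lemma ito_representation_diff:
 fixes f f' h h' :: "real => 'a => 'b::euclidean_space"
 assumes t0: "0 <= t0"
 and ito: "has_ito_integral M W F t0 t h Y" "has_ito_integral M W F t0 t h' Y'"
 and eq: "AE z in M. Th z = x + (LINT r:{t0<..<t}|lborel. f r z) + Y z"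
 "AE z in M. Th' z = x' + (LINT r:{t0<..<t}|lborel. f' r z) + Y' z"
 and f: "joint M f"
 and f': "joint M f'"
 and h: "joint M h"
 and h': "joint M h'"
 and int: "AE z in M. set_integrable lborel {t0<..<t} (%r. f r z)" "AE z in M. set_integrable lborel {t0<..<t} (%r. f' r z)"
 shows "(NN M (%z. nsq (Th z - Th' z))) <= 27 * (nsq (x - x') +
 (NN M (%z. (NI {t0<..<t} (%r. ennreal (norm (f r z - f' r z))))^2)) +
 (NI {t0<..<t} (%r. (NN M (%z. nsq (h r z - h' r z))))))"
proof -
 note [measurable] = f f' h h' section_measurable[OF f] section_measurable[OF f']
 integral_measurable_omega[OF f, of "{t0<..<t}"] integral_measurable_omega[OF f', of "{t0<..<t}"]
 have Ym[measurable]: "Y : BM M" "Y' : BM M" using ito by (auto simp: has_ito_integral_def)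
 let ?I = "%z. (LINT r:{t0<..<t}|lborel. f r z)" and ?I' = "%z. (LINT r:{t0<..<t}|lborel. f' r z)"
 have "(NN M (%z. nsq (Th z - Th' z))) = (NN M (%z. nsq ((x - x') + (?I z - ?I' z) + (Y z - Y' z))))"
 proof (rule nn_cong_AE, use eq in eventually_elim)
 fix z assume "Th z = x + ?I z + Y z" "Th' z = x' + ?I' z + Y' z"
 then have "Th z - Th' z = (x - x') + (?I z - ?I' z) + (Y z - Y' z)" by (simp add: algebra_simps)
 then show "nsq (Th z - Th' z) = nsq ((x - x') + (?I z - ?I' z) + (Y z - Y' z))" by simp
 qed
 also have "... <= 3 * ((NN M (%z. nsq (x - x'))) + (NN M (%z. nsq (?I z - ?I' z))) + (NN M (%z. nsq (Y z - Y' z))))"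
 by (rule nn_integral_norm_add3_sq) measurable
 also have "... <= 3 * (9 * nsq (x - x') +
 9 * (NN M (%z. (NI {t0<..<t} (%r. ennreal (norm (f r z - f' r z))))^2)) +
 9 * (NI {t0<..<t} (%r. (NN M (%z. nsq (h r z - h' r z))))))"
 proof (intro ml_mono add_mono)
 have le9: "a <= 9 * a" for a :: ennreal
 using mr_mono[of 1 9 a] by simp
 show "(NN M (%z. nsq (x - x'))) <= 9 * nsq (x - x')"
 using le9 by (simp add: emeasure_space_1)
 have "(NN M (%z. nsq (?I z - ?I' z))) <= (NN M (%z. (NI {t0<..<t} (%r. ennreal (norm (f r z - f' r z))))^2))"
 proof (rule nn_mono_AE, use int in eventually_elim)
 fix z assume i: "set_integrable lborel {t0<..<t} (%r. f r z)" "set_integrable lborel {t0<..<t} (%r. f' r z)"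
 have "ennreal (norm (?I z - ?I' z)) = ennreal (norm (LINT r|lborel. indr {t0<..<t} r *\<^sub>R (f r z - f' r z)))"
 using set_integral_diff(2)[OF i] by (simp add: slint_def)
 also have "... <= (NN lborel (%r. ennreal (norm (indr {t0<..<t} r *\<^sub>R (f r z - f' r z)))))"
 using set_integral_diff(1)[OF i] unfolding set_integrable_def by (rule integral_norm_bound_ennreal)
 also have "... = (NI {t0<..<t} (%r. ennreal (norm (f r z - f' r z))))"
 by (intro nn_cong) (auto simp: ind_def)
 finally have "(ennreal (norm (?I z - ?I' z)))^2 <= (NI {t0<..<t} (%r. ennreal (norm (f r z - f' r z))))^2"
 by (rule power_mono) simp
 then show "nsq (?I z - ?I' z) <= (NI {t0<..<t} (%r. ennreal (norm (f r z - f' r z))))^2"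
 by (simp add: ennreal_power)
 qed
 also have "... <= 9 * ..." by (rule le9)
 finally show "(NN M (%z. nsq (?I z - ?I' z))) <= 9 * (NN M (%z. (NI {t0<..<t} (%r. ennreal (norm (f r z - f' r z))))^2))" .
 let ?P = "restrict_space lborel {t0<..<t} \<Otimes>\<^sub>M M"
 have id: "(%p. p) : measurable ?P (tprod M)"
 by (auto intro!: measurable_Pair[of fst _ _ snd, simplified] measurable_restrict_space1 mcomp[OF measurable_fst])
 have hd: "(%p. nsq (h (fst p) (snd p) - h' (fst p) (snd p))) : BM ?P"
 by (rule mcomp[OF id, of "%p. nsq (h (fst p) (snd p) - h' (fst p) (snd p))"]) measurable
 have "(NN M (%z. nsq (Y z - Y' z))) <= 9 * (\<integral>\<^sup>+p. nsq (h (fst p) (snd p) - h' (fst p) (snd p)) \<partial>completion ?P)"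
 by (rule has_ito_integral_diff[OF ito t0])
 also have "(\<integral>\<^sup>+p. nsq (h (fst p) (snd p) - h' (fst p) (snd p)) \<partial>completion ?P) =
 (\<integral>\<^sup>+r. (NN M (%z. nsq (h r z - h' r z))) \<partial>restrict_space lborel {t0<..<t})"
 unfolding nn_integral_completion using nn_integral_fst[OF hd] by simp
 also have "... = (NI {t0<..<t} (%r. (NN M (%z. nsq (h r z - h' r z)))))"
 by (rule nn_integral_restrict_space) simp
 finally show "(NN M (%z. nsq (Y z - Y' z))) <= 9 * (NI {t0<..<t} (%r. (NN M (%z. nsq (h r z - h' r z)))))" .
 qed auto
 also have "... = 27 * (nsq (x - x') +
 (NN M (%z. (NI {t0<..<t} (%r. ennreal (norm (f r z - f' r z))))^2)) +
 (NI {t0<..<t} (%r. (NN M (%z. nsq (h r z - h' r z))))))"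
 unfolding distrib_left[symmetric] by (simp only: mult.assoc[symmetric]) simp
 finally show ?thesis .
qed

text \<open>Cauchy-Schwarz in time separates the kernels from the processes, so that the drift acts
  on the input through a factor independent of the integration variable. This is why plain square
  integrability of A and B on the triangle is enough.\<close>

lemma affine_drift_bound:
 fixes X :: "real => 'a => real ^ 'd::finite" and u :: "real => 'a => real ^ 'l::finite"
 and A :: "real => real ^ 'd ^ 'm::finite" and B :: "real => real ^ 'l ^ 'm"
 assumes A[measurable]: "A : BM borel" and B[measurable]: "B : BM borel"
 and X[measurable]: "joint M X"
 and u[measurable]: "joint M u"
 and b[measurable]: "joint M b"
 shows "(NN M (%z. (NI {t0<..<t} (%r. ennreal (norm (A r *v X r z + B r *v u r z + b r z))))^2)) <=
 3 * ((NI {t0<..<t} (%r. ennreal ((norm (A r))^2 + (norm (B r))^2))) *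
 (NI {t0<..<t} (%r. (NN M (%z. ennreal ((norm (X r z))^2 + (norm (u r z))^2))))) +
 (NN M (%z. (NI {t0<..<t} (%r. ennreal (norm (b r z))))^2)))"
proof -
 let ?S = "{t0<..<t}"
 let ?ap = "NI ?S (%r. ennreal ((norm (A r))^2 + (norm (B r))^2))"
 let ?q = "%z. NI ?S (%r. ennreal ((norm (X r z))^2 + (norm (u r z))^2))"
 let ?b = "%z. (NI ?S (%r. ennreal (norm (b r z))))"
 have qm[measurable]: "?q : BM M" by (rule nn_integral_measurable_omega) measurable
 have bm[measurable]: "?b : BM M" by (rule nn_integral_measurable_omega) measurable
 have "(NN M (%z. (NI ?S (%r. ennreal (norm (A r *v X r z + B r *v u r z + b r z))))^2)) <=
 (NN M (%z. 3 * (?ap * ?q z + (?b z)^2)))"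
 proof (rule nn_mono)
 fix z assume z: "z : space M"
 note [measurable] = section_measurable[OF X z] section_measurable[OF u z] section_measurable[OF b z]
 let ?a1 = "NI ?S (%r. ennreal (\<bar>norm (A r)\<bar> * norm (X r z)))"
 let ?a2 = "NI ?S (%r. ennreal (\<bar>norm (B r)\<bar> * norm (u r z)))"
 have "(NI ?S (%r. ennreal (norm (A r *v X r z + B r *v u r z + b r z)))) <=
 (NN lborel (%r. ennreal (\<bar>norm (A r)\<bar> * norm (X r z)) * indicator ?S r + ennreal (\<bar>norm (B r)\<bar> * norm (u r z)) * indicator ?S r
 + ennreal (norm (b r z)) * indicator ?S r))"
 proof (rule nn_mono)
 fix r
 have "norm (A r *v X r z + B r *v u r z + b r z) <= norm (A r *v X r z) + norm (B r *v u r z) + norm (b r z)"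
 by (meson add_right_mono norm_triangle_ineq order_trans)
 also have "... <= \<bar>norm (A r)\<bar> * norm (X r z) + \<bar>norm (B r)\<bar> * norm (u r z) + norm (b r z)"
 using norm_matrix_vector_le[of "A r" "X r z"] norm_matrix_vector_le[of "B r" "u r z"] by simp
 finally have "ennreal (norm (A r *v X r z + B r *v u r z + b r z)) <= ennreal (\<bar>norm (A r)\<bar> * norm (X r z)) + ennreal (\<bar>norm (B r)\<bar> * norm (u r z)) + ennreal (norm (b r z))"
 by (simp add: ennreal_plus[symmetric] ennreal_leI del: ennreal_plus)
 then show "ennreal (norm (A r *v X r z + B r *v u r z + b r z)) * indicator ?S r <=
 ennreal (\<bar>norm (A r)\<bar> * norm (X r z)) * indicator ?S r + ennreal (\<bar>norm (B r)\<bar> * norm (u r z)) * indicator ?S r + ennreal (norm (b r z)) * indicator ?S r"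
 unfolding distrib_right[symmetric] by (rule mr_mono) simp
 qed
 also have "... = ?a1 + ?a2 + ?b z" by (simp add: nn_add)
 finally have "(NI ?S (%r. ennreal (norm (A r *v X r z + B r *v u r z + b r z))))^2 <= (?a1 + ?a2 + ?b z)^2"
 by (rule power_mono) simp
 also have "... <= 3 * (?a1^2 + ?a2^2 + (?b z)^2)" by (rule ennreal_add3_sq)
 also have "... <= 3 * (?ap * ?q z + (?b z)^2)"
 proof (intro ml_mono add_mono order_refl)
 have "?a1^2 + ?a2^2 <= (NI ?S (%r. nsq (A r))) * (NI ?S (%r. nsq (X r z)))
 + (NI ?S (%r. nsq (B r))) * (NI ?S (%r. nsq (u r z)))"
 by (intro add_mono nn_integral_mult_sq_le) measurable
 also have "... <= ?ap * (NI ?S (%r. nsq (X r z))) + ?ap * (NI ?S (%r. nsq (u r z)))"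
 by (intro add_mono mr_mono nn_mono ennreal_leI) auto
 also have "... = ?ap * ?q z"
 unfolding distrib_left[symmetric]
 by (subst nn_add[symmetric]) (auto simp: distrib_right[symmetric] ennreal_plus)
 finally show "?a1^2 + ?a2^2 <= ?ap * ?q z" .
 qed simp
 finally show "(NI ?S (%r. ennreal (norm (A r *v X r z + B r *v u r z + b r z))))^2 <= 3 * (?ap * ?q z + (?b z)^2)" .
 qed
 also have "... = 3 * (?ap * (NN M (%z. ?q z)) + (NN M (%z. (?b z)^2)))"
 by (simp add: nn_cmult nn_add del: ennreal_plus distrib_left_numeral)
 also have "(NN M (%z. ?q z)) = (NI ?S (%r. (NN M (%z. ennreal ((norm (X r z))^2 + (norm (u r z))^2)))))"
 proof -
 have "(NN M (%z. ?q z)) = (NN lborel (%r. NN M (%z. ennreal ((norm (X r z))^2 + (norm (u r z))^2) * indicator ?S r)))"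
 by (rule nn_integral_swap) measurable
 also have "... = (NI ?S (%r. (NN M (%z. ennreal ((norm (X r z))^2 + (norm (u r z))^2)))))"
 by (intro nn_cong) (auto simp: ind_def)
 finally show ?thesis .
 qed
 finally show ?thesis .
qed

text \<open>After the isometry the square already sits inside the time integral, so the kernels
  cannot be separated from the processes: |C|^2 + |D|^2 remains as a genuine Volterra
  kernel.\<close>

lemma affine_diffusion_bound:
 fixes X :: "real => 'a => real ^ 'd::finite" and u :: "real => 'a => real ^ 'l::finite"
 and C :: "real => real ^ 'd ^ 'm::finite" and D :: "real => real ^ 'l ^ 'm"
 assumes C[measurable]: "C : BM borel" and D[measurable]: "D : BM borel"
 and X[measurable]: "joint M X"
 and u[measurable]: "joint M u"
 and b[measurable]: "joint M sg"
 shows "(NI {t0<..<t} (%r. (NN M (%z. nsq (C r *v X r z + D r *v u r z + sg r z))))) <=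
 3 * ((NI {t0<..<t} (%r. ennreal ((norm (C r))^2 + (norm (D r))^2) * (NN M (%z. ennreal ((norm (X r z))^2 + (norm (u r z))^2))))) +
 (NI {t0<..<t} (%r. (nn2 M (sg r)))))"
proof -
 let ?S = "{t0<..<t}"
 let ?n = "%r. NN M (%z. ennreal ((norm (X r z))^2 + (norm (u r z))^2))"
 have "(%p. ennreal ((norm (X (fst p) (snd p)))^2 + (norm (u (fst p) (snd p)))^2)) : BM (tprod M)" by measurable
 from borel_measurable_nn_integral_fst[OF this] have nm[measurable]: "?n : BM borel" by simp
 have "(%p. nsq (sg (fst p) (snd p))) : BM (tprod M)" by measurable
 from borel_measurable_nn_integral_fst[OF this] have sm[measurable]: "(%r. nn2 M (sg r)) : BM borel" by simp
 have "(NI ?S (%r. (NN M (%z. nsq (C r *v X r z + D r *v u r z + sg r z))))) <=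
 (NN lborel (%r. 3 * (ennreal ((norm (C r))^2 + (norm (D r))^2) * ?n r * indicator ?S r + (nn2 M (sg r)) * indicator ?S r)))"
 proof (rule nn_mono)
 fix r
 note [measurable] = time_section_measurable[OF X, of r] time_section_measurable[OF u, of r] time_section_measurable[OF b, of r]
 let ?c = "ennreal ((norm (C r))^2 + (norm (D r))^2)"
 have "(NN M (%z. nsq (C r *v X r z + D r *v u r z + sg r z))) <=
 (NN M (%z. 3 * (?c * ennreal ((norm (X r z))^2 + (norm (u r z))^2) + nsq (sg r z))))"
 proof (rule nn_mono)
 fix z
 have "(norm (C r *v X r z))^2 <= (norm (C r) * norm (X r z))^2" "(norm (D r *v u r z))^2 <= (norm (D r) * norm (u r z))^2"
 by (auto intro!: power_mono norm_matrix_vector_le)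
 then have "(norm (C r *v X r z))^2 + (norm (D r *v u r z))^2 <= ((norm (C r))^2 + (norm (D r))^2) * ((norm (X r z))^2 + (norm (u r z))^2)"
 unfolding power_mult_distrib by (intro add_le_mult_add) auto
 then have "nsq (C r *v X r z) + nsq (D r *v u r z) <= ?c * ennreal ((norm (X r z))^2 + (norm (u r z))^2)"
 by (simp add: ennreal_mult[symmetric] ennreal_plus[symmetric] ennreal_leI del: ennreal_plus)
 then have "3 * (nsq (C r *v X r z) + nsq (D r *v u r z) + nsq (sg r z)) <=
 3 * (?c * ennreal ((norm (X r z))^2 + (norm (u r z))^2) + nsq (sg r z))"
 by (intro ml_mono add_mono) auto
 then show "nsq (C r *v X r z + D r *v u r z + sg r z) <= 3 * (?c * ennreal ((norm (X r z))^2 + (norm (u r z))^2) + nsq (sg r z))"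
 by (rule order_trans[OF ennreal_norm_add3_sq])
 qed
 also have "... = 3 * (?c * ?n r + (nn2 M (sg r)))"
 by (simp add: nn_cmult nn_add del: ennreal_plus distrib_left_numeral)
 finally show "(NN M (%z. nsq (C r *v X r z + D r *v u r z + sg r z))) * indicator ?S r <=
 3 * (?c * ?n r * indicator ?S r + (nn2 M (sg r)) * indicator ?S r)"
 by (cases "r : ?S") auto
 qed
 also have "... = 3 * ((NI ?S (%r. ennreal ((norm (C r))^2 + (norm (D r))^2) * ?n r)) + (NI ?S (%r. (nn2 M (sg r)))))"
 by (simp add: nn_cmult nn_add del: ennreal_plus distrib_left_numeral)
 finally show ?thesis .
qed

end

section \<open>The closed-loop system with Borel coefficients\<close>

text \<open>The deterministic part of the problem with quantitative bounds: \<open>m0\<close> is one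
  common bound for the masses of the kernels, \<open>xx\<close> bounds the gain \<open>XX\<close>.
  Nothing here involves \<open>t0\<close> or the probability space, which makes everything derived
  at this level uniform in them.\<close>

locale svie_kernels =
 fixes T :: real
 and A :: "real => real => real ^ 'd::finite ^ 'd" and B :: "real => real => real ^ 'l::finite ^ 'd"
 and C :: "real => real => real ^ 'd ^ 'd" and D :: "real => real => real ^ 'l ^ 'd"
 and XX :: "real => real ^ 'd ^ 'l" and Ga :: "real => real => real ^ 'd ^ 'l"
 and xx m0 :: real
 assumes T: "0 < T"
 and A: "joint lborel A"
 and B: "joint lborel B"
 and C: "joint lborel C"
 and D: "joint lborel D"
 and Ga: "joint lborel Ga"
 and XX: "XX : BM borel" "\<And>t. norm (XX t) <= xx"
 and ap: "(NI {0<..<T} (%t. (NI {0<..<t} (%r. ennreal ((norm (A t r))^2 + (norm (B t r))^2))))) <= ennreal m0"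
 and kp: "AEI 0 T (%r. (NI {r<..<T} (%t. ennreal ((norm (C t r))^2 + (norm (D t r))^2))) <= ennreal m0)"
 and kp_small: "volterra_small T (%t r. ennreal ((norm (C t r))^2 + (norm (D t r))^2))"
 and gain: "(NI {0<..<T} (%t. (NI {t<..<T} (%s. nsq (Ga s t))))) <= ennreal m0"
 and m0: "0 <= m0"
begin

definition al :: "real => ennreal" where
 "al t = (NI {0<..<t} (%r. ennreal ((norm (A t r))^2 + (norm (B t r))^2)))"

definition ka :: "real => real => ennreal" where
 "ka t r = ennreal ((norm (C t r))^2 + (norm (D t r))^2)"

definition gn :: "real => ennreal" where
 "gn t = (NI {t<..<T} (%s. nsq (Ga s t)))"

text \<open>1458 = 3 * 3 * 81 * 2: the factors 3 come from splitting the control equation and from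
  \<open>gain_bound\<close>, 81 from \<open>sv_rep_diff\<close>, and 2 from the mass bound
  \<open>2 * m0\<close> in \<open>kernel_response_bound\<close>.\<close>

definition step_const :: real where
 "step_const = 1458 * (1 + xx^2) * (1 + m0)"

definition step_kernel :: "real => real => ennreal" where
 "step_kernel t r = ennreal step_const * (al t + ka t r + gn t)"

lemma kernel_sections [measurable]:
 "A t : BM borel" "B t : BM borel" "C t : BM borel" "D t : BM borel"
 "Ga t : BM borel" "(%s. Ga s t) : BM borel"
 using mcomp[OF measurable_Pair1'[of t lborel lborel] A] mcomp[OF measurable_Pair1'[of t lborel lborel] B]
 mcomp[OF measurable_Pair1'[of t lborel lborel] C] mcomp[OF measurable_Pair1'[of t lborel lborel] D]
 mcomp[OF measurable_Pair1'[of t lborel lborel] Ga] mcomp[OF measurable_Pair2'[of t lborel lborel] Ga]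
 by simp_all

lemma al_measurable [measurable]: "al : BM borel"
proof -
 note [measurable] = A B
 have "(%p. ennreal ((norm (A (fst p) (snd p)))^2 + (norm (B (fst p) (snd p)))^2) * indicator {p. 0 < snd p & snd p < fst p} p) : BM (tprod lborel)"
 by measurable
 from lb_nn_fst[OF this] show ?thesis
 by (simp add: al_def[abs_def] ind_def greaterThanLessThan_def greaterThan_def lessThan_def)
qed

lemma gn_measurable [measurable]: "gn : BM borel"
proof -
 note [measurable] = Ga
 have "(%p. nsq (Ga (snd p) (fst p)) * indicator {p. fst p < snd p & snd p < T} p) : BM (tprod lborel)"
 using mcomp[OF measurable_pair_swap' Ga] by (simp add: case_prod_beta')
 from lb_nn_fst[OF this] show ?thesis
 by (simp add: gn_def[abs_def] ind_def greaterThanLessThan_def greaterThan_def lessThan_def)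
qed

lemma ka_measurable [measurable]: "joint lborel ka"
 using kp_small unfolding volterra_small_def ka_def by blast

lemma ka_section [measurable]: "ka t : BM borel" "(%t. ka t r) : BM borel"
 unfolding ka_def using mcomp[OF measurable_Pair2'[of r lborel lborel] C] mcomp[OF measurable_Pair2'[of r lborel lborel] D]
 by simp_all

lemma step_const_pos: "0 < step_const"
 unfolding step_const_def using m0 by (intro mult_pos_pos add_pos_nonneg) auto

lemma step_kernel_small: "volterra_small T step_kernel"
proof -
 have "volterra_small T (%t r. al t)"
 using volterra_small_integrable[OF T al_measurable] ap by (simp add: al_def le_less_trans[OF _ ennreal_less_top])
 moreover have "volterra_small T (%t r. gn t)"
 using volterra_small_integrable[OF T gn_measurable] gain by (simp add: gn_def le_less_trans[OF _ ennreal_less_top])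
 moreover have "volterra_small T ka" using kp_small by (simp add: ka_def[abs_def])
 ultimately have "volterra_small T (%t r. ennreal step_const * (al t + ka t r + gn t))"
 using step_const_pos by (intro volterra_small_cmult volterra_small_add) auto
 then show ?thesis by (simp add: step_kernel_def[abs_def])
qed

lemma al_finite: "AEI 0 T (%t. al t < \<infinity>)"
proof -
 have "(NN lborel (%t. al t * indicator {0<..<T} t)) ~= \<infinity>"
 using ap unfolding al_def by (metis ennreal_neq_top infinity_ennreal_def top.extremum_uniqueI)
 then have "AE t in lborel. al t * indicator {0<..<T} t ~= \<infinity>" by (intro nn_integral_PInf_AE) auto
 then show ?thesis by eventually_elim (auto simp: less_top)
qed

lemma gn_finite: "AEI 0 T (%t. gn t < \<infinity>)"
proof -
 have "(NN lborel (%t. gn t * indicator {0<..<T} t)) ~= \<infinity>"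
 using gain unfolding gn_def by (metis ennreal_neq_top infinity_ennreal_def top.extremum_uniqueI)
 then have "AE t in lborel. gn t * indicator {0<..<T} t ~= \<infinity>" by (intro nn_integral_PInf_AE) auto
 then show ?thesis by eventually_elim (auto simp: less_top)
qed

end

lemma collect_81:
 fixes a b c p q :: "'c::comm_semiring_1"
 shows "27 * (3 * a + 3 * (p + b) + 3 * (q + c)) = 81 * ((a + b + c) + (p + q))"
 by (simp add: algebra_simps)

lemma AE_finite_of_nn_integral:
 fixes f :: "real => ennreal"
 assumes "f : BM borel" "(NI {a<..<b} f) < \<infinity>"
 shows "AEI a b (%t. f t < \<infinity>)"
proof -
 have "AE t in lborel. f t * indicator {a<..<b} t ~= \<infinity>"
 using assms by (intro nn_integral_PInf_AE) auto
 then show ?thesis by eventually_elim (auto simp: less_top)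
qed

locale svie = continuous_brownian_basis M F W + svie_kernels T A B C D XX Ga xx m0
 for M :: "'a measure" and F W and T :: real
 and A :: "real => real => real ^ 'd::finite ^ 'd" and B :: "real => real => real ^ 'l::finite ^ 'd"
 and C :: "real => real => real ^ 'd ^ 'd" and D :: "real => real => real ^ 'l ^ 'd"
 and XX :: "real => real ^ 'd ^ 'l" and Ga :: "real => real => real ^ 'd ^ 'l"
 and xx m0 :: real +
 fixes t0 :: real
 assumes t0: "0 <= t0" "t0 < T"
begin

text \<open>Joint measurability with respect to \<open>M\<close> and adaptedness at almost every
  time are stable under pointwise limits and easy to check, unlike progressive measurability, which
  is restored only at the end by \<open>progressive_version\<close>.\<close>

definition process :: "(real => 'a => 'b::euclidean_space) => bool" where
 "process X \<longleftrightarrow> joint M X &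
 (AEI t0 T (%r. X r : BM (F r))) &
 (NI {t0<..<T} (%r. (nn2 M (X r)))) < \<infinity>"

definition field :: "(real => real => 'a => 'b::euclidean_space) => bool" where
 "field b \<longleftrightarrow> joint3 M b &
 (AEI t0 T (%s. (AEI t0 s (%r. b s r : BM (F r)))))"

definition field_L21 :: "(real => real => 'a => 'b::euclidean_space) => real => ennreal" where
 "field_L21 b s = (NN M (%z. (NI {t0<..<s} (%r. ennreal (norm (b s r z))))^2))"

definition field_L2 :: "(real => real => 'a => 'b::euclidean_space) => real => ennreal" where
 "field_L2 sg s = (NI {t0<..<s} (%r. (nn2 M (sg s r))))"

definition data :: "(real => real ^ 'd) => (real => real => 'a => real ^ 'd) => (real => real => 'a => real ^ 'd) => (real => 'a => real ^ 'l) => bool" where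
 "data x b sg v \<longleftrightarrow> x : BM borel & (NI {t0<..<T} (%s. nsq (x s))) < \<infinity> &
 field b & (NI {t0<..<T} (field_L21 b)) < \<infinity> &
 field sg & (NI {t0<..<T} (%s. field_L2 sg s)) < \<infinity> & process v"

text \<open>One affine stochastic Volterra representation at a single time \<open>t\<close>. With
  the integrands taken at parameter \<open>s\<close>, the choice \<open>t = s\<close> gives the
  equation for X and \<open>t < s\<close> the one for Theta.\<close>

definition sv_rep :: "real ^ 'd => (real => 'a => real ^ 'd) => (real => 'a => real ^ 'd) => real => ('a => real ^ 'd) => bool" where
 "sv_rep x f h t Th \<longleftrightarrow> (EX Y. has_ito_integral M W F t0 t h Y &
 (AE z in M. Th z = x + (LINT r:{t0<..<t}|lborel. f r z) + Y z))"

definition drift where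
 "drift X u b s r z = A s r *v X r z + B s r *v u r z + b s r z"

definition diffusion where
 "diffusion X u sg s r z = C s r *v X r z + D s r *v u r z + sg s r z"

definition step where
 "step x b sg v X u X' Th' u' \<longleftrightarrow>
 (AEI t0 T (%t. sv_rep (x t) (drift X u b t) (diffusion X u sg t) t (X' t))) &
 (AEI t0 T (%s. (ALL t:{t0<..<s}. sv_rep (x s) (drift X u b s) (diffusion X u sg s) t (Th' s t)))) &
 (AEI t0 T (%t. (AE z in M. u' t z = XX t *v X' t z + (LINT s:{t<..<T}|lborel. Ga s t *v Th' s t z) + v t z)))"

definition response :: "(real => real => 'a => real ^ 'd) => bool" where
 "response Th \<longleftrightarrow> joint3 M Th &
 (NI {t0<..<T} (%s. (NI {t0<..<s} (%t. (nn2 M (Th s t)))))) < \<infinity>"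

definition pair_norm :: "(real => 'a => real ^ 'd) => (real => 'a => real ^ 'l) => real => ennreal" where
 "pair_norm X u r = (NN M (%z. ennreal ((norm (X r z))^2 + (norm (u r z))^2)))"

lemma processD:
 assumes "process X"
 shows "joint M X"
 and "AEI t0 T (%r. X r : BM (F r))"
 and "(NI {t0<..<T} (%r. (nn2 M (X r)))) < \<infinity>"
 using assms by (auto simp: process_def)

lemma field_section:
 assumes "(%p. b (fst p) (fst (snd p)) (snd (snd p))) : measurable (tprod (tprod M)) K"
 shows "(%p. b (s::real) (fst p) (snd p)) : measurable (tprod M) K"
 using mcomp[OF measurable_Pair1'[of s lborel "lborel \<Otimes>\<^sub>M M"] assms] by simp

lemma process_time_measurable:
 fixes X :: "real => 'a => 'b::euclidean_space"
 assumes "joint M X"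
 shows "(%r. nn2 M (X r)) : BM borel"
proof -
 note [measurable] = assms
 have "(%p. nsq (X (fst p) (snd p))) : BM (tprod M)" by measurable
 from borel_measurable_nn_integral_fst[OF this] show ?thesis by simp
qed

lemma pair_norm_measurable:
 assumes "joint M X" "joint M u"
 shows "pair_norm X u : BM borel"
proof -
 note [measurable] = assms
 have "(%p. ennreal ((norm (X (fst p) (snd p)))^2 + (norm (u (fst p) (snd p)))^2)) : BM (tprod M)" by measurable
 from borel_measurable_nn_integral_fst[OF this] show ?thesis by (simp add: pair_norm_def[abs_def])
qed

lemma pair_norm_eq:
 assumes "joint M X" "joint M u"
 shows "pair_norm X u r = (nn2 M (X r)) + (nn2 M (u r))"
 using time_section_measurable[OF assms(1), of r] time_section_measurable[OF assms(2), of r]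
 by (simp add: pair_norm_def nn_add)

lemma pair_norm_finite:
 assumes "process X" "process u"
 shows "(NI {t0<..<T} (pair_norm X u)) < \<infinity>"
proof -
 note m = processD(1)[OF assms(1)] processD(1)[OF assms(2)]
 note [measurable] = process_time_measurable[OF m(1)] process_time_measurable[OF m(2)]
 have "(NI {t0<..<T} (pair_norm X u)) = (NI {t0<..<T} (%r. (nn2 M (X r)))) + (NI {t0<..<T} (%r. (nn2 M (u r))))"
 unfolding pair_norm_eq[OF m] by (simp add: distrib_right nn_add)
 then show ?thesis using processD(3)[OF assms(1)] processD(3)[OF assms(2)] by simp
qed

lemma field_norm_measurable:
 fixes b :: "real => real => 'a => 'b::euclidean_space"
 assumes b[measurable]: "joint3 M b"
 shows "field_L21 b : BM borel" "field_L2 b : BM borel"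
proof -
 have "(%q. (fst (fst q), (snd q, snd (fst q)))) : measurable ((tprod M) \<Otimes>\<^sub>M lborel) (tprod (tprod M))" by measurable
 from mcomp[OF this b]
 have [measurable]: "(%q. b (fst (fst q)) (snd q) (snd (fst q))) : BM ((tprod M) \<Otimes>\<^sub>M lborel)" by simp
 have "(%q. ennreal (norm (b (fst (fst q)) (snd q) (snd (fst q)))) * indicator {q. t0 < snd q & snd q < fst (fst q)} q) : BM ((tprod M) \<Otimes>\<^sub>M lborel)"
 by measurable
 from lb_nn_fst[OF this]
 have "(%q. (NN lborel (%r. ennreal (norm (b (fst q) r (snd q))) * indicator {t0<..<fst q} r))^2) : BM (tprod M)"
 by (simp add: ind_def greaterThanLessThan_def greaterThan_def lessThan_def)
 from borel_measurable_nn_integral_fst[OF this] show "field_L21 b : BM borel" by (simp add: field_L21_def[abs_def])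
 have "(%q. (fst (fst q), (snd (fst q), snd q))) : measurable ((tprod lborel) \<Otimes>\<^sub>M M) (tprod (tprod M))" by measurable
 from mcomp[OF this b]
 have [measurable]: "(%q. b (fst (fst q)) (snd (fst q)) (snd q)) : BM ((tprod lborel) \<Otimes>\<^sub>M M)" by simp
 have "(%q. nsq (b (fst (fst q)) (snd (fst q)) (snd q))) : BM ((tprod lborel) \<Otimes>\<^sub>M M)"
 by measurable
 from borel_measurable_nn_integral_fst[OF this]
 have "(%q. (nn2 M (b (fst q) (snd q))) * indicator {q. t0 < snd q & snd q < fst q} q) : BM (tprod lborel)"
 by measurable
 from lb_nn_fst[OF this]
 show "field_L2 b : BM borel"
 by (simp add: field_L2_def[abs_def] ind_def greaterThanLessThan_def greaterThan_def lessThan_def)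
qed

lemma drift_measurable:
 assumes [measurable]: "joint M X" "joint M u"
 "(%p. b s (fst p) (snd p)) : BM (tprod M)"
 shows "(%p. drift X u b s (fst p) (snd p)) : BM (tprod M)"
 "(%p. diffusion X u b s (fst p) (snd p)) : BM (tprod M)"
 unfolding drift_def diffusion_def by measurable

text \<open>The second moment of the integrated norm is finite by \<open>affine_drift_bound\<close>,
  so the drift is integrable on almost every path.\<close>

lemma drift_integrable:
 assumes X: "process X" and u: "process u" and b: "joint3 M b"
 and s: "s : {t0<..<T}" "al s < \<infinity>" "field_L21 b s < \<infinity>" and t: "t <= s"
 shows "AE z in M. set_integrable lborel {t0<..<t} (%r. drift X u b s r z)"
proof -
 note m = processD(1)[OF X] processD(1)[OF u] field_section[OF b, of s]
 have "(NN M (%z. (NI {t0<..<s} (%r. ennreal (norm (drift X u b s r z))))^2)) <=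
 3 * ((NI {t0<..<s} (%r. ennreal ((norm (A s r))^2 + (norm (B s r))^2))) *
 (NI {t0<..<s} (pair_norm X u)) + field_L21 b s)"
 unfolding drift_def pair_norm_def field_L21_def by (rule affine_drift_bound[OF _ _ m]) measurable
 also have "... <= 3 * (al s * (NI {t0<..<T} (pair_norm X u)) + field_L21 b s)"
 unfolding al_def using t0 s by (intro ml_mono add_mono mult_mono nn_mono) (auto simp: ind_def)
 also have "... < \<infinity>"
 using pair_norm_finite[OF X u] s by (simp add: ennreal_mult_less_top)
 finally have fin: "(NN M (%z. (NI {t0<..<s} (%r. ennreal (norm (drift X u b s r z))))^2)) < \<infinity>" .
 note dm = drift_measurable(1)[of X u b s, OF m]
 have "(%z. NI {t0<..<s} (%r. ennreal (norm (drift X u b s r z)))) : BM M"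
 by (rule nn_integral_measurable_omega) (use dm in measurable)
 then have "AE z in M. (NI {t0<..<s} (%r. ennreal (norm (drift X u b s r z))))^2 ~= \<infinity>"
 using fin by (intro nn_integral_PInf_AE) auto
 then show ?thesis
 using AE_space
 proof eventually_elim
 case (elim z)
 have dm': "(%r. drift X u b s r z) : BM lborel" using section_measurable[OF dm elim(2)] by simp
 have "(NN lborel (%r. ennreal (norm (indr {t0<..<t} r *\<^sub>R drift X u b s r z)))) <= (NI {t0<..<s} (%r. ennreal (norm (drift X u b s r z))))"
 using t by (intro nn_mono) (auto simp: ind_def)
 also have "... < \<infinity>" using elim(1) by (auto simp: less_top[symmetric] power2_eq_square ennreal_mult_eq_top_iff)
 finally show ?case unfolding set_integrable_def using dm' by (intro integrableI_bounded) auto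
 qed
qed

definition data_diff where
 "data_diff x b sg x' b' sg' s = nsq (x s - x' s) + field_L21 (%s r z. b s r z - b' s r z) s + field_L2 (%s r z. sg s r z - sg' s r z) s"

text \<open>The equations are affine, so the difference solves the same equation with the
  differences of the data. The constant is 27 from \<open>ito_representation_diff\<close> times 3
  from the affine bounds. Time \<open>t\<close> runs up to and including \<open>s\<close>, to cover
  state and response together.\<close>

lemma sv_rep_diff:
 assumes X: "process X" "process X2" and u: "process u" "process u2"
 and b: "joint3 M b"
 "joint3 M b2"
 and sg: "joint3 M sg"
 "joint3 M sg2"
 and s: "s : {t0<..<T}" "al s < \<infinity>" "field_L21 b s < \<infinity>" "field_L21 b2 s < \<infinity>" and t: "t : {t0<..s}"
 and rep: "sv_rep (x s) (drift X u b s) (diffusion X u sg s) t Th" "sv_rep (x2 s) (drift X2 u2 b2 s) (diffusion X2 u2 sg2 s) t Th2"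
 shows "(NN M (%z. nsq (Th z - Th2 z))) <= 81 * (data_diff x b sg x2 b2 sg2 s +
 (NI {t0<..<t} (%r. (al s + ka s r) * pair_norm (%r z. X r z - X2 r z) (%r z. u r z - u2 r z) r)))"
proof -
 note m1 = processD(1)[OF X(1)] processD(1)[OF u(1)] and m2 = processD(1)[OF X(2)] processD(1)[OF u(2)]
 let ?dX = "%r z. X r z - X2 r z" and ?du = "%r z. u r z - u2 r z"
 let ?db = "%s r z. b s r z - b2 s r z" and ?ds = "%s r z. sg s r z - sg2 s r z"
 let ?n = "pair_norm ?dX ?du"
 have dXm: "(%p. ?dX (fst p) (snd p)) : BM (tprod M)" and dum: "(%p. ?du (fst p) (snd p)) : BM (tprod M)"
 using m1 m2 by measurable
 note [measurable] = pair_norm_measurable[OF dXm dum]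
 have dbm: "(%p. ?db s (fst p) (snd p)) : BM (tprod M)" and dsm: "(%p. ?ds s (fst p) (snd p)) : BM (tprod M)"
 using field_section[OF b(1), of s] field_section[OF b(2), of s] field_section[OF sg(1), of s] field_section[OF sg(2), of s] by measurable
 obtain Y Y2 where Y: "has_ito_integral M W F t0 t (diffusion X u sg s) Y" "AE z in M. Th z = x s + (LINT r:{t0<..<t}|lborel. drift X u b s r z) + Y z"
 "has_ito_integral M W F t0 t (diffusion X2 u2 sg2 s) Y2" "AE z in M. Th2 z = x2 s + (LINT r:{t0<..<t}|lborel. drift X2 u2 b2 s r z) + Y2 z"
 using rep by (auto simp: sv_rep_def)
 have "(NN M (%z. nsq (Th z - Th2 z))) <= 27 * (nsq (x s - x2 s) +
 (NN M (%z. (NI {t0<..<t} (%r. ennreal (norm (drift X u b s r z - drift X2 u2 b2 s r z))))^2)) +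
 (NI {t0<..<t} (%r. (NN M (%z. nsq (diffusion X u sg s r z - diffusion X2 u2 sg2 s r z))))))"
 using t by (intro ito_representation_diff[OF t0(1) Y(1,3,2,4)] drift_measurable[OF m1] drift_measurable[OF m2] field_section b sg drift_integrable X u s) auto
 also have "... <= 27 * (3 * nsq (x s - x2 s) +
 3 * (al s * (NI {t0<..<t} (%r. ?n r)) + field_L21 ?db s) +
 3 * ((NI {t0<..<t} (%r. ka s r * ?n r)) + field_L2 ?ds s))"
 proof (intro ml_mono add_mono)
 show "nsq (x s - x2 s) <= 3 * nsq (x s - x2 s)"
 using mr_mono[of 1 "3::ennreal" "nsq (x s - x2 s)"] by simp
 have e1: "drift X u b s r z - drift X2 u2 b2 s r z = A s r *v ?dX r z + B s r *v ?du r z + ?db s r z" for r z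
 by (simp add: drift_def matrix_vector_mult_diff_distrib)
 have e2: "diffusion X u sg s r z - diffusion X2 u2 sg2 s r z = C s r *v ?dX r z + D s r *v ?du r z + ?ds s r z" for r z
 by (simp add: diffusion_def matrix_vector_mult_diff_distrib)
 have "(NN M (%z. (NI {t0<..<t} (%r. ennreal (norm (drift X u b s r z - drift X2 u2 b2 s r z))))^2)) <=
 3 * ((NI {t0<..<t} (%r. ennreal ((norm (A s r))^2 + (norm (B s r))^2))) * (NI {t0<..<t} (%r. ?n r)) +
 (NN M (%z. (NI {t0<..<t} (%r. ennreal (norm (?db s r z))))^2)))"
 unfolding e1 pair_norm_def by (rule affine_drift_bound[OF _ _ dXm dum dbm]) measurable
 also have "... <= 3 * (al s * (NI {t0<..<t} (%r. ?n r)) + field_L21 ?db s)"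
 unfolding al_def field_L21_def using t t0
 by (intro ml_mono add_mono mr_mono nn_mono power_mono) (auto simp: ind_def)
 finally show "(NN M (%z. (NI {t0<..<t} (%r. ennreal (norm (drift X u b s r z - drift X2 u2 b2 s r z))))^2)) <=
 3 * (al s * (NI {t0<..<t} (%r. ?n r)) + field_L21 ?db s)" .
 have "(NI {t0<..<t} (%r. (NN M (%z. nsq (diffusion X u sg s r z - diffusion X2 u2 sg2 s r z))))) <=
 3 * ((NI {t0<..<t} (%r. ka s r * ?n r)) + (NI {t0<..<t} (%r. (nn2 M (?ds s r)))))"
 unfolding e2 ka_def pair_norm_def by (rule affine_diffusion_bound[OF _ _ dXm dum dsm]) measurable
 also have "... <= 3 * ((NI {t0<..<t} (%r. ka s r * ?n r)) + field_L2 ?ds s)"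
 unfolding field_L2_def using t by (intro ml_mono add_mono order_refl nn_mono) (auto simp: ind_def)
 finally show "(NI {t0<..<t} (%r. (NN M (%z. nsq (diffusion X u sg s r z - diffusion X2 u2 sg2 s r z))))) <=
 3 * ((NI {t0<..<t} (%r. ka s r * ?n r)) + field_L2 ?ds s)" .
 qed auto
 also have "... = 81 * (data_diff x b sg x2 b2 sg2 s + (al s * (NI {t0<..<t} (%r. ?n r)) + (NI {t0<..<t} (%r. ka s r * ?n r))))"
 unfolding data_diff_def by (rule collect_81)
 also have "al s * (NI {t0<..<t} (%r. ?n r)) + (NI {t0<..<t} (%r. ka s r * ?n r)) = (NI {t0<..<t} (%r. (al s + ka s r) * ?n r))"
 proof -
 have "al s * (NI {t0<..<t} (%r. ?n r)) = (NN lborel (%r. al s * (?n r * indicator {t0<..<t} r)))"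
 by (rule nn_cmult[symmetric]) measurable
 then show ?thesis
 by (simp only:) (subst nn_add[symmetric], auto simp: distrib_right mult.assoc intro!: nn_cong)
 qed
 finally show ?thesis .
qed

end

section \<open>The difference estimate for one step\<close>

lemma collect_step_bounds:
 fixes a q g D c N vd :: "'c::comm_semiring_1"
 shows "a + 3 * (q * a + 3 * (g * (81 * (D + c * N))) + vd) = (1 + 3 * q) * a + 729 * (g * D) + (729 * c) * (g * N) + 3 * vd"
 by (simp add: algebra_simps)

lemma collect_kernel:
 fixes K a g n i :: "'c::comm_semiring_1"
 shows "K * (a * n * i + g * (n * i)) = K * (a + g) * n * i"
 by (simp add: algebra_simps)

text \<open>Here \<open>a\<close> and \<open>u\<close> are the second moments of the state and
  control differences. The state bound enters twice, directly and through the gain in the control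
  equation, and \<open>K\<close> is chosen to dominate all resulting coefficients.\<close>

lemma combine_step_bounds:
 fixes a u dd J g De Nt vd :: ennreal and xx m0 :: real
 assumes "a <= 81 * (dd + J)" and "u <= 3 * (ennreal (xx^2) * a + 3 * (g * (81 * (De + ennreal (2 * m0) * Nt))) + vd)" and m0: "0 <= m0"
 defines "K \<equiv> 1458 * (1 + xx^2) * (1 + m0)"
 shows "a + u <= ennreal K * (dd + g * De + vd) + ennreal K * (J + g * Nt)"
proof -
 have K1: "81 + 243 * xx^2 <= K" "729 <= K" "1458 * m0 <= K" "3 <= K"
 proof -
 have x: "0 <= xx^2 * m0" "0 <= xx^2" using m0 by auto
 have "K = 1458 + 1458 * xx^2 + 1458 * m0 + 1458 * (xx^2 * m0)" by (simp add: K_def algebra_simps)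
 then show "81 + 243 * xx^2 <= K" "729 <= K" "1458 * m0 <= K" "3 <= K" using x m0 by simp_all
 qed
 have "a + u <= a + 3 * (ennreal (xx^2) * a + 3 * (g * (81 * (De + ennreal (2 * m0) * Nt))) + vd)"
 by (rule add_left_mono[OF assms(2)])
 also have "... = (1 + 3 * ennreal (xx^2)) * a + 729 * (g * De) + (729 * ennreal (2 * m0)) * (g * Nt) + 3 * vd"
 by (rule collect_step_bounds)
 also have "... <= (1 + 3 * ennreal (xx^2)) * (81 * (dd + J)) + 729 * (g * De) + (729 * ennreal (2 * m0)) * (g * Nt) + 3 * vd"
 by (intro add_mono ml_mono assms(1) order_refl) auto
 also have "... = ennreal (81 + 243 * xx^2) * (dd + J) + ennreal 729 * (g * De) + ennreal (1458 * m0) * (g * Nt) + ennreal 3 * vd"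
 proof -
 have 1: "(1 + 3 * ennreal (xx^2)) * 81 = ennreal (81 + 243 * xx^2)"
 by (simp add: ennreal_mult ennreal_plus distrib_right mult.assoc mult.commute)
 have 2: "729 * ennreal (2 * m0) = ennreal (1458 * m0)"
 using m0 by (simp add: ennreal_mult mult.assoc[symmetric])
 show ?thesis by (simp only: 1 2 mult.assoc[symmetric] ennreal_numeral)
 qed
 also have "... <= ennreal K * (dd + J) + ennreal K * (g * De) + ennreal K * (g * Nt) + ennreal K * vd"
 by (intro add_mono mr_mono ennreal_leI K1) auto
 also have "... = ennreal K * (dd + g * De + vd) + ennreal K * (J + g * Nt)"
 by (simp add: algebra_simps)
 finally show ?thesis .
qed

context svie
begin

lemma gain_bound:
 fixes Z :: "real => 'a => real ^ 'd"
 assumes Z[measurable]: "joint M Z"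
 shows "(NN M (%z. (NI {t<..<T} (%s. ennreal (norm (Ga s t *v Z s z))))^2)) <=
 3 * (gn t * (NI {t<..<T} (%s. (nn2 M (Z s)))))"
proof -
 have "(NN M (%z. (NI {t<..<T} (%s. ennreal (norm (Ga s t *v Z s z + (0 :: real ^ 'l ^ 'l) *v 0 + 0))))^2)) <=
 3 * ((NI {t<..<T} (%s. ennreal ((norm (Ga s t))^2 + (norm (0 :: real ^ 'l ^ 'l))^2))) *
 (NI {t<..<T} (%s. (NN M (%z. ennreal ((norm (Z s z))^2 + (norm (0 :: real ^ 'l))^2))))) +
 (NN M (%z. (NI {t<..<T} (%s. ennreal (norm (0 :: real ^ 'l))))^2)))"
 by (rule affine_drift_bound[of "%s. Ga s t" "%_. 0" Z "%_ _. 0" "%_ _. 0"]) measurable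
 then show ?thesis by (simp add: gn_def)
qed

lemma gain_integrable:
 fixes Z :: "real => 'a => real ^ 'd"
 assumes Z[measurable]: "joint M Z"
 and fin: "gn t < \<infinity>" "(NI {t<..<T} (%s. (nn2 M (Z s)))) < \<infinity>"
 shows "AE z in M. set_integrable lborel {t<..<T} (%s. Ga s t *v Z s z)"
proof -
 have gm: "(%p. Ga (fst p) t *v Z (fst p) (snd p)) : BM (tprod M)" by measurable
 have "3 * (gn t * (NI {t<..<T} (%s. (nn2 M (Z s))))) < \<infinity>"
 using fin by (simp add: ennreal_mult_less_top)
 from le_less_trans[OF gain_bound[OF Z, of t] this]
 have "(NN M (%z. (NI {t<..<T} (%s. ennreal (norm (Ga s t *v Z s z))))^2)) ~= \<infinity>" by simp
 moreover have "(%z. NI {t<..<T} (%s. ennreal (norm (Ga s t *v Z s z)))) : BM M"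
 by (rule nn_integral_measurable_omega) measurable
 ultimately have "AE z in M. (NI {t<..<T} (%s. ennreal (norm (Ga s t *v Z s z))))^2 ~= \<infinity>"
 by (intro nn_integral_PInf_AE) auto
 then show ?thesis
 using AE_space
 proof eventually_elim
 case (elim z)
 have m: "(%s. Ga s t *v Z s z) : BM lborel" using section_measurable[OF gm elim(2)] by simp
 have "(NN lborel (%s. ennreal (norm (indr {t<..<T} s *\<^sub>R (Ga s t *v Z s z))))) = (NI {t<..<T} (%s. ennreal (norm (Ga s t *v Z s z))))"
 by (intro nn_cong) (auto simp: ind_def)
 also have "... < \<infinity>" using elim(1) by (auto simp: less_top[symmetric] power2_eq_square ennreal_mult_eq_top_iff)
 finally show ?case unfolding set_integrable_def using m by (intro integrableI_bounded) auto
 qed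
qed

lemma response_slice:
 fixes Th :: "real => real => 'a => real ^ 'd"
 assumes m: "joint3 M Th"
 shows "(%p. Th (fst p) t (snd p)) : BM (tprod M)"
proof -
 have "(%p. (fst p, (t, snd p))) : measurable (tprod M) (tprod (tprod M))" by measurable
 from mcomp[OF this m] show ?thesis by simp
qed

lemma response_norm_measurable:
 fixes Th :: "real => real => 'a => real ^ 'd"
 assumes m: "joint3 M Th"
 shows "(%q. nn2 M (Th (fst q) (snd q))) : BM (tprod lborel)"
proof -
 have "(%q. (fst (fst q), (snd (fst q), snd q))) : measurable ((tprod lborel) \<Otimes>\<^sub>M M) (tprod (tprod M))" by measurable
 from mcomp[OF this m]
 have [measurable]: "(%q. Th (fst (fst q)) (snd (fst q)) (snd q)) : BM ((tprod lborel) \<Otimes>\<^sub>M M)" by simp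
 have "(%q. nsq (Th (fst (fst q)) (snd (fst q)) (snd q))) : BM ((tprod lborel) \<Otimes>\<^sub>M M)"
 by measurable
 from borel_measurable_nn_integral_fst[OF this] show ?thesis by simp
qed

text \<open>Tonelli on the triangle: integrability in \<open>t < s\<close> for given
  \<open>s\<close> becomes integrability in \<open>s > t\<close> for almost every \<open>t\<close>,
  the direction in which the control equation reads Theta.\<close>

lemma response_slice_finite:
 assumes "response Th"
 shows "AEI t0 T (%t. (NI {t<..<T} (%s. (nn2 M (Th s t)))) < \<infinity>)"
proof -
 have m: "joint3 M Th"
 and fin: "(NI {t0<..<T} (%s. (NI {t0<..<s} (%t. (nn2 M (Th s t)))))) < \<infinity>"
 using assms by (auto simp: response_def)
 let ?q = "%s t. nn2 M (Th s t)"
 note qm[measurable] = response_norm_measurable[OF m]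
 let ?g = "%s t. ?q s t * indicator {p. t0 < snd p & snd p < fst p & fst p < T} (s, t)"
 have gm: "(%p. ?g (fst p) (snd p)) : BM (tprod lborel)" by measurable
 have gm': "(%p. ?g (snd p) (fst p)) : BM (tprod lborel)"
 using mcomp[OF measurable_pair_swap' gm] by (simp add: case_prod_beta')
 have "(NI {t0<..<T} (%s. (NI {t0<..<s} (%t. ?q s t)))) = (NN lborel (%s. NN lborel (%t. ?g s t)))"
 proof (rule nn_cong)
 fix s :: real
 show "(NI {t0<..<s} (%t. ?q s t)) * indicator {t0<..<T} s = (NN lborel (%t. ?g s t))"
 proof (cases "t0 < s & s < T")
 case True
 then have "(NN lborel (%t. ?g s t)) = (NI {t0<..<s} (%t. ?q s t))" by (intro nn_cong) (auto simp: ind_def)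
 then show ?thesis using True by simp
 next
 case False
 then have "?g s t = 0" for t by (auto simp: ind_def)
 then have "(NN lborel (%t. ?g s t)) = 0" by (simp only: nn_integral_const mult_zero_left)
 then show ?thesis using False by simp
 qed
 qed
 also have "... = (NN lborel (%t. NN lborel (%s. ?g s t)))"
 by (rule lborel_pair.Fubini'[symmetric]) (use gm' in \<open>simp add: case_prod_beta'\<close>)
 finally have "(NN lborel (%t. (NN lborel (%s. ?g s t)))) ~= \<infinity>" using fin by simp
 moreover have "(%t. NN lborel (%s. ?g s t)) : BM lborel"
 using lb_nn_fst[OF gm'] by simp
 ultimately have "AE t in lborel. (NN lborel (%s. ?g s t)) ~= \<infinity>" by (intro nn_integral_PInf_AE)
 then show ?thesis
 proof (eventually_elim, intro impI)
 fix t assume h: "(NN lborel (%s. ?g s t)) ~= \<infinity>" "t : {t0<..<T}"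
 have "(NI {t<..<T} (%s. ?q s t)) = (NN lborel (%s. ?g s t))"
 using h(2) by (intro nn_cong) (auto simp: ind_def)
 then show "(NI {t<..<T} (%s. ?q s t)) < \<infinity>" using h(1) by (simp add: less_top)
 qed
qed

text \<open>This is the causality of the feedback: although \<open>s\<close> ranges over the future
  of \<open>t\<close>, the input enters only at times \<open>r < t\<close>. Tonelli integrates
  \<open>s\<close> out first, and \<open>al\<close> and \<open>ka\<close> each contribute mass at
  most \<open>m0\<close>.\<close>

lemma kernel_response_bound:
 fixes n :: "real => ennreal"
 assumes n[measurable]: "n : BM borel" and t: "t : {t0<..<T}"
 shows "(NI {t<..<T} (%s. (NI {t0<..<t} (%r. (al s + ka s r) * n r)))) <= ennreal (2 * m0) * (NI {t0<..<t} n)"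
proof -
 let ?g = "%s r. (al s + ka s r) * n r * indicator {t0<..<t} r * indicator {t<..<T} s"
 have gm[measurable]: "(%p. ?g (fst p) (snd p)) : BM (tprod lborel)" by measurable
 have gm': "(%p. ?g (snd p) (fst p)) : BM (tprod lborel)"
 using mcomp[OF measurable_pair_swap' gm] by (simp add: case_prod_beta')
 have "(NI {t<..<T} (%s. (NI {t0<..<t} (%r. (al s + ka s r) * n r)))) = (NN lborel (%s. NN lborel (%r. ?g s r)))"
 by (intro nn_cong nn_integral_multc[symmetric]) measurable
 also have "... = (NN lborel (%r. NN lborel (%s. ?g s r)))"
 by (rule lborel_pair.Fubini'[symmetric]) (use gm' in \<open>simp add: case_prod_beta'\<close>)
 also have "... <= (NN lborel (%r. ennreal (2 * m0) * (n r * indicator {t0<..<t} r)))"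
 proof (rule nn_mono_AE, use kp in eventually_elim)
 fix r assume k: "r : {0<..<T} --> (NI {r<..<T} (%t. ennreal ((norm (C t r))^2 + (norm (D t r))^2))) <= ennreal m0"
 show "(NN lborel (%s. ?g s r)) <= ennreal (2 * m0) * (n r * indicator {t0<..<t} r)"
 proof (cases "r : {t0<..<t}")
 case True
 have "(NN lborel (%s. ?g s r)) = (NN lborel (%s. n r * (al s * indicator {t<..<T} s + ka s r * indicator {t<..<T} s)))"
 using True by (intro nn_cong) (simp add: algebra_simps)
 also have "... = n r * ((NI {t<..<T} al) + (NI {t<..<T} (%s. ka s r)))"
 by (subst nn_cmult, measurable, subst nn_add) auto
 also have "... <= n r * (ennreal m0 + ennreal m0)"
 proof (intro ml_mono add_mono)
 have "(NI {t<..<T} al) <= (NI {0<..<T} al)"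
 using t t0 by (intro nn_mono) (auto simp: ind_def)
 then show "(NI {t<..<T} al) <= ennreal m0" using ap unfolding al_def by (rule order_trans)
 have "(NI {t<..<T} (%s. ka s r)) <= (NI {r<..<T} (%s. ka s r))"
 using True by (intro nn_mono) (auto simp: ind_def)
 also have "... <= ennreal m0" using k True t t0 unfolding ka_def by auto
 finally show "(NI {t<..<T} (%s. ka s r)) <= ennreal m0" .
 qed auto
 also have "... = ennreal (2 * m0) * (n r * indicator {t0<..<t} r)"
 using True m0 by (simp add: ennreal_plus[symmetric] mult.commute del: ennreal_plus)
 finally show ?thesis .
 qed simp
 qed
 also have "... = ennreal (2 * m0) * (NI {t0<..<t} n)" by (rule nn_cmult) measurable
 finally show ?thesis .
qed

lemma data_diff_measurable:
 assumes "data x b sg v" "data x2 b2 sg2 v2"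
 shows "data_diff x b sg x2 b2 sg2 : BM borel"
proof -
 have [measurable]: "x : BM borel" "x2 : BM borel"
 "joint3 M b"
 "joint3 M b2"
 "joint3 M sg"
 "joint3 M sg2"
 using assms by (auto simp: data_def field_def)
 have [measurable]: "field_L21 (%s r z. b s r z - b2 s r z) : BM borel"
 by (rule field_norm_measurable) measurable
 have [measurable]: "field_L2 (%s r z. sg s r z - sg2 s r z) : BM borel"
 by (rule field_norm_measurable) measurable
 show ?thesis unfolding data_diff_def[abs_def] by measurable
qed

text \<open>The state is estimated by \<open>sv_rep_diff\<close> on the diagonal. For the control,
  the same bound off the diagonal is integrated over \<open>s > t\<close> and multiplied by the gain
  mass \<open>gn t\<close>. This explains the kernel \<open>al + ka + gn\<close>, and the term in
  which \<open>gn t\<close> multiplies the total data difference.\<close>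

theorem step_difference:
 assumes data: "data x b sg v" "data x2 b2 sg2 v2"
 and X: "process X" "process X2" and u: "process u" "process u2"
 and X': "joint M X'" "joint M X2'"
 and u': "joint M u'" "joint M u2'"
 and Th: "response Th" "response Th2"
 and st: "step x b sg v X u X' Th u'" "step x2 b2 sg2 v2 X2 u2 X2' Th2 u2'"
 defines "n \<equiv> pair_norm (%r z. X r z - X2 r z) (%r z. u r z - u2 r z)"
 and "dd \<equiv> data_diff x b sg x2 b2 sg2"
 shows "AEI t0 T (%t. pair_norm (%r z. X' r z - X2' r z) (%r z. u' r z - u2' r z) t <=
 ennreal step_const * (dd t + gn t * (NI {t0<..<T} dd) + (NN M (%z. nsq (v t z - v2 t z)))) +
 (NI {t0<..<t} (%r. step_kernel t r * n r)))"
proof -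
 have fb: "joint3 M b"
 "joint3 M b2"
 and fs: "joint3 M sg"
 "joint3 M sg2"
 and vm: "joint M v" "joint M v2"
 and bf: "(NI {t0<..<T} (field_L21 b)) < \<infinity>" "(NI {t0<..<T} (field_L21 b2)) < \<infinity>"
 using data by (auto simp: data_def field_def process_def)
 have Thm: "joint3 M Th"
 "joint3 M Th2"
 using Th by (auto simp: response_def)
 have ddm[measurable]: "dd : BM borel" unfolding dd_def by (rule data_diff_measurable[OF data])
 have nm[measurable]: "n : BM borel"
 unfolding n_def using processD(1)[OF X(1)] processD(1)[OF X(2)] processD(1)[OF u(1)] processD(1)[OF u(2)]
 by (intro pair_norm_measurable borel_measurable_diff)
 have alf: "AEI t0 T (%s. al s < \<infinity>)" using al_finite by eventually_elim (use t0 in auto)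
 have gnf: "AEI t0 T (%s. gn s < \<infinity>)" using gn_finite by eventually_elim (use t0 in auto)
 note fin = alf gnf AE_finite_of_nn_integral[OF field_norm_measurable(1)[OF fb(1)] bf(1)] AE_finite_of_nn_integral[OF field_norm_measurable(1)[OF fb(2)] bf(2)]
 let ?p = "%s t. NN M (%z. nsq (Th s t z - Th2 s t z))"
 let ?J = "%s t. NI {t0<..<t} (%r. (al s + ka s r) * n r)"
 have E1: "AEI t0 T (%t. (NN M (%z. nsq (X' t z - X2' t z))) <= 81 * (dd t + ?J t t))"
 proof -
 have "AEI t0 T (%t. sv_rep (x t) (drift X u b t) (diffusion X u sg t) t (X' t))"
 "AEI t0 T (%t. sv_rep (x2 t) (drift X2 u2 b2 t) (diffusion X2 u2 sg2 t) t (X2' t))"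
 using st by (auto simp: step_def)
 then show ?thesis using fin(1,3,4)
 proof eventually_elim
 case (elim t)
 show ?case unfolding dd_def n_def
 by (intro impI, rule sv_rep_diff[OF X u fb fs]) (use elim in auto)
 qed
 qed
 have E2: "AEI t0 T (%s. (ALL t:{t0<..<s}. ?p s t <= 81 * (dd s + ?J s t)))"
 proof -
 have "AEI t0 T (%s. (ALL t:{t0<..<s}. sv_rep (x s) (drift X u b s) (diffusion X u sg s) t (Th s t)))"
 "AEI t0 T (%s. (ALL t:{t0<..<s}. sv_rep (x2 s) (drift X2 u2 b2 s) (diffusion X2 u2 sg2 s) t (Th2 s t)))"
 using st by (auto simp: step_def)
 then show ?thesis using fin(1,3,4)
 proof eventually_elim
 case (elim s)
 show ?case unfolding dd_def n_def
 by (intro impI ballI, rule sv_rep_diff[OF X u fb fs]) (use elim in auto)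
 qed
 qed
 have Jm: "(%s. ?J s t) : BM borel" for t
 proof -
 have "(%p. (al (fst p) + ka (fst p) (snd p)) * n (snd p) * indicator {t0<..<t} (snd p)) : BM (tprod lborel)" by measurable
 from lb_nn_fst[OF this] show ?thesis by simp
 qed
 \<comment> \<open>\<open>kernel_response_bound\<close> leaves only the input up to time
   \<open>t\<close>, so the control estimate stays of Volterra type.\<close>
 have E3: "(NI {t<..<T} (%s. ?p s t)) <= 81 * ((NI {t0<..<T} dd) + ennreal (2 * m0) * (NI {t0<..<t} n))"
 if t: "t : {t0<..<T}" for t
 proof -
 note [measurable] = Jm[of t]
 have "(NI {t<..<T} (%s. ?p s t)) <= (NN lborel (%s. 81 * (dd s * indicator {t<..<T} s + ?J s t * indicator {t<..<T} s)))"
 proof (rule nn_mono_AE, use E2 in eventually_elim)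
 fix s assume "s : {t0<..<T} --> (ALL t:{t0<..<s}. ?p s t <= 81 * (dd s + ?J s t))"
 then show "?p s t * indicator {t<..<T} s <= 81 * (dd s * indicator {t<..<T} s + ?J s t * indicator {t<..<T} s)"
 using t by (cases "s : {t<..<T}") auto
 qed
 also have "... = 81 * ((NI {t<..<T} dd) + (NI {t<..<T} (%s. ?J s t)))"
 by (subst nn_cmult, measurable, subst nn_add) auto
 also have "... <= 81 * ((NI {t0<..<T} dd) + ennreal (2 * m0) * (NI {t0<..<t} n))"
 using t by (intro ml_mono add_mono kernel_response_bound[OF nm t] nn_mono) (auto simp: ind_def)
 finally show ?thesis .
 qed
 have U: "AEI t0 T (%t. (AE z in M. u' t z = XX t *v X' t z + (LINT s:{t<..<T}|lborel. Ga s t *v Th s t z) + v t z))"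
 "AEI t0 T (%t. (AE z in M. u2' t z = XX t *v X2' t z + (LINT s:{t<..<T}|lborel. Ga s t *v Th2 s t z) + v2 t z))"
 using st by (auto simp: step_def)
 show ?thesis
 using E1 U fin(2) response_slice_finite[OF Th(1)] response_slice_finite[OF Th(2)]
 proof eventually_elim
 case (elim t)
 show ?case
 proof
 assume t: "t : {t0<..<T}"
 let ?dX = "%z. X' t z - X2' t z"
 let ?I = "%z. LINT s:{t<..<T}|lborel. Ga s t *v Th s t z" and ?I2 = "%z. LINT s:{t<..<T}|lborel. Ga s t *v Th2 s t z"
 let ?a = "nn2 M ?dX"
 let ?vd = "NN M (%z. nsq (v t z - v2 t z))"
 note [measurable] = time_section_measurable[OF X'(1), of t] time_section_measurable[OF X'(2), of t] time_section_measurable[OF u'(1), of t]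
 time_section_measurable[OF u'(2), of t] time_section_measurable[OF vm(1), of t] time_section_measurable[OF vm(2), of t]
 note Tht[measurable] = response_slice[OF Thm(1), of t] response_slice[OF Thm(2), of t]
 have [measurable]: "?I : BM M" by (rule integral_measurable_omega) measurable
 have [measurable]: "?I2 : BM M" by (rule integral_measurable_omega) measurable
 have i1: "AE z in M. set_integrable lborel {t<..<T} (%s. Ga s t *v Th s t z)"
 by (rule gain_integrable[OF Tht(1)]) (use elim t in auto)
 have i2: "AE z in M. set_integrable lborel {t<..<T} (%s. Ga s t *v Th2 s t z)"
 by (rule gain_integrable[OF Tht(2)]) (use elim t in auto)
 have "(NN M (%z. nsq (u' t z - u2' t z))) = (NN M (%z. nsq (XX t *v ?dX z + (?I z - ?I2 z) + (v t z - v2 t z))))"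
 proof (rule nn_cong_AE)
 show "AE z in M. nsq (u' t z - u2' t z) = nsq (XX t *v ?dX z + (?I z - ?I2 z) + (v t z - v2 t z))"
 using elim(2)[rule_format, OF t] elim(3)[rule_format, OF t]
 proof eventually_elim
 case (elim z)
 then have "u' t z - u2' t z = XX t *v ?dX z + (?I z - ?I2 z) + (v t z - v2 t z)"
 by (simp add: matrix_vector_mult_diff_distrib)
 then show ?case by simp
 qed
 qed
 also have "... <= 3 * ((NN M (%z. nsq (XX t *v ?dX z))) + (NN M (%z. nsq (?I z - ?I2 z))) + ?vd)"
 by (rule nn_integral_norm_add3_sq) measurable
 also have "... <= 3 * (ennreal (xx^2) * ?a + 3 * (gn t * (81 * ((NI {t0<..<T} dd) + ennreal (2 * m0) * (NI {t0<..<t} n)))) + ?vd)"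
 proof (intro ml_mono add_mono order_refl)
 have "(NN M (%z. nsq (XX t *v ?dX z))) <= (NN M (%z. ennreal (xx^2) * nsq (?dX z)))"
 proof (rule nn_mono)
 fix z
 have "norm (XX t *v ?dX z) <= xx * norm (?dX z)"
 by (rule order_trans[OF norm_matrix_vector_le mr_mono[OF XX(2)]]) simp
 then have "(norm (XX t *v ?dX z))^2 <= xx^2 * (norm (?dX z))^2" unfolding power_mult_distrib[symmetric] by (rule power_mono) simp
 then show "nsq (XX t *v ?dX z) <= ennreal (xx^2) * nsq (?dX z)"
 by (simp add: ennreal_mult[symmetric] ennreal_leI)
 qed
 also have "... = ennreal (xx^2) * ?a" by (rule nn_cmult) measurable
 finally show "(NN M (%z. nsq (XX t *v ?dX z))) <= ennreal (xx^2) * ?a" .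
 have "(NN M (%z. nsq (?I z - ?I2 z))) <= (NN M (%z. (NI {t<..<T} (%s. ennreal (norm (Ga s t *v (Th s t z - Th2 s t z)))))^2))"
 proof (rule nn_mono_AE, use i1 i2 in eventually_elim)
 fix z assume i: "set_integrable lborel {t<..<T} (%s. Ga s t *v Th s t z)" "set_integrable lborel {t<..<T} (%s. Ga s t *v Th2 s t z)"
 have "ennreal (norm (?I z - ?I2 z)) = ennreal (norm (LINT s|lborel. indr {t<..<T} s *\<^sub>R (Ga s t *v Th s t z - Ga s t *v Th2 s t z)))"
 using set_integral_diff(2)[OF i] by (simp add: slint_def)
 also have "... <= (NN lborel (%s. ennreal (norm (indr {t<..<T} s *\<^sub>R (Ga s t *v Th s t z - Ga s t *v Th2 s t z)))))"
 using set_integral_diff(1)[OF i] unfolding set_integrable_def by (rule integral_norm_bound_ennreal)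
 also have "... = (NI {t<..<T} (%s. ennreal (norm (Ga s t *v (Th s t z - Th2 s t z)))))"
 by (intro nn_cong) (auto simp: ind_def matrix_vector_mult_diff_distrib)
 finally have "(ennreal (norm (?I z - ?I2 z)))^2 <= (NI {t<..<T} (%s. ennreal (norm (Ga s t *v (Th s t z - Th2 s t z)))))^2"
 by (rule power_mono) simp
 then show "nsq (?I z - ?I2 z) <= (NI {t<..<T} (%s. ennreal (norm (Ga s t *v (Th s t z - Th2 s t z)))))^2"
 by (simp add: ennreal_power)
 qed
 also have "... <= 3 * (gn t * (NI {t<..<T} (%s. ?p s t)))"
 by (rule gain_bound[of "%s z. Th s t z - Th2 s t z"]) measurable
 also have "... <= 3 * (gn t * (81 * ((NI {t0<..<T} dd) + ennreal (2 * m0) * (NI {t0<..<t} n))))"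
 by (intro ml_mono E3 t) auto
 finally show "(NN M (%z. nsq (?I z - ?I2 z))) <= 3 * (gn t * (81 * ((NI {t0<..<T} dd) + ennreal (2 * m0) * (NI {t0<..<t} n))))" .
 qed auto
 finally have ub: "(NN M (%z. nsq (u' t z - u2' t z))) <= 3 * (ennreal (xx^2) * ?a + 3 * (gn t * (81 * ((NI {t0<..<T} dd) + ennreal (2 * m0) * (NI {t0<..<t} n)))) + ?vd)" .
 have ab: "?a <= 81 * (dd t + ?J t t)" using elim(1) t by blast
 have "pair_norm (%r z. X' r z - X2' r z) (%r z. u' r z - u2' r z) t = ?a + (NN M (%z. nsq (u' t z - u2' t z)))"
 using X' u' by (intro pair_norm_eq borel_measurable_diff)
 also have "... <= ennreal step_const * (dd t + gn t * (NI {t0<..<T} dd) + ?vd) + ennreal step_const * (?J t t + gn t * (NI {t0<..<t} n))"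
 unfolding step_const_def by (rule combine_step_bounds[OF ab ub m0])
 also have "ennreal step_const * (?J t t + gn t * (NI {t0<..<t} n)) = (NI {t0<..<t} (%r. step_kernel t r * n r))"
 proof -
 have "gn t * (NI {t0<..<t} n) = (NN lborel (%r. gn t * (n r * indicator {t0<..<t} r)))"
 by (rule nn_cmult[symmetric]) measurable
 then have e: "?J t t + gn t * (NI {t0<..<t} n) = (NN lborel (%r. (al t + ka t r) * n r * indicator {t0<..<t} r + gn t * (n r * indicator {t0<..<t} r)))"
 by (subst nn_add) auto
 have "(NI {t0<..<t} (%r. step_kernel t r * n r)) = (NN lborel (%r. ennreal step_const * ((al t + ka t r) * n r * indicator {t0<..<t} r + gn t * (n r * indicator {t0<..<t} r))))"
 unfolding step_kernel_def collect_kernel ..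
 also have "... = ennreal step_const * (NN lborel (%r. (al t + ka t r) * n r * indicator {t0<..<t} r + gn t * (n r * indicator {t0<..<t} r)))"
 by (rule nn_cmult) measurable
 finally show ?thesis unfolding e by (rule sym)
 qed
 finally show "pair_norm (%r z. X' r z - X2' r z) (%r z. u' r z - u2' r z) t <=
 ennreal step_const * (dd t + gn t * (NI {t0<..<T} dd) + ?vd) + (NI {t0<..<t} (%r. step_kernel t r * n r))" .
 qed
 qed
qed

end

section \<open>Existence of one step\<close>

lemma rational_sequence_to:
 fixes t :: real
 assumes "t0 < T" "t : {t0..T}"
 shows "EX q. (ALL n. q n : {t0..T} \<inter> \<rat>) & q ~~> t"
proof -
 have "EX q. q : {t0..T} \<inter> \<rat> & norm (q - t) <= 1 / real (Suc n)" for n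
 proof -
 have "max t0 (t - 1 / real (Suc n)) < min T (t + 1 / real (Suc n))"
 proof -
 have "0 < 1 / real (Suc n)" by simp
 moreover have "max t0 (t - e) < min T (t + e)" if "0 < e" for e :: real using assms that by auto
 ultimately show ?thesis by blast
 qed
 from Rats_dense_in_real[OF this] obtain q where "q : \<rat>" "max t0 (t - 1 / real (Suc n)) < q" "q < min T (t + 1 / real (Suc n))" by blast
 then show ?thesis by (intro exI[of _ q]) (auto simp: abs_le_iff)
 qed
 then obtain q where q: "\<And>n. q n : {t0..T} \<inter> \<rat>" "\<And>n. norm (q n - t) <= 1 / real (Suc n)" by metis
 have "(%n. q n - t) ~~> 0"
 by (rule Lim_null_comparison[OF _ LIMSEQ_inverse_real_of_nat]) (use q(2) in \<open>simp add: inverse_eq_divide\<close>)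
 then show ?thesis using q(1) LIM_zero_cancel by blast
qed

text \<open>Uniform continuity along rational times is a countable condition, so the set
  \<open>G\<close> of paths having it is measurable. On \<open>G\<close> the path is extended by
  limits along fixed rational sequences, elsewhere it is set to 0. Thus every path becomes
  continuous while measurability at each time is kept.\<close>

lemma continuous_modification:
 fixes ph :: "real => 'z => 'b::euclidean_space"
 assumes T: "t0 < T" and ph: "\<And>t. t : {t0..T} ==> ph t : BM Z"
 shows "EX psi. (ALL t. psi t : BM Z) & (ALL z:space Z. continuous_on UNIV (%t. psi t z)) &
 (ALL z:space Z. continuous_on {t0..T} (%t. ph t z) --> (ALL t:{t0..T}. psi t z = ph t z))"
proof -
 let ?Q = "{t0..T} \<inter> \<rat>"
 define uc where "uc n m z \<longleftrightarrow> (ALL q:?Q. ALL q':?Q. \<bar>q - q'\<bar> < 1 / real (Suc m) --> norm (ph q z - ph q' z) <= 1 / real (Suc n))" for n m :: nat and z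
 define G where "G = {z : space Z. ALL n. EX m. uc n m z}"
 have cQ: "countable ?Q" using countable_rat by blast
 have "{z : space Z. uc n m z} : sets Z" for n m
 unfolding uc_def
 proof (intro sets.sets_Collect_countable_All'[OF _ cQ])
 fix q q' assume "q : ?Q" "q' : ?Q"
 then have [measurable]: "ph q : BM Z" "ph q' : BM Z" using ph by auto
 show "{z : space Z. \<bar>q - q'\<bar> < 1 / real (Suc m) --> norm (ph q z - ph q' z) <= 1 / real (Suc n)} : sets Z" by measurable
 qed
 then have G[measurable]: "G : sets Z" unfolding G_def by (intro sets.sets_Collect_countable_All sets.sets_Collect_countable_Ex) blast
 define cl where "cl t = max t0 (min T t)" for t
 have cl: "cl t : {t0..T}" for t using T by (auto simp: cl_def)
 have "ALL t. EX q. (ALL n. q n : ?Q) & q ~~> cl t" using rational_sequence_to[OF T cl] by blast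
 then obtain q where q: "\<And>t n. q t n : ?Q" "\<And>t. q t ~~> cl t" by metis
 define psi where "psi t z = (if z : G then lim (%n. ph (q t n) z) else 0)" for t z
 have half: "\<bar>a - b\<bar> < e" if "\<bar>a - c\<bar> < e / 2" "\<bar>b - c\<bar> < e / 2" for a b c e :: real using that by linarith
 have third: "\<bar>a - b\<bar> < e" if "\<bar>a - c\<bar> < e / 3" "\<bar>b - c'\<bar> < e / 3" "\<bar>c - c'\<bar> < e / 3" for a b c c' e :: real using that by linarith
 have qd: "\<forall>\<^sub>F k in sequentially. \<bar>q t k - cl t\<bar> < e" if "0 < e" for t e
 using tendstoD[OF q(2)[of t] that] by (simp add: dist_real_def)
 have conv: "(%n. ph (q t n) z) ~~> psi t z" if z: "z : G" for t z
 proof -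
 have "Cauchy (%n. ph (q t n) z)"
 proof (rule metric_CauchyI)
 fix e :: real assume "0 < e"
 then obtain n where n: "1 / real (Suc n) < e" using nat_approx_posE by blast
 obtain m where m: "uc n m z" using z by (auto simp: G_def)
 obtain k0 where k0: "\<And>k. k \<ge> k0 ==> \<bar>q t k - cl t\<bar> < 1 / real (Suc m) / 2"
 using qd[of "1 / real (Suc m) / 2" t] by (auto simp: eventually_sequentially)
 show "EX M. \<forall>i\<ge>M. \<forall>j\<ge>M. dist (ph (q t i) z) (ph (q t j) z) < e"
 proof (intro exI[of _ k0] allI impI)
 fix i j assume "k0 <= i" "k0 <= j"
 then have "\<bar>q t i - q t j\<bar> < 1 / real (Suc m)" by (rule half[OF k0 k0])
 then have "norm (ph (q t i) z - ph (q t j) z) <= 1 / real (Suc n)" using m q(1) unfolding uc_def by blast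
 then show "dist (ph (q t i) z) (ph (q t j) z) < e" using n by (simp add: dist_norm)
 qed
 qed
 then have "convergent (%n. ph (q t n) z)" by (rule Cauchy_convergent)
 then show ?thesis using z by (simp add: psi_def convergent_LIMSEQ_iff)
 qed
 have "psi t : BM Z" for t
 proof -
 have [measurable]: "ph (q t n) : BM Z" for n using ph q(1) by auto
 show ?thesis unfolding psi_def by measurable
 qed
 moreover have "continuous_on UNIV (%t. psi t z)" if "z : space Z" for z
 proof (cases "z : G")
 case True
 have "continuous_on UNIV (%t. psi t z)"
 unfolding continuous_on_iff
 proof (intro ballI allI impI)
 fix t e :: real assume "0 < e"
 then obtain n where n: "1 / real (Suc n) < e" using nat_approx_posE by blast
 obtain m where m: "uc n m z" using True by (auto simp: G_def)
 show "\<exists>d>0. ALL t':UNIV. dist t' t < d --> dist (psi t' z) (psi t z) < e"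
 proof (intro exI[of _ "1 / real (Suc m) / 3"] conjI ballI impI)
 fix t' assume "dist t' t < 1 / real (Suc m) / 3"
 then have d: "\<bar>cl t' - cl t\<bar> < 1 / real (Suc m) / 3" by (auto simp: dist_real_def cl_def)
 have "norm (psi t' z - psi t z) <= 1 / real (Suc n)"
 proof (rule Lim_norm_ubound[OF sequentially_bot tendsto_diff[OF conv[OF True] conv[OF True]]])
 have e3: "(0::real) < 1 / real (Suc m) / 3" by simp
 show "\<forall>\<^sub>F k in sequentially. norm (ph (q t' k) z - ph (q t k) z) <= 1 / real (Suc n)"
 using qd[OF e3, of t] qd[OF e3, of t']
 proof eventually_elim
 case (elim k)
 have "\<bar>q t' k - q t k\<bar> < 1 / real (Suc m)" by (rule third[OF elim(2,1) d])
 then show ?case using m q(1) unfolding uc_def by blast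
 qed
 qed
 then show "dist (psi t' z) (psi t z) < e" using n by (simp add: dist_norm)
 qed simp
 qed
 then show ?thesis .
 next
 case False
 then show ?thesis by (simp add: psi_def)
 qed
 moreover have "psi t z = ph t z" if z: "z : space Z" and c: "continuous_on {t0..T} (%t. ph t z)" and t: "t : {t0..T}" for z t
 proof -
 have u: "uniformly_continuous_on {t0..T} (%t. ph t z)" by (rule compact_uniformly_continuous[OF c]) simp
 have "EX m. uc n m z" for n
 proof -
 obtain d where d: "0 < d" "\<And>s s'. s : {t0..T} ==> s' : {t0..T} ==> dist s' s < d ==> dist (ph s' z) (ph s z) < 1 / real (Suc n)"
 using u unfolding uniformly_continuous_on_def by (metis divide_pos_pos of_nat_0_less_iff zero_less_Suc zero_less_one)
 obtain m where m: "1 / real (Suc m) < d" using d(1) nat_approx_posE by blast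
 have "uc n m z" unfolding uc_def
 proof (intro ballI impI)
 fix s s' assume "s : ?Q" "s' : ?Q" "\<bar>s - s'\<bar> < 1 / real (Suc m)"
 then have "dist (ph s z) (ph s' z) < 1 / real (Suc n)" using m by (intro d(2)) (auto simp: dist_real_def)
 then show "norm (ph s z - ph s' z) <= 1 / real (Suc n)" by (simp add: dist_norm)
 qed
 then show ?thesis ..
 qed
 then have zG: "z : G" using z by (simp add: G_def)
 have "cl t = t" using t by (auto simp: cl_def)
 then have "(%n. ph (q t n) z) ~~> ph t z"
 using continuous_on_tendsto_compose[OF c, of "q t" t sequentially] q(1) q(2)[of t] t by (auto simp: eventually_sequentially)
 then show ?thesis using LIMSEQ_unique[OF conv[OF zG]] by blast
 qed
 ultimately show ?thesis by blast
qed

text \<open>As the upper limit converges, the indicators converge at every point except the limit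
  itself, and dominated convergence applies.\<close>

lemma continuous_on_indefinite_integral:
 fixes f :: "real => 'b::euclidean_space"
 assumes f: "set_integrable lborel {a<..<b} f"
 shows "continuous_on {a..b} (%t. LINT r:{a<..<t}|lborel. f r)"
proof (rule continuous_on_sequentiallyI)
 fix c :: "nat => real" and l assume c: "ALL n. c n : {a..b}" "l : {a..b}" "c ~~> l"
 have m: "(%r. indr {a<..<t} r *\<^sub>R f r) : BM lborel" if "t : {a..b}" for t
 proof -
 have "set_integrable lborel {a<..<t} f" using that by (intro set_integrable_subset[OF f]) auto
 then show ?thesis by (auto simp: set_integrable_def)
 qed
 show "(%n. LINT r:{a<..<c n}|lborel. f r) ~~> (LINT r:{a<..<l}|lborel. f r)"
 unfolding slint_def
 proof (rule integral_dominated_convergence[where w="%r. norm (indr {a<..<b} r *\<^sub>R f r)"])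
 show "integrable lborel (%r. norm (indr {a<..<b} r *\<^sub>R f r))" using f unfolding set_integrable_def by (rule integrable_norm)
 have "AE r in lborel. r ~= l" by (rule AE_lborel_singleton)
 then show "AE r in lborel. (%n. indr {a<..<c n} r *\<^sub>R f r) ~~> indr {a<..<l} r *\<^sub>R f r"
 proof eventually_elim
 case (elim r)
 have "\<forall>\<^sub>F n in sequentially. indr {a<..<c n} r *\<^sub>R f r = indr {a<..<l} r *\<^sub>R f r"
 proof (cases "r < l")
 case True
 show ?thesis using order_tendstoD(1)[OF c(3) True] by eventually_elim (use True in \<open>auto simp: ind_def\<close>)
 next
 case False
 then have "l < r" using elim by simp
 show ?thesis using order_tendstoD(2)[OF c(3) \<open>l < r\<close>] by eventually_elim (use \<open>l < r\<close> in \<open>auto simp: ind_def\<close>)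
 qed
 then show ?case by (rule tendsto_eventually)
 qed
 show "AE r in lborel. norm (indr {a<..<c n} r *\<^sub>R f r) <= norm (indr {a<..<b} r *\<^sub>R f r)" for n
 proof (rule AE_I2)
 fix r
 have "c n <= b" using c(1) by auto
 then show "norm (indr {a<..<c n} r *\<^sub>R f r) <= norm (indr {a<..<b} r *\<^sub>R f r)" by (auto simp: ind_def)
 qed
 qed (use m c in auto)
qed

text \<open>If \<open>f\<close> is not integrable, its Bochner integral is 0 by convention and the
  bound is trivial.\<close>

lemma ennreal_norm_integral_le:
 fixes f :: "'x => 'b::{banach, second_countable_topology}"
 shows "ennreal (norm (LINT y|N. f y)) <= (NN N (%y. ennreal (norm (f y))))"
 by (cases "integrable N f") (auto simp: not_integrable_integral_eq intro: integral_norm_bound_ennreal)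

context brownian_basis
begin

text \<open>The set is absorbed into an indicator density. This makes the time measure finite, as
  \<open>adapted_integral\<close> requires, and leaves the sigma-algebra in time unchanged.\<close>

lemma adapted_set_integral:
 fixes f :: "real => 'a => 'b::euclidean_space"
 assumes f: "joint M f" and S[measurable]: "S : sets borel" "emeasure lborel S < \<infinity>"
 and ad: "AE r in lborel. r : S --> f r : BM (F t)" and t: "0 <= t"
 and int: "AE z in M. set_integrable lborel S (%r. f r z)"
 shows "(%z. LINT r:S|lborel. f r z) : BM (F t)"
proof -
 let ?L = "density lborel (%r. ennreal (indr S r))"
 have fm: "(%r. f r z) : BM lborel" if "z : space M" for z
 using mcomp[OF measurable_Pair2'[OF that, of lborel] f] by simp
 have "emeasure ?L (space ?L) = emeasure lborel S"
 by (simp add: emeasure_density ennreal_indicator)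
 then have fin: "finite_measure ?L" using S by (intro finite_measureI) auto
 have eq: "(LINT r|?L. f r z) = (LINT r:S|lborel. f r z)" if "z : space M" for z
 unfolding slint_def using fm[OF that] by (intro integral_density) auto
 have "(%z. LINT r|?L. f r z) : BM (F t)"
 proof (rule adapted_integral[OF fin _ _ t])
 show "(%p. f (fst p) (snd p)) : BM (?L \<Otimes>\<^sub>M M)"
 using f by (simp cong: measurable_cong_sets sets_pair_measure_cong)
 show "AE r in ?L. f r : BM (F t)"
 using ad by (subst AE_density) (auto simp: ind_def)
 show "AE z in M. integrable ?L (%r. f r z)"
 using int AE_space
 proof eventually_elim
 case (elim z)
 then show ?case using fm[of z] by (subst integrable_density) (auto simp: set_integrable_def)
 qed
 qed
 moreover have "space (F t) = space M" using space_filt t by blast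
 ultimately show ?thesis using eq measurable_cong[of "F t" "%z. LINT r|?L. f r z" "%z. LINT r:S|lborel. f r z"] by auto
qed

end

context svie
begin

lemma kernel_triangle_bound:
 fixes n :: "real => ennreal"
 assumes n[measurable]: "n : BM borel"
 shows "(NI {t0<..<T} (%s. (NI {t0<..<s} (%r. ka s r * n r)))) <= ennreal m0 * (NI {t0<..<T} n)"
proof -
 let ?g = "%s r. ka s r * n r * indicator {p. t0 < snd p & snd p < fst p & fst p < T} (s, r)"
 have gm[measurable]: "(%p. ?g (fst p) (snd p)) : BM (tprod lborel)" by measurable
 have gm': "(%p. ?g (snd p) (fst p)) : BM (tprod lborel)"
 using mcomp[OF measurable_pair_swap' gm] by (simp add: case_prod_beta')
 have "(NI {t0<..<T} (%s. (NI {t0<..<s} (%r. ka s r * n r)))) = (NN lborel (%s. NN lborel (%r. ?g s r)))"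
 proof (rule nn_cong)
 fix s :: real
 have "(NI {t0<..<s} (%r. ka s r * n r)) * indicator {t0<..<T} s = (NN lborel (%r. (ka s r * n r * indicator {t0<..<s} r) * indicator {t0<..<T} s))"
 by (rule nn_integral_multc[symmetric]) measurable
 also have "... = (NN lborel (%r. ?g s r))" by (intro nn_cong) (auto simp: ind_def)
 finally show "(NI {t0<..<s} (%r. ka s r * n r)) * indicator {t0<..<T} s = (NN lborel (%r. ?g s r))" .
 qed
 also have "... = (NN lborel (%r. NN lborel (%s. ?g s r)))"
 by (rule lborel_pair.Fubini'[symmetric]) (use gm' in \<open>simp add: case_prod_beta'\<close>)
 also have "... <= (NN lborel (%r. ennreal m0 * (n r * indicator {t0<..<T} r)))"
 proof (rule nn_mono_AE, use kp in eventually_elim)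
 fix r assume k: "r : {0<..<T} --> (NI {r<..<T} (%t. ennreal ((norm (C t r))^2 + (norm (D t r))^2))) <= ennreal m0"
 have "(NN lborel (%s. ?g s r)) = (NN lborel (%s. (n r * indicator {t0<..<T} r) * (ka s r * indicator {r<..<T} s)))"
 by (intro nn_cong) (auto simp: ind_def mult.commute)
 also have "... = (n r * indicator {t0<..<T} r) * (NI {r<..<T} (%s. ka s r))"
 by (rule nn_cmult) measurable
 also have "... <= (n r * indicator {t0<..<T} r) * ennreal m0"
 proof (cases "r : {t0<..<T}")
 case True
 then have "(NI {r<..<T} (%s. ka s r)) <= ennreal m0" using k t0 unfolding ka_def by auto
 then show ?thesis by (intro ml_mono) auto
 qed simp
 finally show "(NN lborel (%s. ?g s r)) <= ennreal m0 * (n r * indicator {t0<..<T} r)" by (simp add: mult.commute)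
 qed
 also have "... = ennreal m0 * (NI {t0<..<T} n)" by (rule nn_cmult) measurable
 finally show ?thesis .
qed

end

context svie
begin

lemma joint_integrand_measurable:
 assumes X: "joint M X" and u: "joint M u"
 and b[measurable]: "joint3 M b"
 shows "(%p. drift X u b (fst p) (fst (snd p)) (snd (snd p))) : BM (tprod (tprod M))"
 and "(%p. diffusion X u b (fst p) (fst (snd p)) (snd (snd p))) : BM (tprod (tprod M))"
proof -
 have s: "snd : measurable (tprod (tprod M)) (tprod M)"
 and f: "(%p. (fst p, fst (snd p))) : measurable (tprod (tprod M)) (tprod lborel)" by measurable
 note [measurable] = mcomp[OF s X] mcomp[OF s u]
 have [measurable]: "(%p. A (fst p) (fst (snd p))) : BM (tprod (tprod M))" "(%p. B (fst p) (fst (snd p))) : BM (tprod (tprod M))"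
 "(%p. C (fst p) (fst (snd p))) : BM (tprod (tprod M))" "(%p. D (fst p) (fst (snd p))) : BM (tprod (tprod M))"
 using mcomp[OF f A] mcomp[OF f B] mcomp[OF f C] mcomp[OF f D] by simp_all
 show "(%p. drift X u b (fst p) (fst (snd p)) (snd (snd p))) : BM (tprod (tprod M))"
 "(%p. diffusion X u b (fst p) (fst (snd p)) (snd (snd p))) : BM (tprod (tprod M))"
 unfolding drift_def diffusion_def by measurable
qed

lemma joint_integrand_adapted:
 assumes X: "process X" and u: "process u" and b: "AEI t0 s (%r. b s r : BM (F r))" and s: "s < T"
 shows "AEI t0 s (%r. drift X u b s r : BM (F r))"
 and "AEI t0 s (%r. diffusion X u b s r : BM (F r))"
proof -
 have d: "drift X u b s r : BM (F r) & diffusion X u b s r : BM (F r)"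
 if [measurable]: "X r : BM (F r)" "u r : BM (F r)" "b s r : BM (F r)" for r
 unfolding drift_def[abs_def] diffusion_def[abs_def] by (intro conjI; measurable)
 show "AEI t0 s (%r. drift X u b s r : BM (F r))"
 using processD(2)[OF X] processD(2)[OF u] b by eventually_elim (use s d in auto)
 show "AEI t0 s (%r. diffusion X u b s r : BM (F r))"
 using processD(2)[OF X] processD(2)[OF u] b by eventually_elim (use s d in auto)
qed

lemma response_gain_measurable:
 assumes m: "joint3 M Th"
 shows "(%p. LINT s:{fst p<..<T}|lborel. Ga s (fst p) *v Th s (fst p) (snd p)) : BM (tprod M)"
proof -
 have g: "(%q. (snd q, fst q)) : measurable ((tprod M) \<Otimes>\<^sub>M lborel) (tprod (tprod M))"
 and h: "(%q. (snd q, fst (fst q))) : measurable ((tprod M) \<Otimes>\<^sub>M lborel) (tprod lborel)" by measurable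
 have [measurable]: "(%q. Th (snd q) (fst (fst q)) (snd (fst q))) : BM ((tprod M) \<Otimes>\<^sub>M lborel)"
 "(%q. Ga (snd q) (fst (fst q))) : BM ((tprod M) \<Otimes>\<^sub>M lborel)"
 using mcomp[OF g m] mcomp[OF h Ga] by simp_all
 have "(%q. indr {q. fst (fst q) < snd q & snd q < T} q *\<^sub>R (Ga (snd q) (fst (fst q)) *v Th (snd q) (fst (fst q)) (snd (fst q)))) : BM ((tprod M) \<Otimes>\<^sub>M lborel)"
 by measurable
 then have "(%p. LINT s|lborel. indr {q. fst (fst q) < snd q & snd q < T} (p, s) *\<^sub>R (Ga s (fst p) *v Th s (fst p) (snd p))) : BM (tprod M)"
 by (intro lborel.borel_measurable_lebesgue_integral) (simp add: case_prod_beta')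
 then show ?thesis by (simp add: slint_def ind_def greaterThanLessThan_def greaterThan_def lessThan_def)
qed

text \<open>Even for \<open>s > t\<close> the value Theta(s,t) is known at time \<open>t\<close>, so
  the integral over future \<open>s\<close> is adapted.\<close>

lemma response_gain_adapted:
 assumes Th: "response Th" and ad: "\<And>s t. t : {t0..T} ==> Th s t : BM (F t)"
 shows "AEI t0 T (%t. (%z. LINT s:{t<..<T}|lborel. Ga s t *v Th s t z) : BM (F t))"
 using response_slice_finite[OF Th] gn_finite
proof (eventually_elim, intro impI)
 fix t assume h: "t : {t0<..<T} --> (NI {t<..<T} (%s. (nn2 M (Th s t)))) < \<infinity>"
 "t : {0<..<T} --> gn t < \<infinity>" and t: "t : {t0<..<T}"
 have sl[measurable]: "(%p. Th (fst p) t (snd p)) : BM (tprod M)" using response_slice Th by (auto simp: response_def)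
 show "(%z. LINT s:{t<..<T}|lborel. Ga s t *v Th s t z) : BM (F t)"
 proof (rule adapted_set_integral)
 show "(%p. Ga (fst p) t *v Th (fst p) t (snd p)) : BM (tprod M)" by measurable
 show "AEI t T (%s. (%z. Ga s t *v Th s t z) : BM (F t))"
 proof (rule AE_I2, rule impI)
 fix s
 have [measurable]: "Th s t : BM (F t)" using ad t by auto
 show "(%z. Ga s t *v Th s t z) : BM (F t)" by measurable
 qed
 show "AE z in M. set_integrable lborel {t<..<T} (%s. Ga s t *v Th s t z)"
 using h t t0 by (intro gain_integrable[OF sl]) auto
 qed (use t t0 in auto)
qed

lemma control_norm_bound:
 assumes Th: "response Th" and v: "joint M v"
 and X: "joint M X"
 shows "(NN M (%z. nsq (XX t *v X t z + (LINT s:{t<..<T}|lborel. Ga s t *v Th s t z) + v t z))) <=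
 3 * (ennreal (xx^2) * (nn2 M (X t)) + 3 * (gn t * (NI {t<..<T} (%s. (nn2 M (Th s t))))) +
 (nn2 M (v t)))"
proof -
 have m: "joint3 M Th" using Th by (simp add: response_def)
 note [measurable] = time_section_measurable[OF v, of t] time_section_measurable[OF X, of t] response_slice[OF m, of t]
 have [measurable]: "(%z. LINT s:{t<..<T}|lborel. Ga s t *v Th s t z) : BM M"
 using mcomp[OF measurable_Pair1'[of t lborel M] response_gain_measurable[OF m]] by simp
 have "(NN M (%z. nsq (XX t *v X t z + (LINT s:{t<..<T}|lborel. Ga s t *v Th s t z) + v t z))) <=
 3 * ((NN M (%z. nsq (XX t *v X t z))) + (NN M (%z. nsq (LINT s:{t<..<T}|lborel. Ga s t *v Th s t z))) +
 (nn2 M (v t)))"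
 by (rule nn_integral_norm_add3_sq) measurable
 also have "... <= 3 * (ennreal (xx^2) * (nn2 M (X t)) + 3 * (gn t * (NI {t<..<T} (%s. (nn2 M (Th s t))))) +
 (nn2 M (v t)))"
 proof (intro ml_mono add_mono order_refl)
 have "(NN M (%z. nsq (XX t *v X t z))) <= (NN M (%z. ennreal (xx^2) * nsq (X t z)))"
 proof (rule nn_mono)
 fix z
 have "norm (XX t *v X t z) <= xx * norm (X t z)"
 by (rule order_trans[OF norm_matrix_vector_le mr_mono[OF XX(2)]]) simp
 then have "(norm (XX t *v X t z))^2 <= xx^2 * (norm (X t z))^2" unfolding power_mult_distrib[symmetric] by (rule power_mono) simp
 then show "nsq (XX t *v X t z) <= ennreal (xx^2) * nsq (X t z)"
 by (simp add: ennreal_mult[symmetric] ennreal_leI)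
 qed
 also have "... = ennreal (xx^2) * (nn2 M (X t))" by (rule nn_cmult) measurable
 finally show "(NN M (%z. nsq (XX t *v X t z))) <= ennreal (xx^2) * (nn2 M (X t))" .
 have "(NN M (%z. nsq (LINT s:{t<..<T}|lborel. Ga s t *v Th s t z))) <= (NN M (%z. (NI {t<..<T} (%s. ennreal (norm (Ga s t *v Th s t z))))^2))"
 proof (rule nn_mono)
 fix z
 have "ennreal (norm (LINT s:{t<..<T}|lborel. Ga s t *v Th s t z)) <= (NN lborel (%s. ennreal (norm (indr {t<..<T} s *\<^sub>R (Ga s t *v Th s t z)))))"
 unfolding slint_def by (rule ennreal_norm_integral_le)
 also have "... = (NI {t<..<T} (%s. ennreal (norm (Ga s t *v Th s t z))))"
 by (intro nn_cong) (auto simp: ind_def)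
 finally have "(ennreal (norm (LINT s:{t<..<T}|lborel. Ga s t *v Th s t z)))^2 <= (NI {t<..<T} (%s. ennreal (norm (Ga s t *v Th s t z))))^2"
 by (rule power_mono) simp
 then show "nsq (LINT s:{t<..<T}|lborel. Ga s t *v Th s t z) <= (NI {t<..<T} (%s. ennreal (norm (Ga s t *v Th s t z))))^2"
 by (simp add: ennreal_power)
 qed
 also have "... <= 3 * (gn t * (NI {t<..<T} (%s. (nn2 M (Th s t)))))"
 by (rule gain_bound[of "%s. Th s t"]) measurable
 finally show "(NN M (%z. nsq (LINT s:{t<..<T}|lborel. Ga s t *v Th s t z))) <= 3 * (gn t * (NI {t<..<T} (%s. (nn2 M (Th s t)))))" .
 qed auto
 finally show ?thesis .
qed

end

context svie
begin

lemma sv_rep_truncate: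
 assumes J: "has_ito_integral M W F t0 t h' Y" and h: "\<And>r z. r : {t0<..<t} ==> h' r z = h r z"
 and f: "\<And>r z. r : {t0<..<t} ==> f' r z = f r z"
 and Th: "AE z in M. Th z = x + (LINT r:{t0<..<t}|lborel. f' r z) + Y z"
 shows "sv_rep x f h t Th"
 unfolding sv_rep_def
proof (intro exI[of _ Y] conjI)
 show "has_ito_integral M W F t0 t h Y"
 by (rule has_ito_integral_cong_AE[OF J], rule AE_I2) (auto simp: sp_pair space_restrict_space h)
 have "(LINT r:{t0<..<t}|lborel. f' r z) = (LINT r:{t0<..<t}|lborel. f r z)" for z
 by (rule set_lebesgue_integral_cong) (auto simp: f)
 then show "AE z in M. Th z = x + (LINT r:{t0<..<t}|lborel. f r z) + Y z" using Th by simp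
qed

text \<open>The exact coefficient is 3 * (1 + 3 + 16 * 3) = 156, rounded up to 300.\<close>

lemma collect_step_exists:
 fixes m n x b g :: ennreal
 shows "3 * (x + 3 * (m * n + b) + 16 * (3 * (m * n + g))) <= 300 * (1 + m) * ((x + b + g) + n)"
proof -
 let ?P = "(1 + m) * ((x + b + g) + n)"
 have P: "?P = (x + b + g + n) + (m * (x + b + g) + m * n)" by (simp only: distrib_left distrib_right mult_1 ac_simps)
 have 1: "x <= ?P" "m * n + b <= ?P" "m * n + g <= ?P"
 unfolding P by (simp_all add: add.assoc add.left_commute add_increasing2 add_increasing add_mono)
 have "3 * (x + 3 * (m * n + b) + 16 * (3 * (m * n + g))) <= 3 * (?P + 3 * ?P + 16 * (3 * ?P))"
 by (intro ml_mono add_mono 1) auto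
 also have "... = (3 * (1 + 3 + 16 * 3)) * ?P" by (simp only: distrib_left[of 3] distrib_right[of _ _ ?P] mult_1 mult.assoc)
 also have "... <= 300 * ?P" by (intro mr_mono) auto
 finally show ?thesis by (simp only: mult.assoc)
qed

text \<open>Theta is constructed first, as a jointly measurable field with adapted paths continuous
  in \<open>t\<close>; the new state is its diagonal, and the new control follows from the feedback
  formula. \<open>R\<close> is a measurable majorant of the squared path of Theta, and its mean
  controls both the triangle norms and the supremum norm.\<close>

lemma step_exists:
 assumes data: "data x b sg v" and X: "process X" and u: "process u"
 shows "EX X' Th u' R. process X' & process u' & response Th & step x b sg v X u X' Th u' &
 (ALL s. ALL y:space M. continuous_on UNIV (%t. Th s t y)) & (ALL s. ALL t:{t0..T}. Th s t : BM (F t)) &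
 joint M R &
 (AEI t0 T (%s. (AE y in M. ALL t:{t0..T}. nsq (Th s t y) <= R s y))) &
 (NI {t0<..<T} (%s. (NN M (R s)))) <= 300 * (1 + ennreal m0) *
 ((NI {t0<..<T} (%s. (nsq (x s) + field_L21 b s + field_L2 sg s))) + (NI {t0<..<T} (pair_norm X u)))"
proof -
 have xm[measurable]: "x : BM borel" and bm: "joint3 M b"
 and sm: "joint3 M sg"
 and bad: "AEI t0 T (%s. (AEI t0 s (%r. b s r : BM (F r))))"
 and sad: "AEI t0 T (%s. (AEI t0 s (%r. sg s r : BM (F r))))"
 and v: "process v"
 and fin: "(NI {t0<..<T} (%s. nsq (x s))) < \<infinity>" "(NI {t0<..<T} (field_L21 b)) < \<infinity>" "(NI {t0<..<T} (%s. field_L2 sg s)) < \<infinity>"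
 using data by (auto simp: data_def field_def)
 note Xm = processD(1)[OF X] and um = processD(1)[OF u]
 note nm[measurable] = pair_norm_measurable[OF Xm um]
 note [measurable] = field_norm_measurable(1)[OF bm] field_norm_measurable(2)[OF sm]
 let ?n = "pair_norm X u"
 let ?Nn = "NI {t0<..<T} (%r. ?n r)"
 note Nfin = pair_norm_finite[OF X u]
 \<comment> \<open>The integrands are cut off at \<open>r = s\<close>. All fields then live on the
   fixed interval from \<open>t0\<close> to \<open>T\<close>, and nothing changes at times
   \<open>t \<le> s\<close>, the only ones that matter.\<close>
 define tr where "tr s r \<longleftrightarrow> s < T & t0 < r & r < s" for s r :: real
 define f where "f s r y = (if tr s r then drift X u b s r y else 0)" for s r y
 define h where "h s r y = (if tr s r then diffusion X u sg s r y else 0)" for s r y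
 note [measurable] = joint_integrand_measurable(1)[OF Xm um bm] joint_integrand_measurable(2)[OF Xm um sm]
 have fm: "joint3 M f"
 unfolding f_def tr_def by measurable
 have hm: "joint3 M h"
 unfolding h_def tr_def by measurable
 \<comment> \<open>A density instead of a restriction makes the parameter measure finite and keeps
   the sigma-algebra of \<open>lborel\<close>, so measurability statements carry over
   unchanged.\<close>
 let ?N = "density lborel (indicator {t0<..<T}) :: real measure"
 have sN: "sets (?N \<Otimes>\<^sub>M K) = sets (lborel \<Otimes>\<^sub>M K)" for K :: "'k measure" by (intro sets_pair_measure_cong) simp_all
 have Nn: "(NN ?N g) = (NI {t0<..<T} g)" if "g : BM borel" for g
 using that by (subst nn_integral_density) (auto simp: mult.commute)
 have AN: "(AE s in ?N. P s) \<longleftrightarrow> (AEI t0 T (%s. P s))" for P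
 by (subst AE_density) (auto simp: ind_def)
 have Nf: "finite_measure ?N"
 using t0 by (intro finite_measureI) (auto simp: emeasure_density nn_integral_indicator)
 have hq: "(%s. NN M (%y. NN lborel (%r. nsq (h s r y)))) : BM borel"
 proof -
 have "(%q. (fst (fst q), (snd q, snd (fst q)))) : measurable ((tprod M) \<Otimes>\<^sub>M lborel) (tprod (tprod M))" by measurable
 from mcomp[OF this hm] have [measurable]: "(%q. h (fst (fst q)) (snd q) (snd (fst q))) : BM ((tprod M) \<Otimes>\<^sub>M lborel)" by simp
 have "(%q. nsq (h (fst (fst q)) (snd q) (snd (fst q)))) : BM ((tprod M) \<Otimes>\<^sub>M lborel)" by measurable
 from borel_measurable_nn_integral_fst[OF lb_nn_fst[OF this]] show ?thesis by simp
 qed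
 have hb: "(NN ?N (%s. NN M (%y. NN lborel (%r. nsq (h s r y))))) <= 3 * (ennreal m0 * ?Nn + (NI {t0<..<T} (%s. field_L2 sg s)))"
 proof -
 have [measurable]: "(%s. NI {t0<..<s} (%r. ka s r * ?n r)) : BM borel"
 proof -
 have "(%p. ka (fst p) (snd p) * ?n (snd p) * indicator {p. t0 < snd p & snd p < fst p} p) : BM (tprod lborel)" by measurable
 from lb_nn_fst[OF this] show ?thesis
 by (simp add: ind_def greaterThanLessThan_def greaterThan_def lessThan_def)
 qed
 have "(NN ?N (%s. NN M (%y. NN lborel (%r. nsq (h s r y))))) = (NI {t0<..<T} (%s. (NN M (%y. NN lborel (%r. nsq (h s r y))))))"
 by (rule Nn[OF hq])
 also have "... <= (NI {t0<..<T} (%s. 3 * ((NI {t0<..<s} (%r. ka s r * ?n r)) + field_L2 sg s)))"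
 proof (intro nn_mono)
 fix s :: real
 have e: "nsq (h s r y) = nsq (diffusion X u sg s r y) * indicator {t0<..<s} r" if "s : {t0<..<T}" for r y
 using that by (auto simp: h_def tr_def)
 note dm[measurable] = drift_measurable(2)[of X u sg s, OF Xm um field_section[OF sm]]
 have "(NN M (%y. NN lborel (%r. nsq (h s r y)))) <= 3 * ((NI {t0<..<s} (%r. ka s r * ?n r)) + field_L2 sg s)" if s: "s : {t0<..<T}"
 proof -
 have "(NN M (%y. NN lborel (%r. nsq (h s r y)))) = (NN lborel (%r. NN M (%y. nsq (diffusion X u sg s r y) * indicator {t0<..<s} r)))"
 unfolding e[OF s] by (rule nn_integral_swap) measurable
 also have "... = (NI {t0<..<s} (%r. (nn2 M (diffusion X u sg s r))))"
 using time_section_measurable[OF dm] by (intro nn_cong nn_integral_multc) measurable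
 also have "... <= 3 * ((NI {t0<..<s} (%r. ka s r * ?n r)) + field_L2 sg s)"
 unfolding diffusion_def ka_def pair_norm_def field_L2_def by (rule affine_diffusion_bound[OF _ _ Xm um field_section[OF sm]]) measurable
 finally show ?thesis .
 qed
 then show "(NN M (%y. NN lborel (%r. nsq (h s r y)))) * indicator {t0<..<T} s <= 3 * ((NI {t0<..<s} (%r. ka s r * ?n r)) + field_L2 sg s) * indicator {t0<..<T} s"
 by (auto simp: ind_def simp del: distrib_left_numeral)
 qed
 also have "... = 3 * ((NI {t0<..<T} (%s. (NI {t0<..<s} (%r. ka s r * ?n r)))) + (NI {t0<..<T} (%s. field_L2 sg s)))"
 proof -
 have e: "(3 * (a + c)) * i = 3 * (a * i + c * i)" for a c i :: "'c::comm_semiring_1" by (simp add: algebra_simps)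
 show ?thesis unfolding e by (simp add: nn_add nn_cmult del: distrib_left_numeral)
 qed
 also have "... <= 3 * (ennreal m0 * ?Nn + (NI {t0<..<T} (%s. field_L2 sg s)))"
 by (intro ml_mono add_mono kernel_triangle_bound nm order_refl) auto
 finally show ?thesis .
 qed
 have hfin: "3 * (ennreal m0 * ?Nn + (NI {t0<..<T} (%s. field_L2 sg s))) < \<infinity>"
 using Nfin fin by (simp add: ennreal_mult_less_top del: distrib_left_numeral)
 have "EX J S. (%p. J (fst p) (fst (snd p)) (snd (snd p))) : BM (?N \<Otimes>\<^sub>M (tprod M)) &
 (%p. S (fst p) (snd p)) : BM (?N \<Otimes>\<^sub>M M) &
 (NN ?N (%s. NN M (S s))) <= 16 * (NN ?N (%s. NN M (%y. NN lborel (%r. nsq (h s r y))))) &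
 (AE s in ?N. (AE y in M. continuous_on {t0..T} (%t. J s t y)) &
 (AE y in M. ALL t:{t0..T}. nsq (J s t y) <= S s y) &
 (ALL t:{t0<..T}. has_ito_integral M W F t0 t (h s) (J s t)) &
 (ALL t:{t0..T}. J s t : BM (F t)))"
 proof (rule stochastic_integral_field[OF Nf t0])
 show "(%p. h (fst p) (fst (snd p)) (snd (snd p))) : BM (?N \<Otimes>\<^sub>M (tprod M))"
 using hm by (simp cong: measurable_cong_sets add: sN)
 show "r ~: {t0<..<T} ==> h s r y = 0" for s r y by (auto simp: h_def tr_def)
 show "AE s in ?N. AEI t0 T (%r. h s r : BM (F r))"
 unfolding AN using sad
 proof (eventually_elim, intro impI)
 fix s assume "s : {t0<..<T} --> (AEI t0 s (%r. sg s r : BM (F r)))" and s: "s : {t0<..<T}"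
 then have "AEI t0 s (%r. sg s r : BM (F r))" by blast
 from joint_integrand_adapted(2)[where b=sg and s=s, OF X u this] s
 have "AEI t0 s (%r. diffusion X u sg s r : BM (F r))" by auto
 then show "AEI t0 T (%r. h s r : BM (F r))"
 proof eventually_elim
 case (elim r)
 show ?case
 proof (cases "tr s r")
 case True
 then have "h s r = diffusion X u sg s r" by (auto simp: h_def)
 then show ?thesis using elim True by (auto simp: tr_def)
 next
 case False
 then have "h s r = (%_. 0)" by (auto simp: h_def)
 then show ?thesis by simp
 qed
 qed
 qed
 show "(NN ?N (%s. NN M (%y. NN lborel (%r. nsq (h s r y))))) < \<infinity>" by (rule le_less_trans[OF hb hfin])
 qed
 then obtain J S where J0: "(%p. J (fst p) (fst (snd p)) (snd (snd p))) : BM (?N \<Otimes>\<^sub>M (tprod M))"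
 and S0: "(%p. S (fst p) (snd p)) : BM (?N \<Otimes>\<^sub>M M)"
 and Sb: "(NN ?N (%s. NN M (S s))) <= 16 * (NN ?N (%s. NN M (%y. NN lborel (%r. nsq (h s r y)))))"
 and JA: "AE s in ?N. (AE y in M. continuous_on {t0..T} (%t. J s t y)) &
 (AE y in M. ALL t:{t0..T}. nsq (J s t y) <= S s y) &
 (ALL t:{t0<..T}. has_ito_integral M W F t0 t (h s) (J s t)) &
 (ALL t:{t0..T}. J s t : BM (F t))" by blast
 have Jm: "joint3 M J"
 using J0 by (simp cong: measurable_cong_sets add: sN)
 have Sm[measurable]: "joint M S"
 using S0 by (simp cong: measurable_cong_sets add: sN)
 define I where "I s t y = (LINT r:{t0<..<t}|lborel. f s r y)" for s t y
 have gq: "(%q. (fst (fst q), (snd q, snd (fst q)))) : measurable ((tprod M) \<Otimes>\<^sub>M lborel) (tprod (tprod M))" by measurable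
 have fq[measurable]: "(%q. f (fst (fst q)) (snd q) (snd (fst q))) : BM ((tprod M) \<Otimes>\<^sub>M lborel)"
 using mcomp[OF gq fm] by simp
 have Im[measurable]: "(%z. I (fst z) t (snd z)) : BM (tprod M)" for t
 proof -
 have "(%q. indr {t0<..<t} (snd q) *\<^sub>R f (fst (fst q)) (snd q) (snd (fst q))) : BM ((tprod M) \<Otimes>\<^sub>M lborel)" by measurable
 then show ?thesis unfolding I_def slint_def
 by (intro lborel.borel_measurable_lebesgue_integral) (simp add: case_prod_beta')
 qed
 have Jt[measurable]: "(%z. J (fst z) t (snd z)) : BM (tprod M)" for t
 proof -
 have "(%z. (fst z, (t, snd z))) : measurable (tprod M) (tprod (tprod M))" by measurable
 from mcomp[OF this Jm] show ?thesis by simp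
 qed
 let ?phi = "%t z. x (fst z) + I (fst z) t (snd z) + J (fst z) t (snd z)"
 \<comment> \<open>The modification is made on pairs of parameter and event, so that
   \<open>psi\<close> is measurable in all three variables by
   \<open>caratheodory_measurable\<close>.\<close>
 have "EX psi. (ALL t. psi t : BM (tprod M)) & (ALL z:space (tprod M). continuous_on UNIV (%t. psi t z)) &
 (ALL z:space (tprod M). continuous_on {t0..T} (%t. ?phi t z) --> (ALL t:{t0..T}. psi t z = ?phi t z))"
 by (rule continuous_modification[OF t0(2)]) measurable
 then obtain psi where pm: "\<And>t. psi t : BM (tprod M)" and pc: "\<And>z. z : space (tprod M) ==> continuous_on UNIV (%t. psi t z)"
 and pe: "\<And>z t. z : space (tprod M) ==> continuous_on {t0..T} (%t. ?phi t z) ==> t : {t0..T} ==> psi t z = ?phi t z"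
 by blast
 define good where "good s \<longleftrightarrow> ((AE y in M. continuous_on {t0..T} (%t. J s t y)) &
 (AE y in M. ALL t:{t0..T}. nsq (J s t y) <= S s y) &
 (ALL t:{t0<..T}. has_ito_integral M W F t0 t (h s) (J s t)) &
 (ALL t:{t0..T}. J s t : BM (F t))) & al s < \<infinity> & field_L21 b s < \<infinity> &
 (AEI t0 s (%r. b s r : BM (F r)))" for s
 have "AEI t0 T (%s. good s)"
 using JA[unfolded AN] al_finite AE_finite_of_nn_integral[OF field_norm_measurable(1)[OF bm] fin(2)] bad
 by eventually_elim (use t0 in \<open>auto simp: good_def\<close>)
 then obtain N0 where N0: "{s : space lborel. \<not> (s : {t0<..<T} --> good s)} \<subseteq> N0" "N0 : null_sets lborel"
 by (elim AE_E) (auto simp: null_sets_def)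
 \<comment> \<open>The property \<open>good\<close> need not define a measurable set; removing a
   Borel null set that contains all failures leaves a Borel set of parameters. For the other
   \<open>s\<close> the response is set to 0.\<close>
 define G where "G = {t0<..<T} - N0"
 have G[measurable]: "G : sets borel" using N0(2) by (auto simp: G_def)
 have good: "good s" "s : {t0<..<T}" if "s : G" for s using that N0(1) by (auto simp: G_def)
 have AEG: "AEI t0 T (%s. s : G)"
 using AE_not_in[OF N0(2)] by eventually_elim (auto simp: G_def)
 define Th where "Th s t y = (if s : G then psi t (s, y) else 0)" for s t y
 have fint: "AE y in M. set_integrable lborel {t0<..<T} (%r. f s r y)" if s: "s : G" for s
 proof -
 have "AE y in M. set_integrable lborel {t0<..<s} (%r. drift X u b s r y)"
 using good[OF s] by (intro drift_integrable[OF X u bm]) (auto simp: good_def)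
 moreover have "indr {t0<..<T} r *\<^sub>R f s r y = indr {t0<..<s} r *\<^sub>R drift X u b s r y" for r y
 using good(2)[OF s] by (auto simp: f_def tr_def ind_def)
 ultimately show ?thesis by (simp add: set_integrable_def)
 qed
 have eq: "AE y in M. ALL t:{t0..T}. Th s t y = x s + I s t y + J s t y" if s: "s : G" for s
 proof -
 have "AE y in M. continuous_on {t0..T} (%t. J s t y)" using good(1)[OF s] by (simp add: good_def)
 then show ?thesis using fint[OF s] AE_space
 proof eventually_elim
 case (elim y)
 have "continuous_on {t0..T} (%t. ?phi t (s, y))"
 using continuous_on_indefinite_integral[OF elim(2)] elim(1) unfolding I_def by (auto intro!: continuous_intros)
 then show ?case using pe[of "(s, y)"] elim(3) s by (auto simp: Th_def sp_pair)
 qed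
 qed
 have Thc: "continuous_on UNIV (%t. Th s t y)" if "y : space M" for s y
 using pc[of "(s, y)"] that by (cases "s : G") (auto simp: Th_def sp_pair)
 have Iad: "I s t : BM (F t)" if s: "s : G" and t: "t : {t0..T}" for s t
 unfolding I_def
 proof (rule adapted_set_integral)
 show "(%p. f s (fst p) (snd p)) : BM (tprod M)" by (rule field_section[OF fm])
 have "AEI t0 s (%r. b s r : BM (F r))" using good(1)[OF s] by (simp add: good_def)
 from joint_integrand_adapted(1)[where b=b and s=s, OF X u this] good(2)[OF s]
 have "AEI t0 s (%r. drift X u b s r : BM (F r))" by auto
 then show "AEI t0 t (%r. f s r : BM (F t))"
 proof (eventually_elim, intro impI)
 fix r assume d: "r : {t0<..<s} --> drift X u b s r : BM (F r)" and r: "r : {t0<..<t}"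
 show "f s r : BM (F t)"
 proof (cases "tr s r")
 case True
 then have "f s r = drift X u b s r" by (auto simp: f_def)
 then have "f s r : BM (F r)" using d True by (auto simp: tr_def)
 then show ?thesis using r t0 by (intro measurable_filt_mono[of r t]) auto
 next
 case False
 then have "f s r = (%_. 0)" by (auto simp: f_def)
 then show ?thesis by simp
 qed
 qed
 show "AE y in M. set_integrable lborel {t0<..<t} (%r. f s r y)"
 using fint[OF s]
 proof eventually_elim
 case (elim y)
 show ?case using t by (intro set_integrable_subset[OF elim]) auto
 qed
 qed (use t t0 in auto)
 have Thad: "Th s t : BM (F t)" if t: "t : {t0..T}" for s t
 proof (cases "s : G")
 case True
 note [measurable] = Iad[OF True t]
 have [measurable]: "J s t : BM (F t)" using good(1)[OF True] t by (auto simp: good_def)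
 have m: "(%y. x s + I s t y + J s t y) : BM (F t)" by measurable
 have e: "AE y in M. x s + I s t y + J s t y = Th s t y" using eq[OF True] by eventually_elim (use t in auto)
 have "0 <= t" using t t0 by auto
 then show ?thesis by (rule measurable_filt_AE_cong[OF _ m e])
 next
 case False
 then have "Th s t = (%_. 0)" by (auto simp: Th_def)
 then show ?thesis by simp
 qed
 have rep: "sv_rep (x s) (drift X u b s) (diffusion X u sg s) t (Th s t)" if s: "s : G" and t: "t : {t0<..s}" for s t
 proof (rule sv_rep_truncate[where h'="h s" and f'="f s" and Y="J s t"])
 have st: "s : {t0<..<T}" by (rule good[OF s])
 show "has_ito_integral M W F t0 t (h s) (J s t)" using good(1)[OF s] t st by (auto simp: good_def)
 show "r : {t0<..<t} ==> h s r y = diffusion X u sg s r y" "r : {t0<..<t} ==> f s r y = drift X u b s r y" for r y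
 using t st by (auto simp: h_def f_def tr_def)
 show "AE y in M. Th s t y = x s + (LINT r:{t0<..<t}|lborel. f s r y) + J s t y"
 using eq[OF s] by eventually_elim (use t st in \<open>auto simp: I_def\<close>)
 qed
 have psij: "(%p. psi (fst p) (snd p)) : BM (borel \<Otimes>\<^sub>M (tprod M))"
 by (rule caratheodory_measurable[OF pm pc])
 have Thm: "joint3 M Th"
 proof -
 have "(%p. (fst (snd p), (fst p, snd (snd p)))) : measurable (tprod (tprod M)) (borel \<Otimes>\<^sub>M (tprod M))" by measurable
 from mcomp[OF this psij] have [measurable]: "(%p. psi (fst (snd p)) (fst p, snd (snd p))) : BM (tprod (tprod M))" by simp
 show ?thesis unfolding Th_def by measurable
 qed
 have Thd[measurable]: "(%p. Th (fst p) (fst p) (snd p)) : BM (tprod M)"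
 proof -
 have "(%p. (fst p, (fst p, snd p))) : measurable (tprod M) (tprod (tprod M))" by measurable
 from mcomp[OF this Thm] show ?thesis by simp
 qed
 define fn where "fn s y = (NN lborel (%r. ennreal (norm (f s r y))))" for s y
 have fnm[measurable]: "joint M fn"
 proof -
 have "(%q. ennreal (norm (f (fst (fst q)) (snd q) (snd (fst q))))) : BM ((tprod M) \<Otimes>\<^sub>M lborel)" by measurable
 from lb_nn_fst[OF this] show ?thesis by (simp add: fn_def)
 qed
 \<comment> \<open>The three summands dominate initial value, drift integral and stochastic integral
   at all times \<open>t\<close> simultaneously, since the drift is integrated in norm over all
   times and \<open>S\<close> dominates the stochastic integral.\<close>
 define R where "R s y = 3 * (nsq (x s) + (fn s y)^2 + S s y)" for s y
 have Rm[measurable]: "joint M R" unfolding R_def by measurable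
 have ThR: "AE y in M. ALL t:{t0..T}. nsq (Th s t y) <= R s y" if s: "s : G" for s
 proof -
 have "AE y in M. ALL t:{t0..T}. nsq (J s t y) <= S s y" using good(1)[OF s] by (simp add: good_def)
 then show ?thesis using eq[OF s]
 proof (eventually_elim, intro ballI)
 fix y t assume J: "ALL t:{t0..T}. nsq (J s t y) <= S s y" and e: "ALL t:{t0..T}. Th s t y = x s + I s t y + J s t y" and t: "t : {t0..T}"
 have "ennreal (norm (I s t y)) <= (NN lborel (%r. ennreal (norm (indr {t0<..<t} r *\<^sub>R f s r y))))"
 unfolding I_def slint_def by (rule ennreal_norm_integral_le)
 also have "... <= fn s y" unfolding fn_def by (intro nn_mono) (auto simp: ind_def)
 finally have "(ennreal (norm (I s t y)))^2 <= (fn s y)^2" by (rule power_mono) simp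
 then have I2: "nsq (I s t y) <= (fn s y)^2" by (simp add: ennreal_power)
 have "nsq (Th s t y) = nsq (x s + I s t y + J s t y)" using e t by auto
 also have "... <= 3 * (nsq (x s) + nsq (I s t y) + nsq (J s t y))" by (rule ennreal_norm_add3_sq)
 also have "... <= R s y" unfolding R_def using J t I2 by (intro ml_mono add_mono) auto
 finally show "nsq (Th s t y) <= R s y" .
 qed
 qed
 have Rt: "(%s. NN M (R s)) : BM borel" using borel_measurable_nn_integral_fst[OF Rm] by simp
 have Rb: "(NI {t0<..<T} (%s. (NN M (R s)))) <= 300 * (1 + ennreal m0) *
 ((NI {t0<..<T} (%s. (nsq (x s) + field_L21 b s + field_L2 sg s))) + ?Nn)"
 proof -
 have [measurable]: "(%s. NN M (S s)) : BM borel" using borel_measurable_nn_integral_fst[OF Sm] by simp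
 have "(NI {t0<..<T} (%s. (NN M (R s)))) <=
 (NI {t0<..<T} (%s. (3 * (nsq (x s) + 3 * (al s * ?Nn + field_L21 b s) + (NN M (S s))))))"
 proof (intro nn_mono)
 fix s :: real
 have [measurable]: "fn s : BM M" "S s : BM M" by (auto intro: time_section_measurable[OF fnm] time_section_measurable[OF Sm])
 have "(NN M (R s)) <= 3 * (nsq (x s) + 3 * (al s * ?Nn + field_L21 b s) + (NN M (S s)))" if s: "s : {t0<..<T}"
 proof -
 have fe: "fn s y = (NI {t0<..<s} (%r. ennreal (norm (drift X u b s r y))))" for y
 unfolding fn_def using s by (intro nn_cong) (auto simp: f_def tr_def ind_def)
 have "(NN M (%y. (fn s y)^2)) <= 3 * ((NI {t0<..<s} (%r. ennreal ((norm (A s r))^2 + (norm (B s r))^2))) *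
 (NI {t0<..<s} (%r. ?n r)) + field_L21 b s)"
 unfolding fe drift_def pair_norm_def field_L21_def by (rule affine_drift_bound[OF _ _ Xm um field_section[OF bm]]) measurable
 also have "... <= 3 * (al s * ?Nn + field_L21 b s)"
 unfolding al_def using t0 s by (intro ml_mono add_mono mult_mono nn_mono) (auto simp: ind_def)
 finally have fb: "(NN M (%y. (fn s y)^2)) <= 3 * (al s * ?Nn + field_L21 b s)" .
 have "(NN M (R s)) = 3 * (nsq (x s) + (NN M (%y. (fn s y)^2)) + (NN M (S s)))"
 unfolding R_def by (simp add: nn_cmult nn_add emeasure_space_1 del: distrib_left_numeral)
 also have "... <= 3 * (nsq (x s) + 3 * (al s * ?Nn + field_L21 b s) + (NN M (S s)))"
 using fb by (intro ml_mono add_mono) auto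
 finally show ?thesis .
 qed
 then show "(NN M (R s)) * indicator {t0<..<T} s <= 3 * (nsq (x s) + 3 * (al s * ?Nn + field_L21 b s) + (NN M (S s))) * indicator {t0<..<T} s"
 by (auto simp: ind_def simp del: distrib_left_numeral)
 qed
 also have "... = 3 * ((NI {t0<..<T} (%s. nsq (x s))) + 3 * ((NI {t0<..<T} al) * ?Nn + (NI {t0<..<T} (field_L21 b))) + (NI {t0<..<T} (%s. (NN M (S s)))))"
 proof -
 have e: "3 * (a + 3 * (l * n + c) + d) * i = 3 * (a * i + 3 * (n * (l * i) + c * i) + d * i)" for a l n c d i :: "'c::comm_semiring_1" by (simp add: algebra_simps)
 show ?thesis unfolding e by (simp add: nn_add nn_cmult mult.commute[of _ ?Nn] del: distrib_left_numeral)
 qed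
 also have "... <= 3 * ((NI {t0<..<T} (%s. nsq (x s))) + 3 * (ennreal m0 * ?Nn + (NI {t0<..<T} (field_L21 b))) + 16 * (3 * (ennreal m0 * ?Nn + (NI {t0<..<T} (%s. field_L2 sg s)))))"
 proof (intro ml_mono add_mono mr_mono order_refl)
 have "(NI {t0<..<T} al) <= (NI {0<..<T} al)"
 using t0 by (intro nn_mono) (auto simp: ind_def)
 then show "(NI {t0<..<T} al) <= ennreal m0" using ap unfolding al_def by (rule order_trans)
 have "(NI {t0<..<T} (%s. (NN M (S s)))) = (NN ?N (%s. NN M (S s)))" by (rule Nn[symmetric]) measurable
 also have "... <= 16 * (3 * (ennreal m0 * ?Nn + (NI {t0<..<T} (%s. field_L2 sg s))))"
 by (rule order_trans[OF Sb ml_mono[OF hb]]) simp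
 finally show "(NI {t0<..<T} (%s. (NN M (S s)))) <= 16 * (3 * (ennreal m0 * ?Nn + (NI {t0<..<T} (%s. field_L2 sg s))))" .
 qed auto
 also have "... <= 300 * (1 + ennreal m0) * (((NI {t0<..<T} (%s. nsq (x s))) + (NI {t0<..<T} (field_L21 b)) + (NI {t0<..<T} (%s. field_L2 sg s))) + ?Nn)"
 by (rule collect_step_exists)
 also have "... = 300 * (1 + ennreal m0) * ((NI {t0<..<T} (%s. (nsq (x s) + field_L21 b s + field_L2 sg s))) + ?Nn)"
 by (simp add: distrib_right nn_add)
 finally show ?thesis .
 qed
 let ?R = "NI {t0<..<T} (%s. (NN M (R s)))"
 have "(NI {t0<..<T} (%s. (nsq (x s) + field_L21 b s + field_L2 sg s))) < \<infinity>"
 using fin by (simp add: distrib_right nn_add)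
 then have Rfin: "?R < \<infinity>" using Nfin by (intro le_less_trans[OF Rb]) (simp add: ennreal_mult_less_top)
 have Thb: "(nn2 M (Th s t)) <= (NN M (R s))" if t: "t : {t0..T}" for s t
 proof (cases "s : G")
 case True
 show ?thesis by (rule nn_mono_AE, use ThR[OF True] in eventually_elim) (use t in auto)
 qed (simp add: Th_def)
 have resp: "response Th"
 unfolding response_def
 proof
 have "(NI {t0<..<T} (%s. (NI {t0<..<s} (%t. (nn2 M (Th s t)))))) <=
 (NN lborel (%s. ennreal (T - t0) * ((NN M (R s)) * indicator {t0<..<T} s)))"
 proof (rule nn_mono)
 fix s :: real
 have "(NI {t0<..<s} (%t. (nn2 M (Th s t)))) <= ennreal (T - t0) * (NN M (R s))" if s: "s : {t0<..<T}"
 proof -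
 have "(NI {t0<..<s} (%t. (nn2 M (Th s t)))) <= (NN lborel (%t. (NN M (R s)) * indicator {t0<..<T} t))"
 using s Thb by (intro nn_mono) (auto simp: ind_def)
 also have "... = ennreal (T - t0) * (NN M (R s))"
 using t0 by (subst nn_integral_cmult_indicator) (auto simp: mult.commute)
 finally show ?thesis .
 qed
 then show "(NI {t0<..<s} (%t. (nn2 M (Th s t)))) * indicator {t0<..<T} s <= ennreal (T - t0) * ((NN M (R s)) * indicator {t0<..<T} s)"
 by (auto simp: ind_def)
 qed
 also have "... = ennreal (T - t0) * ?R" using Rt by (intro nn_cmult) auto
 also have "... < \<infinity>" using Rfin by (simp add: ennreal_mult_less_top)
 finally show "(NI {t0<..<T} (%s. (NI {t0<..<s} (%t. (nn2 M (Th s t)))))) < \<infinity>" .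
 qed (rule Thm)
 \<comment> \<open>Joint measurability and adaptedness of the state come from the field on the
   diagonal, where the representation for \<open>t = s\<close> is available.\<close>
 define X' where "X' t y = Th t t y" for t y
 define u' where "u' t y = XX t *v X' t y + (LINT s:{t<..<T}|lborel. Ga s t *v Th s t y) + v t y" for t y
 have X'm[measurable]: "joint M X'" unfolding X'_def by (rule Thd)
 have X'fin: "(NI {t0<..<T} (%r. (nn2 M (X' r)))) <= ?R"
 using Thb by (intro nn_mono) (auto simp: X'_def ind_def)
 have pX: "process X'"
 unfolding process_def using X'm le_less_trans[OF X'fin Rfin] Thad by (auto simp: X'_def[abs_def])
 have pu: "process u'"
 unfolding process_def
 proof (intro conjI)
 note [measurable] = processD(1)[OF v] response_gain_measurable[OF Thm] XX(1)
 have rga: "AEI t0 T (%t. (%y. LINT s:{t<..<T}|lborel. Ga s t *v Th s t y) : BM (F t))"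
 by (rule response_gain_adapted[OF resp]) (rule Thad)
 show "joint M u'" unfolding u'_def by measurable
 show "AEI t0 T (%r. u' r : BM (F r))"
 using rga processD(2)[OF v] processD(2)[OF pX]
 proof (eventually_elim, intro impI)
 fix r assume "r : {t0<..<T} --> (%y. LINT s:{r<..<T}|lborel. Ga s r *v Th s r y) : BM (F r)"
 "r : {t0<..<T} --> v r : BM (F r)" "r : {t0<..<T} --> X' r : BM (F r)" "r : {t0<..<T}"
 then have [measurable]: "(%y. LINT s:{r<..<T}|lborel. Ga s r *v Th s r y) : BM (F r)" "v r : BM (F r)" "X' r : BM (F r)"
 by auto
 show "u' r : BM (F r)" unfolding u'_def by measurable
 qed
 have "(NI {t0<..<T} (%r. (nn2 M (u' r)))) <=
 (NI {t0<..<T} (%r. 3 * (ennreal (xx^2) * (nn2 M (X' r)) + 3 * (gn r * ?R) + (nn2 M (v r)))))"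
 proof (rule nn_mono)
 fix r :: real
 have "(nn2 M (u' r)) <= 3 * (ennreal (xx^2) * (nn2 M (X' r)) + 3 * (gn r * ?R) + (nn2 M (v r)))" if r: "r : {t0<..<T}"
 proof -
 have "(NI {r<..<T} (%s. (nn2 M (Th s r)))) <= ?R"
 using r Thb by (intro nn_mono) (auto simp: ind_def)
 then show ?thesis unfolding u'_def
 by (intro order_trans[OF control_norm_bound[OF resp processD(1)[OF v] X'm]] ml_mono add_mono order_refl) auto
 qed
 then show "(nn2 M (u' r)) * indicator {t0<..<T} r <= 3 * (ennreal (xx^2) * (nn2 M (X' r)) + 3 * (gn r * ?R) + (nn2 M (v r))) * indicator {t0<..<T} r"
 by (auto simp: ind_def simp del: distrib_left_numeral)
 qed
 also have "... = 3 * (ennreal (xx^2) * (NI {t0<..<T} (%r. (nn2 M (X' r)))) + 3 * ((NI {t0<..<T} gn) * ?R) + (NI {t0<..<T} (%r. (nn2 M (v r)))))"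
 proof -
 note [measurable] = process_time_measurable[OF X'm] process_time_measurable[OF processD(1)[OF v]]
 have e: "3 * (a * l + 3 * (g * n) + d) * i = 3 * (a * (l * i) + 3 * (n * (g * i)) + d * i)" for a l n g d i :: "'c::comm_semiring_1" by (simp add: algebra_simps)
 show ?thesis unfolding e by (simp add: nn_add nn_cmult mult.commute[of _ ?R] del: distrib_left_numeral)
 qed
 also have "... < \<infinity>"
 proof -
 have "(NI {t0<..<T} gn) <= (NI {0<..<T} gn)"
 using t0 by (intro nn_mono) (auto simp: ind_def)
 also have "... < \<infinity>" using gain unfolding gn_def by (rule le_less_trans) simp
 finally show ?thesis using Rfin le_less_trans[OF X'fin Rfin] processD(3)[OF v] by (simp add: ennreal_mult_less_top del: distrib_left_numeral)
 qed
 finally show "(NI {t0<..<T} (%r. (nn2 M (u' r)))) < \<infinity>" .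
 qed
 have "step x b sg v X u X' Th u'"
 unfolding step_def
 proof (intro conjI)
 show "AEI t0 T (%t. sv_rep (x t) (drift X u b t) (diffusion X u sg t) t (X' t))"
 using AEG
 proof (eventually_elim, intro impI)
 fix t assume "t : {t0<..<T} --> t : G" "t : {t0<..<T}"
 then have "sv_rep (x t) (drift X u b t) (diffusion X u sg t) t (Th t t)" by (intro rep) auto
 then show "sv_rep (x t) (drift X u b t) (diffusion X u sg t) t (X' t)" by (simp add: X'_def[abs_def])
 qed
 show "AEI t0 T (%s. (ALL t:{t0<..<s}. sv_rep (x s) (drift X u b s) (diffusion X u sg s) t (Th s t)))"
 using AEG by eventually_elim (auto intro!: rep)
 qed (simp add: u'_def)
 moreover have "AEI t0 T (%s. (AE y in M. ALL t:{t0..T}. nsq (Th s t y) <= R s y))"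
 using AEG by eventually_elim (auto intro: ThR)
 ultimately show ?thesis using pX pu resp Thc Thad Rm Rb by blast
qed

end

section \<open>Null sets of the product, and the weighted distance\<close>

lemma (in brownian_basis) AE_pair_of_time:
 assumes "AE r in lborel. P r"
 shows "AE p in lborel \<Otimes>\<^sub>M M. P (fst p :: real)"
proof -
 interpret Q: pair_sigma_finite lborel M ..
 obtain N where N: "{r : space lborel. \<not> P r} \<subseteq> N" "N : null_sets lborel"
 using assms by (elim AE_E) (auto simp: null_sets_def)
 have [measurable]: "N : sets borel" using N(2) by auto
 have "AE p in lborel \<Otimes>\<^sub>M M. fst p ~: N"
 proof (rule Q.AE_pair_measure)
 show "{p : space (tprod M). fst p ~: N} : sets (tprod M)" by measurable
 show "AE r in lborel. AE z in M. fst (r, z) ~: N" using AE_not_in[OF N(2)] by eventually_elim simp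
 qed
 then show ?thesis by eventually_elim (use N(1) in auto)
qed

lemma (in brownian_basis) AE_restrict_pair:
 fixes S :: "real set"
 assumes P: "AE p in lborel \<Otimes>\<^sub>M M. fst p : S --> P p" and S[measurable]: "S : sets borel"
 shows "AE p in restrict_space lborel S \<Otimes>\<^sub>M M. P p"
proof -
 let ?R = "restrict_space lborel S \<Otimes>\<^sub>M M"
 interpret Q: pair_sigma_finite lborel M ..
 interpret S: sigma_finite_measure "restrict_space lborel S" by (rule sigma_finite_measure_restrict_space[OF lborel.sigma_finite_measure_axioms]) simp
 interpret R: pair_sigma_finite "restrict_space lborel S" M ..
 obtain N where N: "{p : space (tprod M). \<not> (fst p : S --> P p)} \<subseteq> N" "N : null_sets (tprod M)"
 using P by (elim AE_E) (auto simp: null_sets_def)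
 have id: "(%p. (fst p, snd p)) : measurable ?R (tprod M)"
 by (intro measurable_Pair measurable_snd mcomp[OF measurable_fst measurable_restrict_space1]) simp
 have "AE p in ?R. p ~: N"
 proof (rule R.AE_pair_measure)
 have "(%p. (fst p, snd p)) -` N \<inter> space ?R : sets ?R" using N(2) by (intro measurable_sets[OF id]) auto
 then have "space ?R - ((%p. (fst p, snd p)) -` N \<inter> space ?R) : sets ?R" by blast
 moreover have "space ?R - ((%p. (fst p, snd p)) -` N \<inter> space ?R) = {p : space ?R. p ~: N}" by auto
 ultimately show "{p : space ?R. p ~: N} : sets ?R" by simp
 have "AE r in lborel. AE z in M. (r, z) ~: N" by (rule Q.AE_pair[OF AE_not_in[OF N(2)]])
 then have "AE r in lborel. r : S --> (AE z in M. (r, z) ~: N)" by eventually_elim simp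
 then show "AE r in restrict_space lborel S. AE z in M. (r, z) ~: N" by (subst AE_restrict_space_iff) auto
 qed
 then show ?thesis using AE_space
 by eventually_elim (use N(1) in \<open>auto simp: sp_pair space_restrict_space subset_eq\<close>)
qed

lemma (in brownian_basis) AE_pair_swap:
 assumes P: "AE p in lborel \<Otimes>\<^sub>M M. P (fst p :: real) (snd p)"
 shows "AE z in M. AE r in lborel. P r z"
proof -
 interpret Q: pair_sigma_finite lborel M ..
 obtain N where N: "{p : space (tprod M). \<not> P (fst p) (snd p)} \<subseteq> N" "N : null_sets (tprod M)"
 using P by (elim AE_E) (auto simp: null_sets_def)
 have [measurable]: "N : sets (tprod M)" using N(2) by auto
 have "AE r in lborel. AE z in M. (r, z) ~: N" by (rule Q.AE_pair[OF AE_not_in[OF N(2)]])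
 moreover have "{p : space (tprod M). (fst p, snd p) ~: N} : sets (tprod M)"
 proof -
 have "space (tprod M) - N : sets (tprod M)" by measurable
 moreover have "space (tprod M) - N = {p : space (tprod M). (fst p, snd p) ~: N}" by auto
 ultimately show ?thesis by (simp only:)
 qed
 ultimately have "AE z in M. AE r in lborel. (r, z) ~: N" using Q.AE_commute[of "%r z. (r, z) ~: N"] by simp
 then show ?thesis using AE_space
 proof eventually_elim
 case (elim z)
 show ?case using elim(1) by eventually_elim (use N(1) elim(2) in \<open>auto simp: sp_pair subset_eq\<close>)
 qed
qed

lemma convergent_of_suminf_increments:
 fixes f :: "nat => 'b::euclidean_space"
 assumes "(\<Sum>k. 4 ^ k * nsq (f (Suc k) - f k)) < \<infinity>"
 shows "convergent f"
proof -
 obtain c where c: "(\<Sum>k. 4 ^ k * nsq (f (Suc k) - f k)) = ennreal c" "0 <= c"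
 using assms by (cases "\<Sum>k. 4 ^ k * nsq (f (Suc k) - f k)") auto
 have b: "norm (f (Suc k) - f k) <= sqrt c * (1/2) ^ k" for k
 proof -
 have "(4::ennreal) ^ k = ennreal (4 ^ k)" by (metis ennreal_numeral ennreal_power zero_le_numeral)
 then have "ennreal (4 ^ k * (norm (f (Suc k) - f k))^2) = 4 ^ k * nsq (f (Suc k) - f k)" by (simp add: ennreal_mult)
 also have "... <= ennreal c" unfolding c(1)[symmetric] using sum_le_suminf[of "%k. 4 ^ k * nsq (f (Suc k) - f k)" "{k}"] by simp
 finally have "4 ^ k * (norm (f (Suc k) - f k))^2 <= c" using c(2) by simp
 moreover have "(4::real) ^ k = (2 ^ k)^2" by (simp add: power2_eq_square power_mult_distrib[symmetric])
 ultimately have "(2 ^ k * norm (f (Suc k) - f k))^2 <= c" by (simp add: power_mult_distrib)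
 then have "2 ^ k * norm (f (Suc k) - f k) <= sqrt c" by (rule real_le_rsqrt)
 then show ?thesis by (simp add: power_divide field_simps)
 qed
 have "summable (%k. sqrt c * (1/2) ^ k)" by (intro summable_mult summable_geometric) simp
 then have "summable (%k. f (Suc k) - f k)" using b by (rule summable_comparison_test'[where N=0])
 then have "convergent (%n. \<Sum>k<n. f (Suc k) - f k)" by (simp add: summable_iff_convergent)
 then have "convergent (%n. (\<Sum>k<n. f (Suc k) - f k) + f 0)" by (rule convergent_add[OF _ convergent_const])
 then show ?thesis by (simp add: sum_lessThan_telescope)
qed

context svie
begin

lemma sv_rep_cong:
 assumes rep: "sv_rep y f h t Th" and f: "AEP M t0 t (%p. f (fst p) (snd p) = f' (fst p) (snd p))"
 and h: "AEP M t0 t (%p. h (fst p) (snd p) = h' (fst p) (snd p))"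
 and m: "joint M f" "joint M f'"
 shows "sv_rep y f' h' t Th"
proof -
 obtain Y where Y: "has_ito_integral M W F t0 t h Y" "AE z in M. Th z = y + (LINT r:{t0<..<t}|lborel. f r z) + Y z"
 using rep by (auto simp: sv_rep_def)
 have "has_ito_integral M W F t0 t h' Y"
 by (rule has_ito_integral_cong_AE[OF Y(1) AE_completion[OF AE_restrict_pair[OF h]]]) simp
 moreover have "AE z in M. Th z = y + (LINT r:{t0<..<t}|lborel. f' r z) + Y z"
 using Y(2) AE_pair_swap[of "%r z. r : {t0<..<t} --> f r z = f' r z", OF f] AE_space
 proof eventually_elim
 case (elim z)
 have "(LINT r:{t0<..<t}|lborel. f r z) = (LINT r:{t0<..<t}|lborel. f' r z)"
 unfolding slint_def
 proof (rule integral_cong_AE)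
 show "AE r in lborel. indr {t0<..<t} r *\<^sub>R f r z = indr {t0<..<t} r *\<^sub>R f' r z"
 using elim(2) by eventually_elim (auto simp: ind_def)
 qed (use section_measurable[OF m(1) elim(3)] section_measurable[OF m(2) elim(3)] in auto)
 then show ?case using elim(1) by simp
 qed
 ultimately show ?thesis by (auto simp: sv_rep_def)
qed

text \<open>Drift and stochastic integral see the input only up to almost everywhere equality. This
  turns an almost everywhere fixed point into an exact one and lets two solutions be compared with a
  common input.\<close>

lemma step_cong:
 assumes st: "step x b sg v X u X' Th u'"
 and eq: "AEP M t0 T (%p. X (fst p) (snd p) = X2 (fst p) (snd p) & u (fst p) (snd p) = u2 (fst p) (snd p))"
 and m: "joint M X" "joint M X2"
 "joint M u" "joint M u2"
 and b: "joint3 M b"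
 shows "step x b sg v X2 u2 X' Th u'"
proof -
 have R: "sv_rep y (drift X2 u2 b s) (diffusion X2 u2 sg s) t tt" if "sv_rep y (drift X u b s) (diffusion X u sg s) t tt" "t <= T" for y s t tt
 proof (rule sv_rep_cong[OF that(1)])
 show "AEP M t0 t (%p. drift X u b s (fst p) (snd p) = drift X2 u2 b s (fst p) (snd p))"
 using eq by eventually_elim (use that(2) in \<open>simp add: drift_def\<close>)
 show "AEP M t0 t (%p. diffusion X u sg s (fst p) (snd p) = diffusion X2 u2 sg s (fst p) (snd p))"
 using eq by eventually_elim (use that(2) in \<open>simp add: diffusion_def\<close>)
 show "(%p. drift X u b s (fst p) (snd p)) : BM (tprod M)" "(%p. drift X2 u2 b s (fst p) (snd p)) : BM (tprod M)"
 by (rule drift_measurable(1)[of X u b s, OF m(1,3) field_section[OF b]], rule drift_measurable(1)[of X2 u2 b s, OF m(2,4) field_section[OF b]])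
 qed
 note st1 = st[unfolded step_def, THEN conjunct1] and st2 = st[unfolded step_def, THEN conjunct2, THEN conjunct1]
 and st3 = st[unfolded step_def, THEN conjunct2, THEN conjunct2]
 show ?thesis
 unfolding step_def
 proof (intro conjI)
 show "AEI t0 T (%t. sv_rep (x t) (drift X2 u2 b t) (diffusion X2 u2 sg t) t (X' t))"
 using st1
 proof (eventually_elim, intro impI)
 fix t assume "t : {t0<..<T} --> sv_rep (x t) (drift X u b t) (diffusion X u sg t) t (X' t)" "t : {t0<..<T}"
 then show "sv_rep (x t) (drift X2 u2 b t) (diffusion X2 u2 sg t) t (X' t)" by (intro R) auto
 qed
 show "AEI t0 T (%s. (ALL t:{t0<..<s}. sv_rep (x s) (drift X2 u2 b s) (diffusion X2 u2 sg s) t (Th s t)))"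
 using st2
 proof (eventually_elim, intro impI ballI)
 fix s t assume "s : {t0<..<T} --> (ALL t:{t0<..<s}. sv_rep (x s) (drift X u b s) (diffusion X u sg s) t (Th s t))" "s : {t0<..<T}" "t : {t0<..<s}"
 then show "sv_rep (x s) (drift X2 u2 b s) (diffusion X2 u2 sg s) t (Th s t)" by (intro R) auto
 qed
 qed (rule st3)
qed

text \<open>The square of a weighted L2 distance; hence the factor 2 in
  \<open>wnorm_triangle\<close>.\<close>

definition wnorm :: "(real => real) => (real => 'a => real ^ 'd) => (real => 'a => real ^ 'l) => (real => 'a => real ^ 'd) => (real => 'a => real ^ 'l) => ennreal" where
 "wnorm w X u X2 u2 = (NI {t0<..<T} (%t. ennreal (w t) * pair_norm (%r z. X r z - X2 r z) (%r z. u r z - u2 r z) t))"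

text \<open>\<open>volterra_weighted_estimate\<close> applied to \<open>step_difference\<close>. The
  weight is at most 1 on the data terms, and \<open>gn\<close> has total mass at most
  \<open>m0\<close>, which produces the factor \<open>1 + m0\<close>.\<close>

lemma step_weighted:
 assumes data: "data x b sg v" "data x2 b2 sg2 v2"
 and X: "process X" "process X2" and u: "process u" "process u2"
 and X': "joint M X'" "joint M X2'"
 and u': "joint M u'" "joint M u2'"
 and Th: "response Th" "response Th2"
 and st: "step x b sg v X u X' Th u'" "step x2 b2 sg2 v2 X2 u2 X2' Th2 u2'"
 and w: "volterra_weight T step_kernel eta w" "0 < eta"
 shows "wnorm w X' u' X2' u2' <= ennreal step_const * ((1 + ennreal m0) * (NI {t0<..<T} (%s. data_diff x b sg x2 b2 sg2 s)) +
 (NI {t0<..<T} (%t. (NN M (%z. nsq (v t z - v2 t z)))))) + ennreal eta * wnorm w X u X2 u2"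
proof -
 let ?dd = "data_diff x b sg x2 b2 sg2"
 let ?D = "NI {t0<..<T} (%s. ?dd s)"
 let ?v = "%t. NN M (%z. nsq (v t z - v2 t z))"
 let ?d = "%t. ennreal step_const * (?dd t + gn t * ?D + ?v t)"
 have vm: "(%p. v (fst p) (snd p) - v2 (fst p) (snd p)) : BM (tprod M)"
 using data processD(1) by (auto simp: data_def intro!: borel_measurable_diff)
 note [measurable] = data_diff_measurable[OF data] process_time_measurable[OF vm]
 have Dm: "(%p. X (fst p) (snd p) - X2 (fst p) (snd p)) : BM (tprod M)" "(%p. u (fst p) (snd p) - u2 (fst p) (snd p)) : BM (tprod M)"
 using processD(1)[OF X(1)] processD(1)[OF X(2)] processD(1)[OF u(1)] processD(1)[OF u(2)] by measurable
 have km: "(%p. step_kernel (fst p) (snd p)) : BM (tprod lborel)" using step_kernel_small by (auto simp: volterra_small_def)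
 have "wnorm w X' u' X2' u2' <= (NI {t0<..<T} (%t. ennreal (w t) * ?d t)) + ennreal eta * wnorm w X u X2 u2"
 unfolding wnorm_def
 by (rule volterra_weighted_estimate[OF w(1) t0(1) w(2) km pair_norm_measurable[OF Dm] _ step_difference[OF data X u X' u' Th st]]) measurable
 also have "(NI {t0<..<T} (%t. ennreal (w t) * ?d t)) <= (NI {t0<..<T} (%t. ?d t))"
 proof (rule nn_mono)
 fix t
 have "ennreal (w t) <= 1" using w(1) by (auto simp: volterra_weight_def)
 then have "ennreal (w t) * ?d t <= 1 * ?d t" by (rule mr_mono) simp
 then show "ennreal (w t) * ?d t * indicator {t0<..<T} t <= ?d t * indicator {t0<..<T} t" by (intro mr_mono) auto
 qed
 also have "(NI {t0<..<T} (%t. ?d t)) = ennreal step_const * (?D + (NI {t0<..<T} gn) * ?D + (NI {t0<..<T} (%t. ?v t)))"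
 proof -
 have e: "(k * (a + g * dd + c)) * i = k * (a * i + dd * (g * i) + c * i)" for k a g dd c i :: "'c::comm_semiring_1" by (simp add: algebra_simps)
 show ?thesis unfolding e by (simp add: nn_add nn_cmult mult.commute[of _ ?D])
 qed
 also have "... <= ennreal step_const * ((1 + ennreal m0) * ?D + (NI {t0<..<T} (%t. ?v t)))"
 proof -
 have "(NI {t0<..<T} gn) <= (NI {0<..<T} gn)"
 using t0 by (intro nn_mono) (auto simp: ind_def)
 also have "... <= ennreal m0" using gain unfolding gn_def .
 finally show ?thesis unfolding distrib_right[of 1] mult_1 by (intro ml_mono add_mono mr_mono) auto
 qed
 finally show ?thesis by (simp add: add_right_mono)
qed

lemma wnorm_pair_norm:
 assumes w: "volterra_weight T k eta w"
 and m: "joint M X" "joint M X2"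
 "joint M u" "joint M u2"
 and dl: "0 < dl" "\<And>t. dl <= w t"
 shows "ennreal dl * (NI {t0<..<T} (%t. pair_norm (%r z. X r z - X2 r z) (%r z. u r z - u2 r z) t)) <= wnorm w X u X2 u2"
 and "wnorm w X u X2 u2 <= (NI {t0<..<T} (%t. pair_norm (%r z. X r z - X2 r z) (%r z. u r z - u2 r z) t))"
proof -
 let ?n = "pair_norm (%r z. X r z - X2 r z) (%r z. u r z - u2 r z)"
 have Dm: "(%p. X (fst p) (snd p) - X2 (fst p) (snd p)) : BM (tprod M)" "(%p. u (fst p) (snd p) - u2 (fst p) (snd p)) : BM (tprod M)"
 using m by measurable
 note [measurable] = pair_norm_measurable[OF Dm]
 have "ennreal dl * (NI {t0<..<T} (%t. ?n t)) = (NN lborel (%t. ennreal dl * (?n t * indicator {t0<..<T} t)))"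
 by (rule nn_cmult[symmetric]) measurable
 also have "... <= wnorm w X u X2 u2"
 unfolding wnorm_def mult.assoc by (intro nn_mono mr_mono ennreal_leI dl) auto
 finally show "ennreal dl * (NI {t0<..<T} (%t. ?n t)) <= wnorm w X u X2 u2" .
 show "wnorm w X u X2 u2 <= (NI {t0<..<T} (%t. ?n t))"
 unfolding wnorm_def
 proof (intro nn_mono mr_mono)
 fix t
 have "ennreal (w t) <= 1" using w by (auto simp: volterra_weight_def)
 from mr_mono[OF this, of "?n t"] show "ennreal (w t) * ?n t <= ?n t" by simp
 qed auto
qed

lemma pair_norm_diff:
 assumes m: "joint M X" "joint M X2"
 "joint M u" "joint M u2"
 shows "pair_norm (%r z. X r z - X2 r z) (%r z. u r z - u2 r z) t <= 2 * (pair_norm X u t + pair_norm X2 u2 t)"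
proof -
 have [measurable]: "X t : BM M" "X2 t : BM M" "u t : BM M" "u2 t : BM M"
 by (auto intro: time_section_measurable m)
 have "pair_norm (%r z. X r z - X2 r z) (%r z. u r z - u2 r z) t <=
 (NN M (%z. 2 * (ennreal ((norm (X t z))^2 + (norm (u t z))^2) + ennreal ((norm (X2 t z))^2 + (norm (u2 t z))^2))))"
 unfolding pair_norm_def
 proof (rule nn_mono)
 fix z
 have sq: "(norm (a - c))^2 <= 2 * ((norm a)^2 + (norm c)^2)" for a c :: "'e::real_normed_vector"
 using norm_add_sq[of a "- c"] by simp
 have "(norm (X t z - X2 t z))^2 + (norm (u t z - u2 t z))^2 <= 2 * (((norm (X t z))^2 + (norm (u t z))^2) + ((norm (X2 t z))^2 + (norm (u2 t z))^2))"
 using sq[of "X t z" "X2 t z"] sq[of "u t z" "u2 t z"] by simp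
 then have "ennreal ((norm (X t z - X2 t z))^2 + (norm (u t z - u2 t z))^2) <= ennreal (2 * (((norm (X t z))^2 + (norm (u t z))^2) + ((norm (X2 t z))^2 + (norm (u2 t z))^2)))"
 by (rule ennreal_leI)
 then show "ennreal ((norm (X t z - X2 t z))^2 + (norm (u t z - u2 t z))^2) <= 2 * (ennreal ((norm (X t z))^2 + (norm (u t z))^2) + ennreal ((norm (X2 t z))^2 + (norm (u2 t z))^2))"
 by (simp add: ennreal_mult del: distrib_left_numeral)
 qed
 also have "... = 2 * (pair_norm X u t + pair_norm X2 u2 t)"
 by (simp add: pair_norm_def nn_cmult nn_add del: distrib_left_numeral ennreal_plus)
 finally show ?thesis .
qed

lemma wnorm_triangle:
 assumes m: "joint M X" "joint M u"
 "joint M X2" "joint M u2"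
 "joint M X3" "joint M u3"
 and [measurable]: "w : BM borel"
 shows "wnorm w X u X3 u3 <= 2 * (wnorm w X u X2 u2 + wnorm w X3 u3 X2 u2)"
proof -
 have Dm: "(%p. X (fst p) (snd p) - X2 (fst p) (snd p)) : BM (tprod M)" "(%p. u (fst p) (snd p) - u2 (fst p) (snd p)) : BM (tprod M)"
 "(%p. X3 (fst p) (snd p) - X2 (fst p) (snd p)) : BM (tprod M)" "(%p. u3 (fst p) (snd p) - u2 (fst p) (snd p)) : BM (tprod M)"
 using m by measurable
 note [measurable] = pair_norm_measurable[OF Dm(1,2)] pair_norm_measurable[OF Dm(3,4)]
 let ?a = "pair_norm (%r z. X r z - X2 r z) (%r z. u r z - u2 r z)" and ?c = "pair_norm (%r z. X3 r z - X2 r z) (%r z. u3 r z - u2 r z)"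
 have "wnorm w X u X3 u3 <= (NN lborel (%t. 2 * (ennreal (w t) * ?a t * indicator {t0<..<T} t + ennreal (w t) * ?c t * indicator {t0<..<T} t)))"
 unfolding wnorm_def
 proof (rule nn_mono)
 fix t
 have "pair_norm (%r z. X r z - X3 r z) (%r z. u r z - u3 r z) t <= 2 * (?a t + ?c t)"
 using pair_norm_diff[OF Dm(1,3,2,4), of t] by simp
 then have "ennreal (w t) * pair_norm (%r z. X r z - X3 r z) (%r z. u r z - u3 r z) t * indicator {t0<..<T} t <= ennreal (w t) * (2 * (?a t + ?c t)) * indicator {t0<..<T} t"
 by (intro mr_mono ml_mono) auto
 also have "... = 2 * (ennreal (w t) * ?a t * indicator {t0<..<T} t + ennreal (w t) * ?c t * indicator {t0<..<T} t)"
 by (simp only: distrib_left distrib_right ac_simps)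
 finally show "ennreal (w t) * pair_norm (%r z. X r z - X3 r z) (%r z. u r z - u3 r z) t * indicator {t0<..<T} t <=
 2 * (ennreal (w t) * ?a t * indicator {t0<..<T} t + ennreal (w t) * ?c t * indicator {t0<..<T} t)" .
 qed
 also have "... = 2 * (wnorm w X u X2 u2 + wnorm w X3 u3 X2 u2)"
 unfolding wnorm_def by (simp add: nn_cmult nn_add del: distrib_left_numeral)
 finally show ?thesis .
qed

lemma wnorm_finite:
 assumes w: "volterra_weight T k eta w" and p: "process X" "process X2" "process u" "process u2"
 shows "wnorm w X u X2 u2 < \<infinity>"
proof -
 note m = processD(1)[OF p(1)] processD(1)[OF p(2)] processD(1)[OF p(3)] processD(1)[OF p(4)]
 note [measurable] = m pair_norm_measurable[OF m(1,3)] pair_norm_measurable[OF m(2,4)]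
 obtain dl where dl: "0 < dl" "\<And>t. dl <= w t" using w by (auto simp: volterra_weight_def)
 have "(NI {t0<..<T} (%t. pair_norm (%r z. X r z - X2 r z) (%r z. u r z - u2 r z) t)) <=
 (NN lborel (%t. 2 * (pair_norm X u t * indicator {t0<..<T} t + pair_norm X2 u2 t * indicator {t0<..<T} t)))"
 proof (rule nn_mono)
 fix t
 have "pair_norm (%r z. X r z - X2 r z) (%r z. u r z - u2 r z) t <= 2 * (pair_norm X u t + pair_norm X2 u2 t)"
 by (rule pair_norm_diff[OF m])
 then show "pair_norm (%r z. X r z - X2 r z) (%r z. u r z - u2 r z) t * indicator {t0<..<T} t <=
 2 * (pair_norm X u t * indicator {t0<..<T} t + pair_norm X2 u2 t * indicator {t0<..<T} t)"
 by (auto simp: ind_def simp del: distrib_left_numeral)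
 qed
 also have "... = 2 * ((NI {t0<..<T} (pair_norm X u)) + (NI {t0<..<T} (pair_norm X2 u2)))"
 by (simp add: nn_cmult nn_add del: distrib_left_numeral)
 also have "... < \<infinity>" using pair_norm_finite[OF p(1,3)] pair_norm_finite[OF p(2,4)] by (simp add: ennreal_mult_less_top del: distrib_left_numeral)
 finally show ?thesis using wnorm_pair_norm(2)[OF w m dl] by (rule le_less_trans[rotated])
qed

text \<open>The weight is bounded below, so the second moment of the difference vanishes at almost
  every time; measurability of the pair turns this into an almost everywhere statement on the
  product.\<close>

lemma wnorm_zero:
 assumes w: "volterra_weight T k eta w"
 and m[measurable]: "joint M X" "joint M X2"
 "joint M u" "joint M u2"
 and z: "wnorm w X u X2 u2 = 0"
 shows "AEP M t0 T (%p. X (fst p) (snd p) = X2 (fst p) (snd p) & u (fst p) (snd p) = u2 (fst p) (snd p))"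
proof -
 interpret Q: pair_sigma_finite lborel M ..
 let ?n = "pair_norm (%r y. X r y - X2 r y) (%r y. u r y - u2 r y)"
 obtain dl where dl: "0 < dl" "\<And>t. dl <= w t" using w by (auto simp: volterra_weight_def)
 have Dm: "(%p. X (fst p) (snd p) - X2 (fst p) (snd p)) : BM (tprod M)" "(%p. u (fst p) (snd p) - u2 (fst p) (snd p)) : BM (tprod M)"
 by measurable
 note [measurable] = pair_norm_measurable[OF Dm]
 have "ennreal dl * (NI {t0<..<T} (%t. ?n t)) = 0" using wnorm_pair_norm(1)[OF w m dl] z by simp
 then have "(NI {t0<..<T} (%t. ?n t)) = 0" using dl(1) by simp
 then have "AE t in lborel. ?n t * indicator {t0<..<T} t = 0" by (subst (asm) nn_integral_0_iff_AE) auto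
 then have "AE t in lborel. AE y in M. t : {t0<..<T} --> X t y = X2 t y & u t y = u2 t y"
 proof eventually_elim
 case (elim t)
 have [measurable]: "X t : BM M" "X2 t : BM M" "u t : BM M" "u2 t : BM M"
 by (auto intro: time_section_measurable m)
 show ?case
 proof (cases "t : {t0<..<T}")
 case True
 then have "(NN M (%y. ennreal ((norm (X t y - X2 t y))^2 + (norm (u t y - u2 t y))^2))) = 0" using elim by (simp add: pair_norm_def)
 then have "AE y in M. ennreal ((norm (X t y - X2 t y))^2 + (norm (u t y - u2 t y))^2) = 0" by (subst (asm) nn_integral_0_iff_AE) auto
 then show ?thesis
 proof eventually_elim
 case (elim y)
 then have "(norm (X t y - X2 t y))^2 + (norm (u t y - u2 t y))^2 <= 0" by (simp add: ennreal_eq_0_iff del: ennreal_plus)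
 then show ?case by (simp add: sum_power2_le_zero_iff)
 qed
 next
 case False
 then show ?thesis by (intro AE_I2) auto
 qed
 qed
 then have "AE t in lborel. AE y in M. (%p. fst p : {t0<..<T} --> X (fst p) (snd p) = X2 (fst p) (snd p) & u (fst p) (snd p) = u2 (fst p) (snd p)) (t, y)" by simp
 then show ?thesis by (rule Q.AE_pair_measure[rotated]) measurable
qed

end

section \<open>The fixed point: uniqueness, a priori bound and existence\<close>

text \<open>Finiteness of \<open>W\<close> allows the term on the right to be absorbed; the
  resulting factor 16/15 is rounded up to 2.\<close>

lemma ennreal_contraction:
 fixes W E :: ennreal
 assumes "W <= E + ennreal (1/16) * W" "W < \<infinity>"
 shows "W <= 2 * E"
proof (cases E)
 case (real e)
 obtain w where w: "W = ennreal w" "0 <= w" using assms(2) by (cases W) auto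
 have "ennreal w <= ennreal (e + (1/16) * w)" using assms(1) real w by (simp add: ennreal_mult[symmetric] ennreal_plus[symmetric] del: ennreal_plus)
 then have "w <= e + (1/16) * w" using w real by (subst (asm) ennreal_le_iff) auto
 then have "w <= 2 * e" using w(2) by simp
 then have "ennreal w <= ennreal (2 * e)" by (rule ennreal_leI)
 then show ?thesis using w real by (simp add: ennreal_mult)
qed (simp add: ennreal_mult_top)

lemma ennreal_two: "0 <= a ==> 0 <= b ==> 2 * (ennreal a + ennreal b) = ennreal (2 * (a + b))"
proof -
 assume ab: "0 <= a" "0 <= b"
 have "ennreal (2 * (a + b)) = ennreal 2 * ennreal (a + b)" using ab by (intro ennreal_mult) auto
 also have "ennreal (a + b) = ennreal a + ennreal b" by (rule ennreal_plus[OF ab])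
 finally show ?thesis by (simp only: ennreal_numeral)
qed

text \<open>Scaling by \<open>1/c\<close> reduces to the rate \<open>(1/16) ^ k\<close>, so the
  weighted sum of squared increments is finite almost everywhere.\<close>

lemma AE_convergent_of_increments:
 fixes f :: "nat => 's => 'b::euclidean_space"
 assumes [measurable]: "\<And>k. f k : BM N" and c: "0 < c"
 and le: "\<And>k. (NN N (%s. nsq (f (Suc k) s - f k s))) <= ennreal (c * (1/16) ^ k)"
 shows "AE s in N. convergent (%k. f k s)"
proof -
 have "AE s in N. (\<Sum>k. 4 ^ k * (ennreal (1/c) * nsq (f (Suc k) s - f k s))) < \<infinity>"
 proof (rule nn_integral_suminf_finite_AE)
 fix k
 have "(NN N (%s. ennreal (1/c) * nsq (f (Suc k) s - f k s))) = ennreal (1/c) * (NN N (%s. nsq (f (Suc k) s - f k s)))"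
 by (rule nn_cmult) measurable
 also have "... <= ennreal (1/c) * ennreal (c * (1/16) ^ k)" by (intro ml_mono le) auto
 also have "... = ennreal ((1/16) ^ k)" using c by (subst ennreal_mult[symmetric]) auto
 finally show "(NN N (%s. ennreal (1/c) * nsq (f (Suc k) s - f k s))) <= ennreal ((1/16) ^ k)" .
 qed measurable
 then show ?thesis
 proof eventually_elim
 case (elim s)
 have "(\<Sum>k. 4 ^ k * (ennreal (1/c) * nsq (f (Suc k) s - f k s))) = ennreal (1/c) * (\<Sum>k. 4 ^ k * nsq (f (Suc k) s - f k s))"
 by (subst ennreal_suminf_cmult[symmetric]) (simp add: mult.left_commute)
 then have "ennreal (1/c) * (\<Sum>k. 4 ^ k * nsq (f (Suc k) s - f k s)) < \<infinity>" using elim by simp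
 then have "(\<Sum>k. 4 ^ k * nsq (f (Suc k) s - f k s)) < \<infinity>" using c by (auto simp: ennreal_mult_less_top)
 then show ?case by (rule convergent_of_suminf_increments)
 qed
qed

context svie
begin

lemma process_zero: "process (%_ _. 0)"
 by (simp add: process_def)

lemma response_zero: "response (%_ _ _. 0)"
 by (simp add: response_def)

lemma data_zero: "data (%_. 0) (%_ _ _. 0) (%_ _ _. 0) (%_ _. 0)"
 by (simp add: data_def field_def field_L21_def field_L2_def process_zero)

text \<open>Zero solves the system with zero data. Comparing with this solution turns difference
  estimates into a priori estimates.\<close>

lemma step_zero: "step (%_. 0) (%_ _ _. 0) (%_ _ _. 0) (%_ _. 0) (%_ _. 0) (%_ _. 0) (%_ _. 0) (%_ _ _. 0) (%_ _. 0)"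
proof -
 have "has_ito_integral M W F t0 t (%_ _. 0 :: real ^ 'd) (%_. 0)" if "t0 <= t" for t
 unfolding has_ito_integral_def
 proof (intro conjI exI allI)
 show "simple_process_data M F t0 t 0 (%_. t0) (%_ _. 0 :: real ^ 'd)" for k :: nat using that by (simp add: simple_process_data_def)
 qed (simp_all add: simple_process_def simple_integral_def)
 then have "sv_rep 0 (%_ _. 0) (%_ _. 0) t (%_. 0)" if "t0 <= t" for t
 using that by (auto simp: sv_rep_def slint_def)
 then show ?thesis by (simp add: step_def drift_def[abs_def] diffusion_def[abs_def] slint_def)
qed

lemma data_diff_self: "data_diff x b sg x b sg s = 0"
 by (simp add: data_diff_def field_L21_def field_L2_def)

text \<open>With the factor 1/16, squared distances of iterates decay like
  \<open>(1/16) ^ k\<close>, fast enough for \<open>AE_convergent_of_increments\<close> without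
  passing to a subsequence.\<close>

lemma weight_exists:
 obtains w where "volterra_weight T step_kernel (1/16) w"
proof -
 have "(0::real) < 1/16" by simp
 then show ?thesis using step_kernel_small that unfolding volterra_small_def by blast
qed

lemma step_contraction:
 assumes data: "data x b sg v" and X: "process X" "process X2" and u: "process u" "process u2"
 and X': "process X'" "process X2'" and u': "process u'" "process u2'" and Th: "response Th" "response Th2"
 and st: "step x b sg v X u X' Th u'" "step x b sg v X2 u2 X2' Th2 u2'"
 and w: "volterra_weight T step_kernel (1/16) w"
 shows "wnorm w X' u' X2' u2' <= ennreal (1/16) * wnorm w X u X2 u2"
 using step_weighted[OF data data X u processD(1)[OF X'(1)] processD(1)[OF X'(2)] processD(1)[OF u'(1)] processD(1)[OF u'(2)] Th st w]
 by (simp add: data_diff_self)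

text \<open>The common data drop out of the weighted estimate, so the distance of two solutions is
  at most 1/16 of itself, and it is finite.\<close>

lemma solution_unique:
 assumes data: "data x b sg v" and X: "process X" "process X2" and u: "process u" "process u2" and Th: "response Th" "response Th2"
 and st: "step x b sg v X u X Th u" "step x b sg v X2 u2 X2 Th2 u2"
 shows "AEP M t0 T (%p. X (fst p) (snd p) = X2 (fst p) (snd p) & u (fst p) (snd p) = u2 (fst p) (snd p))"
proof -
 obtain w where w: "volterra_weight T step_kernel (1/16) w" using weight_exists by blast
 have "wnorm w X u X2 u2 <= 0 + ennreal (1/16) * wnorm w X u X2 u2"
 using step_contraction[OF data X u X u Th st w] by simp
 from ennreal_contraction[OF this wnorm_finite[OF w X u]] have "wnorm w X u X2 u2 = 0" by simp
 then show ?thesis by (rule wnorm_zero[OF w processD(1)[OF X(1)] processD(1)[OF X(2)] processD(1)[OF u(1)] processD(1)[OF u(2)]])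
qed

lemma solution_estimate:
 assumes data: "data x b sg v" and X: "process X" and u: "process u" and Th: "response Th" and st: "step x b sg v X u X Th u"
 and w: "volterra_weight T step_kernel (1/16) w" and dl: "0 < dl" "\<And>t. dl <= w t"
 shows "ennreal dl * (NI {t0<..<T} (pair_norm X u)) <= 2 * (ennreal step_const *
 ((1 + ennreal m0) * (NI {t0<..<T} (%s. (nsq (x s) + field_L21 b s + field_L2 sg s))) +
 (NI {t0<..<T} (%t. (nn2 M (v t))))))"
proof -
 note z = process_zero
 have d: "data_diff x b sg (%_. 0) (%_ _ _. 0) (%_ _ _. 0) = (%s. nsq (x s) + field_L21 b s + field_L2 sg s)"
 by (simp add: data_diff_def[abs_def])
 have "ennreal dl * (NI {t0<..<T} (pair_norm X u)) <= wnorm w X u (%_ _. 0) (%_ _. 0)"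
 using wnorm_pair_norm(1)[OF w processD(1)[OF X] processD(1)[OF z] processD(1)[OF u] processD(1)[OF z] dl] by simp
 also have "... <= 2 * (ennreal step_const *
 ((1 + ennreal m0) * (NI {t0<..<T} (%s. (nsq (x s) + field_L21 b s + field_L2 sg s))) +
 (NI {t0<..<T} (%t. (NN M (%y. nsq (v t y - 0)))))))"
 proof (rule ennreal_contraction)
 show "wnorm w X u (%_ _. 0) (%_ _. 0) < \<infinity>" by (rule wnorm_finite[OF w X z u z])
 show "wnorm w X u (%_ _. 0) (%_ _. 0) <= ennreal step_const *
 ((1 + ennreal m0) * (NI {t0<..<T} (%s. (nsq (x s) + field_L21 b s + field_L2 sg s))) +
 (NI {t0<..<T} (%t. (NN M (%y. nsq (v t y - 0)))))) + ennreal (1/16) * wnorm w X u (%_ _. 0) (%_ _. 0)"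
 using step_weighted[OF data data_zero X z u z processD(1)[OF X] processD(1)[OF z] processD(1)[OF u] processD(1)[OF z] Th response_zero st step_zero w]
 unfolding d by simp
 qed
 finally show ?thesis by simp
qed

text \<open>Picard iteration from zero. Only state and control pass to the limit; the response is
  obtained by one more step from the limit pair. The output of that step is almost everywhere equal
  to its input, and \<open>step_cong\<close> feeds it back, so that state, control and response
  belong together exactly.\<close>

theorem solution_exists:
 assumes data: "data x b sg v"
 shows "EX X Th u R. process X & process u & response Th & step x b sg v X u X Th u &
 (ALL s. ALL q:space M. continuous_on UNIV (%t. Th s t q)) & (ALL s. ALL t:{t0..T}. Th s t : BM (F t)) &
 joint M R &
 (AEI t0 T (%s. (AE q in M. ALL t:{t0..T}. nsq (Th s t q) <= R s q))) &
 (NI {t0<..<T} (%s. (NN M (R s)))) <= 300 * (1 + ennreal m0) *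
 ((NI {t0<..<T} (%s. (nsq (x s) + field_L21 b s + field_L2 sg s))) + (NI {t0<..<T} (pair_norm X u)))"
proof -
 obtain w where w: "volterra_weight T step_kernel (1/16) w" using weight_exists by blast
 obtain dl where dl: "0 < dl" "\<And>t. dl <= w t" using w by (auto simp: volterra_weight_def)
 interpret Q: pair_sigma_finite lborel M ..
 have wm: "w : BM borel" using w by (auto simp: volterra_weight_def)
 have bm: "joint3 M b" using data by (auto simp: data_def field_def)
 \<comment> \<open>The clause for \<open>n = 0\<close> starts the iteration at zero; the response
   component is carried along so that each step can be read off the sequence.\<close>
 define P where "P = (%(n::nat) (X :: real => 'a => real ^ 'd, u :: real => 'a => real ^ 'l, Th). process X & process u & response Th & (n = 0 --> X = (%_ _. 0) & u = (%_ _. 0)))"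
 define Q where "Q = (%(n::nat) (X, u, Th :: real => real => 'a => real ^ 'd) (X', u', Th'). step x b sg v X u X' Th' u')"
 have "EX Z. ALL n. P n (Z n) & Q n (Z n) (Z (Suc n))"
 proof (rule dependent_nat_choice)
 show "EX z. P 0 z" by (rule exI[of _ "(%_ _. 0, %_ _. 0, %_ _ _. 0)"]) (simp add: P_def process_zero response_zero)
 fix z n assume "P n z"
 then obtain X u Th where z: "z = (X, u, Th)" "process X" "process u" by (cases z) (auto simp: P_def)
 obtain X' Th' u' where "process X'" "process u'" "response Th'" "step x b sg v X u X' Th' u'"
 using step_exists[OF data z(2,3)] by blast
 then show "EX y. P (Suc n) y & Q n z y" by (intro exI[of _ "(X', u', Th')"]) (auto simp: P_def Q_def z(1))
 qed
 then obtain Z where Z: "\<And>n. P n (Z n)" "\<And>n. Q n (Z n) (Z (Suc n))" by blast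
 define X where "X n = fst (Z n)" for n
 define u where "u n = fst (snd (Z n))" for n
 define Th where "Th n = snd (snd (Z n))" for n
 have Zn: "Z n = (X n, u n, Th n)" for n by (simp add: X_def u_def Th_def)
 have p: "process (X n)" "process (u n)" "response (Th n)" and z0: "X 0 = (%_ _. 0)" "u 0 = (%_ _. 0)" for n
 using Z(1)[of n] Z(1)[of 0] unfolding Zn P_def by auto
 have st: "step x b sg v (X n) (u n) (X (Suc n)) (Th (Suc n)) (u (Suc n))" for n
 using Z(2)[of n] unfolding Zn Q_def by simp
 note Xm[measurable] = processD(1)[OF p(1)] and um[measurable] = processD(1)[OF p(2)]
 let ?W = "%j k. wnorm w (X j) (u j) (X k) (u k)"
 have con: "?W (Suc j) (Suc k) <= ennreal (1/16) * ?W j k" for j k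
 by (rule step_contraction[OF data p(1) p(1) p(2) p(2) p(1) p(1) p(2) p(2) p(3) p(3) st st w])
 obtain N where N: "?W 0 1 = ennreal N" "0 <= N" using wnorm_finite[OF w p(1)[of 0] p(1)[of 1] p(2)[of 0] p(2)[of 1]] by (cases "?W 0 1") auto
 have V: "?W m 0 <= ennreal (4 * N)" for m
 proof (induction m)
 case 0
 show ?case by (simp add: wnorm_def pair_norm_def)
 next
 case (Suc m)
 have "?W (Suc m) 0 <= 2 * (?W (Suc m) 1 + ?W 0 1)" by (rule wnorm_triangle[OF Xm um Xm um Xm um wm])
 also have "... <= 2 * (ennreal (1/16) * ennreal (4 * N) + ennreal N)"
 using order_trans[OF con[of m 0] ml_mono[OF Suc]] N by (intro ml_mono add_mono) auto
 also have "... = ennreal (2 * ((1/16) * (4 * N) + N))" 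
 using N(2) by (subst ennreal_mult[symmetric], simp, simp, subst ennreal_two) auto
 also have "... <= ennreal (4 * N)" using N(2) by (intro ennreal_leI) simp
 finally show ?case .
 qed
 have VW: "?W (m + k) k <= ennreal (4 * N * (1/16) ^ k)" for m k
 proof (induction k)
 case (Suc k)
 have "?W (m + Suc k) (Suc k) <= ennreal (1/16) * ennreal (4 * N * (1/16) ^ k)"
 using order_trans[OF con[of "m + k" k] ml_mono[OF Suc]] by simp
 also have "... = ennreal (4 * N * (1/16) ^ Suc k)" using N(2) by (subst ennreal_mult[symmetric]) (auto simp: mult.left_commute)
 finally show ?case .
 qed (use V in simp)
 \<comment> \<open>Division by \<open>dl\<close> passes to the unweighted distance; the summand 1
   keeps \<open>c\<close> positive when \<open>N = 0\<close>.\<close>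
 define c where "c = (4 * N + 1) / dl"
 have c: "0 < c" using N dl(1) by (auto simp: c_def)
 let ?L = "density (tprod M) (%p. indicator {t0<..<T} (fst p))"
 have L: "(NN ?L g) = (NI {t0<..<T} (%t. (NN M (%q. g (t, q)))))" if g[measurable]: "g : BM (tprod M)" for g
 proof -
 have "(NN ?L g) = (NN (tprod M) (%p. indicator {t0<..<T} (fst p) * g p))" by (rule nn_integral_density) measurable
 also have "... = (NN lborel (%t. NN M (%q. indicator {t0<..<T} t * g (t, q))))" by (subst nn_integral_fst[symmetric]) auto
 also have "... = (NI {t0<..<T} (%t. (NN M (%q. g (t, q)))))"
 proof (rule nn_cong)
 fix t :: real
 have "(%q. g (t, q)) : BM M" using mcomp[OF measurable_Pair1'[of t lborel M] g] by simp
 show "(NN M (%q. indicator {t0<..<T} t * g (t, q))) = (NN M (%q. g (t, q))) * indicator {t0<..<T} t"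
 by (rule trans[OF nn_cmult[OF \<open>(%q. g (t, q)) \<in> BM M\<close>] mult.commute])
 qed
 finally show ?thesis .
 qed
 have pn: "(NN ?L (%p. ennreal ((norm (X (m + k) (fst p) (snd p) - X k (fst p) (snd p)))^2 + (norm (u (m + k) (fst p) (snd p) - u k (fst p) (snd p)))^2))) <= ennreal (c * (1/16) ^ k)" for m k
 proof -
 let ?I = "NI {t0<..<T} (%t. pair_norm (%r q. X (m + k) r q - X k r q) (%r q. u (m + k) r q - u k r q) t)"
 have "ennreal dl * ?I <= ennreal (4 * N * (1/16) ^ k)"
 by (rule order_trans[OF wnorm_pair_norm(1)[OF w Xm Xm um um dl] VW])
 then have "ennreal (1/dl) * (ennreal dl * ?I) <= ennreal (1/dl) * ennreal (4 * N * (1/16) ^ k)" by (rule ml_mono) simp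
 also have "ennreal (1/dl) * (ennreal dl * ?I) = ?I" using dl(1) by (simp add: mult.assoc[symmetric] ennreal_mult[symmetric])
 also have "ennreal (1/dl) * ennreal (4 * N * (1/16) ^ k) <= ennreal (c * (1/16) ^ k)"
 using N(2) dl(1) by (subst ennreal_mult[symmetric]) (auto simp: c_def intro!: ennreal_leI divide_right_mono)
 finally have "?I <= ennreal (c * (1/16) ^ k)" .
 then show ?thesis unfolding pair_norm_def by (subst L) auto
 qed
 have sL: "sets ?L = sets (tprod M)" by simp
 have AL: "AEP M t0 T (%p. P p)" if "AE p in ?L. P p" for P
 using that by (subst (asm) AE_density) (auto simp: ind_def)
 have "AE p in ?L. convergent (%k. X k (fst p) (snd p))"
 proof (rule AE_convergent_of_increments[OF _ c])
 show "(%p. X k (fst p) (snd p)) : BM ?L" for k using Xm[of k] by simp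
 show "(NN ?L (%p. nsq (X (Suc k) (fst p) (snd p) - X k (fst p) (snd p)))) <= ennreal (c * (1/16) ^ k)" for k
 by (rule order_trans[OF nn_mono pn[of 1 k]]) (auto intro!: ennreal_leI)
 qed
 from AL[OF this] have cX: "AEP M t0 T (%p. convergent (%k. X k (fst p) (snd p)))" .
 have "AE p in ?L. convergent (%k. u k (fst p) (snd p))"
 proof (rule AE_convergent_of_increments[OF _ c])
 show "(%p. u k (fst p) (snd p)) : BM ?L" for k using um[of k] by simp
 show "(NN ?L (%p. nsq (u (Suc k) (fst p) (snd p) - u k (fst p) (snd p)))) <= ennreal (c * (1/16) ^ k)" for k
 by (rule order_trans[OF nn_mono pn[of 1 k]]) (auto intro!: ennreal_leI)
 qed
 from AL[OF this] have cu: "AEP M t0 T (%p. convergent (%k. u k (fst p) (snd p)))" .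
 define Y where "Y t q = lim (%k. X k t q)" for t q
 define y where "y t q = lim (%k. u k t q)" for t q
 have Ym[measurable]: "joint M Y" unfolding Y_def by (intro borel_measurable_lim_metric Xm)
 have ym[measurable]: "joint M y" unfolding y_def by (intro borel_measurable_lim_metric um)
 \<comment> \<open>Fatou's lemma, as \<open>m\<close> tends to infinity with \<open>k\<close>
   fixed.\<close>
 have Yb: "(NI {t0<..<T} (%t. pair_norm (%r q. Y r q - X k r q) (%r q. y r q - u k r q) t)) <= ennreal (c * (1/16) ^ k)" for k
 proof -
 let ?g = "%m p. ennreal ((norm (X (m + k) (fst p) (snd p) - X k (fst p) (snd p)))^2 + (norm (u (m + k) (fst p) (snd p) - u k (fst p) (snd p)))^2)"
 let ?h = "%p. ennreal ((norm (Y (fst p) (snd p) - X k (fst p) (snd p)))^2 + (norm (y (fst p) (snd p) - u k (fst p) (snd p)))^2)"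
 have "(NI {t0<..<T} (%t. pair_norm (%r q. Y r q - X k r q) (%r q. y r q - u k r q) t)) = (NN ?L (%p. ?h p))"
 unfolding pair_norm_def by (subst L) auto
 also have "... = (NN ?L (%p. liminf (%m. ?g m p)))"
 proof (rule nn_cong_AE, subst AE_density)
 show "AE p in lborel \<Otimes>\<^sub>M M. 0 < (indicator {t0<..<T} (fst p) :: ennreal) --> ?h p = liminf (%m. ?g m p)"
 using cX cu
 proof (eventually_elim, intro impI)
 fix p :: "real \<times> 'a"
 assume h: "fst p : {t0<..<T} --> convergent (%k. X k (fst p) (snd p))" "fst p : {t0<..<T} --> convergent (%k. u k (fst p) (snd p))"
 "0 < (indicator {t0<..<T} (fst p) :: ennreal)"
 have t: "fst p : {t0<..<T}"
 proof (rule ccontr)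
 assume "fst p ~: {t0<..<T}"
 then have "(indicator {t0<..<T} (fst p) :: ennreal) = 0" by (rule indicator_simps(2))
 then show False using h(3) by (simp only: less_irrefl)
 qed
 have "(%m. X (m + k) (fst p) (snd p)) ~~> Y (fst p) (snd p)" "(%m. u (m + k) (fst p) (snd p)) ~~> y (fst p) (snd p)"
 using h(1,2) t by (auto simp: Y_def y_def convergent_LIMSEQ_iff intro: LIMSEQ_ignore_initial_segment)
 then have "(%m. ?g m p) ~~> ?h p" by (intro tendsto_ennrealI tendsto_intros)
 then show "?h p = liminf (%m. ?g m p)" by (intro lim_imp_Liminf[symmetric]) auto
 qed
 qed measurable
 also have "... <= liminf (%m. NN ?L (%p. ?g m p))" by (rule nn_integral_liminf) (simp, measurable)
 also have "... <= liminf (%m::nat. ennreal (c * (1/16) ^ k))" by (intro Liminf_mono always_eventually allI pn)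
 also have "... = ennreal (c * (1/16) ^ k)" by (simp add: Liminf_const)
 finally show ?thesis .
 qed
 have Yfin: "(NI {t0<..<T} (pair_norm Y y)) < \<infinity>"
 using Yb[of 0] by (simp add: z0 le_less_trans)
 have Yad: "AEI t0 T (%r. Y r : BM (F r) & y r : BM (F r))"
 proof -
 have "AE r in lborel. ALL k. r : {t0<..<T} --> X k r : BM (F r)" unfolding AE_all_countable using processD(2)[OF p(1)] by blast
 moreover have "AE r in lborel. ALL k. r : {t0<..<T} --> u k r : BM (F r)" unfolding AE_all_countable using processD(2)[OF p(2)] by blast
 ultimately show ?thesis
 by eventually_elim (auto simp: Y_def[abs_def] y_def[abs_def] intro!: borel_measurable_lim_metric)
 qed
 have pY: "process Y"
 unfolding process_def
 proof (intro conjI Ym)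
 show "AEI t0 T (%r. Y r : BM (F r))" using Yad by eventually_elim auto
 show "(NI {t0<..<T} (%r. (nn2 M (Y r)))) < \<infinity>"
 by (rule le_less_trans[OF _ Yfin]) (auto intro!: nn_mono mr_mono simp: pair_norm_eq[OF Ym ym])
 qed
 have py: "process y"
 unfolding process_def
 proof (intro conjI ym)
 show "AEI t0 T (%r. y r : BM (F r))" using Yad by eventually_elim auto
 show "(NI {t0<..<T} (%r. (nn2 M (y r)))) < \<infinity>"
 by (rule le_less_trans[OF _ Yfin]) (auto intro!: nn_mono mr_mono simp: pair_norm_eq[OF Ym ym])
 qed
 \<comment> \<open>One more step from the limit supplies the response, its continuity and its
   majorant.\<close>
 obtain X' Th' u' R where p': "process X'" "process u'" "response Th'" and st': "step x b sg v Y y X' Th' u'"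
 and rest: "ALL s. ALL q:space M. continuous_on UNIV (%t. Th' s t q)" "ALL s. ALL t:{t0..T}. Th' s t : BM (F t)"
 "joint M R"
 "AEI t0 T (%s. (AE q in M. ALL t:{t0..T}. nsq (Th' s t q) <= R s q))"
 and Rb: "(NI {t0<..<T} (%s. (NN M (R s)))) <= 300 * (1 + ennreal m0) *
 ((NI {t0<..<T} (%s. (nsq (x s) + field_L21 b s + field_L2 sg s))) + (NI {t0<..<T} (pair_norm Y y)))"
 using step_exists[OF data pY py] by blast
 note X'm = processD(1)[OF p'(1)] and u'm = processD(1)[OF p'(2)]
 \<comment> \<open>Both pairs are within \<open>c * (1/16) ^ k\<close> of iterate
   \<open>k + 1\<close>: the output by contraction, the limit by its rate. The triangle inequality
   for squared distances gives 2 * (c + c).\<close>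
 have "wnorm w X' u' Y y <= ennreal (4 * c * (1/16) ^ k)" for k
 proof -
 have Yk: "wnorm w Y y (X j) (u j) <= ennreal (c * (1/16) ^ j)" for j
 by (rule order_trans[OF wnorm_pair_norm(2)[OF w Ym Xm ym um dl] Yb])
 have a: "wnorm w X' u' (X (Suc k)) (u (Suc k)) <= ennreal (c * (1/16) ^ k)"
 proof -
 have "wnorm w X' u' (X (Suc k)) (u (Suc k)) <= ennreal (1/16) * wnorm w Y y (X k) (u k)"
 by (rule step_contraction[OF data pY p(1) py p(2) p'(1) p(1) p'(2) p(2) p'(3) p(3) st' st w])
 also have "... <= 1 * ennreal (c * (1/16) ^ k)" by (intro mult_mono Yk) auto
 finally show ?thesis by simp
 qed
 have b: "wnorm w Y y (X (Suc k)) (u (Suc k)) <= ennreal (c * (1/16) ^ k)"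
 using c by (intro order_trans[OF Yk] ennreal_leI) (auto intro!: ml_mono)
 have "wnorm w X' u' Y y <= 2 * (wnorm w X' u' (X (Suc k)) (u (Suc k)) + wnorm w Y y (X (Suc k)) (u (Suc k)))"
 by (rule wnorm_triangle[OF X'm u'm Xm um Ym ym wm])
 also have "... <= 2 * (ennreal (c * (1/16) ^ k) + ennreal (c * (1/16) ^ k))" by (intro ml_mono add_mono a b) auto
 also have "... = ennreal (4 * c * (1/16) ^ k)"
 using c by (subst ennreal_two) auto
 finally show ?thesis .
 qed
 moreover have "(%k. ennreal (4 * c * (1/16) ^ k)) ~~> ennreal (4 * c * 0)"
 by (intro tendsto_ennrealI tendsto_mult tendsto_const LIMSEQ_realpow_zero) auto
 ultimately have "wnorm w X' u' Y y <= ennreal (4 * c * 0)" by (intro LIMSEQ_le_const) auto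
 then have eq: "AEP M t0 T (%p. X' (fst p) (snd p) = Y (fst p) (snd p) & u' (fst p) (snd p) = y (fst p) (snd p))"
 by (intro wnorm_zero[OF w X'm Ym u'm ym]) simp
 have "step x b sg v X' u' X' Th' u'"
 by (rule step_cong[OF st' _ Ym X'm ym u'm bm]) (use eq in eventually_elim, simp)
 moreover have "(NI {t0<..<T} (pair_norm Y y)) = (NI {t0<..<T} (pair_norm X' u'))"
 proof (rule nn_cong_AE, use Q.AE_pair[OF eq] in eventually_elim)
 fix r assume e: "AE q in M. fst (r, q) : {t0<..<T} --> X' (fst (r, q)) (snd (r, q)) = Y (fst (r, q)) (snd (r, q)) & u' (fst (r, q)) (snd (r, q)) = y (fst (r, q)) (snd (r, q))"
 show "pair_norm Y y r * indicator {t0<..<T} r = pair_norm X' u' r * indicator {t0<..<T} r"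
 proof (cases "r : {t0<..<T}")
 case True
 have "pair_norm Y y r = pair_norm X' u' r" unfolding pair_norm_def
 by (rule nn_cong_AE, use e in eventually_elim) (use True in auto)
 then show ?thesis by simp
 qed simp
 qed
 ultimately show ?thesis using p' rest Rb by (intro exI[of _ X'] exI[of _ Th'] exI[of _ u'] exI[of _ R]) auto
qed

text \<open>Since the inputs agree almost everywhere, both responses represent the same equation,
  and \<open>sv_rep_diff\<close> gives equality almost surely at each single time. Countably many
  times can be joined into one event, hence the rationals.\<close>

lemma response_unique:
 assumes data: "data x b sg v" and X: "process X" "process X2" and u: "process u" "process u2" and Th: "response Th" "response Th2"
 and st: "step x b sg v X u X Th u" "step x b sg v X2 u2 X2 Th2 u2"
 shows "AEP M t0 T (%p. (ALL q:\<rat>. q : {t0<..<fst p} --> Th (fst p) q (snd p) = Th2 (fst p) q (snd p)))"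
proof -
 interpret Q: pair_sigma_finite lborel M ..
 have bm: "joint3 M b"
 and sm: "joint3 M sg"
 and fin: "(NI {t0<..<T} (field_L21 b)) < \<infinity>"
 using data by (auto simp: data_def field_def)
 note m = processD(1)[OF X(1)] processD(1)[OF X(2)] processD(1)[OF u(1)] processD(1)[OF u(2)]
 have tm: "joint3 M Th"
 "joint3 M Th2"
 using Th by (auto simp: response_def)
 note [measurable] = response_slice[OF tm(1)] response_slice[OF tm(2)]
 have sl: "Th s q : BM M" "Th2 s q : BM M" for s q
 using time_section_measurable[OF response_slice[OF tm(1), of q], of s] time_section_measurable[OF response_slice[OF tm(2), of q], of s] by simp_all
 have "step x b sg v X2 u2 X Th u"
 by (rule step_cong[OF st(1) solution_unique[OF data X u Th st] m(1,2,3,4) bm])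
 note r = this[unfolded step_def, THEN conjunct2, THEN conjunct1] st(2)[unfolded step_def, THEN conjunct2, THEN conjunct1]
 have "AE s in lborel. AE z in M. s : {t0<..<T} --> (ALL q:\<rat>. q : {t0<..<s} --> Th s q z = Th2 s q z)"
 using r al_finite AE_finite_of_nn_integral[OF field_norm_measurable(1)[OF bm] fin]
 proof eventually_elim
 fix s assume h: "s : {t0<..<T} --> (ALL t:{t0<..<s}. sv_rep (x s) (drift X2 u2 b s) (diffusion X2 u2 sg s) t (Th s t))"
 "s : {t0<..<T} --> (ALL t:{t0<..<s}. sv_rep (x s) (drift X2 u2 b s) (diffusion X2 u2 sg s) t (Th2 s t))"
 "s : {0<..<T} --> al s < \<infinity>" "s : {t0<..<T} --> field_L21 b s < \<infinity>"
 show "AE z in M. s : {t0<..<T} --> (ALL q:\<rat>. q : {t0<..<s} --> Th s q z = Th2 s q z)"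
 proof (cases "s : {t0<..<T}")
 case s: True
 then have al: "al s < \<infinity>" and bs: "field_L21 b s < \<infinity>" using h t0 by auto
 have "AE z in M. ALL q:\<rat>. q : {t0<..<s} --> Th s q z = Th2 s q z"
 proof (subst AE_ball_countable[OF countable_rat], intro ballI)
 fix q
 show "AE z in M. q : {t0<..<s} --> Th s q z = Th2 s q z"
 proof (cases "q : {t0<..<s}")
 case q: True
 then have q': "q : {t0<..s}" by auto
 have r1: "sv_rep (x s) (drift X2 u2 b s) (diffusion X2 u2 sg s) q (Th s q)" using h(1) q s by blast
 have r2: "sv_rep (x s) (drift X2 u2 b s) (diffusion X2 u2 sg s) q (Th2 s q)" using h(2) q s by blast
 from sv_rep_diff[where b=b and ?b2.0=b and sg=sg and ?sg2.0=sg and s=s and x=x and ?x2.0=x and t=q, OF X(2) X(2) u(2) u(2) bm bm sm sm s al bs bs q' r1 r2]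
 have "(NN M (%z. nsq (Th s q z - Th2 s q z))) = 0" by (simp add: data_diff_self pair_norm_def)
 then have "AE z in M. nsq (Th s q z - Th2 s q z) = 0"
 using sl by (subst (asm) nn_integral_0_iff_AE) auto
 then show ?thesis by eventually_elim simp
 qed (intro AE_I2, auto)
 qed
 then show ?thesis by eventually_elim blast
 qed (intro AE_I2, auto)
 qed
 then have "AE s in lborel. AE z in M. (%p. fst p : {t0<..<T} --> (ALL q:\<rat>. q : {t0<..<fst p} --> Th (fst p) q (snd p) = Th2 (fst p) q (snd p))) (s, z)" by simp
 moreover have "{p : space (tprod M). fst p : {t0<..<T} --> (ALL q:\<rat>. q : {t0<..<fst p} --> Th (fst p) q (snd p) = Th2 (fst p) q (snd p))} : sets (tprod M)"
 unfolding greaterThanLessThan_iff by (intro sets.sets_Collect_imp sets.sets_Collect_countable_All'[OF _ countable_rat]) measurable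
 ultimately show ?thesis by (intro Q.AE_pair_measure)
qed

text \<open>The bound at rational times defines a measurable set, so the iterated statement becomes
  one on the product measure; continuity of the paths then restores all times.\<close>

lemma response_bound_joint:
 assumes Th: "response Th" and c: "ALL s. ALL z:space M. continuous_on UNIV (%t. Th s t z)"
 and R[measurable]: "joint M R"
 and b: "AEI t0 T (%s. (AE z in M. ALL t:{t0..T}. nsq (Th s t z) <= R s z))"
 shows "AEP M t0 T (%p. (ALL t:{t0..T}. nsq (Th (fst p) t (snd p)) <= R (fst p) (snd p)))"
proof -
 interpret Q: pair_sigma_finite lborel M ..
 let ?Q = "{t0..T} \<inter> \<rat>"
 have tm: "joint3 M Th" using Th by (auto simp: response_def)
 note [measurable] = response_slice[OF tm]
 have cQ: "countable ?Q" using countable_rat by blast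
 have "{p : space (tprod M). fst p : {t0<..<T} --> (ALL q:?Q. nsq (Th (fst p) q (snd p)) <= R (fst p) (snd p))} : sets (tprod M)"
 by (intro sets.sets_Collect_imp sets.sets_Collect_countable_All'[OF _ cQ]) measurable
 moreover have "AE s in lborel. AE z in M. (%p. fst p : {t0<..<T} --> (ALL q:?Q. nsq (Th (fst p) q (snd p)) <= R (fst p) (snd p))) (s, z)"
 using b
 proof eventually_elim
 case (elim s)
 show ?case
 proof (cases "s : {t0<..<T}")
 case True
 then have "AE z in M. ALL t:{t0..T}. nsq (Th s t z) <= R s z" using elim by blast
 then show ?thesis by eventually_elim auto
 qed (intro AE_I2, auto)
 qed
 ultimately have "AEP M t0 T (%p. (ALL q:?Q. nsq (Th (fst p) q (snd p)) <= R (fst p) (snd p)))"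
 by (intro Q.AE_pair_measure)
 then show ?thesis using AE_space
 proof (eventually_elim, intro impI ballI)
 fix p t assume h: "fst p : {t0<..<T} --> (ALL q:?Q. nsq (Th (fst p) q (snd p)) <= R (fst p) (snd p))"
 and p: "p : space (tprod M)" "fst p : {t0<..<T}" and t: "t : {t0..T}"
 have "nsq (Th (fst p) t (snd p)) <= (SUP q\<in>?Q. nsq (Th (fst p) q (snd p)))"
 using c p(1) by (intro norm_sq_le_SUP_rational t t0) (auto simp: sp_pair)
 also have "... <= R (fst p) (snd p)" using h p(2) by (intro SUP_least) blast
 finally show "nsq (Th (fst p) t (snd p)) <= R (fst p) (snd p)" .
 qed
qed

end

section \<open>Borel versions of the coefficients and jointly measurable processes\<close>

lemma ennsqrt_less_top_iff: "ennsqrt z < top \<longleftrightarrow> z < top"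
 by (simp add: ennsqrt_def less_top)

lemma ennsqrt_power2: "(ennsqrt z)^2 = z"
proof (cases z)
 case (real r)
 then show ?thesis by (simp add: ennsqrt_def ennreal_power)
qed (simp add: ennsqrt_def)

lemma le_power2_of_ennsqrt_le: "ennsqrt z <= c ==> z <= c^2"
 using power_mono[of "ennsqrt z" c 2] by (simp add: ennsqrt_power2)

lemma ennsqrt_mono: "x <= y ==> ennsqrt x <= ennsqrt y"
 by (cases y; cases x) (auto simp: ennsqrt_def ennreal_leI top_unique)

lemma ennsqrt_add_le: "ennsqrt (x + y) <= ennsqrt x + ennsqrt y"
proof (cases "x = \<infinity> \<or> y = \<infinity>")
 case False
 then obtain a b where "x = ennreal a" "0 <= a" "y = ennreal b" "0 <= b" by (cases x; cases y) auto
 then show ?thesis using sqrt_add_le_add_sqrt[of a b]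
 by (simp add: ennsqrt_def ennreal_plus[symmetric] ennreal_leI del: ennreal_plus)
qed (auto simp: ennsqrt_def)

lemma ennsqrt_cmult: "0 <= c ==> ennsqrt (ennreal c * y) <= ennreal (sqrt c) * ennsqrt y"
proof (cases y)
 case (real r)
 assume "0 <= c"
 then show ?thesis using real by (simp add: ennsqrt_def ennreal_mult[symmetric] real_sqrt_mult)
next
 case top
 assume "0 <= c"
 then show ?thesis using top by (cases "c = 0") (auto simp: ennsqrt_def ennreal_mult_top)
qed

text \<open>The real-valued case is applied to each coordinate; finitely many null sets are then
  combined.\<close>

lemma completion_borel_version:
 fixes g :: "'x => 'b::euclidean_space"
 assumes g: "g : BM (completion N)"
 shows "EX g':BM N. (AE x in N. g x = g' x)"
proof -
 have "ALL i. EX h:BM N. (AE x in N. g x \<bullet> i = h x)"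
 by (intro allI completion_ex_borel_measurable_real borel_measurable_inner g borel_measurable_const)
 then obtain h where h: "\<And>i. h i : BM N" "\<And>i. AE x in N. g x \<bullet> i = h i x" by metis
 note [measurable] = h(1)
 have "AE x in N. ALL i:(Basis :: 'b set). g x \<bullet> i = h i x" using h(2) by (intro AE_finite_allI) auto
 then have "AE x in N. g x = (\<Sum>i\<in>Basis. h i x *\<^sub>R i)"
 proof eventually_elim
 case (elim x)
 have "g x = (\<Sum>i\<in>Basis. (g x \<bullet> i) *\<^sub>R i)" by (rule euclidean_representation[symmetric])
 also have "... = (\<Sum>i\<in>Basis. h i x *\<^sub>R i)" using elim by (intro sum.cong) auto
 finally show ?case .
 qed
 then show ?thesis by (intro bexI[of _ "%x. \<Sum>i\<in>Basis. h i x *\<^sub>R i"]) auto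
qed

lemma lebesgue_on_version:
 fixes f :: "'x::euclidean_space => 'b::euclidean_space"
 assumes f: "f : BM (lebesgue_on S)" and S: "S : sets borel"
 shows "EX f':BM borel. (AE x in lborel. x : S --> f x = f' x)"
proof -
 have "(%x. indr S x *\<^sub>R f x) : BM lebesgue"
 using f S by (subst (asm) borel_measurable_restrict_space_iff) auto
 from completion_borel_version[OF this]
 obtain f' where f': "f' : BM lborel" "AE x in lborel. indr S x *\<^sub>R f x = f' x" by blast
 have "AE x in lborel. x : S --> f x = f' x" using f'(2) by eventually_elim auto
 then show ?thesis using f'(1) by auto
qed

lemma open_triangle2: "open (triangle2 a b)"
proof -
 have "triangle2 a b = {p. a < snd p} \<inter> {p. snd p < fst p} \<inter> {p. fst p < b}" by (auto simp: triangle2_def)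
 then show ?thesis by (auto intro!: open_Int open_Collect_less continuous_intros)
qed

lemma AE_lborel_pair:
 assumes P: "AE p in (lborel :: (real \<times> real) measure). P (fst p) (snd p)"
 shows "AE t in lborel. AE r in lborel. P t r" "AE r in lborel. AE t in lborel. P t r"
proof -
 obtain N where N: "{p : space lborel. \<not> P (fst p) (snd p)} \<subseteq> N" "N : null_sets (tprod lborel)"
 using P by (elim AE_E) (auto simp: null_sets_def lborel_prod)
 have Nm: "N : sets (tprod lborel)" using N(2) by auto
 have 1: "AE t in lborel. AE r in lborel. (t, r) ~: N" by (rule lborel_pair.AE_pair[OF AE_not_in[OF N(2)]])
 then have 2: "AE r in lborel. AE t in lborel. (t, r) ~: N"
 proof (subst (asm) lborel_pair.AE_commute)
 have "space (tprod lborel) - N : sets (tprod lborel)" using Nm by (intro sets.compl_sets)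
 moreover have "space (tprod lborel) - N = {p : space (tprod lborel). (fst p, snd p) ~: N}" by auto
 ultimately show "{p : space (tprod lborel). (fst p, snd p) ~: N} : sets (tprod lborel)" by (simp only:)
 qed
 have i: "P t r" if "(t, r) ~: N" for t r using that N(1) by (auto simp: subset_eq)
 show "AE t in lborel. AE r in lborel. P t r"
 using 1
 proof eventually_elim
 case (elim t)
 show ?case by (rule eventually_mono[OF elim]) (rule i)
 qed
 show "AE r in lborel. AE t in lborel. P t r"
 using 2
 proof eventually_elim
 case (elim r)
 show ?case by (rule eventually_mono[OF elim]) (rule i)
 qed
qed

text \<open>Agreement almost everywhere in the plane is needed in both iterated readings: for almost
  every first argument in the equations of X and Theta, for almost every second one in the space of
  C and D and in the feedback integral.\<close>

lemma kernel_version: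
 fixes f :: "real => real => 'b::euclidean_space"
 assumes f: "f : space_L2_tri 0 T"
 shows "EX f'. joint lborel f' &
 (AE t in lborel. AE r in lborel. 0 < r & r < t & t < T --> f t r = f' t r) &
 (AE r in lborel. AE t in lborel. 0 < r & r < t & t < T --> f t r = f' t r) &
 (NI {0<..<T} (%t. (NI {0<..<t} (%r. nsq (f' t r))))) < \<infinity> &
 (NI {0<..<T} (%r. (NI {r<..<T} (%t. nsq (f' t r))))) < \<infinity>"
proof -
 have tri: "triangle2 0 T : sets borel" using open_triangle2 by (rule borel_open)
 have fm: "(%p. f (fst p) (snd p)) : BM (lebesgue_on (triangle2 0 T))"
 and fin: "(\<integral>\<^sup>+p\<in>triangle2 0 T. nsq (f (fst p) (snd p)) \<partial>lebesgue) < \<infinity>"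
 using f by (auto simp: space_L2_tri_def norm_L2_tri_def ennsqrt_less_top_iff)
 obtain g where g: "g : BM borel" "AE p in lborel. p : triangle2 0 T --> f (fst p) (snd p) = g p"
 using lebesgue_on_version[OF fm tri] by blast
 define f' where "f' t r = g (t, r)" for t r
 have f'm: "joint lborel f'" using g(1) by (simp add: f'_def lborel_prod)
 have e: "AE p in lborel. (%t r. 0 < r & r < t & t < T --> f t r = f' t r) (fst p) (snd p)"
 using g(2) by eventually_elim (auto simp: f'_def triangle2_def case_prod_beta')
 let ?h = "%t r. nsq (f' t r) * indicator (triangle2 0 T) (t, r)"
 have hm: "(%p. ?h (fst p) (snd p)) : BM (tprod lborel)"
 proof -
 have [measurable]: "triangle2 0 T : sets (tprod lborel)" unfolding lborel_prod using tri by simp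
 note [measurable] = f'm
 have "(%p. nsq (f' (fst p) (snd p)) * indicator (triangle2 0 T) p) : BM (tprod lborel)" by measurable
 then show ?thesis by simp
 qed
 have "(\<integral>\<^sup>+p\<in>triangle2 0 T. nsq (f (fst p) (snd p)) \<partial>lebesgue) = (NN lborel (%p. ?h (fst p) (snd p)))"
 unfolding nn_integral_completion
 by (rule nn_cong_AE, use g(2) in eventually_elim) (auto simp: f'_def ind_def)
 also have "... = (NN lborel (%t. NN lborel (%r. ?h t r)))"
 unfolding lborel_prod[symmetric] using lborel.nn_integral_fst[OF hm] by simp
 finally have f1: "(NN lborel (%t. NN lborel (%r. ?h t r))) < \<infinity>" using fin by simp
 moreover have "(NN lborel (%t. NN lborel (%r. ?h t r))) = (NN lborel (%r. NN lborel (%t. ?h t r)))"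
 by (rule lborel_pair.Fubini'[symmetric]) (use hm in \<open>simp add: case_prod_beta'\<close>)
 ultimately have f2: "(NN lborel (%r. NN lborel (%t. ?h t r))) < \<infinity>" by simp
 have "(NI {0<..<T} (%t. (NI {0<..<t} (%r. nsq (f' t r))))) <= (NN lborel (%t. NN lborel (%r. ?h t r)))"
 by (intro nn_mono) (auto simp: ind_def triangle2_def intro!: nn_mono)
 moreover have "(NI {0<..<T} (%r. (NI {r<..<T} (%t. nsq (f' t r))))) <= (NN lborel (%r. NN lborel (%t. ?h t r)))"
 by (intro nn_mono) (auto simp: ind_def triangle2_def intro!: nn_mono)
 ultimately show ?thesis using f'm AE_lborel_pair[OF e] f1 f2 by (intro exI[of _ f']) (auto intro: le_less_trans)
qed

lemma scrL2_norm_bound: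
 fixes f f' :: "real => real => 'b::euclidean_space"
 assumes e: "AE r in lborel. AE t in lborel. 0 < r & r < t & t < T --> f t r = f' t r" and ab: "0 <= a" "b <= T"
 and c: "norm_scrL2 a b f <= ennreal c" "0 <= c"
 shows "AEI a b (%r. (NI {r<..<b} (%t. nsq (f' t r))) <= ennreal (c^2))"
proof -
 have "AE r in lebesgue_on {a<..<b}. ennsqrt (\<integral>\<^sup>+s\<in>{r<..<b}. nsq (f s r) \<partial>lebesgue) <= norm_scrL2 a b f"
 unfolding norm_scrL2_def by (rule esssup_AE)
 then have "AEI a b (%r. ennsqrt (\<integral>\<^sup>+s\<in>{r<..<b}. nsq (f s r) \<partial>lebesgue) <= norm_scrL2 a b f)"
 by (subst (asm) AE_restrict_space_iff) (auto simp: AE_completion_iff)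
 then show ?thesis using e
 proof (eventually_elim, intro impI)
 fix r assume h: "r : {a<..<b} --> ennsqrt (\<integral>\<^sup>+s\<in>{r<..<b}. nsq (f s r) \<partial>lebesgue) <= norm_scrL2 a b f"
 and e: "AE t in lborel. 0 < r & r < t & t < T --> f t r = f' t r" and r: "r : {a<..<b}"
 have "(NI {r<..<b} (%t. nsq (f' t r))) = (\<integral>\<^sup>+s\<in>{r<..<b}. nsq (f s r) \<partial>lebesgue)"
 unfolding nn_integral_completion
 by (rule nn_cong_AE, use e in eventually_elim) (use r ab in \<open>auto simp: ind_def\<close>)
 also have "... <= (ennreal c)^2" using h r c(1) by (intro le_power2_of_ennsqrt_le) (auto intro: order_trans)
 finally show "(NI {r<..<b} (%t. nsq (f' t r))) <= ennreal (c^2)" using c(2) by (simp add: ennreal_power)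
 qed
qed

lemma scrL2_kernel:
 fixes f f' :: "real => real => 'b::euclidean_space"
 assumes f: "f : space_scrL2 0 T" and T: "0 < T" and m[measurable]: "joint lborel f'"
 and e: "AE r in lborel. AE t in lborel. 0 < r & r < t & t < T --> f t r = f' t r"
 shows "\<exists>B\<ge>0. (AEI 0 T (%r. (NI {r<..<T} (%t. nsq (f' t r))) <= ennreal B)) &
 volterra_small T (%t r. nsq (f' t r))"
proof -
 have "norm_scrL2 0 T f < \<infinity>" using f by (auto simp: space_scrL2_def)
 then obtain c where c: "norm_scrL2 0 T f <= ennreal c" "0 <= c" by (cases "norm_scrL2 0 T f") auto
 note B = scrL2_norm_bound[OF e order_refl order_refl c]
 have "volterra_small T (%t r. nsq (f' t r))"
 proof (rule volterra_small_partition[OF _ B])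
 show "(%p. nsq (f' (fst p) (snd p))) : BM (tprod lborel)" by measurable
 fix ep :: real assume ep: "0 < ep"
 \<comment> \<open>The norm is the square root of the kernel mass, so the partition is taken for
   \<open>sqrt ep\<close>.\<close>
 then have "0 < sqrt ep" by simp
 then obtain m U where U: "U 0 = 0" "U m = T" "\<And>i. i < m ==> U i < U (Suc i)" and n: "\<And>i. i < m ==> norm_scrL2 (U i) (U (Suc i)) f < ennreal (sqrt ep)"
 using f unfolding space_scrL2_def by blast
 have U0: "i <= m ==> 0 <= U i" for i
 proof (induction i)
 case (Suc i)
 then show ?case using U(3)[of i] by simp
 qed (simp add: U)
 have UT: "i <= m ==> U i <= T" for i
 proof (induction rule: inc_induct)
 case (step i)
 then show ?case using U(3)[of i] by simp
 qed (simp add: U)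
 have "AE r in lborel. r : {U i<..<U (Suc i)} --> (NI {r<..<U (Suc i)} (%t. nsq (f' t r))) <= ennreal ep" if i: "i < m" for i
 using scrL2_norm_bound[OF e U0 UT, of i "Suc i" "sqrt ep"] n[OF i] i ep by simp
 then show "EX m U. U 0 = 0 & U m = T & (\<forall>i<m. U i < U (Suc i)) &
 (\<forall>i<m. AE r in lborel. r : {U i<..<U (Suc i)} --> (NI {r<..<U (Suc i)} (%t. nsq (f' t r))) <= ennreal ep)"
 using U by (intro exI[of _ m] exI[of _ U]) auto
 qed
 then show ?thesis using B by (intro exI[of _ "c^2"]) auto
qed

text \<open>Points outside \<open>S\<close> are first redirected to \<open>s0\<close>, so that
  \<open>f\<close> is only evaluated where it is measurable; their values are then overwritten by
  0.\<close>

lemma joint_of_restrict: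
 fixes f :: "'x \<times> 'y => 'b::euclidean_space"
 assumes f: "f : BM (restrict_space N S \<Otimes>\<^sub>M K)" and S[measurable]: "S : sets N" and s0: "s0 : S"
 shows "(%p. if fst p : S then f p else 0) : BM (N \<Otimes>\<^sub>M K)"
proof -
 have s0N: "s0 : space N" using s0 sets.sets_into_space[OF S] by auto
 have "(%p. if fst p : S then fst p else s0) : measurable (N \<Otimes>\<^sub>M K) (restrict_space N S)"
 using s0N by (intro measurable_restrict_space2) (auto simp: s0)
 then have "(%p. (if fst p : S then fst p else s0, snd p)) : measurable (N \<Otimes>\<^sub>M K) (restrict_space N S \<Otimes>\<^sub>M K)" by measurable
 from mcomp[OF this f]
 have [measurable]: "(%p. f (if fst p : S then fst p else s0, snd p)) : BM (N \<Otimes>\<^sub>M K)" .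
 have "(%p. if fst p : S then f (if fst p : S then fst p else s0, snd p) else 0) : BM (N \<Otimes>\<^sub>M K)" by measurable
 then show ?thesis by (rule measurable_cong[THEN iffD1, rotated]) auto
qed

context brownian_basis
begin

lemma prog_section:
 assumes p: "prog_measurable F a b xx" and t: "t : {a<..<b}"
 shows "xx t : BM (F t)"
proof -
 have "t : space (restrict_space borel {a<..t})" using t by (auto simp: space_restrict_space)
 from mcomp[OF measurable_Pair1'[OF this] p[unfolded prog_measurable_def, rule_format, OF t]]
 show ?thesis by simp
qed

text \<open>Progressive measurability speaks about \<open>{a<..t}\<close> for \<open>t < b\<close>;
  the process on the whole interval is the limit of its restrictions to times up to
  \<open>c n\<close>, which increase to \<open>b\<close>.\<close>

lemma prog_joint:
 fixes xx :: "real => 'a => 'b::euclidean_space"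
 assumes p: "prog_measurable F a b xx" and ab: "0 <= a" "a < b"
 shows "(%p. if fst p : {a<..<b} then xx (fst p) (snd p) else 0) : BM (tprod M)"
proof -
 \<comment> \<open>The shift by 2 keeps \<open>c n\<close> strictly above \<open>a\<close> already
   for \<open>n = 0\<close>.\<close>
 define c where "c n = b - (b - a) / real (n + 2)" for n
 have c: "c n : {a<..<b}" for n
 proof -
 have "(b - a) * 1 < (b - a) * real (n + 2)" using ab by (intro mult_strict_left_mono) auto
 then have "(b - a) / real (n + 2) < b - a" by (simp add: divide_less_eq)
 moreover have "0 < (b - a) / real (n + 2)" using ab by simp
 ultimately show ?thesis unfolding c_def greaterThanLessThan_iff by linarith
 qed
 have "c ~~> b - 0"
 unfolding c_def by (intro tendsto_diff tendsto_const LIMSEQ_ignore_initial_segment[of "%n. (b - a) / real n" 0 2] lim_const_over_n)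
 then have cl: "c ~~> b" by simp
 show ?thesis
 proof (rule borel_measurable_LIMSEQ_metric)
 fix n
 have ct: "0 <= c n" using c[of n] ab by auto
 have id: "(%z. z) : measurable M (F (c n))" by (rule measurable_from_subalg[OF subalg[OF ct] measurable_ident_sets[OF refl]])
 have "(%p. (fst p, snd p)) : measurable (restrict_space borel {a<..c n} \<Otimes>\<^sub>M M) (restrict_space borel {a<..c n} \<Otimes>\<^sub>M F (c n))"
 by (intro measurable_Pair measurable_fst mcomp[OF measurable_snd id])
 from mcomp[OF this p[unfolded prog_measurable_def, rule_format, OF c]]
 have "(%p. xx (fst p) (snd p)) : BM (restrict_space borel {a<..c n} \<Otimes>\<^sub>M M)" by simp
 from joint_of_restrict[OF this, of "c n"] c[of n]
 have "(%p. if fst p : {a<..c n} then xx (fst p) (snd p) else 0) : BM (borel \<Otimes>\<^sub>M M)" by simp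
 then show "(%p. if fst p : {a<..c n} then xx (fst p) (snd p) else 0) : BM (tprod M)"
 by (simp cong: measurable_cong_sets sets_pair_measure_cong)
 next
 fix p :: "real \<times> 'a"
 have "\<forall>\<^sub>F n in sequentially. (if fst p : {a<..c n} then xx (fst p) (snd p) else 0) = (if fst p : {a<..<b} then xx (fst p) (snd p) else 0)"
 proof (cases "fst p < b")
 case True
 show ?thesis using order_tendstoD(1)[OF cl True] by eventually_elim (use True in auto)
 next
 case False
 have "fst p > c n" for n using False c[of n] by auto
 then show ?thesis using False by (intro always_eventually allI) (auto simp: not_le[symmetric] dest: leD)
 qed
 then show "(%n. if fst p : {a<..c n} then xx (fst p) (snd p) else 0) ~~> (if fst p : {a<..<b} then xx (fst p) (snd p) else 0)"
 by (rule tendsto_eventually)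
 qed
qed

lemma triangle_joint:
 fixes xx :: "real => real => 'a => 'b::euclidean_space"
 assumes m: "(%((t, s), z). xx t s z) : BM (restrict_space borel (triangle2 a b) \<Otimes>\<^sub>M M)" and ab: "a < b"
 shows "(%p. if (fst p, fst (snd p)) : triangle2 a b then xx (fst p) (fst (snd p)) (snd (snd p)) else 0) : BM (tprod (tprod M))"
proof -
 \<comment> \<open>An interior point of the triangle, needed as the default \<open>s0\<close> in
   \<open>joint_of_restrict\<close>.\<close>
 have "((2 * b + a) / 3, (b + 2 * a) / 3) : triangle2 a b" using ab by (auto simp: triangle2_def field_simps)
 from joint_of_restrict[OF m _ this] open_triangle2[of a b]
 have "(%p. if fst p : triangle2 a b then (%((t, s), z). xx t s z) p else 0) : BM (borel \<Otimes>\<^sub>M M)" by auto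
 moreover have "(%p. ((fst p, fst (snd p)), snd (snd p))) : measurable (tprod (tprod M)) (borel \<Otimes>\<^sub>M M)"
 unfolding borel_prod[symmetric] by measurable
 ultimately have "(%p. (%p. if fst p : triangle2 a b then (%((t, s), z). xx t s z) p else 0) ((fst p, fst (snd p)), snd (snd p))) : BM (tprod (tprod M))"
 by (rule mcomp[rotated])
 then show ?thesis by (simp cong: if_cong)
qed

end

lemma AE_iff_cong:
 assumes a: "AE x in N. P x = Q x"
 shows "(AE x in N. P x) \<longleftrightarrow> (AE x in N. Q x)"
proof
 assume "AE x in N. P x"
 with a show "AE x in N. Q x" by eventually_elim simp
next
 assume "AE x in N. Q x"
 with a show "AE x in N. P x" by eventually_elim simp
qed

section \<open>Transfer to the original problem\<close>

text \<open>The suffix 0 marks the objects of the given problem. \<open>W\<close>, \<open>A\<close>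
  to \<open>D\<close>, \<open>XX\<close>, \<open>Ga\<close> and \<open>x\<close> without it are the
  continuous and Borel versions; \<open>b\<close>, \<open>sg\<close> and \<open>v\<close>, defined
  next, are the given data extended by 0.\<close>

locale svie_problem = svie M F W T A B C D XX Ga xx m0 t0
 for M :: "'a measure" and F W and T :: real
 and A :: "real => real => real ^ 'd::finite ^ 'd" and B :: "real => real => real ^ 'l::finite ^ 'd"
 and C :: "real => real => real ^ 'd ^ 'd" and D :: "real => real => real ^ 'l ^ 'd"
 and XX :: "real => real ^ 'd ^ 'l" and Ga :: "real => real => real ^ 'd ^ 'l" and xx m0 t0 :: real +
 fixes W0 :: "real => 'a => real"
 and A0 :: "real => real => real ^ 'd ^ 'd" and B0 :: "real => real => real ^ 'l ^ 'd"
 and C0 :: "real => real => real ^ 'd ^ 'd" and D0 :: "real => real => real ^ 'l ^ 'd"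
 and XX0 :: "real => real ^ 'd ^ 'l" and Ga0 :: "real => real => real ^ 'd ^ 'l"
 and b0 sg0 :: "real => real => 'a => real ^ 'd" and v0 :: "real => 'a => real ^ 'l" and x0 x :: "real => real ^ 'd"
 assumes FW: "F = augmented_filtration M W0" and WW: "AE z in M. \<forall>t\<ge>0. W0 t z = W t z"
 and AD: "AE t in lborel. AE r in lborel. 0 < r & r < t & t < T --> A0 t r = A t r & B0 t r = B t r & C0 t r = C t r & D0 t r = D t r"
 and GX: "AEI 0 T (%t. XX0 t = XX t & (AEI t T (%s. Ga0 s t = Ga s t)))"
 and b0: "b0 : space_L21_F_tri M F 0 T" and sg0: "sg0 : space_L2_F_tri M F 0 T" and v0: "v0 : space_L2_F M F 0 T"
 and x: "x : BM borel" "AEI t0 T (%t. x0 t = x t)" and x0: "norm_L2 t0 T x0 < \<infinity>"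
begin

definition b where "b s r z = (if (s, r) : triangle2 0 T then b0 s r z else 0)"
definition sg where "sg s r z = (if (s, r) : triangle2 0 T then sg0 s r z else 0)"
definition v where "v r z = (if r : {0<..<T} then v0 r z else 0)"

lemma field_of_space:
 fixes xx' :: "real => real => 'a => 'e::euclidean_space"
 assumes xx': "xx' : space_L21_F_tri M F 0 T"
 shows "field (%s r z. if (s, r) : triangle2 0 T then xx' s r z else 0)"
 unfolding field_def
proof (intro conjI AE_I2 impI)
 show "(%p. if (fst p, fst (snd p)) : triangle2 0 T then xx' (fst p) (fst (snd p)) (snd (snd p)) else 0) : BM (tprod (tprod M))"
 using xx' T by (intro triangle_joint) (auto simp: space_L21_F_tri_def)
 fix s r assume s: "s : {t0<..<T}" "r : {t0<..<s}"
 have "prog_measurable F 0 s (xx' s)" using xx' s t0 by (auto simp: space_L21_F_tri_def)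
 from prog_section[OF this, of r] show "(%z. if (s, r) : triangle2 0 T then xx' s r z else 0) : BM (F r)"
 using s t0 by (auto simp: triangle2_def)
qed

lemma norm_L2_x: "norm_L2 t0 T x0 = ennsqrt (NI {t0<..<T} (%s. nsq (x s)))"
 unfolding norm_L2_def nn_integral_completion
 by (rule arg_cong[of _ _ ennsqrt], rule nn_cong_AE, use x(2) in eventually_elim) (auto simp: ind_def)

lemma field_L21_eq: "(NN M (%z. (NI {t0<..<T} (%t. (NI {t0<..<t} (%s. ennreal (norm (b0 t s z))))^2)))) = (NI {t0<..<T} (field_L21 b))"
proof -
 have "field b" using field_of_space[OF b0] by (simp add: b_def[abs_def])
 then have bm: "joint3 M b" by (simp add: field_def)
 have "(%q. (fst (fst q), (snd q, snd (fst q)))) : measurable ((tprod M) \<Otimes>\<^sub>M lborel) (tprod (tprod M))" by measurable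
 from mcomp[OF this bm]
 have [measurable]: "(%q. b (fst (fst q)) (snd q) (snd (fst q))) : BM ((tprod M) \<Otimes>\<^sub>M lborel)" by simp
 have "(%q. ennreal (norm (b (fst (fst q)) (snd q) (snd (fst q)))) * indicator {q. t0 < snd q & snd q < fst (fst q)} q) : BM ((tprod M) \<Otimes>\<^sub>M lborel)"
 by measurable
 from lb_nn_fst[OF this]
 have m[measurable]: "(%q. (NI {t0<..<fst q} (%r. ennreal (norm (b (fst q) r (snd q)))))^2) : BM (tprod M)"
 by (simp add: ind_def greaterThanLessThan_def greaterThan_def lessThan_def)
 have "(NN M (%z. (NI {t0<..<T} (%t. (NI {t0<..<t} (%s. ennreal (norm (b0 t s z))))^2)))) =
 (NN M (%z. (NI {t0<..<T} (%t. (NI {t0<..<t} (%s. ennreal (norm (b t s z))))^2))))"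
 proof (intro nn_cong)
 fix z t
 have "(NI {t0<..<t} (%s. ennreal (norm (b0 t s z)))) = (NI {t0<..<t} (%s. ennreal (norm (b t s z))))" if "t : {t0<..<T}"
 using that t0 by (intro nn_cong) (auto simp: b_def triangle2_def ind_def)
 then show "(NI {t0<..<t} (%s. ennreal (norm (b0 t s z))))^2 * indicator {t0<..<T} t = (NI {t0<..<t} (%s. ennreal (norm (b t s z))))^2 * indicator {t0<..<T} t"
 by (auto simp: ind_def)
 qed
 also have "... = (NN lborel (%t. NN M (%z. (NI {t0<..<t} (%s. ennreal (norm (b t s z))))^2 * indicator {t0<..<T} t)))"
 by (rule nn_integral_swap) measurable
 also have "... = (NI {t0<..<T} (field_L21 b))"
 unfolding field_L21_def by (intro nn_cong nn_integral_multc) (use time_section_measurable[OF m] in simp)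
 finally show ?thesis .
qed

lemma field_L2_eq:
 fixes xx' ze :: "real => real => 'a => 'e::euclidean_space"
 assumes m: "joint3 M ze"
 and e: "\<And>s r z. (s, r) : triangle2 t0 T ==> xx' s r z = ze s r z"
 shows "(NN M (%z. (NI {t0<..<T} (%t. (NI {t0<..<t} (%s. nsq (xx' t s z))))))) = (NI {t0<..<T} (%s. field_L2 ze s))"
proof -
 have "(%q. (fst (fst q), (snd q, snd (fst q)))) : measurable ((tprod M) \<Otimes>\<^sub>M lborel) (tprod (tprod M))" by measurable
 from mcomp[OF this m]
 have [measurable]: "(%q. ze (fst (fst q)) (snd q) (snd (fst q))) : BM ((tprod M) \<Otimes>\<^sub>M lborel)" by simp
 have "(%q. nsq (ze (fst (fst q)) (snd q) (snd (fst q))) * indicator {q. t0 < snd q & snd q < fst (fst q)} q) : BM ((tprod M) \<Otimes>\<^sub>M lborel)"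
 by measurable
 from lb_nn_fst[OF this]
 have m2[measurable]: "(%q. NI {t0<..<fst q} (%r. nsq (ze (fst q) r (snd q)))) : BM (tprod M)"
 by (simp add: ind_def greaterThanLessThan_def greaterThan_def lessThan_def)
 have "(NN M (%z. (NI {t0<..<T} (%t. (NI {t0<..<t} (%s. nsq (xx' t s z))))))) =
 (NN M (%z. (NI {t0<..<T} (%t. (NI {t0<..<t} (%s. nsq (ze t s z)))))))"
 proof (intro nn_cong)
 fix z t
 have "(NI {t0<..<t} (%s. nsq (xx' t s z))) = (NI {t0<..<t} (%s. nsq (ze t s z)))" if "t : {t0<..<T}"
 using that e by (intro nn_cong) (auto simp: triangle2_def ind_def)
 then show "(NI {t0<..<t} (%s. nsq (xx' t s z))) * indicator {t0<..<T} t = (NI {t0<..<t} (%s. nsq (ze t s z))) * indicator {t0<..<T} t"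
 by (auto simp: ind_def)
 qed
 also have "... = (NN lborel (%t. NN M (%z. (NI {t0<..<t} (%s. nsq (ze t s z))) * indicator {t0<..<T} t)))"
 by (rule nn_integral_swap) measurable
 also have "... = (NI {t0<..<T} (%t. (NN M (%z. (NI {t0<..<t} (%s. nsq (ze t s z)))))))"
 by (intro nn_cong nn_integral_multc) (use time_section_measurable[OF m2] in simp)
 also have "... = (NI {t0<..<T} (%s. field_L2 ze s))"
 proof -
 have "(NN M (%z. (NI {t0<..<t} (%s. nsq (ze t s z))))) = field_L2 ze t" for t
 proof -
 note fs[measurable] = field_section[OF m, of t]
 have "(NN M (%z. (NI {t0<..<t} (%s. nsq (ze t s z))))) = (NN lborel (%s. NN M (%z. nsq (ze t s z) * indicator {t0<..<t} s)))"
 by (rule nn_integral_swap) measurable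
 also have "... = field_L2 ze t" unfolding field_L2_def using time_section_measurable[OF fs] by (intro nn_cong nn_integral_multc) measurable
 finally show ?thesis .
 qed
 then show ?thesis by simp
 qed
 finally show ?thesis .
qed

lemma process_norm_eq:
 fixes X Y :: "real => 'a => 'e::euclidean_space"
 assumes e: "AEP M t0 T (%p. X (fst p) (snd p) = Y (fst p) (snd p))"
 and m[measurable]: "joint M Y"
 shows "norm_L2_F M t0 T X = ennsqrt (NI {t0<..<T} (%r. (nn2 M (Y r))))"
proof -
 have "(NN M (%z. (NI {t0<..<T} (%t. nsq (X t z))))) = (NN M (%z. (NI {t0<..<T} (%t. nsq (Y t z)))))"
 proof (rule nn_cong_AE, use AE_pair_swap[OF e] in eventually_elim)
 fix z assume a: "AEI t0 T (%r. X r z = Y r z)"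
 show "(NI {t0<..<T} (%t. nsq (X t z))) = (NI {t0<..<T} (%t. nsq (Y t z)))"
 by (rule nn_cong_AE, use a in eventually_elim) (auto simp: ind_def)
 qed
 also have "... = (NN lborel (%t. NN M (%z. nsq (Y t z) * indicator {t0<..<T} t)))" by (rule nn_integral_swap) measurable
 also have "... = (NI {t0<..<T} (%r. (nn2 M (Y r))))"
 using time_section_measurable[OF m] by (intro nn_cong nn_integral_multc) measurable
 finally show ?thesis by (simp add: norm_L2_F_def)
qed

lemma process_of_space:
 fixes X :: "real => 'a => 'e::euclidean_space"
 assumes X: "X : space_L2_F M F a T" and a: "0 <= a" "a <= t0"
 shows "process (%r z. if r : {a<..<T} then X r z else 0)"
proof -
 have p: "prog_measurable F a T X" and n: "norm_L2_F M a T X < \<infinity>" using X by (auto simp: space_L2_F_def)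
 have m: "(%p. if fst p : {a<..<T} then X (fst p) (snd p) else 0) : BM (tprod M)"
 using prog_joint[OF p a(1)] a t0 by simp
 have "(NN M (%z. (NI {t0<..<T} (%t. nsq (X t z))))) <= (NN M (%z. (NI {a<..<T} (%t. nsq (X t z)))))"
 using a by (intro nn_mono) (auto simp: ind_def)
 then have "norm_L2_F M t0 T X < \<infinity>" using n by (auto simp: norm_L2_F_def ennsqrt_less_top_iff intro: le_less_trans)
 moreover have "norm_L2_F M t0 T X = ennsqrt (NI {t0<..<T} (%r. (NN M (%z. nsq (if r : {a<..<T} then X r z else 0)))))"
 by (rule process_norm_eq[OF _ m]) (use a in auto)
 ultimately have "(NI {t0<..<T} (%r. (NN M (%z. nsq (if r : {a<..<T} then X r z else 0))))) < \<infinity>"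
 by (simp add: ennsqrt_less_top_iff)
 moreover have "(%z. if r : {a<..<T} then X r z else 0) : BM (F r)" if "r : {t0<..<T}" for r
 using prog_section[OF p, of r] that a by simp
 ultimately show ?thesis unfolding process_def using m by simp
qed

lemma problem_data: "data x b sg v"
proof -
 have s21: "sg0 : space_L21_F_tri M F 0 T" using sg0 by (simp add: space_L2_F_tri_def)
 have fb: "field b" using field_of_space[OF b0] by (simp add: b_def[abs_def])
 have fs: "field sg" using field_of_space[OF s21] by (simp add: sg_def[abs_def])
 have "(NI {t0<..<T} (field_L21 b)) <= (NN M (%z. (NI {0<..<T} (%t. (NI {0<..<t} (%s. ennreal (norm (b0 t s z))))^2))))"
 unfolding field_L21_eq[symmetric]
 proof (intro nn_mono mult_mono power_mono)
 show "indicator {t0<..<T} t <= (indicator {0<..<T} t :: ennreal)" for t using t0 by (auto simp: ind_def)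
 show "indicator {t0<..<t} s <= (indicator {0<..<t} s :: ennreal)" for t s using t0 by (auto simp: ind_def)
 qed auto
 moreover have "(NN M (%z. (NI {0<..<T} (%t. (NI {0<..<t} (%s. ennreal (norm (b0 t s z))))^2)))) < \<infinity>"
 using b0 by (auto simp: space_L21_F_tri_def norm_L21_F_tri_def ennsqrt_less_top_iff)
 ultimately have b1: "(NI {t0<..<T} (field_L21 b)) < \<infinity>" by (rule le_less_trans)
 have sm: "joint3 M sg" using fs by (simp add: field_def)
 have "(NI {t0<..<T} (%s. field_L2 sg s)) = (NN M (%z. (NI {t0<..<T} (%t. (NI {t0<..<t} (%s. nsq (sg0 t s z)))))))"
 by (rule field_L2_eq[OF sm, symmetric]) (use t0 in \<open>auto simp: sg_def triangle2_def\<close>)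
 also have "... <= (NN M (%z. (NI {0<..<T} (%t. (NI {0<..<t} (%s. nsq (sg0 t s z)))))))"
 proof (intro nn_mono mult_mono)
 show "indicator {t0<..<T} t <= (indicator {0<..<T} t :: ennreal)" for t using t0 by (auto simp: ind_def)
 show "indicator {t0<..<t} s <= (indicator {0<..<t} s :: ennreal)" for t s using t0 by (auto simp: ind_def)
 qed auto
 also have "... < \<infinity>" using sg0 by (auto simp: space_L2_F_tri_def norm_L2_F_tri_def ennsqrt_less_top_iff)
 finally have s1: "(NI {t0<..<T} (%s. field_L2 sg s)) < \<infinity>" .
 have "process v" using process_of_space[OF v0] t0 by (simp add: v_def[abs_def])
 moreover have "(NI {t0<..<T} (%s. nsq (x s))) < \<infinity>" using x0 by (simp add: norm_L2_x ennsqrt_less_top_iff)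
 ultimately show ?thesis unfolding data_def using fb fs b1 s1 x(1) by simp
qed

lemma set_integral_lebesgue_eq:
 fixes f g :: "real => 'e::euclidean_space"
 assumes g: "g : BM borel" and S: "S : sets borel" and e: "AE r in lborel. r : S --> f r = g r"
 shows "(LINT r:S|lebesgue. f r) = (LINT r:S|lborel. g r)"
proof -
 have m: "(%r. indr S r *\<^sub>R g r) : BM lebesgue" using g S by (intro measurable_completion) auto
 have e': "AE r in lborel. indr S r *\<^sub>R f r = indr S r *\<^sub>R g r" using e by eventually_elim (auto simp: ind_def)
 have e2: "AE r in lborel. indr S r *\<^sub>R g r = indr S r *\<^sub>R f r" using e by eventually_elim (auto simp: ind_def)
 have fm: "(%r. indr S r *\<^sub>R f r) : BM lebesgue"
 by (rule completion.borel_measurable_AE_cong[OF m AE_completion[OF e2]])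
 have "(LINT r:S|lebesgue. f r) = (LINT r:S|lebesgue. g r)"
 unfolding slint_def by (rule integral_cong_AE[OF fm m AE_completion[OF e']])
 then show ?thesis using set_integral_lebesgue_eq_lborel[OF g S] by simp
qed

text \<open>Both integrals depend on their integrands only up to null sets, and the stochastic one
  on the Brownian path only up to a null event.\<close>

lemma representation_iff:
 assumes f: "AEP M t0 t (%p. f' (fst p) (snd p) = f (fst p) (snd p) & h' (fst p) (snd p) = h (fst p) (snd p))"
 and m: "joint M f" and Z: "AE z in M. Z' z = Z z" and y: "y' = y"
 shows "(EX Y. has_ito_integral M W0 (augmented_filtration M W0) t0 t h' Y & (AE z in M. Z' z = y' + (LINT r:{t0<..<t}|lebesgue. f' r z) + Y z)) \<longleftrightarrow> sv_rep y f h t Z"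
proof -
 have h1: "AE p in completion (restrict_space lborel {t0<..<t} \<Otimes>\<^sub>M M). h' (fst p) (snd p) = h (fst p) (snd p)"
 by (rule AE_completion[OF AE_restrict_pair]) (use f in eventually_elim, auto)
 then have h2: "AE p in completion (restrict_space lborel {t0<..<t} \<Otimes>\<^sub>M M). h (fst p) (snd p) = h' (fst p) (snd p)" by eventually_elim simp
 have WW': "AE z in M. \<forall>t\<ge>0. W t z = W0 t z" using WW by eventually_elim simp
 have "has_ito_integral M W0 F t0 t h' Y \<longleftrightarrow> has_ito_integral M W F t0 t h Y" for Y
 using has_ito_integral_cong_AE[OF has_ito_integral_cong_W[OF _ WW' t0(1)] h1, of F Y] has_ito_integral_cong_W[OF has_ito_integral_cong_AE[OF _ h2] WW t0(1), of F Y] by blast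
 moreover have "(AE z in M. Z' z = y' + (LINT r:{t0<..<t}|lebesgue. f' r z) + Y z) \<longleftrightarrow> (AE z in M. Z z = y + (LINT r:{t0<..<t}|lborel. f r z) + Y z)" for Y
 proof -
 have "AE p in lborel \<Otimes>\<^sub>M M. (%r z. r : {t0<..<t} --> f' r z = f r z) (fst p) (snd p)" using f by eventually_elim auto
 from AE_pair_swap[OF this] have "AE z in M. (Z' z = y' + (LINT r:{t0<..<t}|lebesgue. f' r z) + Y z) \<longleftrightarrow> (Z z = y + (LINT r:{t0<..<t}|lborel. f r z) + Y z)"
 using Z AE_space
 proof eventually_elim
 case (elim z)
 have "(LINT r:{t0<..<t}|lebesgue. f' r z) = (LINT r:{t0<..<t}|lborel. f r z)"
 by (rule set_integral_lebesgue_eq[OF section_measurable[OF m elim(3)] _ elim(1)]) simp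
 then show ?case using elim(2) y by simp
 qed
 then show ?thesis by (rule AE_iff_cong)
 qed
 ultimately show ?thesis unfolding sv_rep_def FW[symmetric] by simp
qed

text \<open>The three equations translate one by one, for almost every time, into the clauses of
  \<open>step\<close> with output equal to input. Membership in the solution spaces is the only
  condition left on the given versions.\<close>

lemma solution_iff:
 assumes X: "joint M X" and u: "joint M u"
 and Th: "joint3 M Th"
 and e: "AEP M t0 T (%p. X0 (fst p) (snd p) = X (fst p) (snd p) & u0 (fst p) (snd p) = u (fst p) (snd p))"
 and The: "\<And>s t z. (s, t) : triangle2 t0 T ==> Th0 s t z = Th s t z"
 shows "causal_feedback_solution M W0 T A0 B0 C0 D0 b0 sg0 XX0 Ga0 v0 t0 x0 X0 Th0 u0 \<longleftrightarrow>
 X0 : space_L2_F M F t0 T & Th0 : space_L2_Fc_tri M F t0 T & u0 : space_L2_F M F t0 T & step x b sg v X u X Th u"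
proof -
 interpret Q: pair_sigma_finite lborel M ..
 have bm: "joint3 M b"
 using problem_data by (auto simp: data_def field_def)
 have et: "AEI t0 T (%t. (AE z in M. X0 t z = X t z & u0 t z = u t z))"
 using Q.AE_pair[OF e] by eventually_elim auto
 have coef: "AE p in lborel \<Otimes>\<^sub>M M. fst p : {t0<..<t} -->
 A0 s (fst p) *v X0 (fst p) (snd p) + B0 s (fst p) *v u0 (fst p) (snd p) + b0 s (fst p) (snd p) = drift X u b s (fst p) (snd p) &
 C0 s (fst p) *v X0 (fst p) (snd p) + D0 s (fst p) *v u0 (fst p) (snd p) + sg0 s (fst p) (snd p) = diffusion X u sg s (fst p) (snd p)"
 if s: "s : {t0<..<T}" "t <= s" and k: "AE r in lborel. 0 < r & r < s & s < T --> A0 s r = A s r & B0 s r = B s r & C0 s r = C s r & D0 s r = D s r" for s t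
 using AE_pair_of_time[OF k] e
 proof (eventually_elim, intro impI)
 fix p :: "real \<times> 'a" assume h: "0 < fst p & fst p < s & s < T --> A0 s (fst p) = A s (fst p) & B0 s (fst p) = B s (fst p) & C0 s (fst p) = C s (fst p) & D0 s (fst p) = D s (fst p)"
 "fst p : {t0<..<T} --> X0 (fst p) (snd p) = X (fst p) (snd p) & u0 (fst p) (snd p) = u (fst p) (snd p)" and p: "fst p : {t0<..<t}"
 have "(s, fst p) : triangle2 0 T" using p s t0 by (auto simp: triangle2_def)
 then show "A0 s (fst p) *v X0 (fst p) (snd p) + B0 s (fst p) *v u0 (fst p) (snd p) + b0 s (fst p) (snd p) = drift X u b s (fst p) (snd p) &
 C0 s (fst p) *v X0 (fst p) (snd p) + D0 s (fst p) *v u0 (fst p) (snd p) + sg0 s (fst p) (snd p) = diffusion X u sg s (fst p) (snd p)"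
 using h p s t0 by (simp add: drift_def diffusion_def b_def sg_def)
 qed
 note dm = drift_measurable(1)[of X u b, OF X u field_section[OF bm]]
 have 1: "(AE t in lborel. t : {t0<..<T} -->
 (EX Y. has_ito_integral M W0 (augmented_filtration M W0) t0 t (%s z. C0 t s *v X0 s z + D0 t s *v u0 s z + sg0 t s z) Y &
 (AE z in M. X0 t z = x0 t + (LINT s:{t0<..<t}|lebesgue. A0 t s *v X0 s z + B0 t s *v u0 s z + b0 t s z) + Y z))) \<longleftrightarrow>
 (AEI t0 T (%t. sv_rep (x t) (drift X u b t) (diffusion X u sg t) t (X t)))"
 (is "(AE t in lborel. ?P t) \<longleftrightarrow> (AE t in lborel. ?Q t)")
 proof (rule AE_iff_cong)
 show "AE t in lborel. ?P t = ?Q t"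
 using AD x(2) et
 proof eventually_elim
 case (elim t)
 show ?case
 proof (cases "t : {t0<..<T}")
 case True
 have "AE z in M. X0 t z = X t z" using elim(3) True by auto
 from representation_iff[OF coef[OF True order_refl elim(1)] dm this, of "x0 t" "x t"] elim(2) True show ?thesis by simp
 qed blast
 qed
 qed
 have 2: "(AEI t0 T (%s. (ALL t:{t0<..<s}.
 (EX Y. has_ito_integral M W0 (augmented_filtration M W0) t0 t (%r z. C0 s r *v X0 r z + D0 s r *v u0 r z + sg0 s r z) Y &
 (AE z in M. Th0 s t z = x0 s + (LINT r:{t0<..<t}|lebesgue. A0 s r *v X0 r z + B0 s r *v u0 r z + b0 s r z) + Y z))))) \<longleftrightarrow>
 (AEI t0 T (%s. (ALL t:{t0<..<s}. sv_rep (x s) (drift X u b s) (diffusion X u sg s) t (Th s t))))"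
 (is "(AE t in lborel. ?P t) \<longleftrightarrow> (AE t in lborel. ?Q t)")
 proof (rule AE_iff_cong)
 show "AE s in lborel. ?P s = ?Q s"
 using AD x(2)
 proof eventually_elim
 case (elim s)
 show ?case
 proof (cases "s : {t0<..<T}")
 case True
 have "(EX Y. has_ito_integral M W0 (augmented_filtration M W0) t0 t (%r z. C0 s r *v X0 r z + D0 s r *v u0 r z + sg0 s r z) Y &
 (AE z in M. Th0 s t z = x0 s + (LINT r:{t0<..<t}|lebesgue. A0 s r *v X0 r z + B0 s r *v u0 r z + b0 s r z) + Y z)) \<longleftrightarrow>
 sv_rep (x s) (drift X u b s) (diffusion X u sg s) t (Th s t)" if t: "t : {t0<..<s}" for t
 proof -
 have ts: "t <= s" using t by simp
 have "AE z in M. Th0 s t z = Th s t z" using True t by (intro AE_I2 The) (auto simp: triangle2_def)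
 from representation_iff[OF coef[OF True ts elim(1)] dm this, of "x0 s" "x s"] elim(2) True show ?thesis by simp
 qed
 then show ?thesis by simp
 qed blast
 qed
 qed
 have 3: "(AEI t0 T (%t. (AE z in M.
 u0 t z = XX0 t *v X0 t z + (LINT s:{t<..<T}|lebesgue. Ga0 s t *v Th0 s t z) + v0 t z))) \<longleftrightarrow>
 (AEI t0 T (%t. (AE z in M. u t z = XX t *v X t z + (LINT s:{t<..<T}|lborel. Ga s t *v Th s t z) + v t z)))"
 (is "(AE t in lborel. ?P t) \<longleftrightarrow> (AE t in lborel. ?Q t)")
 proof (rule AE_iff_cong)
 show "AE t in lborel. ?P t = ?Q t"
 using GX et
 proof eventually_elim
 case (elim t)
 show ?case
 proof (cases "t : {t0<..<T}")
 case True
 then have G: "XX0 t = XX t" "AEI t T (%s. Ga0 s t = Ga s t)" using elim(1) t0 by auto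
 have "AE z in M. X0 t z = X t z & u0 t z = u t z" using elim(2) True by auto
 then have "AE z in M. (u0 t z = XX0 t *v X0 t z + (LINT s:{t<..<T}|lebesgue. Ga0 s t *v Th0 s t z) + v0 t z) =
 (u t z = XX t *v X t z + (LINT s:{t<..<T}|lborel. Ga s t *v Th s t z) + v t z)"
 using AE_space
 proof eventually_elim
 case (elim z)
 have "(%s. Th s t z) : BM borel" by (rule section_measurable[OF response_slice[OF Th] elim(2)])
 then have "(%s. Ga s t *v Th s t z) : BM borel" by measurable
 then have "(LINT s:{t<..<T}|lebesgue. Ga0 s t *v Th0 s t z) = (LINT s:{t<..<T}|lborel. Ga s t *v Th s t z)"
 proof (rule set_integral_lebesgue_eq)
 show "AEI t T (%s. Ga0 s t *v Th0 s t z = Ga s t *v Th s t z)"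
 using G(2) by eventually_elim (use True The in \<open>auto simp: triangle2_def\<close>)
 qed simp
 then show ?case using elim(1) G(1) True t0 by (simp add: v_def)
 qed
 from AE_iff_cong[OF this] True show ?thesis by simp
 qed blast
 qed
 qed
 show ?thesis unfolding causal_feedback_solution_def controls_def 1 2 3 unfolding step_def FW[symmetric] by blast
qed

end

context svie_problem
begin

text \<open>Extending a given solution by 0 outside its time domain makes it jointly measurable and
  changes nothing on the domain.\<close>

lemma internal_solution:
 assumes S: "causal_feedback_solution M W0 T A0 B0 C0 D0 b0 sg0 XX0 Ga0 v0 t0 x0 X0 Th0 u0"
 shows "EX X Th u. process X & process u & response Th & step x b sg v X u X Th u &
 (ALL r:{t0<..<T}. X0 r = X r & u0 r = u r) & (ALL s t z. (s, t) : triangle2 t0 T --> Th0 s t z = Th s t z)"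
proof -
 define X where "X r z = (if r : {t0<..<T} then X0 r z else 0)" for r z
 define u where "u r z = (if r : {t0<..<T} then u0 r z else 0)" for r z
 define Th where "Th s t z = (if (s, t) : triangle2 t0 T then Th0 s t z else 0)" for s t z
 have sp: "X0 : space_L2_F M F t0 T" "u0 : space_L2_F M F t0 T" "Th0 : space_L2_F_tri M F t0 T"
 using S by (auto simp: causal_feedback_solution_def controls_def FW space_L2_Fc_tri_def)
 have p: "process X" "process u"
 using process_of_space[OF sp(1)] process_of_space[OF sp(2)] t0 by (simp_all add: X_def[abs_def] u_def[abs_def])
 have m: "joint3 M Th"
 unfolding Th_def using sp(3) t0 by (intro triangle_joint) (auto simp: space_L2_F_tri_def space_L21_F_tri_def)
 have The: "\<And>s t z. (s, t) : triangle2 t0 T ==> Th0 s t z = Th s t z" by (simp add: Th_def)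
 have "norm_L2_F_tri M t0 T Th0 < top" using sp(3) by (simp add: space_L2_F_tri_def)
 moreover have "norm_L2_F_tri M t0 T Th0 = ennsqrt (NI {t0<..<T} (%s. field_L2 Th s))"
 unfolding norm_L2_F_tri_def by (rule arg_cong[of _ _ ennsqrt], rule field_L2_eq[OF m The])
 ultimately have "(NI {t0<..<T} (%s. field_L2 Th s)) < \<infinity>" by (simp add: ennsqrt_less_top_iff)
 then have r: "response Th" using m by (simp add: response_def field_L2_def)
 have "step x b sg v X u X Th u"
 using S by (subst (asm) solution_iff[OF processD(1)[OF p(1)] processD(1)[OF p(2)] m _ The]) (auto simp: X_def u_def)
 then show ?thesis using p r The by (intro exI[of _ X] exI[of _ Th] exI[of _ u]) (auto simp: X_def u_def)
qed

text \<open>At the two endpoints, which are limit points of the open interval, the one-sided limits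
  are the values of the continuous extension \<open>ze\<close>.\<close>

lemma endpoint_ext_continuous:
 fixes tt ze :: "real => real => 'a => 'e::euclidean_space"
 assumes c: "continuous_on UNIV (%s. ze t s z)" and e: "\<And>s. s : {t0<..<t} ==> tt t s z = ze t s z" and s: "s : {t0..t}" "t0 < t"
 shows "endpoint_ext t0 tt t s z = ze t s z"
proof (cases "t0 < s & s < t")
 case True
 then show ?thesis using e by (simp add: endpoint_ext_def)
next
 case False
 have "((%r. ze t r z) \<longlongrightarrow> ze t s z) (at s within {t0<..<t})"
 using c unfolding continuous_on_def by (meson UNIV_I subset_UNIV tendsto_within_subset)
 then have "((%r. tt t r z) \<longlongrightarrow> ze t s z) (at s within {t0<..<t})"
 by (rule Lim_transform_within[where d=1]) (use e in auto)
 moreover have "at s within {t0<..<t} ~= bot"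
 proof -
 have "s = t0 \<or> s = t" using s False by auto
 then show ?thesis unfolding trivial_limit_within using s(2) islimpt_greaterThanLessThan1[of t0 t] islimpt_greaterThanLessThan2[of t0 t] by blast
 qed
 ultimately have "Lim (at s within {t0<..<t}) (%r. tt t r z) = ze t s z" by (intro tendsto_Lim)
 then show ?thesis unfolding endpoint_ext_def if_not_P[OF False] .
qed

lemma norm_L2_Fc_le:
 assumes R: "joint M R"
 and c: "ALL s. ALL z:space M. continuous_on UNIV (%t. Th s t z)"
 and b: "AEP M t0 T (%p. (ALL t:{t0..T}. nsq (Th (fst p) t (snd p)) <= R (fst p) (snd p)))"
 and e: "AEP M t0 T (%p. (ALL s:{t0<..<fst p}. Th0 (fst p) s (snd p) = Th (fst p) s (snd p)))"
 shows "norm_L2_Fc_tri M t0 T Th0 <= ennsqrt (NI {t0<..<T} (%s. (NN M (R s))))"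
 unfolding norm_L2_Fc_tri_def
proof (rule ennsqrt_mono)
 note [measurable] = R
 have "AE p in lborel \<Otimes>\<^sub>M M. (%t z. t : {t0<..<T} --> (SUP s\<in>{t0..t}. nsq (endpoint_ext t0 Th0 t s z)) <= R t z) (fst p) (snd p)"
 using b e AE_space
 proof (eventually_elim, intro impI SUP_least)
 fix p s assume h: "fst p : {t0<..<T} --> (ALL t:{t0..T}. nsq (Th (fst p) t (snd p)) <= R (fst p) (snd p))"
 "fst p : {t0<..<T} --> (ALL s:{t0<..<fst p}. Th0 (fst p) s (snd p) = Th (fst p) s (snd p))"
 "p : space (tprod M)" "fst p : {t0<..<T}" "s : {t0..fst p}"
 have "endpoint_ext t0 Th0 (fst p) s (snd p) = Th (fst p) s (snd p)"
 proof (rule endpoint_ext_continuous)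
 show "continuous_on UNIV (%s. Th (fst p) s (snd p))" using c h(3) by (auto simp: sp_pair)
 qed (use h in auto)
 then show "nsq (endpoint_ext t0 Th0 (fst p) s (snd p)) <= R (fst p) (snd p)" using h by auto
 qed
 from AE_pair_swap[OF this]
 have "(NN M (%z. (NI {t0<..<T} (%t. (SUP s\<in>{t0..t}. nsq (endpoint_ext t0 Th0 t s z)))))) <= (NN M (%z. (NN lborel (%t. R t z * indicator {t0<..<T} t))))"
 proof (intro nn_mono_AE, eventually_elim)
 fix z assume a: "AEI t0 T (%t. (SUP s\<in>{t0..t}. nsq (endpoint_ext t0 Th0 t s z)) <= R t z)"
 show "(NI {t0<..<T} (%t. (SUP s\<in>{t0..t}. nsq (endpoint_ext t0 Th0 t s z)))) <= (NN lborel (%t. R t z * indicator {t0<..<T} t))"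
 by (rule nn_mono_AE, use a in eventually_elim) (auto simp: ind_def)
 qed
 also have "... = (NN lborel (%t. (NN M (%z. R t z * indicator {t0<..<T} t))))" by (rule nn_integral_swap) measurable
 also have "... = (NI {t0<..<T} (%s. (NN M (R s))))"
 by (intro nn_cong nn_integral_multc time_section_measurable[OF R])
 finally show "(NN M (%z. (NI {t0<..<T} (%t. (SUP s\<in>{t0..t}. nsq (endpoint_ext t0 Th0 t s z)))))) <= (NI {t0<..<T} (%s. (NN M (R s))))" .
qed

text \<open>All norms of Theta are controlled through the response condition and the majorant
  \<open>R\<close>: the squared time integral of its norm is at most \<open>(T - t0)^2\<close> times
  \<open>R\<close>, and the squared supremum at most \<open>R\<close>.\<close>

lemma response_in_space:
 assumes Th: "response Th" and c: "ALL s. ALL z:space M. continuous_on UNIV (%t. Th s t z)"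
 and ad: "ALL s. ALL t:{t0..T}. Th s t : BM (F t)"
 and R: "joint M R"
 and b: "AEP M t0 T (%p. (ALL t:{t0..T}. nsq (Th (fst p) t (snd p)) <= R (fst p) (snd p)))"
 and fin: "(NI {t0<..<T} (%s. (NN M (R s)))) < \<infinity>"
 shows "Th : space_L2_Fc_tri M F t0 T"
proof -
 note [measurable] = R
 have m: "joint3 M Th" using Th by (simp add: response_def)
 have cs: "continuous_on S (%s. Th t s z)" if "z : space M" for t z S
 using c that by (meson continuous_on_subset subset_UNIV)
 have RR: "(NN M (%z. (NI {t0<..<T} (%t. R t z)))) = (NI {t0<..<T} (%s. (NN M (R s))))"
 proof -
 have "(NN M (%z. (NN lborel (%t. R t z * indicator {t0<..<T} t)))) = (NN lborel (%t. (NN M (%z. R t z * indicator {t0<..<T} t))))" by (rule nn_integral_swap) measurable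
 also have "... = (NI {t0<..<T} (%s. (NN M (R s))))"
 by (intro nn_cong nn_integral_multc time_section_measurable[OF R])
 finally show ?thesis .
 qed
 have "norm_L21_F_tri M t0 T Th < \<infinity>"
 proof -
 have "(NN M (%z. (NI {t0<..<T} (%t. (NI {t0<..<t} (%s. ennreal (norm (Th t s z))))^2)))) <= (NN M (%z. ennreal ((T - t0)^2) * (NI {t0<..<T} (%t. R t z))))"
 proof (rule nn_mono_AE, use AE_pair_swap[of "%t z. t : {t0<..<T} --> (ALL s:{t0..T}. nsq (Th t s z) <= R t z)", OF b] AE_space in eventually_elim)
 fix z assume a: "AEI t0 T (%t. (ALL s:{t0..T}. nsq (Th t s z) <= R t z))" and z: "z : space M"
 have "(NI {t0<..<T} (%t. (NI {t0<..<t} (%s. ennreal (norm (Th t s z))))^2)) <= (NN lborel (%t. ennreal ((T - t0)^2) * (R t z * indicator {t0<..<T} t)))"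
 proof (rule nn_mono_AE, use a in eventually_elim)
 fix t assume a: "t : {t0<..<T} --> (ALL s:{t0..T}. nsq (Th t s z) <= R t z)"
 have "(NI {t0<..<t} (%s. ennreal (norm (Th t s z))))^2 <= ennreal ((T - t0)^2) * R t z" if t: "t : {t0<..<T}"
 proof -
 have "(NI {t0<..<t} (%s. ennreal (norm (Th t s z)))) <= (NN lborel (%s. ennsqrt (R t z) * indicator {t0<..<T} s))"
 proof (intro nn_mono)
 fix s
 have "ennreal (norm (Th t s z)) <= ennsqrt (R t z)" if "s : {t0<..<t}"
 proof -
 have "nsq (Th t s z) <= R t z" using a t that by auto
 from ennsqrt_mono[OF this] show ?thesis by (simp add: ennsqrt_def)
 qed
 then show "ennreal (norm (Th t s z)) * indicator {t0<..<t} s <= ennsqrt (R t z) * indicator {t0<..<T} s"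
 using t by (auto simp: ind_def)
 qed
 also have "... = ennsqrt (R t z) * ennreal (T - t0)" using t0 by (subst nn_integral_cmult_indicator) auto
 finally have "(NI {t0<..<t} (%s. ennreal (norm (Th t s z))))^2 <= (ennsqrt (R t z) * ennreal (T - t0))^2" by (rule power_mono) simp
 also have "... = ennreal ((T - t0)^2) * R t z" using t0 by (simp add: power_mult_distrib ennsqrt_power2 ennreal_power mult.commute)
 finally show ?thesis .
 qed
 then show "(NI {t0<..<t} (%s. ennreal (norm (Th t s z))))^2 * indicator {t0<..<T} t <= ennreal ((T - t0)^2) * (R t z * indicator {t0<..<T} t)"
 by (auto simp: ind_def)
 qed
 also have "... = ennreal ((T - t0)^2) * (NI {t0<..<T} (%t. R t z))"
 using section_measurable[OF R z] by (intro nn_cmult) auto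
 finally show "(NI {t0<..<T} (%t. (NI {t0<..<t} (%s. ennreal (norm (Th t s z))))^2)) <= ennreal ((T - t0)^2) * (NI {t0<..<T} (%t. R t z))" .
 qed
 also have "... = ennreal ((T - t0)^2) * (NN M (%z. (NI {t0<..<T} (%t. R t z))))"
 using nn_integral_measurable_omega[OF R] by (intro nn_cmult) auto
 also have "... < \<infinity>" using fin unfolding RR by (simp add: ennreal_mult_less_top)
 finally show ?thesis by (simp add: norm_L21_F_tri_def ennsqrt_less_top_iff)
 qed
 moreover have "norm_L2_F_tri M t0 T Th < \<infinity>"
 proof -
 have "norm_L2_F_tri M t0 T Th = ennsqrt (NI {t0<..<T} (%s. field_L2 Th s))"
 unfolding norm_L2_F_tri_def by (rule arg_cong[of _ _ ennsqrt], rule field_L2_eq[OF m refl])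
 then show ?thesis using Th by (simp add: ennsqrt_less_top_iff response_def field_L2_def)
 qed
 moreover have "(%((t, s), z). Th t s z) : BM (restrict_space borel (triangle2 t0 T) \<Otimes>\<^sub>M M)"
 proof -
 have f: "fst : measurable (restrict_space borel (triangle2 t0 T) \<Otimes>\<^sub>M M) (borel \<Otimes>\<^sub>M borel)"
 unfolding borel_prod by (rule mcomp[OF measurable_fst measurable_restrict_space1]) simp
 have "(%p. (fst (fst p), (snd (fst p), snd p))) : measurable (restrict_space borel (triangle2 t0 T) \<Otimes>\<^sub>M M) (tprod (tprod M))"
 using mcomp[OF f measurable_fst] mcomp[OF f measurable_snd] by (intro measurable_Pair measurable_snd) simp_all
 from mcomp[OF this m] show ?thesis by (simp add: case_prod_beta')
 qed
 moreover have "prog_measurable F t0 t (Th t)" if "t : {t0<..<T}" for t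
 by (rule progressive_of_continuous[of t0 t T]) (use that t0 ad cs in auto)
 moreover have "AE (t, z) in lborel \<Otimes>\<^sub>M M. t : {t0<..<T} --> uniformly_continuous_on {t0<..<t} (%s. Th t s z)"
 proof (rule AE_I2, clarify)
 fix t :: real and z assume "(t, z) : space (tprod M)"
 then have "continuous_on {t0..t} (%s. Th t s z)" by (intro cs) (auto simp: sp_pair)
 then have "uniformly_continuous_on {t0..t} (%s. Th t s z)" by (rule compact_uniformly_continuous) simp
 then show "uniformly_continuous_on {t0<..<t} (%s. Th t s z)"
 unfolding uniformly_continuous_on_def by (meson atLeastAtMost_iff greaterThanLessThan_iff less_imp_le)
 qed
 moreover have "norm_L2_Fc_tri M t0 T Th < \<infinity>"
 by (rule le_less_trans[OF norm_L2_Fc_le[OF R c b]]) (use fin in \<open>auto simp: ennsqrt_less_top_iff\<close>)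
 ultimately show ?thesis by (simp add: space_L2_Fc_tri_def space_L2_F_tri_def space_L21_F_tri_def)
qed

text \<open>State and control of the constructed solution are adapted only at almost every time, so
  they are exchanged for progressive versions, which \<open>solution_iff\<close> allows. The
  response is already continuous and adapted everywhere and is kept.\<close>

lemma feedback_solution_exists:
 "EX X Th u. causal_feedback_solution M W0 T A0 B0 C0 D0 b0 sg0 XX0 Ga0 v0 t0 x0 X Th u"
proof -
 obtain X Th u R where p: "process X" "process u" and r: "response Th" and st: "step x b sg v X u X Th u"
 and c: "ALL s. ALL z:space M. continuous_on UNIV (%t. Th s t z)" and ad: "ALL s. ALL t:{t0..T}. Th s t : BM (F t)"
 and R: "joint M R"
 and b: "AEI t0 T (%s. (AE z in M. ALL t:{t0..T}. nsq (Th s t z) <= R s z))"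
 and Rb: "(NI {t0<..<T} (%s. (NN M (R s)))) <= 300 * (1 + ennreal m0) *
 ((NI {t0<..<T} (%s. (nsq (x s) + field_L21 b s + field_L2 sg s))) + (NI {t0<..<T} (pair_norm X u)))"
 using solution_exists[OF problem_data] by blast
 have d: "x : BM borel" "field b" "field sg" "(NI {t0<..<T} (%s. nsq (x s))) < \<infinity>"
 "(NI {t0<..<T} (field_L21 b)) < \<infinity>" "(NI {t0<..<T} (%s. field_L2 sg s)) < \<infinity>"
 using problem_data by (auto simp: data_def)
 note [measurable] = d(1) field_norm_measurable(1)[OF d(2)[unfolded field_def, THEN conjunct1]] field_norm_measurable(2)[OF d(3)[unfolded field_def, THEN conjunct1]]
 have "(NI {t0<..<T} (%s. (nsq (x s) + field_L21 b s + field_L2 sg s))) < \<infinity>"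
 using d by (simp add: distrib_right nn_add)
 then have fin: "(NI {t0<..<T} (%s. (NN M (R s)))) < \<infinity>"
 using pair_norm_finite[OF p] by (intro le_less_trans[OF Rb]) (simp add: ennreal_mult_less_top)
 have version: "EX Y. Y : space_L2_F M F t0 T & (AEP M t0 T (%p. Y (fst p) (snd p) = Z (fst p) (snd p)))"
 if Z: "process Z" for Z :: "real => 'a => 'e::euclidean_space"
 proof -
 have n: "norm_L2_F M t0 T Y = ennsqrt (NI {t0<..<T} (%r. (nn2 M (Z r))))"
 if "AEP M t0 T (%p. Y (fst p) (snd p) = Z (fst p) (snd p))" for Y
 by (rule process_norm_eq[OF that processD(1)[OF Z]])
 have "norm_L2_F M t0 T Z < top" using processD(3)[OF Z] by (subst n) (auto simp: ennsqrt_less_top_iff)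
 then have "(NN M (%z. (NI {t0<..<T} (%r. nsq (Z r z))))) < \<infinity>" by (simp add: norm_L2_F_def ennsqrt_less_top_iff)
 from progressive_version[OF t0 processD(1,2)[OF Z] this] obtain Y where Y: "prog_measurable F t0 T Y"
 "AEP M t0 T (%p. Y (fst p) (snd p) = Z (fst p) (snd p))" by blast
 have "norm_L2_F M t0 T Y < top" using processD(3)[OF Z] by (subst n[OF Y(2)]) (auto simp: ennsqrt_less_top_iff)
 then show ?thesis using Y by (auto simp: space_L2_F_def)
 qed
 obtain X0 where X0: "X0 : space_L2_F M F t0 T" "AEP M t0 T (%p. X0 (fst p) (snd p) = X (fst p) (snd p))" using version[OF p(1)] by blast
 obtain u0 where u0: "u0 : space_L2_F M F t0 T" "AEP M t0 T (%p. u0 (fst p) (snd p) = u (fst p) (snd p))" using version[OF p(2)] by blast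
 have e: "AEP M t0 T (%p. X0 (fst p) (snd p) = X (fst p) (snd p) & u0 (fst p) (snd p) = u (fst p) (snd p))"
 using X0(2) u0(2) by eventually_elim blast
 have m: "joint3 M Th" using r by (simp add: response_def)
 have "Th : space_L2_Fc_tri M F t0 T" by (rule response_in_space[OF r c ad R response_bound_joint[OF r c R b] fin])
 then have "causal_feedback_solution M W0 T A0 B0 C0 D0 b0 sg0 XX0 Ga0 v0 t0 x0 X0 Th u0"
 using solution_iff[OF processD(1)[OF p(1)] processD(1)[OF p(2)] m e refl] X0(1) u0(1) st by blast
 then show ?thesis by blast
qed

text \<open>Every time in the open interval is a limit of rationals from a compact subinterval of
  it, and both paths are continuous there.\<close>

lemma responses_agree:
 assumes r: "AEP M t0 T (%p. (ALL q:\<rat>. q : {t0<..<fst p} --> Th (fst p) q (snd p) = Th2 (fst p) q (snd p)))"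
 and c: "AEP M t0 T (%p. continuous_on {t0<..<fst p} (%s. Th (fst p) s (snd p)))"
 "AEP M t0 T (%p. continuous_on {t0<..<fst p} (%s. Th2 (fst p) s (snd p)))"
 shows "AEP M t0 T (%p. (ALL s:{t0<..<fst p}. Th (fst p) s (snd p) = (Th2 (fst p) s (snd p) :: real ^ 'd)))"
 using r c
proof (eventually_elim, intro impI ballI)
 fix p s assume h: "fst p : {t0<..<T} --> (ALL q:\<rat>. q : {t0<..<fst p} --> Th (fst p) q (snd p) = Th2 (fst p) q (snd p))"
 "fst p : {t0<..<T} --> continuous_on {t0<..<fst p} (%s. Th (fst p) s (snd p))"
 "fst p : {t0<..<T} --> continuous_on {t0<..<fst p} (%s. Th2 (fst p) s (snd p))" "fst p : {t0<..<T}" "s : {t0<..<fst p}"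
 have s: "(t0 + s) / 2 < (s + fst p) / 2" "s : {(t0 + s) / 2..(s + fst p) / 2}" and sub: "{(t0 + s) / 2..(s + fst p) / 2} \<subseteq> {t0<..<fst p}" using h(5) by auto
 obtain q where q: "\<And>n. q n : {(t0 + s) / 2..(s + fst p) / 2} \<inter> \<rat>" "q ~~> s" using rational_sequence_to[OF s] by blast
 have qi: "q n : {t0<..<fst p}" "q n : \<rat>" for n using q(1)[of n] sub by auto
 have a: "(%n. Th (fst p) (q n) (snd p)) ~~> Th (fst p) s (snd p)"
 using continuous_on_tendsto_compose[OF mp[OF h(2) h(4)] q(2) h(5)] qi(1) by simp
 have b: "(%n. Th2 (fst p) (q n) (snd p)) ~~> Th2 (fst p) s (snd p)"
 using continuous_on_tendsto_compose[OF mp[OF h(3) h(4)] q(2) h(5)] qi(1) by simp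
 have e: "Th (fst p) (q n) (snd p) = Th2 (fst p) (q n) (snd p)" for n using h(1,4) qi by blast
 show "Th (fst p) s (snd p) = Th2 (fst p) s (snd p)" by (rule LIMSEQ_unique[OF a[unfolded e] b])
qed

lemma solution_continuous:
 assumes S: "causal_feedback_solution M W0 T A0 B0 C0 D0 b0 sg0 XX0 Ga0 v0 t0 x0 X0 Th0 u0"
 and e: "ALL s t z. (s, t) : triangle2 t0 T --> Th0 s t z = Th s t z"
 shows "AEP M t0 T (%p. continuous_on {t0<..<fst p} (%s. Th (fst p) s (snd p)))"
proof -
 have "AEP M t0 T (%p. uniformly_continuous_on {t0<..<fst p} (%s. Th0 (fst p) s (snd p)))"
 using S by (auto simp: causal_feedback_solution_def space_L2_Fc_tri_def case_prod_beta')
 then show ?thesis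
 proof (eventually_elim, intro impI)
 fix p :: "real \<times> 'a" assume h: "fst p : {t0<..<T} --> uniformly_continuous_on {t0<..<fst p} (%s. Th0 (fst p) s (snd p))" "fst p : {t0<..<T}"
 then have "continuous_on {t0<..<fst p} (%s. Th0 (fst p) s (snd p))" by (intro uniformly_continuous_imp_continuous) blast
 moreover have "Th0 (fst p) s (snd p) = Th (fst p) s (snd p)" if "s : {t0<..<fst p}" for s using e h(2) that by (auto simp: triangle2_def)
 ultimately show "continuous_on {t0<..<fst p} (%s. Th (fst p) s (snd p))" by (rule continuous_on_eq)
 qed
qed

lemma feedback_solution_unique:
 assumes S: "causal_feedback_solution M W0 T A0 B0 C0 D0 b0 sg0 XX0 Ga0 v0 t0 x0 X1 Th1 u1"
 and S2: "causal_feedback_solution M W0 T A0 B0 C0 D0 b0 sg0 XX0 Ga0 v0 t0 x0 X2 Th2 u2"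
 shows "same_triplet M t0 T X1 Th1 u1 X2 Th2 u2"
proof -
 obtain X Th u where p: "process X" "process u" "response Th" "step x b sg v X u X Th u"
 and e: "ALL r:{t0<..<T}. X1 r = X r & u1 r = u r" "ALL s t z. (s, t) : triangle2 t0 T --> Th1 s t z = Th s t z"
 using internal_solution[OF S] by blast
 obtain X' Th' u' where p': "process X'" "process u'" "response Th'" "step x b sg v X' u' X' Th' u'"
 and e': "ALL r:{t0<..<T}. X2 r = X' r & u2 r = u' r" "ALL s t z. (s, t) : triangle2 t0 T --> Th2 s t z = Th' s t z"
 using internal_solution[OF S2] by blast
 note a = problem_data p(1) p'(1) p(2) p'(2) p(3) p'(3) p(4) p'(4)
 have "AEP M t0 T (%p. X1 (fst p) (snd p) = X2 (fst p) (snd p) & u1 (fst p) (snd p) = u2 (fst p) (snd p) &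
 (ALL s:{t0<..<fst p}. Th1 (fst p) s (snd p) = Th2 (fst p) s (snd p)))"
 using solution_unique[OF a] responses_agree[OF response_unique[OF a] solution_continuous[OF S e(2)] solution_continuous[OF S2 e'(2)]]
 proof (eventually_elim, intro impI)
 fix p :: "real \<times> 'a"
 assume h: "fst p : {t0<..<T} --> X (fst p) (snd p) = X' (fst p) (snd p) & u (fst p) (snd p) = u' (fst p) (snd p)"
 "fst p : {t0<..<T} --> (ALL s:{t0<..<fst p}. Th (fst p) s (snd p) = Th' (fst p) s (snd p))" "fst p : {t0<..<T}"
 have "Th1 (fst p) s (snd p) = Th2 (fst p) s (snd p)" if s: "s : {t0<..<fst p}" for s
 proof -
 have "(fst p, s) : triangle2 t0 T" using s h(3) by (simp add: triangle2_def)
 then show ?thesis using e(2) e'(2) h(2,3) s by simp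
 qed
 then show "X1 (fst p) (snd p) = X2 (fst p) (snd p) & u1 (fst p) (snd p) = u2 (fst p) (snd p) & (ALL s:{t0<..<fst p}. Th1 (fst p) s (snd p) = Th2 (fst p) s (snd p))"
 using h(1,3) e(1) e'(1) by simp
 qed
 then show ?thesis unfolding same_triplet_def by (simp add: case_prod_beta')
qed

text \<open>A given solution comes with no majorant for its Theta. The constructed solution has one,
  and by uniqueness the two responses agree, so the supremum norm is estimated through
  \<open>R\<close>. The constant \<open>c\<close> comes from \<open>solution_estimate\<close> after
  dividing by \<open>dl\<close>; it bounds X and u, and the second square root belongs to
  Theta.\<close>

lemma feedback_solution_estimate:
 assumes S: "causal_feedback_solution M W0 T A0 B0 C0 D0 b0 sg0 XX0 Ga0 v0 t0 x0 X0 Th0 u0"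
 and w: "volterra_weight T step_kernel (1/16) w" and dl: "0 < dl" "\<And>t. dl <= w t"
 defines "c \<equiv> 2 * step_const * (1 + m0) / dl"
 shows "norm_L2_F M t0 T X0 + norm_L2_Fc_tri M t0 T Th0 + norm_L2_F M t0 T u0 <=
 ennreal (2 * sqrt c + sqrt (300 * (1 + m0) * (1 + c))) * (norm_L2 t0 T x0 + norm_L21_F_tri M t0 T b0 + norm_L2_F_tri M t0 T sg0 + norm_L2_F M t0 T v0)"
proof -
 obtain X Th u where p: "process X" "process u" "response Th" "step x b sg v X u X Th u"
 and e: "ALL r:{t0<..<T}. X0 r = X r & u0 r = u r" "ALL s t y. (s, t) : triangle2 t0 T --> Th0 s t y = Th s t y"
 using internal_solution[OF S] by blast
 obtain X' Th' u' R where p': "process X'" "process u'" "response Th'" "step x b sg v X' u' X' Th' u'"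
 and c': "ALL s. ALL y:space M. continuous_on UNIV (%t. Th' s t y)" and R: "joint M R"
 and bR: "AEI t0 T (%s. (AE y in M. ALL t:{t0..T}. nsq (Th' s t y) <= R s y))"
 and Rb: "(NI {t0<..<T} (%s. (NN M (R s)))) <= 300 * (1 + ennreal m0) *
 ((NI {t0<..<T} (%s. (nsq (x s) + field_L21 b s + field_L2 sg s))) + (NI {t0<..<T} (pair_norm X' u')))"
 using solution_exists[OF problem_data] by blast
 have d: "x : BM borel" "field b" "field sg" "process v"
 using problem_data by (auto simp: data_def)
 note fm = d(2)[unfolded field_def, THEN conjunct1] d(3)[unfolded field_def, THEN conjunct1]
 note [measurable] = d(1) field_norm_measurable(1)[OF fm(1)] field_norm_measurable(2)[OF fm(2)]
 define dx where "dx = (NI {t0<..<T} (%s. nsq (x s)))"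
 define db where "db = (NI {t0<..<T} (field_L21 b))"
 define ds where "ds = (NI {t0<..<T} (%s. field_L2 sg s))"
 define dv where "dv = (NI {t0<..<T} (%t. (nn2 M (v t))))"
 define E where "E = dx + db + ds + dv"
 have c0: "0 <= c" using step_const_pos m0 dl(1) by (auto simp: c_def)
 have dd: "(NI {t0<..<T} (%s. (nsq (x s) + field_L21 b s + field_L2 sg s))) = dx + db + ds"
 by (simp add: dx_def db_def ds_def distrib_right nn_add)
 \<comment> \<open>Stated for an arbitrary solution, because it is used both for the given one and
   for the one that carries the majorant.\<close>
 have est: "(NI {t0<..<T} (pair_norm Z z)) <= ennreal c * E" if Z: "process Z" "process z" "response Y" "step x b sg v Z z Z Y z" for Z Y z
 proof -
 let ?N = "NI {t0<..<T} (pair_norm Z z)"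
 have "ennreal dl * ?N <= 2 * (ennreal step_const * ((1 + ennreal m0) * (dx + db + ds) + dv))"
 using solution_estimate[OF problem_data Z w dl] unfolding dd dv_def .
 also have "... <= 2 * (ennreal step_const * ((1 + ennreal m0) * E))"
 proof (intro ml_mono)
 have "1 * dv <= (1 + ennreal m0) * dv" by (intro mr_mono) auto
 then show "(1 + ennreal m0) * (dx + db + ds) + dv <= (1 + ennreal m0) * E" by (simp add: E_def distrib_left[of "1 + ennreal m0" "dx + db + ds" dv] add_left_mono)
 qed auto
 also have "... = ennreal (dl * c) * E"
 proof -
 have "ennreal (dl * c) = ennreal (2 * (step_const * (1 + m0)))" using dl(1) by (simp add: c_def mult.assoc)
 also have "... = ennreal 2 * (ennreal step_const * (ennreal 1 + ennreal m0))"
 using m0 step_const_pos by (subst ennreal_mult, simp, simp, subst ennreal_mult, simp, simp, subst ennreal_plus) auto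
 finally show ?thesis by (simp add: mult.assoc)
 qed
 finally have "ennreal (1/dl) * (ennreal dl * ?N) <= ennreal (1/dl) * (ennreal (dl * c) * E)" by (rule ml_mono) simp
 then show ?thesis using dl(1) c0 by (simp add: mult.assoc[symmetric] ennreal_mult[symmetric])
 qed
 have comp: "ennsqrt (NI {t0<..<T} (%r. (nn2 M (Z r)))) <= ennreal (sqrt c) * ennsqrt E"
 if "\<And>r. (nn2 M (Z r)) <= pair_norm X u r" for Z :: "real => 'a => 'e::euclidean_space"
 proof -
 have "(NI {t0<..<T} (%r. (nn2 M (Z r)))) <= ennreal c * E"
 by (rule order_trans[OF _ est[OF p]]) (intro nn_mono mr_mono that, simp)
 from order_trans[OF ennsqrt_mono[OF this] ennsqrt_cmult[OF c0]] show ?thesis .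
 qed
 have nX: "norm_L2_F M t0 T X0 <= ennreal (sqrt c) * ennsqrt E"
 by (subst process_norm_eq[OF _ processD(1)[OF p(1)]], use e in force, rule comp) (auto simp: pair_norm_def intro!: nn_mono)
 have nu: "norm_L2_F M t0 T u0 <= ennreal (sqrt c) * ennsqrt E"
 by (subst process_norm_eq[OF _ processD(1)[OF p(2)]], use e in force, rule comp) (auto simp: pair_norm_def intro!: nn_mono)
 have c2: "AEP M t0 T (%p. continuous_on {t0<..<fst p} (%s. Th' (fst p) s (snd p)))"
 proof (rule AE_I2, rule impI)
 fix p :: "real \<times> 'a" assume "p : space (tprod M)"
 then have "snd p : space M" by (auto simp: sp_pair)
 then show "continuous_on {t0<..<fst p} (%s. Th' (fst p) s (snd p))" using c' by (meson continuous_on_subset subset_UNIV)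
 qed
 have "AEP M t0 T (%p. (ALL s:{t0<..<fst p}. Th (fst p) s (snd p) = Th' (fst p) s (snd p)))"
 by (rule responses_agree[OF response_unique[OF problem_data p(1) p'(1) p(2) p'(2) p(3) p'(3) p(4) p'(4)] solution_continuous[OF S e(2)] c2])
 then have "AEP M t0 T (%p. (ALL s:{t0<..<fst p}. Th0 (fst p) s (snd p) = Th' (fst p) s (snd p)))"
 by eventually_elim (use e(2) in \<open>auto simp: triangle2_def\<close>)
 from norm_L2_Fc_le[OF R c' response_bound_joint[OF p'(3) c' R bR] this]
 have "norm_L2_Fc_tri M t0 T Th0 <= ennsqrt (NI {t0<..<T} (%s. (NN M (R s))))" .
 also have "... <= ennsqrt (ennreal (300 * (1 + m0) * (1 + c)) * E)"
 proof (rule ennsqrt_mono)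
 have "(NI {t0<..<T} (%s. (NN M (R s)))) <= 300 * (1 + ennreal m0) * (E + ennreal c * E)"
 by (rule order_trans[OF Rb]) (intro ml_mono add_mono est[OF p'], auto simp: dd E_def)
 also have "... = ennreal (300 * (1 + m0) * (1 + c)) * E"
 proof -
 have "ennreal (300 * (1 + m0) * (1 + c)) = ennreal 300 * (ennreal 1 + ennreal m0) * (ennreal 1 + ennreal c)"
 using m0 c0 by (subst ennreal_mult, simp, simp, subst ennreal_mult, simp, simp, subst ennreal_plus, simp, simp, subst ennreal_plus) auto
 then show ?thesis by (simp only: mult.assoc distrib_right[of 1 "ennreal c"] mult_1 ennreal_1 ennreal_numeral)
 qed
 finally show "(NI {t0<..<T} (%s. (NN M (R s)))) <= ennreal (300 * (1 + m0) * (1 + c)) * E" .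
 qed
 also have "... <= ennreal (sqrt (300 * (1 + m0) * (1 + c))) * ennsqrt E" using m0 c0 by (intro ennsqrt_cmult) auto
 finally have nT: "norm_L2_Fc_tri M t0 T Th0 <= ennreal (sqrt (300 * (1 + m0) * (1 + c))) * ennsqrt E" .
 have nv: "norm_L2_F M t0 T v0 = ennsqrt dv"
 unfolding dv_def by (rule process_norm_eq[OF _ processD(1)[OF d(4)]]) (use t0 in \<open>auto simp: v_def\<close>)
 have ns: "norm_L2_F_tri M t0 T sg0 = ennsqrt ds"
 unfolding norm_L2_F_tri_def ds_def by (rule arg_cong[of _ _ ennsqrt], rule field_L2_eq[OF fm(2)]) (use t0 in \<open>auto simp: sg_def triangle2_def\<close>)
 have "ennsqrt E <= ennsqrt dx + ennsqrt db + ennsqrt ds + ennsqrt dv"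
 unfolding E_def by (intro order_trans[OF ennsqrt_add_le] add_mono order_refl)
 also have "... = norm_L2 t0 T x0 + norm_L21_F_tri M t0 T b0 + norm_L2_F_tri M t0 T sg0 + norm_L2_F M t0 T v0"
 unfolding nv ns norm_L2_x norm_L21_F_tri_def field_L21_eq dx_def db_def ..
 finally have nE: "ennsqrt E <= norm_L2 t0 T x0 + norm_L21_F_tri M t0 T b0 + norm_L2_F_tri M t0 T sg0 + norm_L2_F M t0 T v0" .
 have "norm_L2_F M t0 T X0 + norm_L2_Fc_tri M t0 T Th0 + norm_L2_F M t0 T u0 <=
 ennreal (sqrt c) * ennsqrt E + ennreal (sqrt (300 * (1 + m0) * (1 + c))) * ennsqrt E + ennreal (sqrt c) * ennsqrt E"
 by (intro add_mono nX nT nu)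
 also have "... = ennreal (2 * sqrt c + sqrt (300 * (1 + m0) * (1 + c))) * ennsqrt E"
 proof -
 have "2 * sqrt c + sqrt (300 * (1 + m0) * (1 + c)) = sqrt c + sqrt (300 * (1 + m0) * (1 + c)) + sqrt c" by simp
 then have "ennreal (2 * sqrt c + sqrt (300 * (1 + m0) * (1 + c))) = ennreal (sqrt c) + ennreal (sqrt (300 * (1 + m0) * (1 + c))) + ennreal (sqrt c)"
 using m0 c0 by (simp only: ennreal_plus add_nonneg_nonneg real_sqrt_ge_zero mult_nonneg_nonneg zero_le_numeral zero_le_one)
 then show ?thesis by (simp only: distrib_right)
 qed
 also have "... <= ennreal (2 * sqrt c + sqrt (300 * (1 + m0) * (1 + c))) * (norm_L2 t0 T x0 + norm_L21_F_tri M t0 T b0 + norm_L2_F_tri M t0 T sg0 + norm_L2_F M t0 T v0)"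
 by (intro ml_mono nE) simp
 finally show ?thesis .
qed

end

section \<open>Assembling the problem from the given coefficients\<close>

lemma kernel_integral_add:
 fixes f :: "real => real => 'b::euclidean_space" and g :: "real => real => 'c::euclidean_space"
 assumes f: "joint lborel f" and g: "joint lborel g"
 shows "(NI {0<..<T} (%t. (NI {0<..<t} (%r. ennreal ((norm (f t r))^2 + (norm (g t r))^2))))) =
 (NI {0<..<T} (%t. (NI {0<..<t} (%r. nsq (f t r))))) + (NI {0<..<T} (%t. (NI {0<..<t} (%r. nsq (g t r)))))"
proof -
 note [measurable] = f g
 have m: "(%t. NI {0<..<t} (%r. nsq (h t r))) : BM borel"
 if [measurable]: "joint lborel h" for h :: "real => real => 'e::euclidean_space"
 proof -
 have "(%p. nsq (h (fst p) (snd p)) * indicator {p. 0 < snd p & snd p < fst p} p) : BM (tprod lborel)"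
 by measurable
 from lb_nn_fst[OF this] show ?thesis
 by (simp add: ind_def greaterThanLessThan_def greaterThan_def lessThan_def)
 qed
 note [measurable] = m[OF f] m[OF g]
 have "(NI {0<..<t} (%r. ennreal ((norm (f t r))^2 + (norm (g t r))^2))) = (NI {0<..<t} (%r. nsq (f t r))) + (NI {0<..<t} (%r. nsq (g t r)))" for t
 proof -
 have [measurable]: "f t : BM borel" "g t : BM borel"
 using mcomp[OF measurable_Pair1'[of t lborel lborel] f] mcomp[OF measurable_Pair1'[of t lborel lborel] g] by simp_all
 show ?thesis by (simp add: distrib_right nn_add)
 qed
 then show ?thesis by (simp add: distrib_right nn_add)
qed

text \<open>A Borel version is set to 0 wherever it exceeds the essential supremum, so that the
  bound holds at every time.\<close>

lemma Linf_version:
 fixes f :: "real => 'b::euclidean_space"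
 assumes f: "f : space_Linf a b"
 shows "EX f' c. f' : BM borel & (ALL t. norm (f' t) <= c) & (AEI a b (%t. f t = f' t))"
proof -
 have fm: "f : BM (lebesgue_on {a<..<b})" and "esssup (lebesgue_on {a<..<b}) (%t. ennreal (norm (f t))) < top"
 using f by (auto simp: space_Linf_def)
 then obtain c where c: "esssup (lebesgue_on {a<..<b}) (%t. ennreal (norm (f t))) = ennreal c" "0 <= c"
 by (cases "esssup (lebesgue_on {a<..<b}) (%t. ennreal (norm (f t)))") auto
 have "AE t in lebesgue_on {a<..<b}. ennreal (norm (f t)) <= ennreal c" unfolding c(1)[symmetric] by (rule esssup_AE)
 then have b: "AEI a b (%t. ennreal (norm (f t)) <= ennreal c)"
 by (subst (asm) AE_restrict_space_iff) (auto simp: AE_completion_iff)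
 obtain g where g[measurable]: "g : BM borel" and e: "AEI a b (%t. f t = g t)"
 using lebesgue_on_version[OF fm] by auto
 define f' where "f' t = (if norm (g t) <= c then g t else 0)" for t
 have "f' : BM borel" unfolding f'_def by measurable
 moreover have "AEI a b (%t. f t = f' t)"
 using b e by eventually_elim (use c(2) in \<open>auto simp: f'_def\<close>)
 ultimately show ?thesis using c(2) by (intro exI[of _ f'] exI[of _ c]) (auto simp: f'_def)
qed

text \<open>All properties are read off Borel versions of the coefficients; the sum of the four
  separate bounds serves as the common \<open>m0\<close>.\<close>

lemma problem_kernels:
 fixes A :: "real => real => real ^ 'd::finite ^ 'd" and B :: "real => real => real ^ 'l::finite ^ 'd"
 and C :: "real => real => real ^ 'd ^ 'd" and D :: "real => real => real ^ 'l ^ 'd"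
 and XX :: "real => real ^ 'd ^ 'l" and Ga :: "real => real => real ^ 'd ^ 'l"
 assumes T: "0 < T" and A: "A : space_L2_tri 0 T" and B: "B : space_L2_tri 0 T" and C: "C : space_scrL2 0 T" and D: "D : space_scrL2 0 T"
 and XX: "XX : space_Linf 0 T" and Ga: "Ga : space_L2_tri 0 T"
 shows "EX A' B' C' D' XX' Ga' xx m0. svie_kernels T A' B' C' D' XX' Ga' xx m0 &
 (AE t in lborel. AE r in lborel. 0 < r & r < t & t < T --> A t r = A' t r & B t r = B' t r & C t r = C' t r & D t r = D' t r) &
 (AEI 0 T (%t. XX t = XX' t & (AEI t T (%s. Ga s t = Ga' s t))))"
proof -
 obtain A' where A': "joint lborel A'" "AE t in lborel. AE r in lborel. 0 < r & r < t & t < T --> A t r = A' t r"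
 "(NI {0<..<T} (%t. (NI {0<..<t} (%r. nsq (A' t r))))) < \<infinity>" using kernel_version[OF A] by blast
 obtain B' where B': "joint lborel B'" "AE t in lborel. AE r in lborel. 0 < r & r < t & t < T --> B t r = B' t r"
 "(NI {0<..<T} (%t. (NI {0<..<t} (%r. nsq (B' t r))))) < \<infinity>" using kernel_version[OF B] by blast
 have CD: "C : space_L2_tri 0 T" "D : space_L2_tri 0 T" using C D by (auto simp: space_scrL2_def)
 obtain C' where C': "joint lborel C'" "AE t in lborel. AE r in lborel. 0 < r & r < t & t < T --> C t r = C' t r"
 "AE r in lborel. AE t in lborel. 0 < r & r < t & t < T --> C t r = C' t r" using kernel_version[OF CD(1)] by blast
 obtain D' where D': "joint lborel D'" "AE t in lborel. AE r in lborel. 0 < r & r < t & t < T --> D t r = D' t r"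
 "AE r in lborel. AE t in lborel. 0 < r & r < t & t < T --> D t r = D' t r" using kernel_version[OF CD(2)] by blast
 obtain Ga' where Ga': "joint lborel Ga'" "AE r in lborel. AE t in lborel. 0 < r & r < t & t < T --> Ga t r = Ga' t r"
 "(NI {0<..<T} (%r. (NI {r<..<T} (%t. nsq (Ga' t r))))) < \<infinity>" using kernel_version[OF Ga] by blast
 obtain XX' xx where XX': "XX' : BM borel" "\<And>t. norm (XX' t) <= xx" "AEI 0 T (%t. XX t = XX' t)"
 using Linf_version[OF XX] by blast
 obtain c where c: "0 <= c" "AEI 0 T (%r. (NI {r<..<T} (%t. nsq (C' t r))) <= ennreal c)" "volterra_small T (%t r. nsq (C' t r))"
 using scrL2_kernel[OF C T C'(1,3)] by blast
 obtain d where d: "0 <= d" "AEI 0 T (%r. (NI {r<..<T} (%t. nsq (D' t r))) <= ennreal d)" "volterra_small T (%t r. nsq (D' t r))"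
 using scrL2_kernel[OF D T D'(1,3)] by blast
 obtain a where a: "(NI {0<..<T} (%t. (NI {0<..<t} (%r. ennreal ((norm (A' t r))^2 + (norm (B' t r))^2))))) = ennreal a" "0 <= a"
 proof -
 have "(NI {0<..<T} (%t. (NI {0<..<t} (%r. ennreal ((norm (A' t r))^2 + (norm (B' t r))^2))))) < \<infinity>"
 unfolding kernel_integral_add[OF A'(1) B'(1)] using A'(3) B'(3) by simp
 then show ?thesis using that by (cases "(NI {0<..<T} (%t. (NI {0<..<t} (%r. ennreal ((norm (A' t r))^2 + (norm (B' t r))^2)))))") auto
 qed
 obtain g where g: "(NI {0<..<T} (%r. (NI {r<..<T} (%t. nsq (Ga' t r))))) = ennreal g" "0 <= g"
 using Ga'(3) by (cases "(NI {0<..<T} (%r. (NI {r<..<T} (%t. nsq (Ga' t r)))))") auto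
 have "svie_kernels T A' B' C' D' XX' Ga' xx (a + c + d + g)"
 proof (rule svie_kernels.intro)
 show "AEI 0 T (%r. (NI {r<..<T} (%t. ennreal ((norm (C' t r))^2 + (norm (D' t r))^2))) <= ennreal (a + c + d + g))"
 using c(2) d(2)
 proof (eventually_elim, intro impI)
 fix r assume h: "r : {0<..<T} --> (NI {r<..<T} (%t. nsq (C' t r))) <= ennreal c"
 "r : {0<..<T} --> (NI {r<..<T} (%t. nsq (D' t r))) <= ennreal d" "r : {0<..<T}"
 have [measurable]: "(%t. C' t r) : BM borel" "(%t. D' t r) : BM borel"
 using mcomp[OF measurable_Pair2'[of r lborel lborel] C'(1)] mcomp[OF measurable_Pair2'[of r lborel lborel] D'(1)] by simp_all
 have "(NI {r<..<T} (%t. ennreal ((norm (C' t r))^2 + (norm (D' t r))^2))) = (NI {r<..<T} (%t. nsq (C' t r))) + (NI {r<..<T} (%t. nsq (D' t r)))"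
 by (simp add: distrib_right nn_add)
 also have "... <= ennreal c + ennreal d" using h by (intro add_mono) auto
 also have "... = ennreal (c + d)" using c(1) d(1) by simp
 also have "... <= ennreal (a + c + d + g)" using a(2) g(2) by (intro ennreal_leI) simp
 finally show "(NI {r<..<T} (%t. ennreal ((norm (C' t r))^2 + (norm (D' t r))^2))) <= ennreal (a + c + d + g)" .
 qed
 show "volterra_small T (%t r. ennreal ((norm (C' t r))^2 + (norm (D' t r))^2))"
 using volterra_small_add[OF c(3) d(3)] by simp
 qed (use T A'(1) B'(1) C'(1) D'(1) Ga'(1) XX' a c(1) d(1) g in \<open>auto intro: ennreal_leI\<close>)
 moreover have "AE t in lborel. AE r in lborel. 0 < r & r < t & t < T --> A t r = A' t r & B t r = B' t r & C t r = C' t r & D t r = D' t r"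
 using A'(2) B'(2) C'(2) D'(2)
 proof eventually_elim
 case (elim t)
 show ?case using elim by eventually_elim blast
 qed
 moreover have "AEI 0 T (%t. XX t = XX' t & (AEI t T (%s. Ga s t = Ga' s t)))"
 using XX'(3) Ga'(2)
 proof (eventually_elim, intro impI conjI)
 fix t assume h: "t : {0<..<T} --> XX t = XX' t" "AE s in lborel. 0 < t & t < s & s < T --> Ga s t = Ga' s t" "t : {0<..<T}"
 show "XX t = XX' t" using h(1,3) by blast
 show "AEI t T (%s. Ga s t = Ga' s t)" using h(2) by eventually_elim (use h(3) in auto)
 qed
 ultimately show ?thesis by blast
qed

theorem theorem2p4:
  fixes T :: real
    and A :: "real \<Rightarrow> real \<Rightarrow> real ^ 'd::finite ^ 'd"
    and B :: "real \<Rightarrow> real \<Rightarrow> real ^ 'l::finite ^ 'd"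
    and C :: "real \<Rightarrow> real \<Rightarrow> real ^ 'd ^ 'd"
    and D :: "real \<Rightarrow> real \<Rightarrow> real ^ 'l ^ 'd"
    and \<Xi> :: "real \<Rightarrow> real ^ 'd ^ 'l"
    and \<Gamma> :: "real \<Rightarrow> real \<Rightarrow> real ^ 'd ^ 'l"
  assumes "0 < T"
    and "A \<in> space_L2_tri 0 T" and "B \<in> space_L2_tri 0 T"
    and "C \<in> space_scrL2 0 T" and "D \<in> space_scrL2 0 T"
  shows
    "(\<forall>(M :: 'a measure) W b \<sigma> v t0 x.
        brownian_setting M W \<and>
        b \<in> space_L21_F_tri M (augmented_filtration M W) 0 T \<and>
        \<sigma> \<in> space_L2_F_tri M (augmented_filtration M W) 0 T \<and>
        (\<Xi>, \<Gamma>, v) \<in> feedback_strategies M W T \<and> (t0, x) \<in> input_conditions T \<longrightarrow>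
        (\<exists>X \<Theta> u. causal_feedback_solution M W T A B C D b \<sigma> \<Xi> \<Gamma> v t0 x X \<Theta> u) \<and>
        (\<forall>X \<Theta> u X' \<Theta>' u'.
           causal_feedback_solution M W T A B C D b \<sigma> \<Xi> \<Gamma> v t0 x X \<Theta> u \<and>
           causal_feedback_solution M W T A B C D b \<sigma> \<Xi> \<Gamma> v t0 x X' \<Theta>' u' \<longrightarrow>
           same_triplet M t0 T X \<Theta> u X' \<Theta>' u')) \<and>
     (\<exists>K::real. K > 0 \<and> (\<forall>(M :: 'a measure) W b \<sigma> v t0 x X \<Theta> u.
        brownian_setting M W \<and>
        b \<in> space_L21_F_tri M (augmented_filtration M W) 0 T \<and>
        \<sigma> \<in> space_L2_F_tri M (augmented_filtration M W) 0 T \<and>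
        (\<Xi>, \<Gamma>, v) \<in> feedback_strategies M W T \<and> (t0, x) \<in> input_conditions T \<and>
        causal_feedback_solution M W T A B C D b \<sigma> \<Xi> \<Gamma> v t0 x X \<Theta> u \<longrightarrow>
        norm_L2_F M t0 T X + norm_L2_Fc_tri M t0 T \<Theta> + norm_L2_F M t0 T u
          \<le> ennreal K * (norm_L2 t0 T x + norm_L21_F_tri M t0 T b
                          + norm_L2_F_tri M t0 T \<sigma> + norm_L2_F M t0 T v)))"
proof (cases "\<Xi> \<in> space_Linf 0 T \<and> \<Gamma> \<in> space_L2_tri 0 T")
  case False
  \<comment> \<open>If \<open>\<Xi>\<close> or \<open>\<Gamma>\<close> is not admissible there is no
    strategy to consider, and any positive constant will do.\<close>
  then show ?thesis by (auto simp: feedback_strategies_def intro!: exI[of _ 1])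
next
  case True
  obtain A' B' C' D' \<Xi>' \<Gamma>' \<xi> m0 where K: "svie_kernels T A' B' C' D' \<Xi>' \<Gamma>' \<xi> m0"
    and AD: "AE t in lborel. AE r in lborel. 0 < r \<and> r < t \<and> t < T \<longrightarrow> A t r = A' t r \<and> B t r = B' t r \<and> C t r = C' t r \<and> D t r = D' t r"
    and GX: "AE t in lborel. t \<in> {0<..<T} \<longrightarrow> \<Xi> t = \<Xi>' t \<and> (AE s in lborel. s \<in> {t<..<T} \<longrightarrow> \<Gamma> s t = \<Gamma>' s t)"
    using problem_kernels[OF assms True[THEN conjunct1] True[THEN conjunct2]] by blast
  interpret K: svie_kernels T A' B' C' D' \<Xi>' \<Gamma>' \<xi> m0 by (rule K)
  have "(0::real) < 1/16" by simp
  \<comment> \<open>The weight is chosen here, from the kernels on the whole interval and before any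
    probability space, initial time or data are fixed, so that the same \<open>k\<close> serves all
    of them.\<close>
  then obtain w where w: "volterra_weight T K.step_kernel (1/16) w" using K.step_kernel_small unfolding volterra_small_def by blast
  obtain \<delta> where \<delta>: "0 < \<delta>" "\<And>t. \<delta> \<le> w t" using w by (auto simp: volterra_weight_def)
  define c where "c = 2 * K.step_const * (1 + m0) / \<delta>"
  define k where "k = 2 * sqrt c + sqrt (300 * (1 + m0) * (1 + c))"
  have "0 \<le> c" using K.step_const_pos K.m0 \<delta>(1) by (auto simp: c_def)
  then have k: "0 < k" using K.m0 by (auto simp: k_def intro!: add_nonneg_pos mult_pos_pos)
  have problem: "\<exists>W' x'. svie_problem M (augmented_filtration M W) W' T A' B' C' D' \<Xi>' \<Gamma>' \<xi> m0 t0 W A B C D \<Xi> \<Gamma> b \<sigma> v x x'"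
    if H: "brownian_setting M W \<and> b \<in> space_L21_F_tri M (augmented_filtration M W) 0 T \<and> \<sigma> \<in> space_L2_F_tri M (augmented_filtration M W) 0 T \<and>
      (\<Xi>, \<Gamma>, v) \<in> feedback_strategies M W T \<and> (t0, x) \<in> input_conditions T" for M :: "'a measure" and W b \<sigma> v t0 x
  proof -
    have "brownian_basis M (augmented_filtration M W) W" using H by (intro brownian_basis_augmented) blast
    from brownian_basis.continuous_version[OF this] obtain W'
      where W': "continuous_brownian_basis M (augmented_filtration M W) W'" "AE \<omega> in M. \<forall>t\<ge>0. W' t \<omega> = W t \<omega>" by blast
    have x: "x \<in> borel_measurable (lebesgue_on {t0<..<T})" "norm_L2 t0 T x < \<infinity>" and t0: "0 \<le> t0" "t0 < T"
      using H by (auto simp: input_conditions_def space_L2_def)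
    obtain x' where x': "x' \<in> borel_measurable borel" "AE t in lborel. t \<in> {t0<..<T} \<longrightarrow> x t = x' t"
      using lebesgue_on_version[OF x(1)] by auto
    have "svie M (augmented_filtration M W) W' T A' B' C' D' \<Xi>' \<Gamma>' \<xi> m0 t0"
      using W'(1) K t0 by (intro svie.intro svie_axioms.intro)
    moreover have "AE \<omega> in M. \<forall>t\<ge>0. W t \<omega> = W' t \<omega>" using W'(2) by eventually_elim simp
    ultimately have "svie_problem M (augmented_filtration M W) W' T A' B' C' D' \<Xi>' \<Gamma>' \<xi> m0 t0 W A B C D \<Xi> \<Gamma> b \<sigma> v x x'"
      using H AD GX x' x(2) by (intro svie_problem.intro svie_problem_axioms.intro) (auto simp: feedback_strategies_def controls_def)
    then show ?thesis by blast
  qed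
  have EU: "(\<exists>X \<Theta> u. causal_feedback_solution M W T A B C D b \<sigma> \<Xi> \<Gamma> v t0 x X \<Theta> u) \<and>
        (\<forall>X \<Theta> u X' \<Theta>' u'.
           causal_feedback_solution M W T A B C D b \<sigma> \<Xi> \<Gamma> v t0 x X \<Theta> u \<and>
           causal_feedback_solution M W T A B C D b \<sigma> \<Xi> \<Gamma> v t0 x X' \<Theta>' u' \<longrightarrow>
           same_triplet M t0 T X \<Theta> u X' \<Theta>' u')"
    if H: "brownian_setting M W \<and> b \<in> space_L21_F_tri M (augmented_filtration M W) 0 T \<and> \<sigma> \<in> space_L2_F_tri M (augmented_filtration M W) 0 T \<and>
      (\<Xi>, \<Gamma>, v) \<in> feedback_strategies M W T \<and> (t0, x) \<in> input_conditions T" for M :: "'a measure" and W b \<sigma> v t0 x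
  proof -
    obtain W' x' where "svie_problem M (augmented_filtration M W) W' T A' B' C' D' \<Xi>' \<Gamma>' \<xi> m0 t0 W A B C D \<Xi> \<Gamma> b \<sigma> v x x'"
      using problem[OF H] by blast
    from svie_problem.feedback_solution_exists[OF this] svie_problem.feedback_solution_unique[OF this] show ?thesis by blast
  qed
  have ES: "norm_L2_F M t0 T X + norm_L2_Fc_tri M t0 T \<Theta> + norm_L2_F M t0 T u
          \<le> ennreal k * (norm_L2 t0 T x + norm_L21_F_tri M t0 T b + norm_L2_F_tri M t0 T \<sigma> + norm_L2_F M t0 T v)"
    if H: "brownian_setting M W \<and> b \<in> space_L21_F_tri M (augmented_filtration M W) 0 T \<and> \<sigma> \<in> space_L2_F_tri M (augmented_filtration M W) 0 T \<and>
      (\<Xi>, \<Gamma>, v) \<in> feedback_strategies M W T \<and> (t0, x) \<in> input_conditions T \<and>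
      causal_feedback_solution M W T A B C D b \<sigma> \<Xi> \<Gamma> v t0 x X \<Theta> u" for M :: "'a measure" and W b \<sigma> v t0 x X \<Theta> u
  proof -
    obtain W' x' where "svie_problem M (augmented_filtration M W) W' T A' B' C' D' \<Xi>' \<Gamma>' \<xi> m0 t0 W A B C D \<Xi> \<Gamma> b \<sigma> v x x'"
      using problem[of M W b \<sigma> v t0 x] H by blast
    from svie_problem.feedback_solution_estimate[OF this _ w \<delta>] H show ?thesis unfolding k_def c_def by blast
  qed
  show ?thesis
    by (rule conjI, (intro allI impI, rule EU, assumption), rule exI[of _ k], rule conjI[OF k], intro allI impI, rule ES, assumption)
qed

end
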